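(* Let $G\times M\to M$ be a proper (smooth) action of a Lie group $G$ on a manifold $M$ and let $q:M\to M/G$ denote the quotient map. Then the affine $C^\infty$-scheme $\mathrm{Spec}(C^\infty(M)^G)$ of the ring of invariant functions is isomorphic (as a local $C^\infty$-ringed space) to $(M/G, C^\infty_{M/G})$, where $$C^\infty_{M/G}(U)=\{f:U\to\mathbb{R}\mid f\circ q\in C^\infty(q^{-1}(U))\}$$ for all open sets $U\subset M/G$.
   Context: Manifolds are smooth, Hausdorff and second countable; $M/G$ carries the quotient topology. A $C^\infty$-ring is a set $\mathscr{A}$ with an operation $f_{\mathscr{A}}:\mathscr{A}^n\to\mathscr{A}$ for each $n\geq 0$ and each $f\in C^\infty(\mathbb{R}^n)$, compatible with composition of smooth functions and sending coordinate functions to projections; maps of $C^\infty$-rings preserve all operations. It has an underlying commutative unital $\mathbb{R}$-algebra. On rings of real-valued functions such as $C^\infty(M)$, $C^\infty(M)^G$ (the $G$-invariant smooth functions) and $C^\infty_{M/G}(U)$ the operations are $f(a_1,\ldots,a_n)=f\circ(a_1,\ldots,a_n)$. A local $C^\infty$-ringed space is a topological space with a sheaf of $C^\infty$-rings whose stalks are local $C^\infty$-rings (i.e. have a unique $C^\infty$-ring map to $\mathbb{R}$; equivalently, a unique maximal ideal, with quotient $\mathbb{R}$). A map $(X,\mathscr{O}_X)\to(Y,\mathscr{O}_Y)$ is a pair $(f,f_\#)$ with $f:X\to Y$ continuous and $f_\#:\mathscr{O}_Y\to f_*\mathscr{O}_X$ a map of sheaves of $C^\infty$-rings. Construction of $\mathrm{Spec}(\mathscr{A})=(X_{\mathscr{A}},\mathscr{O}_{\mathscr{A}})$: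 $X_{\mathscr{A}}=\mathrm{Hom}(\mathscr{A},\mathbb{R})$ is the set of $C^\infty$-ring maps $\mathscr{A}\to\mathbb{R}$ with the topology having as a basis the sets $\{x\mid x(a)\neq 0\}$, $a\in\mathscr{A}$. For $x\in X_{\mathscr{A}}$ let $\pi_x:\mathscr{A}\to\mathscr{A}_x$ be the $C^\infty$-ring localization of $\mathscr{A}$ at $\{a\mid x(a)\neq0\}$; it is surjective with kernel $I_x=\{a\in\mathscr{A}\mid\exists\, d\in\mathscr{A},\ x(d)\neq0,\ ad=0\}$. $\mathscr{O}_{\mathscr{A}}(U)$ is the set of all $s:U\to\bigsqcup_{x\in U}\mathscr{A}_x$ which are locally of the form $x\mapsto\pi_x(a)$ for some $a\in\mathscr{A}$, with pointwise operations. *)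

theory Defs
  imports
    "HOL-Analysis.Analysis"
    "HOL-Analysis.Abstract_Euclidean_Space"
    "HOL-Algebra.Ideal"
    "HOL-Algebra.Group_Action"
begin

section \<open>Smooth functions of several real variables\<close>

text \<open>
  Real \<open>n\<close>-space is \<^term>\<open>Euclidean_space n\<close>, whose points are the \<open>x :: nat \<Rightarrow> real\<close> with
  \<open>x i = 0\<close> for \<open>i \<ge> n\<close>.  Unlike with a type of class \<^class>\<open>euclidean_space\<close>, the dimension can
  be quantified over and can be \<open>0\<close> (discrete groups are Lie groups).
\<close>

abbreviation Rn :: "nat \<Rightarrow> (nat \<Rightarrow> real) set" where
  "Rn n \<equiv> topspace (Euclidean_space n)"

primrec Ck_on :: "nat \<Rightarrow> nat \<Rightarrow> (nat \<Rightarrow> real) set \<Rightarrow> ((nat \<Rightarrow> real) \<Rightarrow> real) \<Rightarrow> bool" where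
  "Ck_on 0 n U f \<longleftrightarrow> continuous_map (subtopology (Euclidean_space n) U) euclideanreal f"
| "Ck_on (Suc k) n U f \<longleftrightarrow>
     continuous_map (subtopology (Euclidean_space n) U) euclideanreal f \<and>
     (\<forall>i<n. (\<forall>x\<in>U. (\<lambda>t. f (x(i := t))) differentiable at (x i)) \<and>
            Ck_on k n U (\<lambda>x. deriv (\<lambda>t. f (x(i := t))) (x i)))"

text \<open>Used only for \<open>U\<close> open in \<^term>\<open>Euclidean_space n\<close>.\<close>

definition smooth_on :: "nat \<Rightarrow> (nat \<Rightarrow> real) set \<Rightarrow> ((nat \<Rightarrow> real) \<Rightarrow> real) \<Rightarrow> bool" where
  "smooth_on n U f \<longleftrightarrow> (\<forall>k. Ck_on k n U f)"

definition Cinf_Rn :: "nat \<Rightarrow> ((nat \<Rightarrow> real) \<Rightarrow> real) set" where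
  "Cinf_Rn n = {f \<in> extensional (Rn n). smooth_on n (Rn n) f}"

definition point :: "real list \<Rightarrow> nat \<Rightarrow> real" where
  "point as = (\<lambda>i. if i < length as then as ! i else 0)"


section \<open>Smooth manifolds\<close>

text \<open>The atlas need not be maximal; it stands for the smooth structure it generates.\<close>

record 'm manifold =
  mtop :: "'m topology"
  mdim :: nat
  atlas :: "('m set \<times> ('m \<Rightarrow> nat \<Rightarrow> real)) set"

locale smooth_manifold =
  fixes M :: "'m manifold"
  assumes Hausdorff: "Hausdorff_space (mtop M)"
    and second_countable: "second_countable (mtop M)"
    and chart_open: "(U, \<phi>) \<in> atlas M \<Longrightarrow> openin (mtop M) U"
    and chart_homeo: "(U, \<phi>) \<in> atlas M \<Longrightarrow>
          openin (Euclidean_space (mdim M)) (\<phi> ` U) \<and>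
          homeomorphic_map (subtopology (mtop M) U)
            (subtopology (Euclidean_space (mdim M)) (\<phi> ` U)) \<phi>"
    and charts_cover: "(\<Union>(U, \<phi>)\<in>atlas M. U) = topspace (mtop M)"
    and transition_smooth: "\<lbrakk>(U, \<phi>) \<in> atlas M; (V, \<psi>) \<in> atlas M; i < mdim M\<rbrakk> \<Longrightarrow>
          smooth_on (mdim M) (\<phi> ` (U \<inter> V)) (\<lambda>z. \<psi> (inv_into U \<phi> z) i)"

definition smooth_real_on :: "'m manifold \<Rightarrow> 'm set \<Rightarrow> ('m \<Rightarrow> real) \<Rightarrow> bool" where
  "smooth_real_on M W f \<longleftrightarrow>
     (\<forall>(U, \<phi>)\<in>atlas M. smooth_on (mdim M) (\<phi> ` (U \<inter> W)) (\<lambda>z. f (inv_into U \<phi> z)))"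

definition smooth_map :: "'m manifold \<Rightarrow> 'n manifold \<Rightarrow> ('m \<Rightarrow> 'n) \<Rightarrow> bool" where
  "smooth_map M N f \<longleftrightarrow>
     continuous_map (mtop M) (mtop N) f \<and>
     (\<forall>(U, \<phi>)\<in>atlas M. \<forall>(V, \<psi>)\<in>atlas N. \<forall>i<mdim N.
        smooth_on (mdim M) (\<phi> ` (U \<inter> f -` V)) (\<lambda>z. \<psi> (f (inv_into U \<phi> z)) i))"

definition prod_manifold :: "'m manifold \<Rightarrow> 'n manifold \<Rightarrow> ('m \<times> 'n) manifold" where
  "prod_manifold M N =
     \<lparr>mtop = prod_topology (mtop M) (mtop N),
      mdim = mdim M + mdim N,
      atlas = {(U \<times> V, \<lambda>(x, y) i. if i < mdim M then \<phi> x i else \<psi> y (i - mdim M)) |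
               U \<phi> V \<psi>. (U, \<phi>) \<in> atlas M \<and> (V, \<psi>) \<in> atlas N}\<rparr>"


section \<open>Lie groups and proper actions\<close>

locale lie_group = group G + L: smooth_manifold L
  for G :: "('g, 'b) monoid_scheme" (structure) and L :: "'g manifold" +
  assumes carrier_eq: "carrier G = topspace (mtop L)"
    and smooth_mult: "smooth_map (prod_manifold L L) L (\<lambda>(g, h). g \<otimes> h)"
    and smooth_inv: "smooth_map L L (m_inv G)"

locale smooth_action =
  lie_group G L + M: smooth_manifold M + group_action G "topspace (mtop M)" act
  for G :: "('g, 'b) monoid_scheme" (structure) and L :: "'g manifold"
    and M :: "'m manifold" and act :: "'g \<Rightarrow> 'm \<Rightarrow> 'm" +
  assumes smooth_act: "smooth_map (prod_manifold L M) M (\<lambda>(g, x). act g x)"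

locale proper_smooth_action = smooth_action +
  assumes proper_act:
    "proper_map (prod_topology (mtop L) (mtop M)) (prod_topology (mtop M) (mtop M))
       (\<lambda>(g, x). (act g x, x))"

definition quotient_topology :: "'a topology \<Rightarrow> ('a \<Rightarrow> 'b) \<Rightarrow> 'b topology" where
  "quotient_topology X q =
     topology (\<lambda>U. U \<subseteq> q ` topspace X \<and> openin X {x \<in> topspace X. q x \<in> U})"

lemma openin_quotient_topology:
  "openin (quotient_topology X q) U \<longleftrightarrow>
     U \<subseteq> q ` topspace X \<and> openin X {x \<in> topspace X. q x \<in> U}"
proof -
  have "istopology (\<lambda>U. U \<subseteq> q ` topspace X \<and> openin X {x \<in> topspace X. q x \<in> U})"
    unfolding istopology_def
  proof (intro conjI allI impI; (elim conjE)?)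
    fix S T
    assume "openin X {x \<in> topspace X. q x \<in> S}" "openin X {x \<in> topspace X. q x \<in> T}"
    moreover have "{x \<in> topspace X. q x \<in> S \<inter> T} =
        {x \<in> topspace X. q x \<in> S} \<inter> {x \<in> topspace X. q x \<in> T}" by auto
    ultimately show "openin X {x \<in> topspace X. q x \<in> S \<inter> T}" by auto
  next
    fix K assume K: "\<forall>S\<in>K. S \<subseteq> q ` topspace X \<and> openin X {x \<in> topspace X. q x \<in> S}"
    have "{x \<in> topspace X. q x \<in> \<Union>K} = (\<Union>S\<in>K. {x \<in> topspace X. q x \<in> S})" by auto
    with K show "openin X {x \<in> topspace X. q x \<in> \<Union>K}" by auto
  qed auto
  then show ?thesis
    by (simp add: quotient_topology_def)
qed

lemma topspace_quotient_topology: "topspace (quotient_topology X q) = q ` topspace X"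
proof -
  have "{x \<in> topspace X. q x \<in> q ` topspace X} = topspace X" by auto
  then have "openin (quotient_topology X q) (q ` topspace X)"
    by (simp add: openin_quotient_topology)
  then show ?thesis
    by (metis openin_quotient_topology openin_subset openin_topspace subset_antisym)
qed

lemma quotient_map_quotient_topology: "quotient_map X (quotient_topology X q) q"
  by (auto simp: quotient_map_def openin_quotient_topology topspace_quotient_topology)


section \<open>C-infinity-rings\<close>

text \<open>
  \<^term>\<open>cop A f as\<close> is the operation of \<open>f \<in> Cinf_Rn n\<close> on the \<open>n\<close>-tuple \<open>as\<close>; the arity \<open>n\<close> is the
  length of the list.
\<close>

record 'a cinf_ring = "'a partial_object" +
  cop :: "((nat \<Rightarrow> real) \<Rightarrow> real) \<Rightarrow> 'a list \<Rightarrow> 'a"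

locale cinf_ring =
  fixes A :: "'a cinf_ring"
  assumes cop_closed: "\<lbrakk>as \<in> lists (carrier A); f \<in> Cinf_Rn (length as)\<rbrakk> \<Longrightarrow>
          cop A f as \<in> carrier A"
    and cop_proj: "\<lbrakk>as \<in> lists (carrier A); i < length as\<rbrakk> \<Longrightarrow>
          cop A (\<lambda>x\<in>Rn (length as). x i) as = as ! i"
    and cop_compose: "\<lbrakk>as \<in> lists (carrier A); gs \<in> lists (Cinf_Rn (length as));
            f \<in> Cinf_Rn (length gs)\<rbrakk> \<Longrightarrow>
          cop A (\<lambda>x\<in>Rn (length as). f (point (map (\<lambda>g. g x) gs))) as =
          cop A f (map (\<lambda>g. cop A g as) gs)"

text \<open>Maps are extensional, so that they are determined by their values on the carrier.\<close>

definition cinf_hom :: "'a cinf_ring \<Rightarrow> 'b cinf_ring \<Rightarrow> ('a \<Rightarrow> 'b) set" where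
  "cinf_hom A B = {\<phi> \<in> carrier A \<rightarrow>\<^sub>E carrier B.
     \<forall>as\<in>lists (carrier A). \<forall>f\<in>Cinf_Rn (length as). \<phi> (cop A f as) = cop B f (map \<phi> as)}"

definition cinf_real :: "real cinf_ring" where
  "cinf_real = \<lparr>carrier = UNIV, cop = (\<lambda>f as. f (point as))\<rparr>"

definition function_cinf_ring :: "'p set \<Rightarrow> ('p \<Rightarrow> real) set \<Rightarrow> ('p \<Rightarrow> real) cinf_ring" where
  "function_cinf_ring S F =
     \<lparr>carrier = F, cop = (\<lambda>f as. \<lambda>x\<in>S. f (point (map (\<lambda>a. a x) as)))\<rparr>"

definition underlying_ring :: "'a cinf_ring \<Rightarrow> 'a ring" where
  "underlying_ring A =
     \<lparr>carrier = carrier A,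
      monoid.mult = (\<lambda>a b. cop A (\<lambda>x\<in>Rn 2. x 0 * x 1) [a, b]),
      one = cop A (\<lambda>x\<in>Rn 0. 1) [],
      zero = cop A (\<lambda>x\<in>Rn 0. 0) [],
      add = (\<lambda>a b. cop A (\<lambda>x\<in>Rn 2. x 0 + x 1) [a, b])\<rparr>"

text \<open>
  Besides having a unique point \<open>p\<close>, a local ring is required to have the kernel of \<open>p\<close> as its
  unique maximal ideal.  The quotient by it is then \<open>\<real>\<close>, as \<open>p\<close> is onto.
\<close>

definition local_cinf_ring :: "'a cinf_ring \<Rightarrow> bool" where
  "local_cinf_ring A \<longleftrightarrow>
     cinf_ring A \<and>
     (\<exists>!p. p \<in> cinf_hom A cinf_real) \<and>
     (\<forall>p\<in>cinf_hom A cinf_real. \<forall>m.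
        maximalideal m (underlying_ring A) \<longleftrightarrow> m = {a \<in> carrier A. p a = 0})"

text \<open>
  The localization at \<open>S\<close>, by its universal property, realised on the type \<open>'a set\<close> and tested
  against rings on that type.  When \<open>S\<close> is the complement of the kernel of a point of \<open>A\<close>, the
  localization is a quotient of \<open>A\<close>, so it can be realised by cosets in \<open>A\<close>; it is then itself
  a test object, and the restriction to one type loses nothing.
\<close>

definition is_localization ::
  "'a cinf_ring \<Rightarrow> 'a set \<Rightarrow> 'a set cinf_ring \<times> ('a \<Rightarrow> 'a set) \<Rightarrow> bool" where
  "is_localization A S = (\<lambda>(L, \<pi>).
     cinf_ring L \<and> \<pi> \<in> cinf_hom A L \<and>
     (\<forall>a\<in>S. \<pi> a \<in> Units (underlying_ring L)) \<and>
     (\<forall>(B :: 'a set cinf_ring) \<phi>.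
        cinf_ring B \<and> \<phi> \<in> cinf_hom A B \<and> (\<forall>a\<in>S. \<phi> a \<in> Units (underlying_ring B)) \<longrightarrow>
        (\<exists>!\<psi>. \<psi> \<in> cinf_hom L B \<and> (\<forall>a\<in>carrier A. \<psi> (\<pi> a) = \<phi> a))))"

definition localization :: "'a cinf_ring \<Rightarrow> 'a set \<Rightarrow> 'a set cinf_ring \<times> ('a \<Rightarrow> 'a set)" where
  "localization A S = (SOME L\<pi>. is_localization A S L\<pi>)"


section \<open>Local C-infinity-ringed spaces\<close>

record ('p, 's) ringed_space =
  rs_top :: "'p topology"
  sections :: "'p set \<Rightarrow> 's cinf_ring"
  restr :: "'p set \<Rightarrow> 'p set \<Rightarrow> 's \<Rightarrow> 's"

locale cinf_ringed_space =
  fixes X :: "('p, 's) ringed_space"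
  assumes sections_ring: "openin (rs_top X) U \<Longrightarrow> cinf_ring (sections X U)"
    and restr_hom: "\<lbrakk>openin (rs_top X) U; openin (rs_top X) V; V \<subseteq> U\<rbrakk> \<Longrightarrow>
          restr X U V \<in> cinf_hom (sections X U) (sections X V)"
    and restr_id: "\<lbrakk>openin (rs_top X) U; s \<in> carrier (sections X U)\<rbrakk> \<Longrightarrow> restr X U U s = s"
    and restr_comp: "\<lbrakk>openin (rs_top X) U; openin (rs_top X) V; openin (rs_top X) W;
            W \<subseteq> V; V \<subseteq> U; s \<in> carrier (sections X U)\<rbrakk> \<Longrightarrow>
          restr X V W (restr X U V s) = restr X U W s"
    and locality: "\<lbrakk>\<And>U. U \<in> \<U> \<Longrightarrow> openin (rs_top X) U;
            s \<in> carrier (sections X (\<Union>\<U>)); t \<in> carrier (sections X (\<Union>\<U>));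
            \<And>U. U \<in> \<U> \<Longrightarrow> restr X (\<Union>\<U>) U s = restr X (\<Union>\<U>) U t\<rbrakk> \<Longrightarrow> s = t"
    and gluing: "\<lbrakk>\<And>U. U \<in> \<U> \<Longrightarrow> openin (rs_top X) U;
            \<And>U. U \<in> \<U> \<Longrightarrow> \<sigma> U \<in> carrier (sections X U);
            \<And>U V. \<lbrakk>U \<in> \<U>; V \<in> \<U>\<rbrakk> \<Longrightarrow> restr X U (U \<inter> V) (\<sigma> U) = restr X V (U \<inter> V) (\<sigma> V)\<rbrakk> \<Longrightarrow>
          \<exists>t\<in>carrier (sections X (\<Union>\<U>)). \<forall>U\<in>\<U>. restr X (\<Union>\<U>) U t = \<sigma> U"

definition germ :: "('p, 's) ringed_space \<Rightarrow> 'p \<Rightarrow> 'p set \<Rightarrow> 's \<Rightarrow> ('p set \<times> 's) set" where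
  "germ X x U s = {(V, t). openin (rs_top X) V \<and> x \<in> V \<and> t \<in> carrier (sections X V) \<and>
     (\<exists>W. openin (rs_top X) W \<and> x \<in> W \<and> W \<subseteq> U \<inter> V \<and> restr X U W s = restr X V W t)}"

text \<open>
  An operation is applied to germs by representing them all on one common neighbourhood \<open>W\<close>.
\<close>

definition stalk :: "('p, 's) ringed_space \<Rightarrow> 'p \<Rightarrow> ('p set \<times> 's) set cinf_ring" where
  "stalk X x =
     \<lparr>carrier = {germ X x U s | U s. openin (rs_top X) U \<and> x \<in> U \<and> s \<in> carrier (sections X U)},
      cop = (\<lambda>f \<gamma>s. THE \<gamma>. \<exists>W ss. openin (rs_top X) W \<and> x \<in> W \<and>
               ss \<in> lists (carrier (sections X W)) \<and> \<gamma>s = map (germ X x W) ss \<and>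
               \<gamma> = germ X x W (cop (sections X W) f ss))\<rparr>"

locale local_cinf_ringed_space = cinf_ringed_space X
  for X :: "('p, 's) ringed_space" +
  assumes local_stalks: "x \<in> topspace (rs_top X) \<Longrightarrow> local_cinf_ring (stalk X x)"

definition preimg :: "('p, 's) ringed_space \<Rightarrow> ('p \<Rightarrow> 'q) \<Rightarrow> 'q set \<Rightarrow> 'p set" where
  "preimg X f V = {x \<in> topspace (rs_top X). f x \<in> V}"

definition ringed_space_map ::
  "('p, 's) ringed_space \<Rightarrow> ('q, 't) ringed_space \<Rightarrow> ('p \<Rightarrow> 'q) \<Rightarrow> ('q set \<Rightarrow> 't \<Rightarrow> 's) \<Rightarrow> bool" where
  "ringed_space_map X Y f f\<^sub>s \<longleftrightarrow>
     continuous_map (rs_top X) (rs_top Y) f \<and>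
     (\<forall>V. openin (rs_top Y) V \<longrightarrow>
        f\<^sub>s V \<in> cinf_hom (sections Y V) (sections X (preimg X f V))) \<and>
     (\<forall>V V'. openin (rs_top Y) V \<and> openin (rs_top Y) V' \<and> V' \<subseteq> V \<longrightarrow>
        (\<forall>t\<in>carrier (sections Y V).
           f\<^sub>s V' (restr Y V V' t) = restr X (preimg X f V) (preimg X f V') (f\<^sub>s V t)))"

definition ringed_space_isomorphic ::
  "('p, 's) ringed_space \<Rightarrow> ('q, 't) ringed_space \<Rightarrow> bool" where
  "ringed_space_isomorphic X Y \<longleftrightarrow>
     (\<exists>f f\<^sub>s g g\<^sub>s.
        ringed_space_map X Y f f\<^sub>s \<and> ringed_space_map Y X g g\<^sub>s \<and>
        (\<forall>x\<in>topspace (rs_top X). g (f x) = x) \<and>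
        (\<forall>y\<in>topspace (rs_top Y). f (g y) = y) \<and>
        (\<forall>U. openin (rs_top X) U \<longrightarrow>
           (\<forall>s\<in>carrier (sections X U). f\<^sub>s (preimg Y g U) (g\<^sub>s U s) = s)) \<and>
        (\<forall>V. openin (rs_top Y) V \<longrightarrow>
           (\<forall>t\<in>carrier (sections Y V). g\<^sub>s (preimg X f V) (f\<^sub>s V t) = t)))"


section \<open>The spectrum\<close>

text \<open>
  The sets \<open>{x. x a \<noteq> 0}\<close> are closed under finite intersections, because \<open>x (a b) = x a x b\<close>, so
  they form a basis of the topology they generate.
\<close>

definition Spec_top :: "'a cinf_ring \<Rightarrow> ('a \<Rightarrow> real) topology" where
  "Spec_top A =
     topology_generated_by {{x \<in> cinf_hom A cinf_real. x a \<noteq> 0} | a. a \<in> carrier A}"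

definition Spec_local :: "'a cinf_ring \<Rightarrow> ('a \<Rightarrow> real) \<Rightarrow> 'a set cinf_ring" where
  "Spec_local A x = fst (localization A {a \<in> carrier A. x a \<noteq> 0})"

definition Spec_proj :: "'a cinf_ring \<Rightarrow> ('a \<Rightarrow> real) \<Rightarrow> 'a \<Rightarrow> 'a set" where
  "Spec_proj A x = snd (localization A {a \<in> carrier A. x a \<noteq> 0})"

definition Spec_sections ::
  "'a cinf_ring \<Rightarrow> ('a \<Rightarrow> real) set \<Rightarrow> (('a \<Rightarrow> real) \<Rightarrow> 'a set) cinf_ring" where
  "Spec_sections A U =
     \<lparr>carrier = {s \<in> (\<Pi>\<^sub>E x\<in>U. carrier (Spec_local A x)).
        \<forall>x\<in>U. \<exists>V. \<exists>a\<in>carrier A. openin (Spec_top A) V \<and> x \<in> V \<and> V \<subseteq> U \<and>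
          (\<forall>y\<in>V. s y = Spec_proj A y a)},
      cop = (\<lambda>f ss. \<lambda>x\<in>U. cop (Spec_local A x) f (map (\<lambda>s. s x) ss))\<rparr>"

definition Spec :: "'a cinf_ring \<Rightarrow> ('a \<Rightarrow> real, ('a \<Rightarrow> real) \<Rightarrow> 'a set) ringed_space" where
  "Spec A =
     \<lparr>rs_top = Spec_top A,
      sections = Spec_sections A,
      restr = (\<lambda>U V. \<lambda>s\<in>carrier (Spec_sections A U). restrict s V)\<rparr>"


section \<open>Invariant functions and the orbit space\<close>

definition invariant_functions ::
  "('g, 'b) monoid_scheme \<Rightarrow> 'm manifold \<Rightarrow> ('g \<Rightarrow> 'm \<Rightarrow> 'm) \<Rightarrow> ('m \<Rightarrow> real) cinf_ring" where
  "invariant_functions G M act =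
     function_cinf_ring (topspace (mtop M))
       {a \<in> extensional (topspace (mtop M)).
          smooth_real_on M (topspace (mtop M)) a \<and>
          (\<forall>g\<in>carrier G. \<forall>x\<in>topspace (mtop M). a (act g x) = a x)}"

definition orbit_space_sections ::
  "('g, 'b) monoid_scheme \<Rightarrow> 'm manifold \<Rightarrow> ('g \<Rightarrow> 'm \<Rightarrow> 'm) \<Rightarrow>
     'm set set \<Rightarrow> ('m set \<Rightarrow> real) cinf_ring" where
  "orbit_space_sections G M act U =
     function_cinf_ring U
       {f \<in> extensional U.
          smooth_real_on M {x \<in> topspace (mtop M). orbit G act x \<in> U} (f \<circ> orbit G act)}"

text \<open>
  The quotient map is \<^term>\<open>orbit G act\<close>, so the points of the orbit space are the orbits.
\<close>

definition orbit_space ::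
  "('g, 'b) monoid_scheme \<Rightarrow> 'm manifold \<Rightarrow> ('g \<Rightarrow> 'm \<Rightarrow> 'm) \<Rightarrow>
     ('m set, 'm set \<Rightarrow> real) ringed_space" where
  "orbit_space G M act =
     \<lparr>rs_top = quotient_topology (mtop M) (orbit G act),
      sections = orbit_space_sections G M act,
      restr = (\<lambda>U V. \<lambda>f\<in>carrier (orbit_space_sections G M act U). restrict f V)\<rparr>"

end

theory Submission
  imports Defs "HOL-Computational_Algebra.Polynomial"
begin

text \<open>
  Write \<open>A\<close> for the ring of invariant smooth functions, and \<open>q\<close> for the quotient map.  An orbit gives
  a point of \<open>Spec A\<close>, the evaluation at any of its elements.  The theorem says that this is a
  homeomorphism, under which the germs of smooth functions on \<open>M/G\<close> become the localizations of \<open>A\<close>.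

  \<^emph>\<open>Every point is an evaluation.\<close>  If \<open>p\<close> is a point of \<open>A\<close> that is no evaluation, then the functions
  in the kernel of \<open>p\<close> have no common zero, and by second countability already countably many of
  them, \<open>a\<^sub>0, a\<^sub>1, \<dots>\<close>, have none.  A locally finite sum of functions of the \<open>a\<^sub>i\<close> is an invariant function
  \<open>h\<close> that exceeds \<open>N\<close> on the common zeros of the first \<open>N\<close> of them.  For large \<open>N\<close> the function
  \<open>(h - p h)\<^sup>2 + \<Sum>i<N. a\<^sub>i\<^sup>2\<close> has no zeros, so it is invertible in \<open>A\<close>, but \<open>p\<close> maps it to \<open>0\<close>
  (\<open>exhaustion_by_zero_sets\<close>, \<open>hom_is_evaluation\<close>).

  \<^emph>\<open>There are many invariant functions.\<close>  For each point \<open>x\<close> of an open invariant set \<open>W\<close> there is an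
  invariant function that vanishes outside of \<open>W\<close> and is positive at \<open>x\<close> (\<open>invariant_bump\<close>): the average
  of an ordinary bump function \<open>f\<close> over the group.  The average is \<open>x \<mapsto> I (\<lambda>g. f (g x))\<close> for a positive
  linear functional \<open>I\<close> on the continuous functions on \<open>G\<close> with compact support that is invariant under
  right translations.  It is obtained as a limit of normalized covering numbers (\<open>haar_functional\<close>).  As
  the action is proper, the functions \<open>\<lambda>g. f (g x)\<close> have compact supports, locally uniformly in \<open>x\<close>
  (\<open>compact_transporter\<close>).  Hence one can differentiate under \<open>I\<close> (\<open>I_parameter_Ck\<close>), and the average is
  smooth.  Orbits are closed because the action is proper, so the invariant functions separate orbits,
  and \<open>M/G\<close> and \<open>Spec A\<close> have the same points (\<open>ev_eq_iff\<close>).  Both topologies are generated by the sets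
  on which an invariant function does not vanish (\<open>continuous_to_orbit\<close>, \<open>continuous_to_point\<close>).

  \<^emph>\<open>The sheaves agree.\<close>  Near each orbit, a section of the sheaf on \<open>M/G\<close> agrees with an element of \<open>A\<close>,
  after multiplication by an invariant cutoff function (\<open>extension_exists\<close>).  The localization of \<open>A\<close> at a
  point \<open>p\<close> is the quotient of \<open>A\<close> that identifies \<open>a\<close> and \<open>b\<close> if they agree wherever some \<open>d\<close> with
  \<open>p d \<noteq> 0\<close> does not vanish (\<open>germ_ring_is_localization\<close>); by the existence of bump functions this means
  that they agree near the orbit (\<open>extension_unique\<close>).  So a section over an open set of \<open>M/G\<close> is the same
  as a family of elements of the localizations that comes locally from \<open>A\<close> (\<open>pull\<close>, \<open>push\<close>).

  \<^emph>\<open>The stalks are local.\<close>  On both sides a germ has a value at the point.  If this value is \<open>c \<noteq> 0\<close>, then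
  the germ is inverted by applying to it a smooth function on \<open>\<real>\<close> that is \<open>1 / t\<close> for \<open>t\<close> near \<open>c\<close>
  (\<open>local_stalkI\<close>, \<open>local_cinf_ringI\<close>).
\<close>

section \<open>Smooth functions of several variables\<close>

lemma Rn_iff: "x \<in> Rn n \<longleftrightarrow> (\<forall>i\<ge>n. x i = 0)"
  by (simp add: topspace_Euclidean_space)

lemma Rn_upd: "x \<in> Rn n \<Longrightarrow> i < n \<Longrightarrow> x(i := t) \<in> Rn n"
  by (auto simp: Rn_iff)

definition cube :: "nat \<Rightarrow> (nat \<Rightarrow> real) \<Rightarrow> real \<Rightarrow> (nat \<Rightarrow> real) set" where
  "cube n x e = {y \<in> Rn n. \<forall>i<n. \<bar>y i - x i\<bar> < e}"

lemma continuous_map_coordinate: "continuous_map (Euclidean_space n) euclideanreal (\<lambda>x. x i)"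
  unfolding Euclidean_space_def
  by (intro continuous_map_from_subtopology continuous_map_product_projection) auto

lemma openin_cube: "openin (Euclidean_space n) (cube n x e)"
proof -
  have "openin (Euclidean_space n) {y \<in> Rn n. y i \<in> ball (x i) e}" for i
    by (rule openin_continuous_map_preimage[OF continuous_map_coordinate]) auto
  then have *: "openin (Euclidean_space n) {y \<in> Rn n. \<bar>y i - x i\<bar> < e}" for i
    by (simp add: dist_real_def abs_minus_commute)
  have "openin (Euclidean_space n) {y \<in> Rn n. \<forall>i<m. \<bar>y i - x i\<bar> < e}" for m
  proof (induction m)
    case 0 then show ?case by (simp only: not_less_zero simp_thms) simp
  next
    case (Suc m)
    have "{y \<in> Rn n. \<forall>i<Suc m. \<bar>y i - x i\<bar> < e}
      = {y \<in> Rn n. \<forall>i<m. \<bar>y i - x i\<bar> < e} \<inter> {y \<in> Rn n. \<bar>y m - x m\<bar> < e}"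
      by (auto simp: less_Suc_eq)
    then show ?case using Suc * by (simp only: openin_Int)
  qed
  then show ?thesis by (simp only: cube_def)
qed

lemma openin_Euclidean_iff_cube:
  "openin (Euclidean_space n) U \<longleftrightarrow> U \<subseteq> Rn n \<and> (\<forall>x\<in>U. \<exists>e>0. cube n x e \<subseteq> U)"
proof
  assume R: "U \<subseteq> Rn n \<and> (\<forall>x\<in>U. \<exists>e>0. cube n x e \<subseteq> U)"
  show "openin (Euclidean_space n) U"
  proof (subst openin_subopen, intro ballI)
    fix x assume x: "x \<in> U"
    then obtain e where e: "e > 0" "cube n x e \<subseteq> U" using R by blast
    have "x \<in> cube n x e" using R x e by (auto simp: cube_def)
    then show "\<exists>T. openin (Euclidean_space n) T \<and> x \<in> T \<and> T \<subseteq> U" using openin_cube e by blast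
  qed
next
  assume U: "openin (Euclidean_space n) U"
  then have sub: "U \<subseteq> Rn n" by (rule openin_subset)
  obtain S where S: "openin (powertop_real UNIV) S" "U = S \<inter> {x. \<forall>i\<ge>n. x i = 0}"
    using U by (auto simp: Euclidean_space_def openin_subtopology)
  have "\<exists>e>0. cube n x e \<subseteq> U" if x: "x \<in> U" for x
  proof -
    have "x \<in> S" using x S by auto
    then obtain B where B: "\<forall>i. open (B i)" "x \<in> Pi\<^sub>E UNIV B" "Pi\<^sub>E UNIV B \<subseteq> S"
      "finite {i. B i \<noteq> UNIV}"
      using S(1) unfolding openin_product_topology_alt by auto
    have "\<exists>e>0. \<forall>t. \<bar>t - x i\<bar> < e \<longrightarrow> t \<in> B i" for i
    proof -
      have "x i \<in> B i" using B(2) by auto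
      then show ?thesis using B(1) unfolding open_dist by (auto simp: dist_real_def)
    qed
    then obtain r where r: "\<And>i. r i > 0" "\<And>i t. \<bar>t - x i\<bar> < r i \<Longrightarrow> t \<in> B i" by metis
    define e where "e = Min (insert 1 (r ` {..<n}))"
    have e: "e > 0" "\<And>i. i < n \<Longrightarrow> e \<le> r i" using r by (auto simp: e_def)
    have "y \<in> U" if y: "y \<in> cube n x e" for y
    proof -
      have "y i \<in> B i" for i
      proof (cases "i < n")
        case True
        then show ?thesis using y e(2)[of i] r(2)[of "y i" i] by (auto simp: cube_def)
      next
        case False
        then have "y i = x i" using y x sub by (auto simp: cube_def Rn_iff)
        then show ?thesis using r(2)[of "y i" i] r(1)[of i] by auto
      qed
      then show ?thesis using B S y by (auto simp: cube_def Rn_iff)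
    qed
    then show ?thesis using e by blast
  qed
  with sub show "U \<subseteq> Rn n \<and> (\<forall>x\<in>U. \<exists>e>0. cube n x e \<subseteq> U)" by blast
qed

lemma continuous_on_cube_iff:
  assumes U: "U \<subseteq> Rn n"
  shows "continuous_map (subtopology (Euclidean_space n) U) euclideanreal f \<longleftrightarrow>
    (\<forall>x\<in>U. \<forall>e>0. \<exists>d>0. \<forall>y\<in>U. y \<in> cube n x d \<longrightarrow> \<bar>f y - f x\<bar> < e)" (is "?L \<longleftrightarrow> ?R")
proof
  assume L: ?L
  show ?R
  proof (intro ballI allI impI)
    fix x e assume x: "x \<in> U" and e: "e > (0::real)"
    have "openin (subtopology (Euclidean_space n) U)
        {y \<in> topspace (subtopology (Euclidean_space n) U). f y \<in> ball (f x) e}"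
      by (rule openin_continuous_map_preimage[OF L]) auto
    then obtain T where T: "openin (Euclidean_space n) T"
      "{y \<in> topspace (subtopology (Euclidean_space n) U). f y \<in> ball (f x) e} = T \<inter> U"
      by (auto simp: openin_subtopology)
    have "x \<in> {y \<in> topspace (subtopology (Euclidean_space n) U). f y \<in> ball (f x) e}"
      using x e U by auto
    then have "x \<in> T" using T by blast
    then obtain d where d: "d > 0" "cube n x d \<subseteq> T"
      using T(1) unfolding openin_Euclidean_iff_cube by blast
    have "\<bar>f y - f x\<bar> < e" if "y \<in> U" "y \<in> cube n x d" for y
    proof -
      have "y \<in> T \<inter> U" using that d by blast
      then have "f y \<in> ball (f x) e" using T(2) by blast
      then show ?thesis by (auto simp: dist_real_def)
    qed
    then show "\<exists>d>0. \<forall>y\<in>U. y \<in> cube n x d \<longrightarrow> \<bar>f y - f x\<bar> < e" using d by blast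
  qed
next
  assume R: ?R
  show ?L unfolding continuous_map
  proof (intro conjI allI impI)
    show "f ` topspace (subtopology (Euclidean_space n) U) \<subseteq> topspace euclideanreal" by simp
    fix S :: "real set" assume "openin euclideanreal S"
    then have S: "open S" by simp
    show "openin (subtopology (Euclidean_space n) U) {x \<in> topspace (subtopology (Euclidean_space n) U). f x \<in> S}"
    proof (subst openin_subopen, intro ballI)
      fix x assume x: "x \<in> {x \<in> topspace (subtopology (Euclidean_space n) U). f x \<in> S}"
      then obtain e where e: "e > 0" "\<And>z. \<bar>z - f x\<bar> < e \<Longrightarrow> z \<in> S"
        using S unfolding open_dist by (auto simp: dist_real_def)
      have "x \<in> U" using x by simp
      with R e(1) obtain d where d: "d > 0" "\<And>y. y \<in> U \<Longrightarrow> y \<in> cube n x d \<Longrightarrow> \<bar>f y - f x\<bar> < e"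
        by blast
      have "openin (subtopology (Euclidean_space n) U) (cube n x d \<inter> U)"
        using openin_cube by (auto simp: openin_subtopology)
      moreover have "x \<in> cube n x d \<inter> U" using x d by (auto simp: cube_def)
      moreover have "cube n x d \<inter> U \<subseteq> {x \<in> topspace (subtopology (Euclidean_space n) U). f x \<in> S}"
        using d e U by auto
      ultimately show "\<exists>T. openin (subtopology (Euclidean_space n) U) T \<and> x \<in> T \<and>
        T \<subseteq> {x \<in> topspace (subtopology (Euclidean_space n) U). f x \<in> S}" by blast
    qed
  qed
qed

lemma openin_Rn_subset: "openin (Euclidean_space n) U \<Longrightarrow> U \<subseteq> Rn n"
  by (rule openin_subset)

lemma cube_in_open: "openin (Euclidean_space n) U \<Longrightarrow> x \<in> U \<Longrightarrow> \<exists>e>0. cube n x e \<subseteq> U"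
  by (simp add: openin_Euclidean_iff_cube)

lemma open_line_in:
  assumes "openin (Euclidean_space n) U" "x \<in> U" "i < n"
  shows "\<exists>e>0. \<forall>t. \<bar>t - x i\<bar> < e \<longrightarrow> x(i := t) \<in> U"
proof -
  obtain e where e: "e > 0" "cube n x e \<subseteq> U" using cube_in_open[OF assms(1,2)] by blast
  have "x(i := t) \<in> U" if "\<bar>t - x i\<bar> < e" for t
  proof -
    have "x \<in> Rn n" using assms(2) openin_Rn_subset[OF assms(1)] by blast
    then have "x(i := t) \<in> cube n x e"
      using that e(1) assms(3) by (simp add: cube_def Rn_upd)
    then show ?thesis using e by blast
  qed
  then show ?thesis using e by blast
qed

lemma eventually_line_in:
  assumes "openin (Euclidean_space n) U" "x \<in> U" "i < n"
  shows "\<forall>\<^sub>F t in nhds (x i). x(i := t) \<in> U"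
  using open_line_in[OF assms] by (auto simp: eventually_nhds_metric dist_real_def)

definition pderiv_at :: "nat \<Rightarrow> ((nat \<Rightarrow> real) \<Rightarrow> real) \<Rightarrow> (nat \<Rightarrow> real) \<Rightarrow> real" where
  "pderiv_at i f x = deriv (\<lambda>t. f (x(i := t))) (x i)"

lemma Ck_on_Suc_iff:
  "Ck_on (Suc k) n U f \<longleftrightarrow>
     continuous_map (subtopology (Euclidean_space n) U) euclideanreal f \<and>
     (\<forall>i<n. (\<forall>x\<in>U. ((\<lambda>t. f (x(i := t))) has_real_derivative pderiv_at i f x) (at (x i))) \<and>
            Ck_on k n U (pderiv_at i f))"
  by (simp add: pderiv_at_def[abs_def] DERIV_deriv_iff_real_differentiable)

declare Ck_on.simps(2)[simp del]

lemma Ck_on_continuous: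
  "Ck_on k n U f \<Longrightarrow> continuous_map (subtopology (Euclidean_space n) U) euclideanreal f"
  by (cases k) (auto simp: Ck_on.simps(2))

lemma Ck_on_cong:
  assumes "openin (Euclidean_space n) U" "\<And>x. x \<in> U \<Longrightarrow> f x = g x" "Ck_on k n U f"
  shows "Ck_on k n U g"
  using assms(2,3)
proof (induction k arbitrary: f g)
  case 0
  then show ?case by (auto elim!: continuous_map_eq)
next
  case (Suc k)
  have c: "continuous_map (subtopology (Euclidean_space n) U) euclideanreal g"
    using Ck_on_continuous[OF Suc.prems(2)] Suc.prems(1) by (auto elim!: continuous_map_eq)
  have ev: "\<forall>\<^sub>F t in nhds (x i). f (x(i := t)) = g (x(i := t))" if "i < n" "x \<in> U" for i x
    using eventually_line_in[OF assms(1) that(2,1)] by eventually_elim (rule Suc.prems(1))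
  have pd: "pderiv_at i f x = pderiv_at i g x" if "i < n" "x \<in> U" for i x
    unfolding pderiv_at_def by (rule deriv_cong_ev[OF ev[OF that] refl])
  have "((\<lambda>t. g (x(i := t))) has_real_derivative pderiv_at i g x) (at (x i))" if "i < n" "x \<in> U" for i x
  proof -
    have "((\<lambda>t. f (x(i := t))) has_real_derivative pderiv_at i f x) (at (x i))"
      using Suc.prems(2) that unfolding Ck_on_Suc_iff by blast
    then have "((\<lambda>t. f (x(i := t))) has_real_derivative pderiv_at i g x) (at (x i))"
      by (simp only: pd[OF that])
    then show ?thesis by (rule DERIV_cong_ev[OF refl ev[OF that] refl, THEN iffD1])
  qed
  moreover have "Ck_on k n U (pderiv_at i g)" if "i < n" for i
    using Suc.IH[of "pderiv_at i f" "pderiv_at i g"] pd that Suc.prems(2) by (auto simp: Ck_on_Suc_iff)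
  ultimately show ?case using c by (auto simp: Ck_on_Suc_iff)
qed

text \<open>
  The derivatives in the definition are given by \<^const>\<open>deriv\<close>.  It is enough to exhibit functions that
  are equal to them on \<open>U\<close>, because on the open set \<open>U\<close> differentiability only depends on the
  restriction to \<open>U\<close>.
\<close>

lemma Ck_on_SucI:
  assumes U: "openin (Euclidean_space n) U"
    and c: "continuous_map (subtopology (Euclidean_space n) U) euclideanreal f"
    and d: "\<And>i x. i < n \<Longrightarrow> x \<in> U \<Longrightarrow> ((\<lambda>t. f (x(i := t))) has_real_derivative f' i x) (at (x i))"
    and k: "\<And>i. i < n \<Longrightarrow> Ck_on k n U (f' i)"
  shows "Ck_on (Suc k) n U f"
proof -
  have pd: "pderiv_at i f x = f' i x" if "i < n" "x \<in> U" for i x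
    unfolding pderiv_at_def using DERIV_imp_deriv[OF d[OF that]] .
  have "Ck_on k n U (pderiv_at i f)" if "i < n" for i
    by (rule Ck_on_cong[OF U _ k[OF that]]) (simp add: pd that)
  then show ?thesis using c d pd by (auto simp: Ck_on_Suc_iff)
qed

lemma Ck_on_SucD: "Ck_on (Suc k) n U f \<Longrightarrow> Ck_on k n U f"
  by (induction k arbitrary: f) (auto simp: Ck_on_Suc_iff)

lemma Ck_on_subset:
  assumes "V \<subseteq> U" "Ck_on k n U f"
  shows "Ck_on k n V f"
  using assms(2)
proof (induction k arbitrary: f)
  case 0
  then show ?case using assms(1) continuous_map_from_subtopology_mono by fastforce
next
  case (Suc k)
  then have "continuous_map (subtopology (Euclidean_space n) V) euclideanreal f"
    using assms(1) Ck_on_continuous continuous_map_from_subtopology_mono by blast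
  then show ?case using Suc assms(1) by (auto simp: Ck_on_Suc_iff)
qed

lemma continuous_map_local:
  assumes U: "U \<subseteq> Rn n"
    and loc: "\<And>x. x \<in> U \<Longrightarrow> \<exists>V. openin (Euclidean_space n) V \<and> x \<in> V \<and>
      continuous_map (subtopology (Euclidean_space n) (U \<inter> V)) euclideanreal f"
  shows "continuous_map (subtopology (Euclidean_space n) U) euclideanreal f"
  unfolding continuous_on_cube_iff[OF U]
proof (intro ballI allI impI)
  fix x and e :: real assume x: "x \<in> U" and e: "e > 0"
  obtain V where V: "openin (Euclidean_space n) V" "x \<in> V"
    "continuous_map (subtopology (Euclidean_space n) (U \<inter> V)) euclideanreal f"
    using loc[OF x] by blast
  obtain d where d: "d > 0" "cube n x d \<subseteq> V" using cube_in_open[OF V(1,2)] by blast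
  have "U \<inter> V \<subseteq> Rn n" using U by blast
  from V(3)[unfolded continuous_on_cube_iff[OF this]] x V(2) e
  obtain d' where d': "d' > 0" "\<And>y. y \<in> U \<inter> V \<Longrightarrow> y \<in> cube n x d' \<Longrightarrow> \<bar>f y - f x\<bar> < e" by blast
  have "\<bar>f y - f x\<bar> < e" if "y \<in> U" "y \<in> cube n x (min d d')" for y
  proof -
    have "y \<in> cube n x d" "y \<in> cube n x d'" using that by (auto simp: cube_def)
    then show ?thesis using d d' that by blast
  qed
  moreover have "min d d' > 0" using d d' by auto
  ultimately show "\<exists>d>0. \<forall>y\<in>U. y \<in> cube n x d \<longrightarrow> \<bar>f y - f x\<bar> < e" by blast
qed

lemma Ck_on_local:
  assumes "U \<subseteq> Rn n" "\<And>x. x \<in> U \<Longrightarrow> \<exists>V. openin (Euclidean_space n) V \<and> x \<in> V \<and> Ck_on k n (U \<inter> V) f"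
  shows "Ck_on k n U f"
  using assms(2)
proof (induction k arbitrary: f)
  case 0
  then show ?case using continuous_map_local[OF assms(1)] by simp
next
  case (Suc k)
  have "continuous_map (subtopology (Euclidean_space n) U) euclideanreal f"
  proof (rule continuous_map_local[OF assms(1)])
    fix x assume "x \<in> U"
    from Suc.prems[OF this]
    show "\<exists>V. openin (Euclidean_space n) V \<and> x \<in> V \<and>
      continuous_map (subtopology (Euclidean_space n) (U \<inter> V)) euclideanreal f"
      by (auto dest: Ck_on_continuous)
  qed
  moreover have "((\<lambda>t. f (x(i := t))) has_real_derivative pderiv_at i f x) (at (x i))" if "i < n" "x \<in> U" for i x
    using Suc.prems[OF that(2)] that by (auto simp: Ck_on_Suc_iff)
  moreover have "Ck_on k n U (pderiv_at i f)" if "i < n" for i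
  proof (rule Suc.IH)
    fix x assume "x \<in> U"
    then show "\<exists>V. openin (Euclidean_space n) V \<and> x \<in> V \<and> Ck_on k n (U \<inter> V) (pderiv_at i f)"
      using Suc.prems[of x] that unfolding Ck_on_Suc_iff by blast
  qed
  ultimately show ?case by (auto simp: Ck_on_Suc_iff)
qed

lemma Ck_on_const: "openin (Euclidean_space n) U \<Longrightarrow> Ck_on k n U (\<lambda>x. c)"
proof (induction k arbitrary: c)
  case (Suc k)
  show ?case by (rule Ck_on_SucI[where f'="\<lambda>_ _. 0"]) (use Suc in \<open>auto intro!: derivative_eq_intros\<close>)
qed auto

lemma Ck_on_proj: 
  assumes U: "openin (Euclidean_space n) U"
  shows "Ck_on k n U (\<lambda>x. x i)"
proof -
  have c: "continuous_map (subtopology (Euclidean_space n) U) euclideanreal (\<lambda>x. x i)"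
    by (intro continuous_map_from_subtopology continuous_map_coordinate)
  show ?thesis
  proof (cases k)
    case (Suc k')
    show ?thesis unfolding Suc
      by (rule Ck_on_SucI[OF U c, where f'="\<lambda>j _. if j = i then 1 else 0"])
         (auto simp: U Ck_on_const fun_upd_def)
  qed (use c in simp)
qed

lemma Ck_on_add:
  assumes U: "openin (Euclidean_space n) U" and "Ck_on k n U f" "Ck_on k n U g"
  shows "Ck_on k n U (\<lambda>x. f x + g x)"
  using assms(2,3)
proof (induction k arbitrary: f g)
  case 0 then show ?case by (auto intro: continuous_map_add)
next
  case (Suc k)
  show ?case
  proof (rule Ck_on_SucI[OF U, where f'="\<lambda>i x. pderiv_at i f x + pderiv_at i g x"])
    show "continuous_map (subtopology (Euclidean_space n) U) euclideanreal (\<lambda>x. f x + g x)"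
      using Suc by (auto simp: Ck_on_Suc_iff intro: continuous_map_add)
    fix i assume i: "i < n"
    show "Ck_on k n U (\<lambda>x. pderiv_at i f x + pderiv_at i g x)"
      using Suc i by (auto simp: Ck_on_Suc_iff)
    fix x assume x: "x \<in> U"
    show "((\<lambda>t. f (x(i := t)) + g (x(i := t))) has_real_derivative
         pderiv_at i f x + pderiv_at i g x) (at (x i))"
      by (rule DERIV_add) (use Suc.prems i x in \<open>simp_all add: Ck_on_Suc_iff\<close>)
  qed
qed

lemma Ck_on_mult:
  assumes U: "openin (Euclidean_space n) U" and "Ck_on k n U f" "Ck_on k n U g"
  shows "Ck_on k n U (\<lambda>x. f x * g x)"
  using assms(2,3)
proof (induction k arbitrary: f g)
  case 0 then show ?case by (auto intro: continuous_map_real_mult)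
next
  case (Suc k)
  have [simp]: "Ck_on k n U f" "Ck_on k n U g" using Suc Ck_on_SucD by auto
  show ?case
  proof (rule Ck_on_SucI[OF U, where f'="\<lambda>i x. pderiv_at i f x * g x + f x * pderiv_at i g x"])
    show "continuous_map (subtopology (Euclidean_space n) U) euclideanreal (\<lambda>x. f x * g x)"
      using Suc by (auto simp: Ck_on_Suc_iff intro: continuous_map_real_mult)
    fix i assume i: "i < n"
    show "Ck_on k n U (\<lambda>x. pderiv_at i f x * g x + f x * pderiv_at i g x)"
      using Suc i by (intro Ck_on_add[OF U] Suc.IH) (auto simp: Ck_on_Suc_iff)
    fix x assume x: "x \<in> U"
    show "((\<lambda>t. f (x(i := t)) * g (x(i := t))) has_real_derivative
         pderiv_at i f x * g x + f x * pderiv_at i g x) (at (x i))"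
      using DERIV_mult[of "\<lambda>t. f (x(i := t))" "pderiv_at i f x" "x i" UNIV "\<lambda>t. g (x(i := t))" "pderiv_at i g x"] Suc i x
      by (auto simp: Ck_on_Suc_iff algebra_simps)
  qed
qed

lemma Ck_on_sum:
  assumes "openin (Euclidean_space n) U" "\<And>j. j \<in> J \<Longrightarrow> Ck_on k n U (f j)"
  shows "Ck_on k n U (\<lambda>x. \<Sum>j\<in>J. f j x)"
  using assms by (induction J rule: infinite_finite_induct) (auto intro: Ck_on_const Ck_on_add)

lemma mean_value_between:
  fixes F F' :: "real \<Rightarrow> real"
  assumes D: "\<And>s. \<bar>s - x\<bar> < d \<Longrightarrow> (F has_real_derivative F' s) (at s)" and t: "\<bar>t - x\<bar> < d"
  shows "\<exists>s. \<bar>s - x\<bar> < d \<and> F t - F x = (t - x) * F' s"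
proof -
  consider "t = x" | "t < x" | "x < t" by linarith
  then show ?thesis
  proof cases
    case 1
    then show ?thesis using t by (intro exI[of _ x]) auto
  next
    case 2
    have "\<exists>s>t. s < x \<and> F x - F t = (x - t) * F' s" by (rule MVT2[OF 2]) (rule D, use t in linarith)
    then obtain s where "s > t" "s < x" "F x - F t = (x - t) * F' s" by blast
    then show ?thesis using t by (intro exI[of _ s]) (auto simp: algebra_simps)
  next
    case 3
    have "\<exists>s>x. s < t \<and> F t - F x = (t - x) * F' s" by (rule MVT2[OF 3]) (rule D, use t in linarith)
    then obtain s where "s > x" "s < t" "F t - F x = (t - x) * F' s" by blast
    then show ?thesis using t by (intro exI[of _ s]) auto
  qed
qed

text \<open>
  Chain rule along a curve: the points \<open>x\<^sub>j\<close> that agree with \<open>c t\<close> in the first \<open>j\<close> coordinates and with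
  \<open>c t\<^sub>0\<close> in the others join \<open>c t\<^sub>0\<close> to \<open>c t\<close> by steps in coordinate directions.  By the mean value theorem
  the \<open>j\<close>-th step changes \<open>f\<close> by a value of its \<open>j\<close>-th partial derivative times \<open>c t j - c t\<^sub>0 j\<close>, and this
  value tends to the one at \<open>c t\<^sub>0\<close> as the partial derivatives are continuous.
\<close>

lemma chain_rule_curve:
  fixes c :: "real \<Rightarrow> nat \<Rightarrow> real"
  assumes V: "openin (Euclidean_space m) V" and f: "Ck_on (Suc 0) m V f"
    and cV: "c t0 \<in> V" and cR: "\<forall>\<^sub>F t in nhds t0. c t \<in> Rn m"
    and c': "\<And>j. j < m \<Longrightarrow> ((\<lambda>t. c t j) has_real_derivative c' j) (at t0)"
  shows "((\<lambda>t. f (c t)) has_real_derivative (\<Sum>j<m. pderiv_at j f (c t0) * c' j)) (at t0)"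
proof -
  define x where "x = c t0"
  define mix where "mix = (\<lambda>j t i. if i < j then c t i else x i)"
  have xR: "x \<in> Rn m" using cV V openin_Rn_subset x_def by blast
  have mix0: "mix j t0 = x" for j by (auto simp: mix_def x_def)
  have step: "((\<lambda>t. f (mix (Suc j) t) - f (mix j t)) has_real_derivative pderiv_at j f x * c' j) (at t0)"
    if j: "j < m" for j
  proof -
    have *: "\<exists>\<delta>>0. \<forall>y\<in>cube m x \<delta>. y \<in> V \<and> \<bar>pderiv_at j f y - pderiv_at j f x\<bar> < e" if e: "e > 0" for e
    proof -
      have "continuous_map (subtopology (Euclidean_space m) V) euclideanreal (pderiv_at j f)"
        using f j by (auto simp: Ck_on_Suc_iff)
      from this[unfolded continuous_on_cube_iff[OF openin_Rn_subset[OF V]]] cV e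
      obtain d where d: "d > 0" "\<And>y. y\<in>V \<Longrightarrow> y \<in> cube m x d \<Longrightarrow> \<bar>pderiv_at j f y - pderiv_at j f x\<bar> < e"
        unfolding x_def by blast
      obtain d' where d': "d' > 0" "cube m x d' \<subseteq> V" using cube_in_open[OF V cV] x_def by blast
      have "cube m x (min d d') \<subseteq> cube m x d \<inter> cube m x d'" by (auto simp: cube_def)
      then show ?thesis using d d' by (intro exI[of _ "min d d'"]) auto
    qed
    have near: "\<forall>\<^sub>F t in nhds t0. c t \<in> cube m x \<delta>" if d: "\<delta> > 0" for \<delta>
    proof -
      have "\<forall>\<^sub>F t in nhds t0. \<bar>c t i - x i\<bar> < \<delta>" if "i < m" for i
      proof -
        have "isCont (\<lambda>t. c t i) t0" using c'[OF that] DERIV_isCont by blast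
        then have "((\<lambda>t. c t i) \<longlongrightarrow> x i) (nhds t0)" using isCont_def tendsto_at_iff_tendsto_nhds x_def by metis
        then show ?thesis using d by (auto simp: tendsto_iff dist_real_def)
      qed
      then have "\<forall>\<^sub>F t in nhds t0. \<forall>i\<in>{..<m}. \<bar>c t i - x i\<bar> < \<delta>" by (intro eventually_ball_finite) auto
      then show ?thesis using cR by eventually_elim (auto simp: cube_def)
    qed
    \<comment> \<open>the mean value theorem in the coordinate \<open>j\<close>\<close>
    have mvt: "\<exists>\<xi>. \<xi> \<in> cube m x \<delta> \<and> f (mix (Suc j) t) - f (mix j t) = pderiv_at j f \<xi> * (c t j - x j)"
      if ct: "c t \<in> cube m x \<delta>" and dV: "cube m x \<delta> \<subseteq> V" and d: "\<delta> > 0" for t \<delta>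
    proof -
      define y where "y = mix j t"
      have yc: "y(j := s) \<in> cube m x \<delta>" if "\<bar>s - x j\<bar> < \<delta>" for s
        using ct xR d j that by (auto simp: y_def mix_def cube_def Rn_iff)
      have y1: "mix j t = y(j := x j)" "mix (Suc j) t = y(j := c t j)"
        by (auto simp: y_def mix_def)
      have der: "((\<lambda>s. f (y(j := s))) has_real_derivative pderiv_at j f (y(j := s))) (at s)"
        if "\<bar>s - x j\<bar> < \<delta>" for s
      proof -
        have "y(j := s) \<in> V" using yc[OF that] dV by blast
        then have "((\<lambda>t. f ((y(j := s))(j := t))) has_real_derivative pderiv_at j f (y(j := s))) (at ((y(j := s)) j))"
          using f j unfolding Ck_on_Suc_iff by blast
        then show ?thesis by simp
      qed
      have ctj: "\<bar>c t j - x j\<bar> < \<delta>" using ct j by (auto simp: cube_def)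
      obtain s where "\<bar>s - x j\<bar> < \<delta>"
        "f (y(j := c t j)) - f (y(j := x j)) = (c t j - x j) * pderiv_at j f (y(j := s))"
        using mean_value_between[where F="\<lambda>s. f (y(j := s))" and F'="\<lambda>s. pderiv_at j f (y(j := s))", OF der ctj] by blast
      then show ?thesis using yc y1 by (intro exI[of _ "y(j := s)"]) (simp add: mult.commute)
    qed
    \<comment> \<open>the difference quotient in direction \<open>j\<close>, continued to the case \<open>c t j = c t\<^sub>0 j\<close>, in which the step is trivial\<close>
    define \<Phi> where "\<Phi> = (\<lambda>t. if c t j = x j then pderiv_at j f x
        else (f (mix (Suc j) t) - f (mix j t)) / (c t j - x j))"
    have \<Phi>: "(\<Phi> \<longlongrightarrow> pderiv_at j f x) (at t0)"
      unfolding tendsto_iff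
    proof (intro allI impI)
      fix e :: real assume "e > 0"
      then obtain \<delta> where \<delta>: "\<delta> > 0" "\<forall>y\<in>cube m x \<delta>. y \<in> V \<and> \<bar>pderiv_at j f y - pderiv_at j f x\<bar> < e"
        using * by blast
      have "\<forall>\<^sub>F t in nhds t0. dist (\<Phi> t) (pderiv_at j f x) < e"
        using near[OF \<delta>(1)]
      proof eventually_elim
        case (elim t)
        obtain \<xi> where "\<xi> \<in> cube m x \<delta>" "f (mix (Suc j) t) - f (mix j t) = pderiv_at j f \<xi> * (c t j - x j)"
          using mvt[OF elim _ \<delta>(1)] \<delta>(2) by blast
        then show ?case using \<delta>(2) \<open>e > 0\<close> by (auto simp: \<Phi>_def dist_real_def)
      qed
      then show "\<forall>\<^sub>F t in at t0. dist (\<Phi> t) (pderiv_at j f x) < e"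
        by (simp add: eventually_nhds_conv_at)
    qed
    have "((\<lambda>t. \<Phi> t * ((c t j - c t0 j) / (t - t0))) \<longlongrightarrow> pderiv_at j f x * c' j) (at t0)"
      by (intro tendsto_mult \<Phi>) (use c'[OF j] in \<open>simp add: has_field_derivative_iff\<close>)
    moreover have "\<forall>\<^sub>F t in at t0. \<Phi> t * ((c t j - c t0 j) / (t - t0)) =
        ((f (mix (Suc j) t) - f (mix j t)) - (f (mix (Suc j) t0) - f (mix j t0))) / (t - t0)"
    proof -
      obtain \<delta> where \<delta>: "\<delta> > 0" "\<forall>y\<in>cube m x \<delta>. y \<in> V \<and> \<bar>pderiv_at j f y - pderiv_at j f x\<bar> < 1"
        using *[of 1] by auto
      have "\<forall>\<^sub>F t in nhds t0. \<Phi> t * ((c t j - c t0 j) / (t - t0)) =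
        ((f (mix (Suc j) t) - f (mix j t)) - (f (mix (Suc j) t0) - f (mix j t0))) / (t - t0)"
        using near[OF \<delta>(1)]
      proof eventually_elim
        case (elim t)
        obtain \<xi> where "\<xi> \<in> cube m x \<delta>" "f (mix (Suc j) t) - f (mix j t) = pderiv_at j f \<xi> * (c t j - x j)"
          using mvt[OF elim _ \<delta>(1)] \<delta>(2) by blast
        then show ?case by (auto simp: \<Phi>_def mix0 x_def)
      qed
      then show ?thesis by (simp add: eventually_nhds_conv_at)
    qed
    ultimately show ?thesis
      unfolding has_field_derivative_iff by (rule Lim_transform_eventually)
  qed
  have "((\<lambda>t. \<Sum>j<m. f (mix (Suc j) t) - f (mix j t)) has_real_derivative (\<Sum>j<m. pderiv_at j f x * c' j)) (at t0)"
    by (rule DERIV_sum) (use step in auto)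
  then have "((\<lambda>t. f (mix m t) - f (mix 0 t)) has_real_derivative (\<Sum>j<m. pderiv_at j f x * c' j)) (at t0)"
    by (simp only: sum_lessThan_telescope[where f="\<lambda>j. f (mix j _)"])
  then have "((\<lambda>t. f (mix m t) - f x + f x) has_real_derivative (\<Sum>j<m. pderiv_at j f x * c' j) + 0) (at t0)"
    by (intro DERIV_add DERIV_const) (simp add: mix_def)
  then have "((\<lambda>t. f (mix m t)) has_real_derivative (\<Sum>j<m. pderiv_at j f x * c' j)) (at t0)" by simp
  moreover have ev: "\<forall>\<^sub>F t in nhds t0. f (mix m t) = f (c t)"
    using cR
  proof eventually_elim
    case (elim t)
    have "mix m t = c t" using elim xR by (auto simp: mix_def Rn_iff fun_eq_iff)
    then show ?case by simp
  qed
  ultimately show ?thesis unfolding x_def by (simp only: DERIV_cong_ev[OF refl ev refl])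
qed

text \<open>
  The partial derivatives of \<open>f \<circ> G\<close> are sums of products of \<open>(\<partial>\<^sub>j f) \<circ> G\<close> and \<open>\<partial>\<^sub>i G\<^sub>j\<close>, which are of
  class \<open>C\<^sup>k\<close> by induction if \<open>f\<close> and \<open>G\<close> are of class \<open>C\<^sup>k\<^sup>+\<^sup>1\<close>.
\<close>

lemma Ck_on_compose:
  assumes U: "openin (Euclidean_space n) U" and V: "openin (Euclidean_space m) V"
    and GV: "\<And>x. x \<in> U \<Longrightarrow> G x \<in> V" and G: "\<And>j. j < m \<Longrightarrow> Ck_on k n U (\<lambda>x. G x j)"
    and f: "Ck_on k m V f"
  shows "Ck_on k n U (\<lambda>x. f (G x))"
  using G f
proof (induction k arbitrary: f)
  have cont: "continuous_map (subtopology (Euclidean_space n) U) euclideanreal (\<lambda>x. f (G x))"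
    if "\<And>j. j < m \<Longrightarrow> continuous_map (subtopology (Euclidean_space n) U) euclideanreal (\<lambda>x. G x j)"
      "continuous_map (subtopology (Euclidean_space m) V) euclideanreal f" for f
  proof -
    have "continuous_map (subtopology (Euclidean_space n) U) (Euclidean_space m) (\<lambda>x i. if i < m then G x i else 0)"
      using that by (simp add: continuous_map_componentwise_Euclidean_space)
    then have "continuous_map (subtopology (Euclidean_space n) U) (Euclidean_space m) G"
      by (rule continuous_map_eq) (use GV openin_Rn_subset[OF V] in \<open>force simp: Rn_iff fun_eq_iff\<close>)
    then have "continuous_map (subtopology (Euclidean_space n) U) (subtopology (Euclidean_space m) V) G"
      by (rule continuous_map_into_subtopology) (use GV in auto)
    from continuous_map_compose[OF this that(2)] show ?thesis by (simp add: o_def)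
  qed
  {
    case 0
    then show ?case using cont by auto
  next
    case (Suc k)
    show ?case
    proof (rule Ck_on_SucI[OF U, where f'="\<lambda>i x. \<Sum>j<m. pderiv_at j f (G x) * pderiv_at i (\<lambda>x. G x j) x"])
      show "continuous_map (subtopology (Euclidean_space n) U) euclideanreal (\<lambda>x. f (G x))"
        by (rule cont[OF Ck_on_continuous[OF Suc.prems(1)] Ck_on_continuous[OF Suc.prems(2)]])
      fix i assume i: "i < n"
      show "Ck_on k n U (\<lambda>x. \<Sum>j<m. pderiv_at j f (G x) * pderiv_at i (\<lambda>x. G x j) x)"
      proof (intro Ck_on_sum[OF U] Ck_on_mult[OF U])
        fix j assume j: "j \<in> {..<m}"
        then show "Ck_on k n U (pderiv_at i (\<lambda>x. G x j))" using Suc.prems(1) i by (auto simp: Ck_on_Suc_iff)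
        show "Ck_on k n U (\<lambda>x. pderiv_at j f (G x))"
        proof (rule Suc.IH)
          show "Ck_on k n U (\<lambda>x. G x j)" if "j < m" for j by (rule Ck_on_SucD[OF Suc.prems(1)[OF that]])
          show "Ck_on k m V (pderiv_at j f)" using Suc.prems(2) j by (simp add: Ck_on_Suc_iff)
        qed
      qed
      fix x assume x: "x \<in> U"
      have "((\<lambda>t. f (G (x(i := t)))) has_real_derivative
         (\<Sum>j<m. pderiv_at j f (G (x(i := x i))) * pderiv_at i (\<lambda>x. G x j) x)) (at (x i))"
      proof (rule chain_rule_curve[OF V])
        show "Ck_on (Suc 0) m V f" using Suc.prems(2) by (auto simp: Ck_on_Suc_iff Ck_on_continuous)
        show "G (x(i := x i)) \<in> V" using GV x by auto
        show "\<forall>\<^sub>F t in nhds (x i). G (x(i := t)) \<in> Rn m"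
          using eventually_line_in[OF U x i] by eventually_elim (use GV openin_Rn_subset[OF V] in blast)
        fix j assume "j < m"
        then show "((\<lambda>t. G (x(i := t)) j) has_real_derivative pderiv_at i (\<lambda>x. G x j) x) (at (x i))"
          using Suc.prems(1) i x by (auto simp: Ck_on_Suc_iff)
      qed
      then show "((\<lambda>t. f (G (x(i := t)))) has_real_derivative
         (\<Sum>j<m. pderiv_at j f (G x) * pderiv_at i (\<lambda>x. G x j) x)) (at (x i))" by simp
    qed
  }
qed

lemma openin_Rn1: "open T \<Longrightarrow> openin (Euclidean_space (Suc 0)) {x \<in> Rn (Suc 0). x 0 \<in> T}"
  by (rule openin_continuous_map_preimage[OF continuous_map_coordinate]) auto

definition smooth_real_fun :: "real set \<Rightarrow> (real \<Rightarrow> real) \<Rightarrow> bool" where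
  "smooth_real_fun T f \<longleftrightarrow> smooth_on 1 {x \<in> Rn 1. x 0 \<in> T} (\<lambda>x. f (x 0))"

text \<open>
  By induction on the order of differentiability, as the derivative of a member is again a member.  The
  set \<open>\<F>\<close> replaces formulas for the higher derivatives.
\<close>

lemma smooth_real_fun_coinduct:
  assumes T: "open T" and f: "f \<in> \<F>"
    and step: "\<And>g. g \<in> \<F> \<Longrightarrow> \<exists>g'\<in>\<F>. \<forall>t\<in>T. (g has_real_derivative g' t) (at t)"
  shows "smooth_real_fun T f"
proof -
  have "Ck_on k (Suc 0) {x \<in> Rn (Suc 0). x 0 \<in> T} (\<lambda>x. f (x 0))" if "f \<in> \<F>" for k f
    using that
  proof (induction k arbitrary: f)
    have c: "continuous_map (subtopology (Euclidean_space (Suc 0)) {x \<in> Rn (Suc 0). x 0 \<in> T}) euclideanreal (\<lambda>x. f (x 0))"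
      if f: "f \<in> \<F>" for f
    proof -
      have "continuous_on T f" using step[OF f] by (meson DERIV_continuous_on has_field_derivative_at_within)
      then have "continuous_map (top_of_set T) euclideanreal f" by simp
      moreover have "continuous_map (subtopology (Euclidean_space (Suc 0)) {x \<in> Rn (Suc 0). x 0 \<in> T}) (top_of_set T) (\<lambda>x. x 0)"
        by (intro continuous_map_into_subtopology continuous_map_from_subtopology continuous_map_coordinate) auto
      ultimately have "continuous_map (subtopology (Euclidean_space (Suc 0)) {x \<in> Rn (Suc 0). x 0 \<in> T}) euclideanreal (f \<circ> (\<lambda>x. x 0))"
        by (rule continuous_map_compose[rotated])
      then show ?thesis by (simp add: o_def)
    qed
    {
      case 0
      then show ?case using c by simp
    next
      case (Suc k)
      then obtain g' where g': "g' \<in> \<F>" "\<forall>t\<in>T. (f has_real_derivative g' t) (at t)" using step by blast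
      show ?case
        by (rule Ck_on_SucI[OF openin_Rn1[OF T] c[OF Suc.prems], where f'="\<lambda>i x. g' (x 0)"])
           (use g' Suc.IH in auto)
    }
  qed
  then show ?thesis using f by (simp add: smooth_real_fun_def smooth_on_def)
qed

lemma Ck_on_compose_real:
  assumes U: "openin (Euclidean_space n) U" and T: "open T" and "smooth_real_fun T f"
    and "\<And>x. x \<in> U \<Longrightarrow> g x \<in> T" "Ck_on k n U g"
  shows "Ck_on k n U (\<lambda>x. f (g x))"
proof -
  define G where "G = (\<lambda>x i. if i = (0::nat) then g x else 0)"
  have "Ck_on k n U (\<lambda>x. f (G x 0))"
  proof (rule Ck_on_compose[OF U openin_Rn1[OF T], where f="\<lambda>y. f (y 0)"])
    show "Ck_on k (Suc 0) {x \<in> Rn (Suc 0). x 0 \<in> T} (\<lambda>y. f (y 0))"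
      using assms(3) by (simp add: smooth_real_fun_def smooth_on_def)
    show "G x \<in> {x \<in> Rn (Suc 0). x 0 \<in> T}" if "x \<in> U" for x
      using assms(4)[OF that] by (simp add: G_def Rn_iff)
    show "Ck_on k n U (\<lambda>x. G x j)" if "j < Suc 0" for j
      using that assms(5) by (simp add: G_def)
  qed
  then show ?thesis by (simp add: G_def)
qed

lemma smooth_real_fun_inverse: "smooth_real_fun {t. t \<noteq> 0} inverse"
proof (rule smooth_real_fun_coinduct[where \<F>="{\<lambda>t. c * inverse t ^ m | c m. True}"])
  have "open (- {0::real})" by (rule open_Compl) simp
  then show "open {t::real. t \<noteq> 0}" by (simp add: Compl_eq)
  show "inverse \<in> {\<lambda>t::real. c * inverse t ^ m | c m. True}"
    by (auto intro!: exI[of _ 1] exI[of _ "Suc 0"])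
  fix g :: "real \<Rightarrow> real" assume "g \<in> {\<lambda>t. c * inverse t ^ m | c m. True}"
  then obtain c m where g: "g = (\<lambda>t. c * inverse t ^ m)" by blast
  have "(g has_real_derivative (- (c * real m)) * inverse t ^ Suc m) (at t)" if "t \<noteq> 0" for t
  proof (cases m)
    case 0 then show ?thesis by (simp add: g)
  next
    case (Suc m')
    show ?thesis unfolding g
      by (rule derivative_eq_intros refl | use that in \<open>simp add: Suc field_simps power_inverse\<close>)+
  qed
  then have "\<forall>t\<in>{t. t \<noteq> 0}. (g has_real_derivative (\<lambda>t. (- (c * real m)) * inverse t ^ Suc m) t) (at t)"
    by simp
  moreover have "(\<lambda>t. (- (c * real m)) * inverse t ^ Suc m) \<in> {\<lambda>t. c * inverse t ^ m | c m. True}"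
    by (rule CollectI, rule exI[where x="- (c * real m)"], rule exI[where x="Suc m"]) simp
  ultimately show "\<exists>g'\<in>{\<lambda>t. c * inverse t ^ m | c m. True}. \<forall>t\<in>{t. t \<noteq> 0}. (g has_real_derivative g' t) (at t)"
    by (rule bexI)
qed

lemma Ck_on_divide:
  assumes U: "openin (Euclidean_space n) U" and "Ck_on k n U f" "Ck_on k n U g" "\<And>x. x \<in> U \<Longrightarrow> g x \<noteq> 0"
  shows "Ck_on k n U (\<lambda>x. f x / g x)"
proof -
  have "open (- {0::real})" by (rule open_Compl) simp
  then have "open {t::real. t \<noteq> 0}" by (simp add: Compl_eq)
  then have "Ck_on k n U (\<lambda>x. inverse (g x))"
    by (rule Ck_on_compose_real[OF U _ smooth_real_fun_inverse]) (use assms in auto)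
  then show ?thesis unfolding divide_inverse using Ck_on_mult[OF U] assms by auto
qed

lemma Ck_on_diff:
  assumes U: "openin (Euclidean_space n) U" and "Ck_on k n U f" "Ck_on k n U g"
  shows "Ck_on k n U (\<lambda>x. f x - g x)"
  using Ck_on_add[OF U assms(2) Ck_on_mult[OF U Ck_on_const[OF U, of k "-1"] assms(3)]] by simp

subsection \<open>The flat exponential\<close>

definition flat_exp :: "real \<Rightarrow> real" where
  "flat_exp t = (if t > 0 then exp (- 1 / t) else 0)"

lemma flat_exp_pos: "t > 0 \<Longrightarrow> flat_exp t > 0" and flat_exp_zero: "t \<le> 0 \<Longrightarrow> flat_exp t = 0"
  and flat_exp_nonneg: "flat_exp t \<ge> 0"
  by (auto simp: flat_exp_def)

lemma poly_exp_tendsto_0: "((\<lambda>s. poly P s * exp (- s)) \<longlongrightarrow> (0::real)) at_top"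
proof -
  have "((\<lambda>s. \<Sum>i\<le>degree P. coeff P i * (s ^ i / exp s)) \<longlongrightarrow> (\<Sum>i\<le>degree P. coeff P i * 0)) at_top"
    by (intro tendsto_sum tendsto_mult tendsto_const tendsto_power_div_exp_0)
  then have "((\<lambda>s. \<Sum>i\<le>degree P. coeff P i * (s ^ i / exp s)) \<longlongrightarrow> 0) at_top" by simp
  then show ?thesis
    by (simp add: poly_altdef sum_distrib_right exp_minus divide_inverse mult.assoc)
qed

text \<open>
  The functions \<open>P (1 / t) * exp (- 1 / t)\<close> with \<open>P\<close> a polynomial, continued by \<open>0\<close> to \<open>t \<le> 0\<close>, are
  closed under differentiation.  The only question is the point \<open>0\<close>, where the difference quotient
  is again such a function and tends to \<open>0\<close>, as \<open>exp\<close> grows faster than polynomials.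
\<close>

lemma smooth_flat_exp: "smooth_real_fun UNIV flat_exp"
proof -
  define E where "E = (\<lambda>P (t::real). if t > 0 then poly P (1 / t) * exp (- 1 / t) else 0)"
  \<comment> \<open>\<open>D P\<close> is the polynomial \<open>X\<^sup>2 (P - P')\<close>, by the product rule with \<open>s = 1 / t\<close> and \<open>ds/dt = - s\<^sup>2\<close>\<close>
  define D where "D = (\<lambda>P :: real poly. [:0, 0, 1:] * (P - pderiv P))"
  have der: "(E P has_real_derivative E (D P) t) (at t)" for P t
  proof -
    consider "t < 0" | "t > 0" | "t = 0" by linarith
    then show ?thesis
    proof cases
      case 1
      have "\<forall>\<^sub>F x in nhds t. E P x = 0"
        using order_tendstoD(2)[OF tendsto_ident_at[of t UNIV], of 0] 1
        by (auto simp: E_def eventually_nhds intro!: exI[of _ "{..<0}"])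
      then have "(E P has_real_derivative 0) (at t)"
        using DERIV_cong_ev[of t t "E P" "\<lambda>_. 0" 0 0] by auto
      then show ?thesis using 1 by (simp add: E_def)
    next
      case 2
      have ev: "\<forall>\<^sub>F x in nhds t. E P x = poly P (1 / x) * exp (- 1 / x)"
        using 2 by (auto simp: E_def eventually_nhds intro!: exI[of _ "{0<..}"])
      have "((\<lambda>x. poly P (1 / x)) has_real_derivative poly (pderiv P) (1 / t) * (- 1 / t^2)) (at t)"
        by (rule DERIV_chain2[OF poly_DERIV]) (use 2 in \<open>auto intro!: derivative_eq_intros simp: power2_eq_square\<close>)
      moreover have "((\<lambda>x. exp (- 1 / x)) has_real_derivative exp (- 1 / t) * (1 / t^2)) (at t)"
        by (rule DERIV_chain2[OF DERIV_exp]) (use 2 in \<open>auto intro!: derivative_eq_intros simp: power2_eq_square\<close>)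
      ultimately have "((\<lambda>x. poly P (1 / x) * exp (- 1 / x)) has_real_derivative
          poly (pderiv P) (1 / t) * (- 1 / t^2) * exp (- 1 / t) + exp (- 1 / t) * (1 / t^2) * poly P (1 / t)) (at t)"
        by (rule DERIV_mult)
      moreover have "poly (pderiv P) (1 / t) * (- 1 / t^2) * exp (- 1 / t) + exp (- 1 / t) * (1 / t^2) * poly P (1 / t)
         = E (D P) t"
        using 2 by (simp add: E_def D_def power2_eq_square algebra_simps)
      ultimately have "((\<lambda>x. poly P (1 / x) * exp (- 1 / x)) has_real_derivative E (D P) t) (at t)" by simp
      then show ?thesis using DERIV_cong_ev[OF refl ev refl] by simp
    next
      case 3
      have "((\<lambda>h. E P h / h) \<longlongrightarrow> 0) (at_right 0)"
      proof -
        have "((\<lambda>s. poly (P * [:0, 1:]) s * exp (- s)) \<longlongrightarrow> (0::real)) at_top" by (rule poly_exp_tendsto_0)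
        moreover have "\<forall>\<^sub>F s in at_top. poly (P * [:0, 1:]) s * exp (- s) = E P (inverse s) / inverse s"
          using eventually_gt_at_top[of 0] by eventually_elim (auto simp: E_def field_simps)
        ultimately have "((\<lambda>s. E P (inverse s) / inverse s) \<longlongrightarrow> 0) at_top" by (rule Lim_transform_eventually)
        then show ?thesis by (simp add: filterlim_at_right_to_top)
      qed
      moreover have "((\<lambda>h. E P h / h) \<longlongrightarrow> 0) (at_left 0)"
      proof (rule tendsto_eventually)
        show "\<forall>\<^sub>F h in at_left 0. E P h / h = 0"
          by (auto simp: E_def eventually_at_filter)
      qed
      ultimately have "((\<lambda>h. E P h / h) \<longlongrightarrow> 0) (at 0)" by (simp add: filterlim_split_at)
      then show ?thesis using 3 by (simp add: has_field_derivative_iff E_def)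
    qed
  qed
  have "smooth_real_fun UNIV (E [:1:])"
  proof (rule smooth_real_fun_coinduct[where \<F>="range E"])
    fix g assume "g \<in> range E"
    then obtain P where "g = E P" by blast
    then have "\<forall>t\<in>UNIV. (g has_real_derivative E (D P) t) (at t)" using der by simp
    then show "\<exists>g'\<in>range E. \<forall>t\<in>UNIV. (g has_real_derivative g' t) (at t)" by (intro bexI[where x="E (D P)"]) simp_all
  qed simp_all
  moreover have "E [:1:] = flat_exp" by (simp add: E_def flat_exp_def fun_eq_iff)
  ultimately show ?thesis by simp
qed

lemma Ck_on_flat_exp:
  assumes "openin (Euclidean_space n) U" "Ck_on k n U g"
  shows "Ck_on k n U (\<lambda>x. flat_exp (g x))"
  by (rule Ck_on_compose_real[OF assms(1) open_UNIV smooth_flat_exp]) (use assms in auto)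

section \<open>Algebra of C-infinity-rings\<close>

lemma openin_Rn: "openin (Euclidean_space n) (Rn n)"
  by (rule openin_topspace)

lemma smooth_on_const: "openin (Euclidean_space n) U \<Longrightarrow> smooth_on n U (\<lambda>_. c)"
  and smooth_on_proj: "openin (Euclidean_space n) U \<Longrightarrow> smooth_on n U (\<lambda>x. x i)"
  by (simp_all add: smooth_on_def Ck_on_const Ck_on_proj)

lemma
  assumes "openin (Euclidean_space n) U" "smooth_on n U f" "smooth_on n U g"
  shows smooth_on_add: "smooth_on n U (\<lambda>x. f x + g x)"
    and smooth_on_mult: "smooth_on n U (\<lambda>x. f x * g x)"
    and smooth_on_diff: "smooth_on n U (\<lambda>x. f x - g x)"
    and smooth_on_divide: "(\<And>x. x \<in> U \<Longrightarrow> g x \<noteq> 0) \<Longrightarrow> smooth_on n U (\<lambda>x. f x / g x)"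
    and smooth_on_flat_exp: "smooth_on n U (\<lambda>x. flat_exp (f x))"
  using assms by (simp_all add: smooth_on_def Ck_on_add Ck_on_mult Ck_on_diff Ck_on_divide
      Ck_on_flat_exp)

lemma smooth_on_cong:
  "openin (Euclidean_space n) U \<Longrightarrow> (\<And>x. x \<in> U \<Longrightarrow> f x = g x) \<Longrightarrow> smooth_on n U f \<Longrightarrow> smooth_on n U g"
  unfolding smooth_on_def using Ck_on_cong[of n U f g] by simp

lemma smooth_on_subset: "V \<subseteq> U \<Longrightarrow> smooth_on n U f \<Longrightarrow> smooth_on n V f"
  unfolding smooth_on_def using Ck_on_subset by simp

lemma smooth_on_sum:
  assumes "openin (Euclidean_space n) U" "\<And>j. j \<in> J \<Longrightarrow> smooth_on n U (f j)"
  shows "smooth_on n U (\<lambda>x. \<Sum>j\<in>J. f j x)"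
  using assms by (simp add: smooth_on_def Ck_on_sum)

lemma smooth_on_compose:
  assumes "openin (Euclidean_space n) U" "openin (Euclidean_space m) V"
    "\<And>x. x \<in> U \<Longrightarrow> G x \<in> V" "\<And>j. j < m \<Longrightarrow> smooth_on n U (\<lambda>x. G x j)" "smooth_on m V f"
  shows "smooth_on n U (\<lambda>x. f (G x))"
  unfolding smooth_on_def
proof
  fix k
  have G: "Ck_on k n U (\<lambda>x. G x j)" if "j < m" for j
    using assms(4)[OF that] by (simp add: smooth_on_def)
  have "Ck_on k m V f" using assms(5) by (simp add: smooth_on_def)
  then show "Ck_on k n U (\<lambda>x. f (G x))"
    by (intro Ck_on_compose[where G=G and f=f and V=V and m=m] assms(1,2,3) G)
qed

lemma smooth_on_local:
  assumes "U \<subseteq> Rn n"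
    "\<And>x. x \<in> U \<Longrightarrow> \<exists>V. openin (Euclidean_space n) V \<and> x \<in> V \<and> smooth_on n (U \<inter> V) f"
  shows "smooth_on n U f"
  unfolding smooth_on_def
proof
  fix k show "Ck_on k n U f"
  proof (rule Ck_on_local[OF assms(1)])
    fix x assume "x \<in> U"
    from assms(2)[OF this] show "\<exists>V. openin (Euclidean_space n) V \<and> x \<in> V \<and> Ck_on k n (U \<inter> V) f"
      by (auto simp: smooth_on_def)
  qed
qed

abbreviation smooth_real :: "(real \<Rightarrow> real) \<Rightarrow> bool" where
  "smooth_real h \<equiv> smooth_on (Suc 0) (Rn (Suc 0)) (\<lambda>x. h (x 0))"

lemma restrict_Cinf_Rn [simp]: "smooth_on n (Rn n) g \<Longrightarrow> restrict g (Rn n) \<in> Cinf_Rn n"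
  using smooth_on_cong[OF openin_Rn, of n g "restrict g (Rn n)"] by (simp add: Cinf_Rn_def)

lemma Cinf_RnD: "f \<in> Cinf_Rn n \<Longrightarrow> smooth_on n (Rn n) f" "f \<in> Cinf_Rn n \<Longrightarrow> restrict f (Rn n) = f"
  by (auto simp: Cinf_Rn_def extensional_restrict)

lemma point_in_Rn [simp]: "point as \<in> Rn (length as)"
  by (simp add: Rn_iff point_def)

lemma smooth_real_affine: "smooth_real (\<lambda>t. t - c)"
  by (intro smooth_on_diff smooth_on_const smooth_on_proj openin_Rn)

text \<open>
  Near \<open>c\<close> the function \<open>t / (t\<^sup>2 + flat_exp (c\<^sup>2 / 2 - t\<^sup>2))\<close> is \<open>1 / t\<close>, and its denominator is
  positive everywhere.  So elements of a C-infinity-ring can be inverted near a point at which they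
  do not vanish.
\<close>

lemma smooth_local_inverse:
  assumes "c \<noteq> (0::real)"
  obtains r e where "smooth_real r" "e > 0" "\<And>t. \<bar>t - c\<bar> < e \<Longrightarrow> t * r t = 1"
proof
  define r where "r = (\<lambda>t. t / (t * t + flat_exp (c\<^sup>2 / 2 - t * t)))"
  have pos: "t * t + flat_exp (c\<^sup>2 / 2 - t * t) > 0" for t
    using assms flat_exp_nonneg[of "c\<^sup>2 / 2 - t * t"] flat_exp_pos[of "c\<^sup>2 / 2"]
    by (cases "t = 0") (auto intro!: add_pos_nonneg simp: zero_less_mult_iff)
  show "smooth_real r" unfolding r_def
    using pos by (intro smooth_on_divide smooth_on_add smooth_on_mult smooth_on_diff
        smooth_on_flat_exp[where g="\<lambda>_. 0"] smooth_on_const smooth_on_proj openin_Rn) (metis less_irrefl)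
  show "\<bar>c\<bar> / 4 > 0" using assms by simp
  fix t assume t: "\<bar>t - c\<bar> < \<bar>c\<bar> / 4"
  have "\<bar>t\<bar> \<ge> 3 / 4 * \<bar>c\<bar>" using t by (auto simp: abs_if split: if_splits)
  then have "(3 / 4 * \<bar>c\<bar>) * (3 / 4 * \<bar>c\<bar>) \<le> \<bar>t\<bar> * \<bar>t\<bar>"
    by (intro mult_mono) auto
  then have "9 / 16 * c\<^sup>2 \<le> t * t" by (simp add: power2_eq_square)
  moreover have "c\<^sup>2 > 0" using assms by simp
  ultimately have "c\<^sup>2 / 2 - t * t \<le> 0" and t0: "t * t \<noteq> 0" by linarith+
  then show "t * r t = 1" by (simp add: r_def flat_exp_zero)
qed

lemma smooth_bump_at:
  assumes "e > 0"
  obtains b where "smooth_real b" "b c > 0" "\<And>t. \<bar>t - c\<bar> \<ge> e \<Longrightarrow> b t = 0"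
proof
  show "smooth_real (\<lambda>t. flat_exp (e\<^sup>2 - (t - c) * (t - c)))"
    by (intro smooth_on_flat_exp[where g="\<lambda>_. 0"] smooth_on_mult smooth_on_diff
         smooth_on_const smooth_on_proj openin_Rn)
  show "flat_exp (e\<^sup>2 - (c - c) * (c - c)) > 0" using assms by (simp add: flat_exp_pos)
  fix t assume "\<bar>t - c\<bar> \<ge> e"
  then have "e * e \<le> \<bar>t - c\<bar> * \<bar>t - c\<bar>" using assms by (intro mult_mono) auto
  then show "flat_exp (e\<^sup>2 - (t - c) * (t - c)) = 0"
    by (intro flat_exp_zero) (simp add: power2_eq_square)
qed

text \<open>
  Operations are indexed by extensional functions; \<open>cval\<close> accepts any function and restricts it, so that
  operations can be written as lambda terms.
\<close>

definition cval :: "'a cinf_ring \<Rightarrow> 'a list \<Rightarrow> ((nat \<Rightarrow> real) \<Rightarrow> real) \<Rightarrow> 'a" where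
  "cval A as g = cop A (restrict g (Rn (length as))) as"

lemma underlying_ring_simps:
  "carrier (underlying_ring A) = carrier A"
  "a \<otimes>\<^bsub>underlying_ring A\<^esub> b = cval A [a, b] (\<lambda>x. x 0 * x 1)"
  "a \<oplus>\<^bsub>underlying_ring A\<^esub> b = cval A [a, b] (\<lambda>x. x 0 + x 1)"
  "\<one>\<^bsub>underlying_ring A\<^esub> = cval A [] (\<lambda>_. 1)"
  "\<zero>\<^bsub>underlying_ring A\<^esub> = cval A [] (\<lambda>_. 0)"
  by (simp_all add: underlying_ring_def cval_def numeral_2_eq_2)

context cinf_ring
begin

lemma cval_closed [simp]:
  "as \<in> lists (carrier A) \<Longrightarrow> smooth_on (length as) (Rn (length as)) g \<Longrightarrow> cval A as g \<in> carrier A"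
  unfolding cval_def by (rule cop_closed) simp_all

lemma cval_proj: "as \<in> lists (carrier A) \<Longrightarrow> i < length as \<Longrightarrow> cval A as (\<lambda>x. x i) = as ! i"
  unfolding cval_def by (rule cop_proj)

lemma cval_compose:
  assumes as: "as \<in> lists (carrier A)"
    and gs: "\<And>g. g \<in> set gs \<Longrightarrow> smooth_on (length as) (Rn (length as)) g"
    and f: "smooth_on (length gs) (Rn (length gs)) f"
  shows "cval A (map (cval A as) gs) f = cval A as (\<lambda>x. f (point (map (\<lambda>g. g x) gs)))"
proof -
  let ?gs = "map (\<lambda>g. restrict g (Rn (length as))) gs"
  have "cop A (\<lambda>x\<in>Rn (length as). (restrict f (Rn (length gs))) (point (map (\<lambda>g. g x) ?gs))) as =
          cop A (restrict f (Rn (length gs))) (map (\<lambda>g. cop A g as) ?gs)"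
    using cop_compose[OF as, of ?gs "restrict f (Rn (length gs))"] gs f by (auto simp: in_lists_conv_set)
  moreover have "(\<lambda>x\<in>Rn (length as). (restrict f (Rn (length gs))) (point (map (\<lambda>g. g x) ?gs)))
      = (\<lambda>x\<in>Rn (length as). f (point (map (\<lambda>g. g x) gs)))"
  proof (rule restrict_ext)
    fix x assume x: "x \<in> Rn (length as)"
    have "map (\<lambda>g. g x) ?gs = map (\<lambda>g. g x) gs" using x by simp
    moreover have "point (map (\<lambda>g. g x) gs) \<in> Rn (length gs)"
      using point_in_Rn[of "map (\<lambda>g. g x) gs"] by (simp only: length_map)
    ultimately show "(restrict f (Rn (length gs))) (point (map (\<lambda>g. g x) ?gs)) = f (point (map (\<lambda>g. g x) gs))"
      by (simp only: restrict_apply simp_thms if_True)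
  qed
  ultimately show ?thesis by (simp add: cval_def[abs_def] o_def)
qed

lemma cval_const: "as \<in> lists (carrier A) \<Longrightarrow> cval A as (\<lambda>_. c) = cval A [] (\<lambda>_. c)"
  using cval_compose[of as "[]" "\<lambda>_. c"] by (simp add: smooth_on_const openin_Rn)

lemma
  assumes "as \<in> lists (carrier A)" "smooth_on (length as) (Rn (length as)) g"
    "smooth_on (length as) (Rn (length as)) h"
  shows cval_mult: "cval A as g \<otimes>\<^bsub>underlying_ring A\<^esub> cval A as h = cval A as (\<lambda>x. g x * h x)"
    and cval_add: "cval A as g \<oplus>\<^bsub>underlying_ring A\<^esub> cval A as h = cval A as (\<lambda>x. g x + h x)"
proof -
  have 2: "smooth_on (length [g, h]) (Rn (length [g, h])) (\<lambda>x. x 0 * x 1)"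
    "smooth_on (length [g, h]) (Rn (length [g, h])) (\<lambda>x. x 0 + x 1)"
    by (intro smooth_on_mult smooth_on_add smooth_on_proj openin_Rn)+
  show "cval A as g \<otimes>\<^bsub>underlying_ring A\<^esub> cval A as h = cval A as (\<lambda>x. g x * h x)"
    "cval A as g \<oplus>\<^bsub>underlying_ring A\<^esub> cval A as h = cval A as (\<lambda>x. g x + h x)"
    using cval_compose[OF assms(1) _ 2(1)] cval_compose[OF assms(1) _ 2(2)] assms(2,3)
    by (auto simp: underlying_ring_simps point_def)
qed

lemma cval_proj3:
  assumes "a \<in> carrier A" "b \<in> carrier A" "c \<in> carrier A"
  shows "cval A [a, b, c] (\<lambda>x. x 0) = a" "cval A [a, b, c] (\<lambda>x. x (Suc 0)) = b"
    "cval A [a, b, c] (\<lambda>x. x (Suc (Suc 0))) = c"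
  using cval_proj[of "[a, b, c]" 0] cval_proj[of "[a, b, c]" "Suc 0"] cval_proj[of "[a, b, c]" "Suc (Suc 0)"] assms
  by simp_all

text \<open>
  Every ring identity is an equality of two polynomial functions, applied to the same tuple.
\<close>

lemma cring_underlying: "cring (underlying_ring A)"
proof -
  let ?R = "underlying_ring A"
  note sm = smooth_on_mult smooth_on_add smooth_on_proj smooth_on_const openin_Rn
  have closed: "a \<otimes>\<^bsub>?R\<^esub> b \<in> carrier A" "a \<oplus>\<^bsub>?R\<^esub> b \<in> carrier A"
    if "a \<in> carrier A" "b \<in> carrier A" for a b
    unfolding underlying_ring_simps using that by (auto intro!: cval_closed sm)
  have const_closed: "\<one>\<^bsub>?R\<^esub> \<in> carrier A" "\<zero>\<^bsub>?R\<^esub> \<in> carrier A"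
    unfolding underlying_ring_simps by (auto intro!: cval_closed sm)
  have laws: "(a \<otimes>\<^bsub>?R\<^esub> b) \<otimes>\<^bsub>?R\<^esub> c = a \<otimes>\<^bsub>?R\<^esub> (b \<otimes>\<^bsub>?R\<^esub> c)" "a \<otimes>\<^bsub>?R\<^esub> b = b \<otimes>\<^bsub>?R\<^esub> a"
    "(a \<oplus>\<^bsub>?R\<^esub> b) \<oplus>\<^bsub>?R\<^esub> c = a \<oplus>\<^bsub>?R\<^esub> (b \<oplus>\<^bsub>?R\<^esub> c)" "a \<oplus>\<^bsub>?R\<^esub> b = b \<oplus>\<^bsub>?R\<^esub> a"
    "(a \<oplus>\<^bsub>?R\<^esub> b) \<otimes>\<^bsub>?R\<^esub> c = (a \<otimes>\<^bsub>?R\<^esub> c) \<oplus>\<^bsub>?R\<^esub> (b \<otimes>\<^bsub>?R\<^esub> c)"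
    "\<one>\<^bsub>?R\<^esub> \<otimes>\<^bsub>?R\<^esub> a = a" "\<zero>\<^bsub>?R\<^esub> \<oplus>\<^bsub>?R\<^esub> a = a" "\<exists>y\<in>carrier A. y \<oplus>\<^bsub>?R\<^esub> a = \<zero>\<^bsub>?R\<^esub>"
    if abc: "a \<in> carrier A" "b \<in> carrier A" "c \<in> carrier A" for a b c
  proof -
    define as where "as = [a, b, c]"
    define E where "E = cval A as"
    have as: "as \<in> lists (carrier A)" "length as = 3" using abc by (auto simp: as_def)
    let ?s = "\<lambda>g. smooth_on 3 (Rn 3) g"
    have E: "E g \<otimes>\<^bsub>?R\<^esub> E h = E (\<lambda>x. g x * h x)" "E g \<oplus>\<^bsub>?R\<^esub> E h = E (\<lambda>x. g x + h x)"
      if "?s g" "?s h" for g h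
      unfolding E_def using cval_mult cval_add as that by auto
    have s: "?s (\<lambda>x. x i)" "?s (\<lambda>_. r)" "?s g \<Longrightarrow> ?s h \<Longrightarrow> ?s (\<lambda>x. g x * h x)"
      "?s g \<Longrightarrow> ?s h \<Longrightarrow> ?s (\<lambda>x. g x + h x)" for i r g h by (intro sm; assumption)+
    have E0: "\<one>\<^bsub>?R\<^esub> = E (\<lambda>_. 1)" "\<zero>\<^bsub>?R\<^esub> = E (\<lambda>_. 0)"
      using cval_const[OF as(1)] by (simp_all add: E_def underlying_ring_simps)
    have abcE: "a = E (\<lambda>x. x 0)" "b = E (\<lambda>x. x (Suc 0))" "c = E (\<lambda>x. x (Suc (Suc 0)))"
      using cval_proj3[OF abc] by (simp_all add: E_def as_def)
    show "(a \<otimes>\<^bsub>?R\<^esub> b) \<otimes>\<^bsub>?R\<^esub> c = a \<otimes>\<^bsub>?R\<^esub> (b \<otimes>\<^bsub>?R\<^esub> c)" "a \<otimes>\<^bsub>?R\<^esub> b = b \<otimes>\<^bsub>?R\<^esub> a"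
      "(a \<oplus>\<^bsub>?R\<^esub> b) \<oplus>\<^bsub>?R\<^esub> c = a \<oplus>\<^bsub>?R\<^esub> (b \<oplus>\<^bsub>?R\<^esub> c)" "a \<oplus>\<^bsub>?R\<^esub> b = b \<oplus>\<^bsub>?R\<^esub> a"
      "(a \<oplus>\<^bsub>?R\<^esub> b) \<otimes>\<^bsub>?R\<^esub> c = (a \<otimes>\<^bsub>?R\<^esub> c) \<oplus>\<^bsub>?R\<^esub> (b \<otimes>\<^bsub>?R\<^esub> c)"
      "\<one>\<^bsub>?R\<^esub> \<otimes>\<^bsub>?R\<^esub> a = a" "\<zero>\<^bsub>?R\<^esub> \<oplus>\<^bsub>?R\<^esub> a = a"
      unfolding abcE E0 by (simp_all add: E s algebra_simps)
    have "E (\<lambda>x. -1 * x 0) \<oplus>\<^bsub>?R\<^esub> a = \<zero>\<^bsub>?R\<^esub>"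
      unfolding abcE E0 by (subst E) (intro s, intro s, simp)
    moreover have "E (\<lambda>x. -1 * x 0) \<in> carrier A"
      unfolding E_def using as s(3)[OF s(2) s(1), of "-1" 0] by (intro cval_closed) auto
    ultimately show "\<exists>y\<in>carrier A. y \<oplus>\<^bsub>?R\<^esub> a = \<zero>\<^bsub>?R\<^esub>" by blast
  qed
  show ?thesis
  proof (rule cringI)
    show "abelian_group ?R"
      by (rule abelian_groupI) (use laws closed const_closed in \<open>auto simp: underlying_ring_simps(1)\<close>)
    show "comm_monoid ?R"
      by (rule comm_monoidI) (use laws closed const_closed in \<open>auto simp: underlying_ring_simps(1)\<close>)
  qed (use laws in \<open>auto simp: underlying_ring_simps(1)\<close>)
qed

end

lemma Cinf_Rn_compose:
  assumes "gs \<in> lists (Cinf_Rn n)" "f \<in> Cinf_Rn (length gs)"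
  shows "(\<lambda>x\<in>Rn n. f (point (map (\<lambda>g. g x) gs))) \<in> Cinf_Rn n"
proof (intro restrict_Cinf_Rn smooth_on_compose[where f=f and G="\<lambda>y. point (map (\<lambda>g. g y) gs)"
      and V="Rn (length gs)" and m="length gs"] openin_Rn)
  show "smooth_on (length gs) (Rn (length gs)) f" using Cinf_RnD(1)[OF assms(2)] .
  show "point (map (\<lambda>g. g y) gs) \<in> Rn (length gs)" for y using point_in_Rn[of "map (\<lambda>g. g y) gs"] by simp
  fix j assume "j < length gs"
  then show "smooth_on n (Rn n) (\<lambda>y. point (map (\<lambda>g. g y) gs) j)"
    using Cinf_RnD(1)[of "gs ! j" n] assms(1) by (simp add: point_def in_lists_conv_set)
qed

text \<open>
  An algebraic identity involves finitely many elements.  So it is enough that these can be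
  represented in one C-infinity-ring, which may depend on them: a ring of sections over a small
  neighbourhood for a stalk, the ring itself for a quotient.
\<close>

lemma cinf_ring_by_representatives:
  assumes rep: "\<And>cs. cs \<in> lists (carrier D) \<Longrightarrow>
      \<exists>(A :: 'a cinf_ring) \<pi> as. cinf_ring A \<and> as \<in> lists (carrier A) \<and> cs = map \<pi> as \<and>
        (\<forall>a\<in>carrier A. \<pi> a \<in> carrier D) \<and>
        (\<forall>bs\<in>lists (carrier A). \<forall>f\<in>Cinf_Rn (length bs). cop D f (map \<pi> bs) = \<pi> (cop A f bs))"
  shows "cinf_ring D"
proof
  fix cs f assume "cs \<in> lists (carrier D)"
  from rep[OF this] obtain A :: "'a cinf_ring" and \<pi> as where A: "cinf_ring A"
    and as: "as \<in> lists (carrier A)" and cs: "cs = map \<pi> as" and \<pi>: "\<forall>a\<in>carrier A. \<pi> a \<in> carrier D"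
    and cop: "\<forall>bs\<in>lists (carrier A). \<forall>f\<in>Cinf_Rn (length bs). cop D f (map \<pi> bs) = \<pi> (cop A f bs)"
    by (elim exE conjE)
  interpret A: cinf_ring A by fact
  note cop = cop[rule_format]
  { assume "f \<in> Cinf_Rn (length cs)"
    then show "cop D f cs \<in> carrier D" using cop[OF as, of f] A.cop_closed[OF as, of f] \<pi> cs by simp }
  { fix i assume i: "i < length cs"
    have "(\<lambda>x\<in>Rn (length as). x i) \<in> Cinf_Rn (length as)"
      by (intro restrict_Cinf_Rn smooth_on_proj openin_Rn)
    then show "cop D (\<lambda>x\<in>Rn (length cs). x i) cs = cs ! i"
      using cop[OF as] A.cop_proj[OF as] i cs by simp }
  { fix gs assume "gs \<in> lists (Cinf_Rn (length cs))" and f: "f \<in> Cinf_Rn (length gs)"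
    then have gs: "gs \<in> lists (Cinf_Rn (length as))" using cs by simp
    have as2: "map (\<lambda>g. cop A g as) gs \<in> lists (carrier A)" using A.cop_closed[OF as] gs by auto
    let ?h = "\<lambda>x\<in>Rn (length as). f (point (map (\<lambda>g. g x) gs))"
    have "cop D ?h cs = \<pi> (cop A ?h as)" unfolding cs by (rule cop[OF as Cinf_Rn_compose[OF gs f]])
    also have "\<dots> = \<pi> (cop A f (map (\<lambda>g. cop A g as) gs))" using A.cop_compose[OF as gs f] by simp
    also have "\<dots> = cop D f (map \<pi> (map (\<lambda>g. cop A g as) gs))" using cop[OF as2] f by simp
    also have "map \<pi> (map (\<lambda>g. cop A g as) gs) = map (\<lambda>g. cop D g cs) gs"
      unfolding cs using cop[OF as] gs by auto
    finally show "cop D (\<lambda>x\<in>Rn (length cs). f (point (map (\<lambda>g. g x) gs))) cs = cop D f (map (\<lambda>g. cop D g cs) gs)"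
      unfolding cs by (simp only: length_map) }
qed

lemma cinf_hom_closed: "\<phi> \<in> cinf_hom A B \<Longrightarrow> a \<in> carrier A \<Longrightarrow> \<phi> a \<in> carrier B"
  by (auto simp: cinf_hom_def)

lemma cinf_hom_cop:
  "\<phi> \<in> cinf_hom A B \<Longrightarrow> as \<in> lists (carrier A) \<Longrightarrow> f \<in> Cinf_Rn (length as) \<Longrightarrow>
    \<phi> (cop A f as) = cop B f (map \<phi> as)"
  by (simp add: cinf_hom_def)

lemma cinf_hom_cval:
  "\<phi> \<in> cinf_hom A B \<Longrightarrow> as \<in> lists (carrier A) \<Longrightarrow> smooth_on (length as) (Rn (length as)) g \<Longrightarrow>
    \<phi> (cval A as g) = cval B (map \<phi> as) g"
  unfolding cval_def by (subst cinf_hom_cop) auto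

lemma smooth_on_2: "smooth_on (length [a, b]) (Rn (length [a, b])) (\<lambda>x. x 0 * x 1)"
    "smooth_on (length [a, b]) (Rn (length [a, b])) (\<lambda>x. x 0 + x 1)"
  by (intro smooth_on_mult smooth_on_add smooth_on_proj openin_Rn)+

lemma
  assumes "\<phi> \<in> cinf_hom A B" "a \<in> carrier A" "b \<in> carrier A"
  shows cinf_hom_mult: "\<phi> (a \<otimes>\<^bsub>underlying_ring A\<^esub> b) = \<phi> a \<otimes>\<^bsub>underlying_ring B\<^esub> \<phi> b"
    and cinf_hom_add: "\<phi> (a \<oplus>\<^bsub>underlying_ring A\<^esub> b) = \<phi> a \<oplus>\<^bsub>underlying_ring B\<^esub> \<phi> b"
  using cinf_hom_cval[OF assms(1) _ smooth_on_2(1)[of a b]] cinf_hom_cval[OF assms(1) _ smooth_on_2(2)[of a b]] assms(2,3)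
  by (auto simp: underlying_ring_simps)

lemma
  assumes "\<phi> \<in> cinf_hom A B"
  shows cinf_hom_one: "\<phi> \<one>\<^bsub>underlying_ring A\<^esub> = \<one>\<^bsub>underlying_ring B\<^esub>"
    and cinf_hom_zero: "\<phi> \<zero>\<^bsub>underlying_ring A\<^esub> = \<zero>\<^bsub>underlying_ring B\<^esub>"
  using cinf_hom_cval[OF assms, of "[]"] by (auto simp: underlying_ring_simps smooth_on_const openin_Rn)

lemma carrier_cinf_real [simp]: "carrier cinf_real = UNIV"
  by (simp add: cinf_real_def)

lemma cval_cinf_real [simp]: "cval cinf_real as g = g (point as)"
  using point_in_Rn[of as] by (simp add: cval_def cinf_real_def del: point_in_Rn)

lemma underlying_cinf_real [simp]:
  "a \<otimes>\<^bsub>underlying_ring cinf_real\<^esub> b = a * b" "a \<oplus>\<^bsub>underlying_ring cinf_real\<^esub> b = a + b"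
  "\<one>\<^bsub>underlying_ring cinf_real\<^esub> = 1" "\<zero>\<^bsub>underlying_ring cinf_real\<^esub> = 0"
  by (simp_all add: underlying_ring_simps point_def)

text \<open>
  Any invertible element lies in no proper ideal and is mapped to a nonzero number by each point.  So
  the kernel of \<open>p\<close> contains each proper ideal, and a second point \<open>q\<close> with \<open>q c \<noteq> p c\<close> would make \<open>c - q c\<close>
  a unit in the kernel of \<open>q\<close>.
\<close>

lemma local_cinf_ringI:
  assumes A: "cinf_ring A" and p: "p \<in> cinf_hom A cinf_real"
    and unit: "\<And>c. c \<in> carrier A \<Longrightarrow> p c \<noteq> 0 \<Longrightarrow>
      \<exists>d\<in>carrier A. c \<otimes>\<^bsub>underlying_ring A\<^esub> d = \<one>\<^bsub>underlying_ring A\<^esub>"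
  shows "local_cinf_ring A"
proof -
  interpret cinf_ring A by fact
  let ?R = "underlying_ring A"
  interpret R: cring ?R by (rule cring_underlying)
  have cR [simp]: "carrier ?R = carrier A" by (simp add: underlying_ring_simps)
  have uniq: "q = p" if q: "q \<in> cinf_hom A cinf_real" for q
  proof (rule extensionalityI[of _ "carrier A"])
    show "q \<in> extensional (carrier A)" "p \<in> extensional (carrier A)"
      using p q by (auto simp: cinf_hom_def PiE_def)
    fix c assume c: "c \<in> carrier A"
    show "q c = p c"
    proof (rule ccontr)
      assume ne: "q c \<noteq> p c"
      define c' where "c' = cval A [c] (\<lambda>x. x 0 - q c)"
      have sm: "smooth_on (length [c]) (Rn (length [c])) (\<lambda>x. x 0 - q c)"
        using smooth_real_affine[of "q c"] by simp
      have c': "c' \<in> carrier A" unfolding c'_def using c by (intro cval_closed sm) auto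
      have v: "r c' = r c - q c" if "r \<in> cinf_hom A cinf_real" for r
        unfolding c'_def using cinf_hom_cval[OF that _ sm] c by (simp add: point_def)
      obtain d where d: "d \<in> carrier A" "c' \<otimes>\<^bsub>?R\<^esub> d = \<one>\<^bsub>?R\<^esub>"
        using unit[OF c'] v[OF p] ne by auto
      have "q c' * q d = 1"
        using cinf_hom_mult[OF q c' d(1)] d(2) cinf_hom_one[OF q] by simp
      then show False using v[OF q] by simp
    qed
  qed
  define K where "K = {a \<in> carrier A. p a = 0}"
  have pm: "p (a \<otimes>\<^bsub>?R\<^esub> b) = p a * p b" "p (a \<oplus>\<^bsub>?R\<^esub> b) = p a + p b"
    if "a \<in> carrier A" "b \<in> carrier A" for a b
    using cinf_hom_mult[OF p that] cinf_hom_add[OF p that] by simp_all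
  have p1: "p \<one>\<^bsub>?R\<^esub> = 1" "p \<zero>\<^bsub>?R\<^esub> = 0" using cinf_hom_one[OF p] cinf_hom_zero[OF p] by simp_all
  have "ideal K ?R"
  proof (rule idealI)
    show "ring ?R" by (rule R.ring_axioms)
    show "subgroup K (add_monoid ?R)"
    proof (rule group.subgroupI)
      show "Group.group (add_monoid ?R)" by (rule R.a_group)
      show "K \<subseteq> carrier (add_monoid ?R)" by (auto simp: K_def)
      show "K \<noteq> {}" using p1 R.zero_closed by (auto simp: K_def)
      fix a b assume ab: "a \<in> K" 
      then show "b \<in> K \<Longrightarrow> a \<otimes>\<^bsub>add_monoid ?R\<^esub> b \<in> K" using pm R.add.m_closed by (auto simp: K_def)
      have a: "a \<in> carrier A" using ab by (auto simp: K_def)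
      then have "p (a \<oplus>\<^bsub>?R\<^esub> (\<ominus>\<^bsub>?R\<^esub> a)) = p a + p (\<ominus>\<^bsub>?R\<^esub> a)" using pm R.a_inv_closed by auto
      then have "p (\<ominus>\<^bsub>?R\<^esub> a) = 0" using ab a p1 R.r_neg[of a] by (auto simp: K_def)
      then have "\<ominus>\<^bsub>?R\<^esub> a \<in> K" using a R.a_inv_closed[of a] by (auto simp: K_def)
      then show "inv\<^bsub>add_monoid ?R\<^esub> a \<in> K" by (simp add: a_inv_def)
    qed
    fix a x assume ax: "a \<in> K" "x \<in> carrier ?R"
    then show "x \<otimes>\<^bsub>?R\<^esub> a \<in> K" "a \<otimes>\<^bsub>?R\<^esub> x \<in> K" using pm R.m_closed by (auto simp: K_def)
  qed
  then interpret K: ideal K ?R .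
  have one_in: "J = carrier A" if J: "ideal J ?R" "c \<in> J" "p c \<noteq> 0" for J c
  proof -
    interpret J: ideal J ?R by fact
    have c: "c \<in> carrier A" using J(2) J.Icarr by simp
    obtain d where d: "d \<in> carrier A" "c \<otimes>\<^bsub>?R\<^esub> d = \<one>\<^bsub>?R\<^esub>" using unit[OF c J(3)] by blast
    have "c \<otimes>\<^bsub>?R\<^esub> d \<in> J" using J.I_r_closed[OF J(2)] d(1) by simp
    then show ?thesis using J.one_imp_carrier d(2) by simp
  qed
  have Knc: "K \<noteq> carrier A" using p1 R.one_closed unfolding K_def by force
  have maxK: "maximalideal K ?R"
  proof (rule maximalidealI)
    show "ideal K ?R" by fact
    show "carrier ?R \<noteq> K" using Knc by simp
    fix J assume J: "ideal J ?R" "K \<subseteq> J" "J \<subseteq> carrier ?R"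
    show "J = K \<or> J = carrier ?R"
    proof (cases "J \<subseteq> K")
      case False
      then obtain c where "c \<in> J" "p c \<noteq> 0" using J(3) by (auto simp: K_def)
      then show ?thesis using one_in[OF J(1)] by simp
    qed (use J in auto)
  qed
  have "m = K" if m: "maximalideal m ?R" for m
  proof -
    interpret m: maximalideal m ?R by fact
    have "m \<subseteq> K"
    proof
      fix c assume c: "c \<in> m"
      then have "c \<in> carrier A" using m.Icarr by simp
      moreover have "p c = 0" using one_in[OF m.ideal_axioms c] m.I_notcarr by auto
      ultimately show "c \<in> K" by (simp add: K_def)
    qed
    then show ?thesis using m.I_maximal[OF \<open>ideal K ?R\<close>] Knc by (auto simp: K_def)
  qed
  then have max: "maximalideal m ?R \<longleftrightarrow> m = {a \<in> carrier A. p a = 0}" for m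
    using maxK unfolding K_def by blast
  show ?thesis unfolding local_cinf_ring_def
  proof (intro conjI ex1I[of _ p] ballI allI A p)
    fix q assume "q \<in> cinf_hom A cinf_real"
    then show q: "q = p" by (rule uniq)
    show "maximalideal m ?R \<longleftrightarrow> m = {a \<in> carrier A. q a = 0}" for m using max unfolding q .
  qed
qed

subsection \<open>Rings of functions\<close>

locale cinf_functions =
  fixes S :: "'p set" and F :: "('p \<Rightarrow> real) set"
  assumes functions_extensional: "F \<subseteq> extensional S"
    and functions_closed: "\<And>as f. as \<in> lists F \<Longrightarrow> f \<in> Cinf_Rn (length as) \<Longrightarrow>
          (\<lambda>x\<in>S. f (point (map (\<lambda>a. a x) as))) \<in> F"
begin

abbreviation A where "A \<equiv> function_cinf_ring S F"

lemma carrier_functions [simp]: "carrier A = F"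
  by (simp add: function_cinf_ring_def)

lemma cop_functions: "cop A f as = (\<lambda>x\<in>S. f (point (map (\<lambda>a. a x) as)))"
  by (simp add: function_cinf_ring_def)

sublocale ring: cinf_ring A
proof
  fix as f assume as: "as \<in> lists (carrier A)"
  then have as': "as \<in> lists F" by simp
  show "f \<in> Cinf_Rn (length as) \<Longrightarrow> cop A f as \<in> carrier A"
    using functions_closed[OF as'] by (simp add: cop_functions)
  fix i assume i: "i < length as"
  have "cop A (\<lambda>x\<in>Rn (length as). x i) as = (\<lambda>x\<in>S. (as ! i) x)"
    unfolding cop_functions
  proof (rule restrict_ext)
    fix x
    show "(\<lambda>x\<in>Rn (length as). x i) (point (map (\<lambda>a. a x) as)) = (as ! i) x"
      using i point_in_Rn[of "map (\<lambda>a. a x) as"] by (simp add: point_def)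
  qed
  also have "\<dots> = as ! i"
    using functions_extensional as' i by (intro extensional_restrict) (auto simp: in_lists_conv_set)
  finally show "cop A (\<lambda>x\<in>Rn (length as). x i) as = as ! i" .
next
  fix as gs f
  assume as: "as \<in> lists (carrier A)" and gs: "gs \<in> lists (Cinf_Rn (length as))" and f: "f \<in> Cinf_Rn (length gs)"
  show "cop A (\<lambda>x\<in>Rn (length as). f (point (map (\<lambda>g. g x) gs))) as = cop A f (map (\<lambda>g. cop A g as) gs)"
    unfolding cop_functions
  proof (rule restrict_ext)
    fix x assume x: "x \<in> S"
    have "point (map (\<lambda>a. a x) as) \<in> Rn (length as)"
      using point_in_Rn[of "map (\<lambda>a. a x) as"] by simp
    then show "(\<lambda>x\<in>Rn (length as). f (point (map (\<lambda>g. g x) gs))) (point (map (\<lambda>a. a x) as)) =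
      f (point (map (\<lambda>a. a x) (map (\<lambda>g. \<lambda>x\<in>S. g (point (map (\<lambda>a. a x) as))) gs)))"
      using x by (simp add: o_def)
  qed
qed

lemma cval_functions:
  assumes "x \<in> S"
  shows "cval A as g x = g (point (map (\<lambda>a. a x) as))"
proof -
  have "point (map (\<lambda>a. a x) as) \<in> Rn (length as)"
    using point_in_Rn[of "map (\<lambda>a. a x) as"] by simp
  then show ?thesis using assms by (simp add: cval_def cop_functions)
qed

lemma mult_functions: "x \<in> S \<Longrightarrow> (a \<otimes>\<^bsub>underlying_ring A\<^esub> b) x = a x * b x"
  using cval_functions[of x "[a, b]" "\<lambda>x. x 0 * x 1"] by (simp add: underlying_ring_simps(2) point_def)

lemma functions_eqI: "a \<in> F \<Longrightarrow> b \<in> F \<Longrightarrow> (\<And>x. x \<in> S \<Longrightarrow> a x = b x) \<Longrightarrow> a = b"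
  using functions_extensional by (meson extensionalityI subsetD)

end

section \<open>Sheaves of functions and stalks\<close>

text \<open>
  When sections are functions and restriction is restriction of functions, the sheaf axioms reduce
  to the statement that being a section is a local property.
\<close>

lemma function_sheafI:
  assumes ring: "\<And>U. openin (rs_top X) U \<Longrightarrow> cinf_ring (sections X U)"
    and ext: "\<And>U s. s \<in> carrier (sections X U) \<Longrightarrow> s \<in> extensional U"
    and restr: "\<And>U V. restr X U V = (\<lambda>s\<in>carrier (sections X U). restrict s V)"
    and closed: "\<And>U V s. openin (rs_top X) U \<Longrightarrow> openin (rs_top X) V \<Longrightarrow> V \<subseteq> U \<Longrightarrow>
      s \<in> carrier (sections X U) \<Longrightarrow> restrict s V \<in> carrier (sections X V)"
    and cop: "\<And>U V ss f. V \<subseteq> U \<Longrightarrow>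
      restrict (cop (sections X U) f ss) V = cop (sections X V) f (map (\<lambda>s. restrict s V) ss)"
    and local: "\<And>\<U> t. (\<And>U. U \<in> \<U> \<Longrightarrow> openin (rs_top X) U) \<Longrightarrow> t \<in> extensional (\<Union>\<U>) \<Longrightarrow>
      (\<And>U. U \<in> \<U> \<Longrightarrow> restrict t U \<in> carrier (sections X U)) \<Longrightarrow> t \<in> carrier (sections X (\<Union>\<U>))"
  shows "cinf_ringed_space X"
proof (rule cinf_ringed_space.intro)
  have r: "restr X U V s = restrict s V" if "s \<in> carrier (sections X U)" for U V s
    using that by (simp add: restr)
  show "cinf_ring (sections X U)" if "openin (rs_top X) U" for U by (rule ring[OF that])
  show "restr X U V \<in> cinf_hom (sections X U) (sections X V)"
    if UV: "openin (rs_top X) U" "openin (rs_top X) V" "V \<subseteq> U" for U V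
    unfolding cinf_hom_def
  proof (intro CollectI conjI ballI)
    show "restr X U V \<in> carrier (sections X U) \<rightarrow>\<^sub>E carrier (sections X V)"
      unfolding restr using closed[OF UV] by auto
    fix ss f assume ss: "ss \<in> lists (carrier (sections X U))" and f: "f \<in> Cinf_Rn (length ss)"
    have c: "cop (sections X U) f ss \<in> carrier (sections X U)"
      by (rule cinf_ring.cop_closed[OF ring[OF UV(1)] ss f])
    have m: "map (restr X U V) ss = map (\<lambda>s. restrict s V) ss" using ss r by auto
    show "restr X U V (cop (sections X U) f ss) = cop (sections X V) f (map (restr X U V) ss)"
      unfolding r[OF c] m by (rule cop[OF UV(3)])
  qed
  show "restr X U U s = s" if "s \<in> carrier (sections X U)" for U s
    using r[OF that] ext[OF that] by (simp add: extensional_restrict)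
  show "restr X V W (restr X U V s) = restr X U W s"
    if UVW: "openin (rs_top X) U" "openin (rs_top X) V" "W \<subseteq> V" "V \<subseteq> U" and s: "s \<in> carrier (sections X U)" for U V W s
    using r[OF s] r[OF closed[OF UVW(1,2,4) s]] UVW(3) by (simp add: Int_absorb1)
  show "s = t" if st: "s \<in> carrier (sections X (\<Union>\<U>))" "t \<in> carrier (sections X (\<Union>\<U>))"
    and eq: "\<And>U. U \<in> \<U> \<Longrightarrow> restr X (\<Union>\<U>) U s = restr X (\<Union>\<U>) U t" for \<U> s t
  proof (rule extensionalityI[OF ext[OF st(1)] ext[OF st(2)]])
    fix x assume "x \<in> \<Union>\<U>"
    then obtain U where U: "U \<in> \<U>" "x \<in> U" by blast
    have "restrict s U x = restrict t U x" using eq[OF U(1)] r[OF st(1)] r[OF st(2)] by simp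
    then show "s x = t x" using U by simp
  qed
  show "\<exists>t\<in>carrier (sections X (\<Union>\<U>)). \<forall>U\<in>\<U>. restr X (\<Union>\<U>) U t = \<sigma> U"
    if op: "\<And>U. U \<in> \<U> \<Longrightarrow> openin (rs_top X) U"
      and \<sigma>: "\<And>U. U \<in> \<U> \<Longrightarrow> \<sigma> U \<in> carrier (sections X U)"
      and eq: "\<And>U V. U \<in> \<U> \<Longrightarrow> V \<in> \<U> \<Longrightarrow> restr X U (U \<inter> V) (\<sigma> U) = restr X V (U \<inter> V) (\<sigma> V)" for \<U> \<sigma>
  proof -
    have agree: "\<sigma> U x = \<sigma> V x" if UV: "U \<in> \<U>" "V \<in> \<U>" and x: "x \<in> U" "x \<in> V" for U V x
    proof -
      have "restrict (\<sigma> U) (U \<inter> V) x = restrict (\<sigma> V) (U \<inter> V) x"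
        using eq[OF UV] r[OF \<sigma>[OF UV(1)]] r[OF \<sigma>[OF UV(2)]] by simp
      then show ?thesis using x by simp
    qed
    define t where "t = (\<lambda>x\<in>\<Union>\<U>. \<sigma> (SOME U. U \<in> \<U> \<and> x \<in> U) x)"
    have t: "t x = \<sigma> U x" if UU: "U \<in> \<U>" "x \<in> U" for U x
    proof -
      define W where "W = (SOME U. U \<in> \<U> \<and> x \<in> U)"
      have W: "W \<in> \<U> \<and> x \<in> W" unfolding W_def by (rule someI[of _ U]) (use UU in simp)
      have "x \<in> \<Union>\<U>" using UU by blast
      then have "t x = \<sigma> W x" by (simp only: t_def W_def restrict_apply if_True)
      then show ?thesis using agree[OF conjunct1[OF W] UU(1) conjunct2[OF W] UU(2)] by simp
    qed
    have rt: "restrict t U = \<sigma> U" if "U \<in> \<U>" for U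
      by (rule extensionalityI[OF restrict_extensional ext[OF \<sigma>[OF that]]]) (simp add: t[OF that])
    have "t \<in> carrier (sections X (\<Union>\<U>))"
    proof (rule local)
      show "t \<in> extensional (\<Union>\<U>)" by (simp add: t_def)
    qed (simp_all add: op rt \<sigma>)
    then show ?thesis using r rt by (intro bexI[of _ t]) simp_all
  qed
qed

context cinf_ringed_space
begin

abbreviation Op where "Op \<equiv> openin (rs_top X)"
abbreviation C where "C U \<equiv> carrier (sections X U)"

lemma restr_closed: "Op U \<Longrightarrow> Op V \<Longrightarrow> V \<subseteq> U \<Longrightarrow> s \<in> C U \<Longrightarrow> restr X U V s \<in> C V"
  by (rule cinf_hom_closed[OF restr_hom])

lemma germ_subset:
  assumes U: "Op U" "x \<in> U" "s \<in> C U" and V: "Op V" "x \<in> V" "t \<in> C V"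
    and W: "Op W" "x \<in> W" "W \<subseteq> U \<inter> V" "restr X U W s = restr X V W t"
  shows "germ X x V t \<subseteq> germ X x U s"
proof
  fix z assume "z \<in> germ X x V t"
  then obtain V' r W' where z: "z = (V', r)" and V': "Op V'" "x \<in> V'" "r \<in> C V'"
    and W': "Op W'" "x \<in> W'" "W' \<subseteq> V \<inter> V'" "restr X V W' t = restr X V' W' r"
    by (auto simp: germ_def)
  have N: "Op (W \<inter> W')" "x \<in> W \<inter> W'" using W W' by auto
  have "restr X U (W \<inter> W') s = restr X W (W \<inter> W') (restr X U W s)"
    by (rule restr_comp[OF U(1) W(1) N(1) _ _ U(3), symmetric]) (use W(3) in auto)
  also have "\<dots> = restr X V (W \<inter> W') t"
    unfolding W(4) by (rule restr_comp[OF V(1) W(1) N(1) _ _ V(3)]) (use W(3) in auto)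
  also have "\<dots> = restr X W' (W \<inter> W') (restr X V W' t)"
    by (rule restr_comp[OF V(1) W'(1) N(1) _ _ V(3), symmetric]) (use W'(3) in auto)
  also have "\<dots> = restr X V' (W \<inter> W') r"
    unfolding W'(4) by (rule restr_comp[OF V'(1) W'(1) N(1) _ _ V'(3)]) (use W'(3) in auto)
  finally have "restr X U (W \<inter> W') s = restr X V' (W \<inter> W') r" .
  moreover have "W \<inter> W' \<subseteq> U \<inter> V'" using W W' by auto
  ultimately show "z \<in> germ X x U s" using N V' unfolding z germ_def by blast
qed

lemma germ_eq_iff:
  assumes U: "Op U" "x \<in> U" "s \<in> C U" and V: "Op V" "x \<in> V" "t \<in> C V"
  shows "germ X x U s = germ X x V t \<longleftrightarrow> (\<exists>W. Op W \<and> x \<in> W \<and> W \<subseteq> U \<inter> V \<and> restr X U W s = restr X V W t)"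
proof
  assume eq: "germ X x U s = germ X x V t"
  have "(V, t) \<in> germ X x V t" using V unfolding germ_def by auto
  then have "(V, t) \<in> germ X x U s" using eq by simp
  then show "\<exists>W. Op W \<and> x \<in> W \<and> W \<subseteq> U \<inter> V \<and> restr X U W s = restr X V W t"
    unfolding germ_def by blast
next
  assume "\<exists>W. Op W \<and> x \<in> W \<and> W \<subseteq> U \<inter> V \<and> restr X U W s = restr X V W t"
  then obtain W where W: "Op W" "x \<in> W" "W \<subseteq> U \<inter> V" "restr X U W s = restr X V W t" by blast
  have W': "W \<subseteq> V \<inter> U" using W by auto
  show "germ X x U s = germ X x V t"
    using germ_subset[OF U V W] germ_subset[OF V U W(1,2) W' W(4)[symmetric]] by (rule equalityI[rotated])
qed

lemma germ_restr:
  assumes "Op U" "Op W" "x \<in> W" "W \<subseteq> U" "s \<in> C U"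
  shows "germ X x W (restr X U W s) = germ X x U s"
proof -
  have "restr X W W (restr X U W s) = restr X U W s"
    using restr_id[OF assms(2) restr_closed[OF assms(1,2,4,5)]] .
  then show ?thesis
    using assms restr_closed[OF assms(1,2,4,5)] by (subst germ_eq_iff) auto
qed

lemma carrier_stalk:
  "carrier (stalk X x) = {germ X x U s | U s. Op U \<and> x \<in> U \<and> s \<in> C U}"
  by (simp add: stalk_def)

lemma common_representation:
  assumes "x \<in> topspace (rs_top X)" "\<gamma>s \<in> lists (carrier (stalk X x))"
  shows "\<exists>W ss. Op W \<and> x \<in> W \<and> ss \<in> lists (C W) \<and> \<gamma>s = map (germ X x W) ss"
  using assms(2)
proof (induction \<gamma>s)
  case Nil
  show ?case using assms(1) by (intro exI[of _ "topspace (rs_top X)"] exI[of _ "[]"]) auto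
next
  case (Cons \<gamma> \<gamma>s)
  then obtain W ss where W: "Op W" "x \<in> W" "ss \<in> lists (C W)" "\<gamma>s = map (germ X x W) ss" by blast
  obtain U s where U: "Op U" "x \<in> U" "s \<in> C U" "\<gamma> = germ X x U s"
    using Cons unfolding carrier_stalk by auto
  let ?N = "U \<inter> W"
  have N: "Op ?N" "x \<in> ?N" using U W by auto
  have "germ X x ?N (restr X U ?N s) = \<gamma>" using germ_restr[OF U(1) N] U by auto
  moreover have "map (germ X x ?N) (map (restr X W ?N) ss) = \<gamma>s"
    unfolding W(4) using germ_restr[OF W(1) N] W(3) by auto
  moreover have "restr X U ?N s \<in> C ?N" using restr_closed[OF U(1) N(1)] U by auto
  moreover have "map (restr X W ?N) ss \<in> lists (C ?N)" using restr_closed[OF W(1) N(1)] W(3) by auto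
  ultimately show ?case using N
    by (intro exI[of _ ?N] exI[of _ "restr X U ?N s # map (restr X W ?N) ss"]) auto
qed

lemma germ_lists_eq:
  assumes W: "Op W" "x \<in> W" and W': "Op W'" "x \<in> W'"
    and ss: "ss \<in> lists (C W)" "ss' \<in> lists (C W')" "map (germ X x W) ss = map (germ X x W') ss'"
  shows "\<exists>N. Op N \<and> x \<in> N \<and> N \<subseteq> W \<inter> W' \<and> map (restr X W N) ss = map (restr X W' N) ss'"
proof -
  have "length ss = length ss'" using ss(3) by (metis length_map)
  then show ?thesis using ss
  proof (induction ss ss' rule: list_induct2)
    case Nil
    show ?case using W W' by (intro exI[of _ "W \<inter> W'"]) auto
  next
    case (Cons s ss s' ss')
    then obtain N where N: "Op N" "x \<in> N" "N \<subseteq> W \<inter> W'" "map (restr X W N) ss = map (restr X W' N) ss'" by auto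
    have s: "s \<in> C W" "s' \<in> C W'" "germ X x W s = germ X x W' s'" using Cons by auto
    obtain N' where N': "Op N'" "x \<in> N'" "N' \<subseteq> W \<inter> W'" "restr X W N' s = restr X W' N' s'"
      using s(3) germ_eq_iff[OF W s(1) W' s(2)] by blast
    let ?N = "N \<inter> N'"
    have NN: "Op ?N" using N N' by auto
    have "restr X W ?N s = restr X N' ?N (restr X W N' s)"
      by (rule restr_comp[OF W(1) N'(1) NN _ _ s(1), symmetric]) (use N'(3) in auto)
    also have "\<dots> = restr X W' ?N s'"
      unfolding N'(4) by (rule restr_comp[OF W'(1) N'(1) NN _ _ s(2)]) (use N'(3) in auto)
    finally have 1: "restr X W ?N s = restr X W' ?N s'" .
    have rW: "restr X N ?N (restr X W N r) = restr X W ?N r" if "r \<in> set ss" for r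
      using that Cons.prems by (intro restr_comp[OF W(1) N(1) NN]) (use N(3) in auto)
    have rW': "restr X N ?N (restr X W' N r) = restr X W' ?N r" if "r \<in> set ss'" for r
      using that Cons.prems by (intro restr_comp[OF W'(1) N(1) NN]) (use N(3) in auto)
    have "map (restr X W ?N) ss = map (restr X N ?N) (map (restr X W N) ss)"
      using rW by simp
    also have "\<dots> = map (restr X W' ?N) ss'"
      unfolding N(4) using rW' by simp
    finally show ?case using 1 N N' NN by (intro exI[of _ ?N]) auto
  qed
qed

text \<open>
  Germs of finitely many sections have representatives over a common neighbourhood, and two such
  representatives of the same germs agree over a smaller one.  So the operations, which the stalk
  defines by a choice of representatives, can be computed with any of them.
\<close>

lemma cop_stalk:
  assumes W: "Op W" "x \<in> W" and ss: "ss \<in> lists (C W)" and f: "f \<in> Cinf_Rn (length ss)"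
  shows "cop (stalk X x) f (map (germ X x W) ss) = germ X x W (cop (sections X W) f ss)"
proof -
  have *: "germ X x W' (cop (sections X W') f ss') = germ X x W (cop (sections X W) f ss)"
    if W': "Op W'" "x \<in> W'" "ss' \<in> lists (C W')" "map (germ X x W) ss = map (germ X x W') ss'" for W' ss'
  proof -
    obtain N where N: "Op N" "x \<in> N" "N \<subseteq> W \<inter> W'" "map (restr X W N) ss = map (restr X W' N) ss'"
      using germ_lists_eq[OF W W'(1,2) ss W'(3,4)] by blast
    have len: "length ss' = length ss" using W'(4) by (metis length_map)
    have NW: "N \<subseteq> W" "N \<subseteq> W'" using N by auto
    have f': "f \<in> Cinf_Rn (length ss')" using f len by simp
    have c: "cop (sections X W) f ss \<in> C W" "cop (sections X W') f ss' \<in> C W'"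
      using cinf_ring.cop_closed[OF sections_ring] W W' ss f f' by auto
    have "restr X W N (cop (sections X W) f ss) = cop (sections X N) f (map (restr X W N) ss)"
      by (rule cinf_hom_cop[OF restr_hom[OF W(1) N(1) NW(1)] ss f])
    also have "\<dots> = restr X W' N (cop (sections X W') f ss')"
      unfolding N(4) by (rule cinf_hom_cop[OF restr_hom[OF W'(1) N(1) NW(2)] W'(3) f', symmetric])
    finally have "restr X W' N (cop (sections X W') f ss') = restr X W N (cop (sections X W) f ss)" ..
    then show ?thesis using N by (subst germ_eq_iff[OF W'(1,2) c(2) W c(1)]) auto
  qed
  show ?thesis unfolding stalk_def cinf_ring.simps
    by (rule the_equality) (use * W ss in blast)+
qed

lemma stalk_cinf_ring:
  assumes x: "x \<in> topspace (rs_top X)"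
  shows "cinf_ring (stalk X x)"
proof (rule cinf_ring_by_representatives)
  fix \<gamma>s assume "\<gamma>s \<in> lists (carrier (stalk X x))"
  then obtain W ss where W: "Op W" "x \<in> W" and ss: "ss \<in> lists (C W)" "\<gamma>s = map (germ X x W) ss"
    using common_representation[OF x] by blast
  show "\<exists>(A :: 's cinf_ring) \<pi> as. cinf_ring A \<and> as \<in> lists (carrier A) \<and> \<gamma>s = map \<pi> as \<and>
        (\<forall>a\<in>carrier A. \<pi> a \<in> carrier (stalk X x)) \<and>
        (\<forall>bs\<in>lists (carrier A). \<forall>f\<in>Cinf_Rn (length bs). cop (stalk X x) f (map \<pi> bs) = \<pi> (cop A f bs))"
  proof (intro exI conjI ballI)
    show "cinf_ring (sections X W)" by (rule sections_ring[OF W(1)])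
    show "ss \<in> lists (C W)" "\<gamma>s = map (germ X x W) ss" by fact+
    show "germ X x W s \<in> carrier (stalk X x)" if "s \<in> C W" for s
      using that W by (auto simp: carrier_stalk)
    show "cop (stalk X x) f (map (germ X x W) bs) = germ X x W (cop (sections X W) f bs)"
      if "bs \<in> lists (C W)" "f \<in> Cinf_Rn (length bs)" for bs f by (rule cop_stalk[OF W that])
  qed
qed

lemma cval_stalk:
  assumes "Op W" "x \<in> W" "ss \<in> lists (C W)" "smooth_on (length ss) (Rn (length ss)) g"
  shows "cval (stalk X x) (map (germ X x W) ss) g = germ X x W (cval (sections X W) ss g)"
  using cop_stalk[OF assms(1-3) restrict_Cinf_Rn[OF assms(4)]] by (simp add: cval_def)

text \<open>
  A section with a nonzero value \<open>v\<close> at \<open>x\<close> is inverted by a smooth function \<open>r\<close> of it with \<open>t * r t = 1\<close> for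
  \<open>t\<close> near \<open>v\<close>.  This uses only that smooth functions of one variable that agree near the value of a
  section give the same germ when applied to the section.
\<close>

lemma local_stalkI:
  assumes x: "x \<in> topspace (rs_top X)"
    and val: "\<And>U. Op U \<Longrightarrow> x \<in> U \<Longrightarrow> val U \<in> cinf_hom (sections X U) cinf_real"
    and val_restr: "\<And>U V s. Op U \<Longrightarrow> Op V \<Longrightarrow> x \<in> V \<Longrightarrow> V \<subseteq> U \<Longrightarrow> s \<in> C U \<Longrightarrow>
      val V (restr X U V s) = val U s"
    and germs: "\<And>U s g h e. Op U \<Longrightarrow> x \<in> U \<Longrightarrow> s \<in> C U \<Longrightarrow> smooth_real g \<Longrightarrow> smooth_real h \<Longrightarrow>
      e > 0 \<Longrightarrow> (\<And>t. \<bar>t - val U s\<bar> < e \<Longrightarrow> g t = h t) \<Longrightarrow>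
      \<exists>W. Op W \<and> x \<in> W \<and> W \<subseteq> U \<and>
        restr X U W (cval (sections X U) [s] (\<lambda>y. g (y 0))) = restr X U W (cval (sections X U) [s] (\<lambda>y. h (y 0)))"
  shows "local_cinf_ring (stalk X x)"
proof -
  define p where "p = (\<lambda>\<gamma>\<in>carrier (stalk X x). THE v. \<exists>U s. Op U \<and> x \<in> U \<and> s \<in> C U \<and> \<gamma> = germ X x U s \<and> v = val U s)"
  have p_germ: "p (germ X x U s) = val U s" if U: "Op U" "x \<in> U" "s \<in> C U" for U s
  proof -
    have "(THE v. \<exists>U' s'. Op U' \<and> x \<in> U' \<and> s' \<in> C U' \<and> germ X x U s = germ X x U' s' \<and> v = val U' s') = val U s"
    proof (rule the_equality)
      fix v assume "\<exists>U' s'. Op U' \<and> x \<in> U' \<and> s' \<in> C U' \<and> germ X x U s = germ X x U' s' \<and> v = val U' s'"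
      then obtain U' s' where U': "Op U'" "x \<in> U'" "s' \<in> C U'" "germ X x U s = germ X x U' s'" "v = val U' s'" by blast
      obtain W where "Op W" "x \<in> W" "W \<subseteq> U \<inter> U'" "restr X U W s = restr X U' W s'"
        using germ_eq_iff[OF U U'(1-3)] U'(4) by blast
      then show "v = val U s" using val_restr U U' by (metis Int_subset_iff)
    qed (use U in blast)
    then show ?thesis using U by (auto simp: p_def carrier_stalk)
  qed
  have p: "p \<in> cinf_hom (stalk X x) cinf_real"
    unfolding cinf_hom_def
  proof (intro CollectI conjI ballI)
    show "p \<in> carrier (stalk X x) \<rightarrow>\<^sub>E carrier cinf_real" by (simp add: p_def)
    fix as f assume as: "as \<in> lists (carrier (stalk X x))" and f: "f \<in> Cinf_Rn (length as)"
    obtain W ss where W: "Op W" "x \<in> W" and ss: "ss \<in> lists (C W)" and eq: "as = map (germ X x W) ss"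
      using common_representation[OF x as] by blast
    have f': "f \<in> Cinf_Rn (length ss)" using f eq by simp
    have c: "cop (sections X W) f ss \<in> C W" using cinf_ring.cop_closed[OF sections_ring[OF W(1)] ss f'] .
    have "p (cop (stalk X x) f as) = val W (cop (sections X W) f ss)"
      unfolding eq cop_stalk[OF W ss f'] by (rule p_germ[OF W c])
    also have "\<dots> = cop cinf_real f (map (val W) ss)" by (rule cinf_hom_cop[OF val[OF W] ss f'])
    also have "map (val W) ss = map p as" unfolding eq using p_germ[OF W] ss by auto
    finally show "p (cop (stalk X x) f as) = cop cinf_real f (map p as)" .
  qed
  show ?thesis
  proof (rule local_cinf_ringI[OF stalk_cinf_ring[OF x] p])
    fix \<gamma> assume \<gamma>: "\<gamma> \<in> carrier (stalk X x)" "p \<gamma> \<noteq> 0"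
    then obtain U s where U: "Op U" "x \<in> U" and s: "s \<in> C U" and \<gamma>s: "\<gamma> = germ X x U s"
      by (auto simp: carrier_stalk)
    interpret U: cinf_ring "sections X U" by (rule sections_ring[OF U(1)])
    have "val U s \<noteq> 0" using \<gamma> p_germ[OF U s] \<gamma>s by simp
    then obtain r e where r: "smooth_real r" "e > 0" "\<And>t. \<bar>t - val U s\<bar> < e \<Longrightarrow> t * r t = 1"
      using smooth_local_inverse by metis
    have ss: "[s] \<in> lists (C U)" using s by simp
    have sm: "smooth_real (\<lambda>t. t)" "smooth_real (\<lambda>t. 1)" "smooth_real (\<lambda>t. t * r t)"
      by (intro smooth_on_mult smooth_on_proj smooth_on_const openin_Rn r(1))+
    define d where "d = cval (sections X U) [s] (\<lambda>y. r (y 0))"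
    have d: "d \<in> C U" unfolding d_def using U.cval_closed[OF ss] r(1) by simp
    have sproj: "cval (sections X U) [s] (\<lambda>y. y 0) = s" using U.cval_proj[OF ss, of 0] by simp
    have "\<gamma> \<otimes>\<^bsub>underlying_ring (stalk X x)\<^esub> germ X x U d = germ X x U (s \<otimes>\<^bsub>underlying_ring (sections X U)\<^esub> d)"
      unfolding \<gamma>s underlying_ring_simps using cval_stalk[OF U, of "[s, d]"] s d smooth_on_2(1)[of s d] by auto
    also have "s \<otimes>\<^bsub>underlying_ring (sections X U)\<^esub> d = cval (sections X U) [s] (\<lambda>y. y 0 * r (y 0))"
      using U.cval_mult[OF ss, of "\<lambda>y. y 0" "\<lambda>y. r (y 0)"] sm(1) r(1) sproj by (simp add: d_def)
    also have "germ X x U \<dots> = germ X x U (cval (sections X U) [s] (\<lambda>_. 1))"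
    proof -
      obtain W where "Op W" "x \<in> W" "W \<subseteq> U" "restr X U W (cval (sections X U) [s] (\<lambda>y. y 0 * r (y 0)))
        = restr X U W (cval (sections X U) [s] (\<lambda>y. 1))"
        using germs[OF U s sm(3,2) r(2,3)] by blast
      moreover have "cval (sections X U) [s] (\<lambda>y. y 0 * r (y 0)) \<in> C U" "cval (sections X U) [s] (\<lambda>y. 1) \<in> C U"
        using U.cval_closed[OF ss] sm by simp_all
      ultimately show ?thesis using U germ_eq_iff by auto
    qed
    also have "\<dots> = \<one>\<^bsub>underlying_ring (stalk X x)\<^esub>"
      using U.cval_const[OF ss] cval_stalk[OF U, of "[]"] by (simp add: underlying_ring_simps smooth_on_const openin_Rn)
    finally show "\<exists>d\<in>carrier (stalk X x). \<gamma> \<otimes>\<^bsub>underlying_ring (stalk X x)\<^esub> d = \<one>\<^bsub>underlying_ring (stalk X x)\<^esub>"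
      using U d by (auto simp: carrier_stalk)
  qed
qed

end

section \<open>The localization of a ring of functions at a point\<close>

lemma lists_imageD: "cs \<in> lists (g ` B) \<Longrightarrow> \<exists>as\<in>lists B. cs = map g as"
  by (simp only: lists_image image_iff)

context cinf_functions
begin

text \<open>
  The condition \<open>(a - b) d = 0\<close> of the ideal \<open>I\<^sub>p\<close>, written pointwise as \<open>a\<close> and \<open>b\<close> are functions: they
  agree on the open set where \<open>d\<close> does not vanish.
\<close>

definition germ_rel :: "(('p \<Rightarrow> real) \<Rightarrow> real) \<Rightarrow> ('p \<Rightarrow> real) \<Rightarrow> ('p \<Rightarrow> real) \<Rightarrow> bool" where
  "germ_rel p a b \<longleftrightarrow> (\<exists>d\<in>F. p d \<noteq> 0 \<and> (\<forall>x\<in>S. d x \<noteq> 0 \<longrightarrow> a x = b x))"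

definition germ_class :: "(('p \<Rightarrow> real) \<Rightarrow> real) \<Rightarrow> ('p \<Rightarrow> real) \<Rightarrow> ('p \<Rightarrow> real) set" where
  "germ_class p = (\<lambda>a\<in>F. {b \<in> F. germ_rel p a b})"

definition germ_ring :: "(('p \<Rightarrow> real) \<Rightarrow> real) \<Rightarrow> ('p \<Rightarrow> real) set cinf_ring" where
  "germ_ring p = \<lparr>carrier = germ_class p ` F,
     cop = (\<lambda>f cs. germ_class p (cop A f (map (\<lambda>c. SOME a. a \<in> F \<and> germ_class p a = c) cs)))\<rparr>"

context
  fixes p assumes p: "p \<in> cinf_hom A cinf_real"
begin

lemma hom_mult: "a \<in> F \<Longrightarrow> b \<in> F \<Longrightarrow> p (\<lambda>x\<in>S. a x * b x) = p a * p b"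
  and mult_closed: "a \<in> F \<Longrightarrow> b \<in> F \<Longrightarrow> (\<lambda>x\<in>S. a x * b x) \<in> F"
proof -
  assume ab: "a \<in> F" "b \<in> F"
  interpret R: cring "underlying_ring A" by (rule ring.cring_underlying)
  have eq: "a \<otimes>\<^bsub>underlying_ring A\<^esub> b = (\<lambda>x\<in>S. a x * b x)"
  proof (rule extensionalityI[of _ S])
    have "a \<otimes>\<^bsub>underlying_ring A\<^esub> b \<in> F" using R.m_closed ab by (simp add: underlying_ring_simps(1))
    then show "a \<otimes>\<^bsub>underlying_ring A\<^esub> b \<in> extensional S" using functions_extensional by blast
  qed (simp_all add: mult_functions)
  have "a \<otimes>\<^bsub>underlying_ring A\<^esub> b \<in> F" using R.m_closed ab by (simp add: underlying_ring_simps(1))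
  then show "(\<lambda>x\<in>S. a x * b x) \<in> F" by (simp only: eq)
  show "p (\<lambda>x\<in>S. a x * b x) = p a * p b" using cinf_hom_mult[OF p, of a b] ab eq by simp
qed

lemma one_functions: "(\<lambda>x\<in>S. 1) \<in> F" "p (\<lambda>x\<in>S. 1) = 1"
proof -
  have "cval A [] (\<lambda>_. 1) = (\<lambda>x\<in>S. 1)"
    by (rule extensionalityI[of _ S])
       (use ring.cval_closed[of "[]" "\<lambda>_. 1"] functions_extensional in \<open>auto simp: cval_functions smooth_on_const openin_Rn\<close>)
  then show "(\<lambda>x\<in>S. 1) \<in> F" "p (\<lambda>x\<in>S. 1) = 1"
    using cinf_hom_one[OF p] ring.cval_closed[of "[]" "\<lambda>_. 1"]
    by (simp_all add: underlying_ring_simps smooth_on_const openin_Rn)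
qed

lemma germ_rel_refl: "germ_rel p a a"
  using one_functions unfolding germ_rel_def by force

lemma germ_rel_sym: "germ_rel p a b \<Longrightarrow> germ_rel p b a"
  unfolding germ_rel_def by metis

lemma germ_rel_common:
  assumes "list_all2 (germ_rel p) as bs"
  shows "\<exists>d\<in>F. p d \<noteq> 0 \<and> (\<forall>x\<in>S. d x \<noteq> 0 \<longrightarrow> map (\<lambda>a. a x) as = map (\<lambda>b. b x) bs)"
  using assms
proof (induction rule: list_all2_induct)
  case Nil
  then show ?case using one_functions by force
next
  case (Cons a as b bs)
  obtain d where d: "d \<in> F" "p d \<noteq> 0" "\<forall>x\<in>S. d x \<noteq> 0 \<longrightarrow> map (\<lambda>a. a x) as = map (\<lambda>b. b x) bs"
    using Cons by blast
  obtain e where e: "e \<in> F" "p e \<noteq> 0" "\<forall>x\<in>S. e x \<noteq> 0 \<longrightarrow> a x = b x"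
    using Cons unfolding germ_rel_def by blast
  have "p (\<lambda>x\<in>S. d x * e x) \<noteq> 0" "(\<lambda>x\<in>S. d x * e x) \<in> F"
    using hom_mult[OF d(1) e(1)] mult_closed[OF d(1) e(1)] d(2) e(2) by (simp_all del: restrict_apply)
  moreover have "\<forall>x\<in>S. (\<lambda>x\<in>S. d x * e x) x \<noteq> 0 \<longrightarrow> map (\<lambda>a. a x) (a # as) = map (\<lambda>b. b x) (b # bs)"
    using d(3) e(3) by simp
  ultimately show ?case by blast
qed

lemma germ_rel_trans: "germ_rel p a b \<Longrightarrow> germ_rel p b c \<Longrightarrow> germ_rel p a c"
  using germ_rel_common[of "[a, b]" "[b, c]"] unfolding germ_rel_def by auto

lemma germ_class_eq_iff: "a \<in> F \<Longrightarrow> b \<in> F \<Longrightarrow> germ_class p a = germ_class p b \<longleftrightarrow> germ_rel p a b"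
proof -
  assume ab: "a \<in> F" "b \<in> F"
  have "germ_rel p a b" if "germ_class p a = germ_class p b"
  proof -
    have "b \<in> germ_class p b" using ab germ_rel_refl by (simp add: germ_class_def)
    then have "b \<in> germ_class p a" using that by simp
    then show ?thesis using ab by (simp add: germ_class_def)
  qed
  moreover have "{c \<in> F. germ_rel p a c} = {c \<in> F. germ_rel p b c}" if "germ_rel p a b"
    using germ_rel_trans[OF that] germ_rel_trans[OF germ_rel_sym[OF that]] by (intro Collect_cong conj_cong refl iffI)
  ultimately show ?thesis using ab by (auto simp: germ_class_def)
qed

text \<open>
  Finitely many relations hold on a common nonvanishing set, that of the product of the functions \<open>d\<close>, and
  there all operations agree.
\<close>

lemma germ_rel_cop:
  assumes "list_all2 (germ_rel p) as bs"
  shows "germ_rel p (cop A f as) (cop A f bs)"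
proof -
  obtain d where d: "d \<in> F" "p d \<noteq> 0" "\<forall>x\<in>S. d x \<noteq> 0 \<longrightarrow> map (\<lambda>a. a x) as = map (\<lambda>b. b x) bs"
    using germ_rel_common[OF assms] by blast
  then show ?thesis unfolding germ_rel_def by (intro bexI[of _ d]) (auto simp: cop_functions)
qed

lemma cop_germ_ring:
  assumes as: "as \<in> lists F" and f: "f \<in> Cinf_Rn (length as)"
  shows "cop (germ_ring p) f (map (germ_class p) as) = germ_class p (cop A f as)"
proof -
  define bs where "bs = map (\<lambda>a. SOME b. b \<in> F \<and> germ_class p b = germ_class p a) as"
  have b: "(SOME b. b \<in> F \<and> germ_class p b = germ_class p a) \<in> F \<and>
      germ_class p (SOME b. b \<in> F \<and> germ_class p b = germ_class p a) = germ_class p a"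
    if "a \<in> F" for a by (rule someI[of _ a]) (use that in simp)
  then have bs: "bs \<in> lists F" using as by (auto simp: bs_def)
  have "list_all2 (germ_rel p) bs as"
    unfolding bs_def list_all2_map1
  proof (rule list.rel_refl_strong)
    fix a assume "a \<in> set as"
    then have "a \<in> F" using as by auto
    then show "germ_rel p (SOME b. b \<in> F \<and> germ_class p b = germ_class p a) a"
      using b germ_class_eq_iff by blast
  qed
  then have "germ_rel p (cop A f bs) (cop A f as)" by (rule germ_rel_cop)
  moreover have "cop A f bs \<in> F" "cop A f as \<in> F"
    using ring.cop_closed[of bs f] ring.cop_closed[of as f] bs as f by (simp_all add: bs_def)
  ultimately have "germ_class p (cop A f bs) = germ_class p (cop A f as)" using germ_class_eq_iff by simp
  then show ?thesis by (simp add: germ_ring_def bs_def o_def)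
qed

lemma germ_ring_cinf_ring: "cinf_ring (germ_ring p)"
proof (rule cinf_ring_by_representatives)
  fix cs assume "cs \<in> lists (carrier (germ_ring p))"
  then obtain as where as: "as \<in> lists F" "cs = map (germ_class p) as"
    using lists_imageD[of cs "germ_class p" F] by (auto simp: germ_ring_def)
  show "\<exists>(A :: ('p \<Rightarrow> real) cinf_ring) \<pi> as. cinf_ring A \<and> as \<in> lists (carrier A) \<and> cs = map \<pi> as \<and>
        (\<forall>a\<in>carrier A. \<pi> a \<in> carrier (germ_ring p)) \<and>
        (\<forall>bs\<in>lists (carrier A). \<forall>f\<in>Cinf_Rn (length bs). cop (germ_ring p) f (map \<pi> bs) = \<pi> (cop A f bs))"
    using ring.cinf_ring_axioms as cop_germ_ring
    by (intro exI[of _ A] exI[of _ "germ_class p"] exI[of _ as]) (simp add: germ_ring_def)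
qed

lemma germ_class_hom: "germ_class p \<in> cinf_hom A (germ_ring p)"
  unfolding cinf_hom_def
proof (intro CollectI conjI ballI)
  show "germ_class p \<in> carrier A \<rightarrow>\<^sub>E carrier (germ_ring p)"
    by (auto simp: germ_ring_def germ_class_def)
  fix as f assume "as \<in> lists (carrier A)" "f \<in> Cinf_Rn (length as)"
  then show "germ_class p (cop A f as) = cop (germ_ring p) f (map (germ_class p) as)"
    using cop_germ_ring[of as f] by simp
qed

end

end

lemma cinf_hom_compose:
  assumes "\<phi> \<in> cinf_hom A B" "\<psi> \<in> cinf_hom B D" "cinf_ring A"
  shows "(\<lambda>a\<in>carrier A. \<psi> (\<phi> a)) \<in> cinf_hom A D"
  unfolding cinf_hom_def
proof (intro CollectI conjI ballI)
  show "(\<lambda>a\<in>carrier A. \<psi> (\<phi> a)) \<in> carrier A \<rightarrow>\<^sub>E carrier D"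
    using cinf_hom_closed[OF assms(1)] cinf_hom_closed[OF assms(2)] by auto
  fix as f assume as: "as \<in> lists (carrier A)" and f: "f \<in> Cinf_Rn (length as)"
  have "cop A f as \<in> carrier A" using cinf_ring.cop_closed[OF assms(3) as f] .
  moreover have "map \<phi> as \<in> lists (carrier B)" using as cinf_hom_closed[OF assms(1)] by auto
  moreover have "map (\<lambda>a\<in>carrier A. \<psi> (\<phi> a)) as = map \<psi> (map \<phi> as)" using as by auto
  ultimately show "(\<lambda>a\<in>carrier A. \<psi> (\<phi> a)) (cop A f as) = cop D f (map (\<lambda>a\<in>carrier A. \<psi> (\<phi> a)) as)"
    using cinf_hom_cop[OF assms(1) as f] cinf_hom_cop[OF assms(2), of "map \<phi> as" f] f by (simp del: map_map)
qed

lemma cinf_hom_id: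
  assumes "cinf_ring A" shows "(\<lambda>a\<in>carrier A. a) \<in> cinf_hom A A"
  unfolding cinf_hom_def
proof (intro CollectI conjI ballI)
  fix as f assume as: "as \<in> lists (carrier A)" and f: "f \<in> Cinf_Rn (length as)"
  moreover have "map (\<lambda>a\<in>carrier A. a) as = as" using as by (intro map_idI) auto
  ultimately show "(\<lambda>a\<in>carrier A. a) (cop A f as) = cop A f (map (\<lambda>a\<in>carrier A. a) as)"
    using cinf_ring.cop_closed[OF assms as f] by simp
qed auto

lemma cinf_hom_eqI:
  assumes "\<phi> \<in> cinf_hom A B" "\<psi> \<in> cinf_hom A B" "\<And>a. a \<in> carrier A \<Longrightarrow> \<phi> a = \<psi> a"
  shows "\<phi> = \<psi>"
  by (rule extensionalityI[of _ "carrier A"]) (use assms in \<open>auto simp: cinf_hom_def PiE_def\<close>)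

lemma is_localizationD:
  fixes A :: "'a cinf_ring"
  assumes "is_localization A S (L, \<pi>)"
  shows "cinf_ring L" "\<pi> \<in> cinf_hom A L" "\<And>a. a \<in> S \<Longrightarrow> \<pi> a \<in> Units (underlying_ring L)"
    and "\<And>(B :: 'a set cinf_ring) \<phi>. cinf_ring B \<Longrightarrow> \<phi> \<in> cinf_hom A B \<Longrightarrow>
       (\<And>a. a \<in> S \<Longrightarrow> \<phi> a \<in> Units (underlying_ring B)) \<Longrightarrow>
       \<exists>!\<psi>. \<psi> \<in> cinf_hom L B \<and> (\<forall>a\<in>carrier A. \<psi> (\<pi> a) = \<phi> a)"
  using assms unfolding is_localization_def split by simp_all

text \<open>
  A localization is unique up to a unique isomorphism.  Hence surjectivity and the kernel pairs of
  the structure map may be computed in any model.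
\<close>

lemma localization_compare:
  fixes A :: "'a cinf_ring"
  assumes A: "cinf_ring A" and L0: "is_localization A S (L0, \<pi>0)" and L: "is_localization A S (L, \<pi>)"
    and onto: "carrier L0 = \<pi>0 ` carrier A"
  shows "carrier L = \<pi> ` carrier A"
    and "\<And>a b. a \<in> carrier A \<Longrightarrow> b \<in> carrier A \<Longrightarrow> \<pi> a = \<pi> b \<longleftrightarrow> \<pi>0 a = \<pi>0 b"
proof -
  note l0 = is_localizationD[OF L0] and l = is_localizationD[OF L]
  obtain \<psi> where \<psi>: "\<psi> \<in> cinf_hom L0 L" "\<forall>a\<in>carrier A. \<psi> (\<pi>0 a) = \<pi> a"
    using ex1_implies_ex[OF l0(4)[OF l(1,2,3)]] by blast
  obtain \<eta> where \<eta>: "\<eta> \<in> cinf_hom L L0" "\<forall>a\<in>carrier A. \<eta> (\<pi> a) = \<pi>0 a"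
    using ex1_implies_ex[OF l(4)[OF l0(1,2,3)]] by blast
  have pc: "\<pi> a \<in> carrier L" if "a \<in> carrier A" for a using cinf_hom_closed[OF l(2) that] .
  have ex1: "\<exists>!\<psi>. \<psi> \<in> cinf_hom L L \<and> (\<forall>a\<in>carrier A. \<psi> (\<pi> a) = \<pi> a)" by (rule l(4)[OF l(1,2,3)])
  have i1: "(\<lambda>c\<in>carrier L. \<psi> (\<eta> c)) \<in> cinf_hom L L \<and> (\<forall>a\<in>carrier A. (\<lambda>c\<in>carrier L. \<psi> (\<eta> c)) (\<pi> a) = \<pi> a)"
    using cinf_hom_compose[OF \<eta>(1) \<psi>(1) l(1)] \<psi>(2) \<eta>(2) pc by simp
  have i2: "(\<lambda>c\<in>carrier L. c) \<in> cinf_hom L L \<and> (\<forall>a\<in>carrier A. (\<lambda>c\<in>carrier L. c) (\<pi> a) = \<pi> a)"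
    using cinf_hom_id[OF l(1)] pc by simp
  have comp: "(\<lambda>c\<in>carrier L. \<psi> (\<eta> c)) = (\<lambda>c\<in>carrier L. c)"
  proof -
    obtain u where "\<And>v. v \<in> cinf_hom L L \<and> (\<forall>a\<in>carrier A. v (\<pi> a) = \<pi> a) \<Longrightarrow> v = u"
      using ex1 unfolding Ex1_def by blast
    from this[OF i1] this[OF i2] show ?thesis by simp
  qed
  show "carrier L = \<pi> ` carrier A"
  proof (intro equalityI subsetI)
    fix c assume c: "c \<in> carrier L"
    have "\<eta> c \<in> carrier L0" by (rule cinf_hom_closed[OF \<eta>(1) c])
    then obtain a where a: "a \<in> carrier A" "\<eta> c = \<pi>0 a" using onto by blast
    have "c = \<psi> (\<eta> c)" using fun_cong[OF comp, of c] c by simp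
    also have "\<dots> = \<pi> a" using a \<psi>(2) by simp
    finally show "c \<in> \<pi> ` carrier A" using a by blast
  qed (use pc in blast)
  fix a b assume "a \<in> carrier A" "b \<in> carrier A"
  then show "\<pi> a = \<pi> b \<longleftrightarrow> \<pi>0 a = \<pi>0 b" using \<psi>(2) \<eta>(2) by metis
qed

lemma (in cring) unitI: "a \<in> carrier R \<Longrightarrow> b \<in> carrier R \<Longrightarrow> a \<otimes> b = \<one> \<Longrightarrow> a \<in> Units R"
  unfolding Units_def using m_comm[of a b] by auto

context cinf_functions
begin

context
  fixes p assumes p: "p \<in> cinf_hom A cinf_real"
begin

text \<open>
  A smooth function with small support around \<open>p a\<close>, applied to \<open>a\<close>, is an element of the ring that
  does not vanish at \<open>p\<close>.
\<close>

lemma germ_rel_smooth_real: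
  assumes a: "a \<in> F" and "smooth_real g" "smooth_real h" "e > 0" "\<And>t. \<bar>t - p a\<bar> < e \<Longrightarrow> g t = h t"
  shows "germ_rel p (cval A [a] (\<lambda>y. g (y 0))) (cval A [a] (\<lambda>y. h (y 0)))"
proof -
  obtain b where b: "smooth_real b" "b (p a) > 0" "\<And>t. \<bar>t - p a\<bar> \<ge> e \<Longrightarrow> b t = 0"
    using smooth_bump_at[OF assms(4)] by metis
  let ?d = "cval A [a] (\<lambda>y. b (y 0))"
  have "?d \<in> F" using ring.cval_closed[of "[a]" "\<lambda>y. b (y 0)"] a b(1) by simp
  moreover have "p ?d = b (p a)"
    using cinf_hom_cval[OF p, of "[a]" "\<lambda>y. b (y 0)"] a b(1) by (simp add: point_def)
  moreover have "cval A [a] (\<lambda>y. g (y 0)) x = cval A [a] (\<lambda>y. h (y 0)) x" if "x \<in> S" "?d x \<noteq> 0" for x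
    using that assms(5)[of "a x"] b(3)[of "a x"] by (force simp: cval_functions point_def)
  ultimately show ?thesis unfolding germ_rel_def using b(2) by (intro bexI[of _ ?d]) auto
qed

text \<open>
  \<open>d a = d b\<close> and \<open>\<phi> d\<close> can be cancelled.
\<close>

lemma germ_rel_imp_eq:
  assumes B: "cinf_ring B" and \<phi>: "\<phi> \<in> cinf_hom A B"
    and inv: "\<And>d. d \<in> F \<Longrightarrow> p d \<noteq> 0 \<Longrightarrow> \<phi> d \<in> Units (underlying_ring B)"
    and ab: "a \<in> F" "b \<in> F" "germ_rel p a b"
  shows "\<phi> a = \<phi> b"
proof -
  let ?R = "underlying_ring B"
  interpret R: cring ?R by (rule cinf_ring.cring_underlying[OF B])
  obtain d where d: "d \<in> F" "p d \<noteq> 0" "\<forall>x\<in>S. d x \<noteq> 0 \<longrightarrow> a x = b x"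
    using ab(3) unfolding germ_rel_def by blast
  interpret RA: cring "underlying_ring A" by (rule ring.cring_underlying)
  have "d \<otimes>\<^bsub>underlying_ring A\<^esub> a = d \<otimes>\<^bsub>underlying_ring A\<^esub> b"
  proof (rule functions_eqI)
    show "d \<otimes>\<^bsub>underlying_ring A\<^esub> a \<in> F" "d \<otimes>\<^bsub>underlying_ring A\<^esub> b \<in> F"
      using RA.m_closed d(1) ab by (simp_all add: underlying_ring_simps(1))
  qed (use d(3) in \<open>auto simp: mult_functions\<close>)
  then have "\<phi> d \<otimes>\<^bsub>?R\<^esub> \<phi> a = \<phi> d \<otimes>\<^bsub>?R\<^esub> \<phi> b"
    using cinf_hom_mult[OF \<phi>, of d a] cinf_hom_mult[OF \<phi>, of d b] d(1) ab by simp
  moreover have "\<phi> d \<in> Units ?R" by (rule inv[OF d(1,2)])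
  moreover have "\<phi> a \<in> carrier ?R" "\<phi> b \<in> carrier ?R"
    using cinf_hom_closed[OF \<phi>] ab by (simp_all add: underlying_ring_simps(1))
  ultimately show ?thesis using R.Units_l_cancel by blast
qed

lemma germ_rel_value: "a \<in> F \<Longrightarrow> b \<in> F \<Longrightarrow> germ_rel p a b \<Longrightarrow> p a = p b"
proof -
  assume ab: "a \<in> F" "b \<in> F" "germ_rel p a b"
  then obtain d where d: "d \<in> F" "p d \<noteq> 0" "\<forall>x\<in>S. d x \<noteq> 0 \<longrightarrow> a x = b x"
    unfolding germ_rel_def by blast
  have "(\<lambda>x\<in>S. d x * a x) = (\<lambda>x\<in>S. d x * b x)" by (rule restrict_ext) (use d(3) in auto)
  then have "p d * p a = p d * p b"
    using hom_mult[OF p d(1) ab(1)] hom_mult[OF p d(1) ab(2)] by (simp only:)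
  then show "p a = p b" using d(2) by simp
qed

text \<open>
  The inverse of \<open>a\<close> is \<open>r \<circ> a\<close> for a smooth function \<open>r\<close> with \<open>t * r t = 1\<close> near \<open>p a\<close>: the product is \<open>1\<close>
  near \<open>p\<close>.  Thus the elements of \<open>A\<close> are enough to make all these \<open>a\<close> invertible, and the localization is
  a quotient of \<open>A\<close>.
\<close>

lemma germ_class_unit:
  assumes a: "a \<in> F" "p a \<noteq> 0"
  shows "germ_class p a \<in> Units (underlying_ring (germ_ring p))"
proof -
  let ?R = "underlying_ring (germ_ring p)"
  note G = germ_ring_cinf_ring[OF p] and gh = germ_class_hom[OF p]
  interpret R: cring ?R by (rule cinf_ring.cring_underlying[OF G])
  obtain r e where r: "smooth_real r" "e > 0" "\<And>t. \<bar>t - p a\<bar> < e \<Longrightarrow> t * r t = 1"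
    using smooth_local_inverse[OF a(2)] by metis
  let ?b = "cval A [a] (\<lambda>y. r (y 0))"
  have aa: "[a] \<in> lists (carrier A)" using a by simp
  have b: "?b \<in> F" using ring.cval_closed[OF aa] r(1) by simp
  have sm: "smooth_real (\<lambda>t. t)" "smooth_real (\<lambda>t. 1)" "smooth_real (\<lambda>t. t * r t)"
    by (intro smooth_on_mult smooth_on_proj smooth_on_const openin_Rn r(1))+
  have 1: "a \<otimes>\<^bsub>underlying_ring A\<^esub> ?b = cval A [a] (\<lambda>y. y 0 * r (y 0))"
    using ring.cval_mult[OF aa, of "\<lambda>y. y 0" "\<lambda>y. r (y 0)"] sm(1) r(1) ring.cval_proj[OF aa, of 0] by simp
  have 2: "cval A [a] (\<lambda>_. 1) = \<one>\<^bsub>underlying_ring A\<^esub>"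
    using ring.cval_const[OF aa, of 1] by (simp add: underlying_ring_simps)
  have m: "cval A [a] (\<lambda>y. y 0 * r (y 0)) \<in> F" "cval A [a] (\<lambda>_. 1) \<in> F"
    using ring.cval_closed[OF aa] sm by simp_all
  have "germ_rel p (cval A [a] (\<lambda>y. y 0 * r (y 0))) (cval A [a] (\<lambda>_. 1))"
    using germ_rel_smooth_real[OF a(1) sm(3,2) r(2,3)] by simp
  then have "germ_class p (a \<otimes>\<^bsub>underlying_ring A\<^esub> ?b) = germ_class p \<one>\<^bsub>underlying_ring A\<^esub>"
    unfolding 1 2[symmetric] using germ_class_eq_iff[OF p m] by simp
  then have "germ_class p a \<otimes>\<^bsub>?R\<^esub> germ_class p ?b = \<one>\<^bsub>?R\<^esub>"
    using cinf_hom_mult[OF gh, of a ?b] cinf_hom_one[OF gh] a b by simp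
  then show ?thesis
    using R.unitI[of "germ_class p a" "germ_class p ?b"] cinf_hom_closed[OF gh] a b
    by (simp add: underlying_ring_simps(1))
qed

lemma germ_ring_is_localization:
  "is_localization A {a \<in> carrier A. p a \<noteq> 0} (germ_ring p, germ_class p)"
  unfolding is_localization_def split
proof (intro conjI allI impI ballI)
  show "cinf_ring (germ_ring p)" by (rule germ_ring_cinf_ring[OF p])
  show "germ_class p \<in> cinf_hom A (germ_ring p)" by (rule germ_class_hom[OF p])
  fix a assume "a \<in> {a \<in> carrier A. p a \<noteq> 0}"
  then show "germ_class p a \<in> Units (underlying_ring (germ_ring p))" by (intro germ_class_unit) auto
next
  fix B :: "('p \<Rightarrow> real) set cinf_ring" and \<phi>
  assume "cinf_ring B \<and> \<phi> \<in> cinf_hom A B \<and> (\<forall>a\<in>{a \<in> carrier A. p a \<noteq> 0}. \<phi> a \<in> Units (underlying_ring B))"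
  then have B: "cinf_ring B" and \<phi>: "\<phi> \<in> cinf_hom A B"
    and inv: "\<And>d. d \<in> F \<Longrightarrow> p d \<noteq> 0 \<Longrightarrow> \<phi> d \<in> Units (underlying_ring B)" by auto
  have carG: "carrier (germ_ring p) = germ_class p ` F" by (simp add: germ_ring_def)
  define \<psi> where "\<psi> = (\<lambda>c\<in>carrier (germ_ring p). \<phi> (SOME a. a \<in> F \<and> germ_class p a = c))"
  have \<psi>: "\<psi> (germ_class p a) = \<phi> a" if a: "a \<in> F" for a
  proof -
    define b where "b = (SOME b. b \<in> F \<and> germ_class p b = germ_class p a)"
    have "b \<in> F \<and> germ_class p b = germ_class p a"
      unfolding b_def by (rule someI[of _ a]) (use a in simp)
    then have "\<phi> b = \<phi> a" using germ_rel_imp_eq[OF B \<phi> inv, of b a] germ_class_eq_iff[OF p, of b a] a by blast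
    then show ?thesis using a by (simp add: \<psi>_def carG b_def)
  qed
  have "\<psi> \<in> cinf_hom (germ_ring p) B"
    unfolding cinf_hom_def
  proof (intro CollectI conjI ballI)
    show "\<psi> \<in> carrier (germ_ring p) \<rightarrow>\<^sub>E carrier B"
    proof (rule PiE_I)
      fix c assume "c \<in> carrier (germ_ring p)"
      then obtain a where "a \<in> F" "c = germ_class p a" by (auto simp: carG)
      then show "\<psi> c \<in> carrier B" using \<psi> cinf_hom_closed[OF \<phi>] by simp
    qed (simp add: \<psi>_def)
    fix cs f assume "cs \<in> lists (carrier (germ_ring p))" and f: "f \<in> Cinf_Rn (length cs)"
    then obtain as where as: "as \<in> lists F" and cs: "cs = map (germ_class p) as"
      using lists_imageD[of cs "germ_class p" F] by (auto simp: carG)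
    have as': "as \<in> lists (carrier A)" and f': "f \<in> Cinf_Rn (length as)" using as f cs by auto
    have "cop A f as \<in> F" using ring.cop_closed[OF as' f'] by simp
    then have "\<psi> (cop (germ_ring p) f cs) = \<phi> (cop A f as)"
      unfolding cs cop_germ_ring[OF p as f'] by (rule \<psi>)
    also have "\<dots> = cop B f (map \<phi> as)" by (rule cinf_hom_cop[OF \<phi> as' f'])
    also have "map \<phi> as = map \<psi> cs" unfolding cs using \<psi> as by auto
    finally show "\<psi> (cop (germ_ring p) f cs) = cop B f (map \<psi> cs)" .
  qed
  then show "\<exists>!\<psi>. \<psi> \<in> cinf_hom (germ_ring p) B \<and> (\<forall>a\<in>carrier A. \<psi> (germ_class p a) = \<phi> a)"
  proof (intro ex1I[where a=\<psi>] conjI)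
    show "\<forall>a\<in>carrier A. \<psi> (germ_class p a) = \<phi> a" using \<psi> by simp
    fix \<psi>' assume \<psi>': "\<psi>' \<in> cinf_hom (germ_ring p) B \<and> (\<forall>a\<in>carrier A. \<psi>' (germ_class p a) = \<phi> a)"
    show "\<psi>' = \<psi>"
    proof (rule cinf_hom_eqI[OF conjunct1[OF \<psi>'] \<open>\<psi> \<in> cinf_hom (germ_ring p) B\<close>])
      fix c assume "c \<in> carrier (germ_ring p)"
      then obtain a where "a \<in> F" "c = germ_class p a" by (auto simp: carG)
      then show "\<psi>' c = \<psi> c" using \<psi> \<psi>' by simp
    qed
  qed
qed

lemma Spec_localization:
  "is_localization A {a \<in> carrier A. p a \<noteq> 0} (Spec_local A p, Spec_proj A p)"
  unfolding Spec_local_def Spec_proj_def prod.collapse localization_def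
  by (rule someI[where P="is_localization A {a \<in> carrier A. p a \<noteq> 0}"]) (rule germ_ring_is_localization)

lemma Spec_local_ring: "cinf_ring (Spec_local A p)"
  and Spec_proj_hom: "Spec_proj A p \<in> cinf_hom A (Spec_local A p)"
  using is_localizationD(1,2)[OF Spec_localization] by auto

lemma Spec_proj_onto: "carrier (Spec_local A p) = Spec_proj A p ` F"
  and Spec_proj_eq_iff: "a \<in> F \<Longrightarrow> b \<in> F \<Longrightarrow> Spec_proj A p a = Spec_proj A p b \<longleftrightarrow> germ_rel p a b"
proof -
  have onto: "carrier (germ_ring p) = germ_class p ` carrier A" by (simp add: germ_ring_def)
  note cmp = localization_compare[OF ring.cinf_ring_axioms germ_ring_is_localization Spec_localization onto]
  show "carrier (Spec_local A p) = Spec_proj A p ` F" using cmp(1) by simp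
  assume "a \<in> F" "b \<in> F"
  then show "Spec_proj A p a = Spec_proj A p b \<longleftrightarrow> germ_rel p a b"
    using cmp(2)[of a b] germ_class_eq_iff[OF p] by simp
qed

end

section \<open>The spectrum of a ring of functions\<close>

abbreviation pts where "pts \<equiv> cinf_hom A cinf_real"
abbreviation OpS where "OpS \<equiv> openin (Spec_top A)"

lemma open_nonvanishing: "a \<in> F \<Longrightarrow> OpS {x \<in> pts. x a \<noteq> 0}"
  unfolding Spec_top_def by (rule topology_generated_by_Basis) auto

lemma topspace_Spec: "topspace (Spec_top A) = pts"
proof -
  have "x \<in> \<Union>{{x \<in> pts. x a \<noteq> 0} | a. a \<in> carrier A}" if "x \<in> pts" for x
  proof -
    have "x \<in> {x \<in> pts. x (\<lambda>x\<in>S. 1) \<noteq> 0}" using that one_functions(2)[OF that] by (simp del: restrict_apply)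
    moreover have "{x \<in> pts. x (\<lambda>x\<in>S. 1) \<noteq> 0} \<in> {{x \<in> pts. x a \<noteq> 0} | a. a \<in> carrier A}"
      using one_functions(1)[OF that] by auto
    ultimately show ?thesis by blast
  qed
  then show ?thesis unfolding Spec_top_def topology_generated_by_topspace by blast
qed

lemma open_pts: "OpS U \<Longrightarrow> x \<in> U \<Longrightarrow> x \<in> pts"
  using openin_subset[of "Spec_top A" U] topspace_Spec by blast

lemma carrier_Spec_sections:
  "s \<in> carrier (Spec_sections A U) \<longleftrightarrow> s \<in> (\<Pi>\<^sub>E x\<in>U. carrier (Spec_local A x)) \<and>
        (\<forall>x\<in>U. \<exists>V. \<exists>a\<in>F. OpS V \<and> x \<in> V \<and> V \<subseteq> U \<and> (\<forall>y\<in>V. s y = Spec_proj A y a))"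
  by (simp add: Spec_sections_def)

lemma cop_Spec_sections:
  "cop (Spec_sections A U) f ss = (\<lambda>x\<in>U. cop (Spec_local A x) f (map (\<lambda>s. s x) ss))"
  by (simp add: Spec_sections_def)

lemma cval_Spec_sections:
  "x \<in> U \<Longrightarrow> cval (Spec_sections A U) ss g x = cval (Spec_local A x) (map (\<lambda>s. s x) ss) g"
  by (simp add: cval_def cop_Spec_sections)

lemma Spec_section_values:
  "ss \<in> lists (carrier (Spec_sections A U)) \<Longrightarrow> x \<in> U \<Longrightarrow> map (\<lambda>s. s x) ss \<in> lists (carrier (Spec_local A x))"
  by (auto simp: carrier_Spec_sections PiE_iff)

lemma Spec_sections_common:
  assumes "OpS U" "x \<in> U" "ss \<in> lists (carrier (Spec_sections A U))"
  shows "\<exists>V as. OpS V \<and> x \<in> V \<and> V \<subseteq> U \<and> as \<in> lists F \<and> (\<forall>y\<in>V. map (\<lambda>s. s y) ss = map (Spec_proj A y) as)"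
  using assms(3)
proof (induction ss)
  case Nil
  then show ?case using assms by (intro exI[of _ U] exI[of _ "[]"]) auto
next
  case (Cons s ss)
  then obtain V as where V: "OpS V" "x \<in> V" "V \<subseteq> U" "as \<in> lists F" "\<forall>y\<in>V. map (\<lambda>s. s y) ss = map (Spec_proj A y) as"
    by blast
  have "s \<in> carrier (Spec_sections A U)" using Cons by simp
  then obtain W a where W: "OpS W" "x \<in> W" "W \<subseteq> U" "a \<in> F" "\<forall>y\<in>W. s y = Spec_proj A y a"
    using assms(2) unfolding carrier_Spec_sections by blast
  show ?case using V W by (intro exI[of _ "V \<inter> W"] exI[of _ "a # as"]) auto
qed

lemma cop_Spec_proj:
  assumes "y \<in> pts" "as \<in> lists F" "f \<in> Cinf_Rn (length as)"
  shows "cop (Spec_local A y) f (map (Spec_proj A y) as) = Spec_proj A y (cop A f as)"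
  using cinf_hom_cop[OF Spec_proj_hom[OF assms(1)], of as f] assms(2,3) by simp

lemma Spec_sections_ring:
  assumes U: "OpS U"
  shows "cinf_ring (Spec_sections A U)"
proof
  fix ss f assume ss: "ss \<in> lists (carrier (Spec_sections A U))"
  have ring: "cinf_ring (Spec_local A x)" if "x \<in> U" for x using Spec_local_ring open_pts[OF U that] by blast
  note vals = Spec_section_values[OF ss]
  { assume f: "f \<in> Cinf_Rn (length ss)"
    show "cop (Spec_sections A U) f ss \<in> carrier (Spec_sections A U)"
      unfolding carrier_Spec_sections
    proof (intro conjI ballI)
      show "cop (Spec_sections A U) f ss \<in> (\<Pi>\<^sub>E x\<in>U. carrier (Spec_local A x))"
        unfolding cop_Spec_sections using cinf_ring.cop_closed[OF ring vals] f by auto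
      fix x assume x: "x \<in> U"
      obtain V as where V: "OpS V" "x \<in> V" "V \<subseteq> U" "as \<in> lists F" "\<forall>y\<in>V. map (\<lambda>s. s y) ss = map (Spec_proj A y) as"
        using Spec_sections_common[OF U x ss] by blast
      have "length as = length ss" using V(2,5) by (metis length_map)
      then have f': "f \<in> Cinf_Rn (length as)" using f by simp
      have "cop (Spec_sections A U) f ss y = Spec_proj A y (cop A f as)" if y: "y \<in> V" for y
        using V(3,5) y cop_Spec_proj[OF open_pts[OF V(1) y] V(4) f'] by (auto simp: cop_Spec_sections)
      moreover have "cop A f as \<in> F" using ring.cop_closed[of as f] V(4) f' by simp
      ultimately show "\<exists>V. \<exists>a\<in>F. OpS V \<and> x \<in> V \<and> V \<subseteq> U \<and> (\<forall>y\<in>V. cop (Spec_sections A U) f ss y = Spec_proj A y a)"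
        using V by blast
    qed }
  { fix i assume i: "i < length ss"
    have "cop (Spec_sections A U) (\<lambda>x\<in>Rn (length ss). x i) ss = (\<lambda>x\<in>U. (ss ! i) x)"
      unfolding cop_Spec_sections
    proof (rule restrict_ext)
      fix x assume "x \<in> U"
      then show "cop (Spec_local A x) (\<lambda>x\<in>Rn (length ss). x i) (map (\<lambda>s. s x) ss) = (ss ! i) x"
        using cinf_ring.cop_proj[OF ring[OF \<open>x \<in> U\<close>] vals[OF \<open>x \<in> U\<close>], of i] i by simp
    qed
    also have "\<dots> = ss ! i"
    proof (rule extensional_restrict)
      have "ss ! i \<in> carrier (Spec_sections A U)" using ss i by (simp add: in_lists_conv_set)
      then show "ss ! i \<in> extensional U" by (simp add: carrier_Spec_sections PiE_def)
    qed
    finally show "cop (Spec_sections A U) (\<lambda>x\<in>Rn (length ss). x i) ss = ss ! i" . }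
  { fix gs assume gs: "gs \<in> lists (Cinf_Rn (length ss))" and f: "f \<in> Cinf_Rn (length gs)"
    show "cop (Spec_sections A U) (\<lambda>x\<in>Rn (length ss). f (point (map (\<lambda>g. g x) gs))) ss =
          cop (Spec_sections A U) f (map (\<lambda>g. cop (Spec_sections A U) g ss) gs)"
      unfolding cop_Spec_sections
    proof (rule restrict_ext)
      fix x assume x: "x \<in> U"
      have "cop (Spec_local A x) (\<lambda>x\<in>Rn (length (map (\<lambda>s. s x) ss)). f (point (map (\<lambda>g. g x) gs))) (map (\<lambda>s. s x) ss)
        = cop (Spec_local A x) f (map (\<lambda>g. cop (Spec_local A x) g (map (\<lambda>s. s x) ss)) gs)"
        using cinf_ring.cop_compose[OF ring[OF x] vals[OF x], of gs f] gs f by simp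
      then show "cop (Spec_local A x) (\<lambda>x\<in>Rn (length ss). f (point (map (\<lambda>g. g x) gs))) (map (\<lambda>s. s x) ss) =
         cop (Spec_local A x) f (map (\<lambda>s. s x) (map (\<lambda>g. \<lambda>x\<in>U. cop (Spec_local A x) g (map (\<lambda>s. s x) ss)) gs))"
        using x by (simp only: length_map map_map o_def restrict_apply if_True)
    qed }
qed

lemma Spec_simps:
  "rs_top (Spec A) = Spec_top A" "sections (Spec A) = Spec_sections A"
  "s \<in> carrier (Spec_sections A U) \<Longrightarrow> restr (Spec A) U V s = restrict s V"
  by (simp_all add: Spec_def)

lemma Spec_restrict_closed:
  assumes "OpS V" "V \<subseteq> U" "s \<in> carrier (Spec_sections A U)"
  shows "restrict s V \<in> carrier (Spec_sections A V)"
  unfolding carrier_Spec_sections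
proof (intro conjI ballI)
  show "restrict s V \<in> (\<Pi>\<^sub>E x\<in>V. carrier (Spec_local A x))"
    using assms(2,3) by (auto simp: carrier_Spec_sections)
  fix x assume x: "x \<in> V"
  then obtain W a where W: "OpS W" "x \<in> W" "W \<subseteq> U" "a \<in> F" "\<forall>y\<in>W. s y = Spec_proj A y a"
    using assms(2,3) unfolding carrier_Spec_sections by blast
  then show "\<exists>W. \<exists>a\<in>F. OpS W \<and> x \<in> W \<and> W \<subseteq> V \<and> (\<forall>y\<in>W. restrict s V y = Spec_proj A y a)"
    using x assms(1) by (intro exI[of _ "V \<inter> W"] bexI[of _ a]) auto
qed

lemma Spec_ringed_space: "cinf_ringed_space (Spec A)"
proof (rule function_sheafI, unfold Spec_simps(1,2))
  show "s \<in> extensional U" if "s \<in> carrier (Spec_sections A U)" for s U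
    using that by (simp add: carrier_Spec_sections PiE_def)
  show "restr (Spec A) U V = (\<lambda>s\<in>carrier (Spec_sections A U). restrict s V)" for U V
    by (simp add: Spec_def)
  show "restrict (cop (Spec_sections A U) f ss) V = cop (Spec_sections A V) f (map (\<lambda>s. restrict s V) ss)"
    if "V \<subseteq> U" for U V ss f
    unfolding cop_Spec_sections using that by (auto simp: o_def fun_eq_iff restrict_def)
  fix \<U> t assume t: "t \<in> extensional (\<Union>\<U>)" "\<And>U. U \<in> \<U> \<Longrightarrow> restrict t U \<in> carrier (Spec_sections A U)"
  show "t \<in> carrier (Spec_sections A (\<Union>\<U>))"
    unfolding carrier_Spec_sections
  proof (intro conjI ballI PiE_I)
    fix x assume "x \<in> \<Union>\<U>"
    then obtain U where U: "U \<in> \<U>" "x \<in> U" by blast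
    have r: "restrict t U y = t y" if "y \<in> U" for y using that by simp
    show "t x \<in> carrier (Spec_local A x)"
      using t(2)[OF U(1)] U(2) r[OF U(2)] unfolding carrier_Spec_sections by (metis PiE_mem)
    obtain V a where V: "OpS V" "x \<in> V" "V \<subseteq> U" "a \<in> F" "\<forall>y\<in>V. restrict t U y = Spec_proj A y a"
      using t(2)[OF U(1)] U(2) unfolding carrier_Spec_sections by blast
    have "\<forall>y\<in>V. t y = Spec_proj A y a" using V(3,5) r by (metis subsetD)
    then show "\<exists>V. \<exists>a\<in>F. OpS V \<and> x \<in> V \<and> V \<subseteq> \<Union>\<U> \<and> (\<forall>y\<in>V. t y = Spec_proj A y a)"
      using V(1-4) U(1) by (intro exI[of _ V] bexI[of _ a]) auto
  qed (use t(1) in \<open>simp add: extensional_def\<close>)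
qed (use Spec_sections_ring Spec_restrict_closed in simp_all)

text \<open>
  The point of the localization at \<open>p\<close> that \<open>p\<close> induces.
\<close>

definition germ_value :: "(('p \<Rightarrow> real) \<Rightarrow> real) \<Rightarrow> ('p \<Rightarrow> real) set \<Rightarrow> real" where
  "germ_value p c = p (SOME a. a \<in> F \<and> Spec_proj A p a = c)"

lemma some_representative:
  assumes "p \<in> pts" "a \<in> F"
  shows "(SOME b. b \<in> F \<and> Spec_proj A p b = Spec_proj A p a) \<in> F"
    "germ_rel p (SOME b. b \<in> F \<and> Spec_proj A p b = Spec_proj A p a) a"
proof -
  define b where "b = (SOME b. b \<in> F \<and> Spec_proj A p b = Spec_proj A p a)"
  have "b \<in> F \<and> Spec_proj A p b = Spec_proj A p a" unfolding b_def by (rule someI[of _ a]) (use assms in simp)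
  then have "b \<in> F" "germ_rel p b a" using Spec_proj_eq_iff[OF assms(1), of b a] assms(2) by auto
  then show "(SOME b. b \<in> F \<and> Spec_proj A p b = Spec_proj A p a) \<in> F"
    "germ_rel p (SOME b. b \<in> F \<and> Spec_proj A p b = Spec_proj A p a) a" by (simp_all add: b_def)
qed

lemma germ_value: "p \<in> pts \<Longrightarrow> a \<in> F \<Longrightarrow> germ_value p (Spec_proj A p a) = p a"
  using germ_rel_value[of p "SOME b. b \<in> F \<and> Spec_proj A p b = Spec_proj A p a" a] some_representative[of p a]
  unfolding germ_value_def by simp

text \<open>
  Let \<open>s\<close> be given near \<open>p\<close> by \<open>a\<close>.  If \<open>g\<close> and \<open>h\<close> agree near \<open>p a\<close>, then \<open>g \<circ> a\<close> and \<open>h \<circ> a\<close> agree where some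
  \<open>d\<close> with \<open>p d \<noteq> 0\<close> does not vanish.  The same \<open>d\<close> identifies them in the localizations at all \<open>y\<close> with
  \<open>y d \<noteq> 0\<close>, and these form a neighbourhood of \<open>p\<close>.
\<close>

lemma Spec_local_ringed_space: "local_cinf_ringed_space (Spec A)"
proof -
  interpret X: cinf_ringed_space "Spec A" by (rule Spec_ringed_space)
  show ?thesis
  proof
    fix p assume "p \<in> topspace (rs_top (Spec A))"
    then have p: "p \<in> pts" by (simp add: Spec_simps topspace_Spec)
    let ?val = "\<lambda>U. \<lambda>s\<in>carrier (Spec_sections A U). germ_value p (s p)"
    show "local_cinf_ring (stalk (Spec A) p)"
    proof (rule X.local_stalkI[where val="?val"])
      show "p \<in> topspace (rs_top (Spec A))" by fact
    next
      fix U assume "openin (rs_top (Spec A)) U" and pU: "p \<in> U"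
      then have U: "OpS U" by (simp add: Spec_simps)
      show "?val U \<in> cinf_hom (sections (Spec A) U) cinf_real"
        unfolding cinf_hom_def Spec_simps
      proof (intro CollectI conjI ballI)
        show "?val U \<in> carrier (Spec_sections A U) \<rightarrow>\<^sub>E carrier cinf_real" by simp
        fix ss f assume ss: "ss \<in> lists (carrier (Spec_sections A U))" and f: "f \<in> Cinf_Rn (length ss)"
        obtain V as where V: "p \<in> V" "as \<in> lists F" "\<forall>y\<in>V. map (\<lambda>s. s y) ss = map (Spec_proj A y) as"
          using Spec_sections_common[OF U pU ss] by blast
        have eq: "map (\<lambda>s. s p) ss = map (Spec_proj A p) as" using V by blast
        have "length as = length ss" using eq by (metis length_map)
        then have f': "f \<in> Cinf_Rn (length as)" using f by simp
        have as': "as \<in> lists (carrier A)" using V(2) by simp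
        have c: "cop (Spec_sections A U) f ss \<in> carrier (Spec_sections A U)"
          using cinf_ring.cop_closed[OF Spec_sections_ring[OF U] ss f] .
        have "cop (Spec_sections A U) f ss p = Spec_proj A p (cop A f as)"
          using cop_Spec_proj[OF p V(2) f'] pU by (simp add: cop_Spec_sections eq)
        then have "?val U (cop (Spec_sections A U) f ss) = p (cop A f as)"
          using germ_value[OF p, of "cop A f as"] ring.cop_closed[OF as' f'] c by simp
        also have "\<dots> = cop cinf_real f (map p as)" by (rule cinf_hom_cop[OF p as' f'])
        also have "map p as = map (germ_value p) (map (Spec_proj A p) as)" using germ_value[OF p] V(2) by auto
        also have "\<dots> = map (?val U) ss" unfolding eq[symmetric] using ss by auto
        finally show "?val U (cop (Spec_sections A U) f ss) = cop cinf_real f (map (?val U) ss)" .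
      qed
    next
      fix U V s assume "openin (rs_top (Spec A)) U" "openin (rs_top (Spec A)) V" "p \<in> V" "V \<subseteq> U"
        "s \<in> carrier (sections (Spec A) U)"
      then show "?val V (restr (Spec A) U V s) = ?val U s"
        using Spec_restrict_closed[of V U s] by (simp add: Spec_simps)
    next
      fix U s and g h :: "real \<Rightarrow> real" and e :: real
      assume "openin (rs_top (Spec A)) U" and pU: "p \<in> U" and "s \<in> carrier (sections (Spec A) U)"
        and gh: "smooth_real g" "smooth_real h" and e: "e > 0"
        and agree: "\<And>t. \<bar>t - ?val U s\<bar> < e \<Longrightarrow> g t = h t"
      then have U: "OpS U" and s: "s \<in> carrier (Spec_sections A U)" by (simp_all add: Spec_simps)
      obtain V a where V: "OpS V" "p \<in> V" "V \<subseteq> U" "a \<in> F" "\<forall>y\<in>V. s y = Spec_proj A y a"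
        using s pU unfolding carrier_Spec_sections by blast
      have "?val U s = p a" using germ_value[OF p V(4)] V s by simp
      then have "germ_rel p (cval A [a] (\<lambda>y. g (y 0))) (cval A [a] (\<lambda>y. h (y 0)))"
        using germ_rel_smooth_real[OF p V(4) gh e] agree by simp
      then obtain d where d: "d \<in> F" "p d \<noteq> 0"
        "\<forall>x\<in>S. d x \<noteq> 0 \<longrightarrow> cval A [a] (\<lambda>y. g (y 0)) x = cval A [a] (\<lambda>y. h (y 0)) x"
        unfolding germ_rel_def by blast
      let ?W = "V \<inter> {x \<in> pts. x d \<noteq> 0}"
      have W: "OpS ?W" "p \<in> ?W" "?W \<subseteq> U" using V d p open_nonvanishing[OF d(1)] by auto
      have sp: "cval (Spec_sections A U) [s] (\<lambda>y. k (y 0)) y = Spec_proj A y (cval A [a] (\<lambda>y. k (y 0)))"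
        if "smooth_real k" "y \<in> V" for k y
        using cinf_hom_cval[OF Spec_proj_hom[OF open_pts[OF V(1) that(2)]], of "[a]" "\<lambda>y. k (y 0)"] V that
        by (auto simp: cval_Spec_sections)
      have cc: "cval (Spec_sections A U) [s] (\<lambda>y. k (y 0)) \<in> carrier (Spec_sections A U)"
        "cval A [a] (\<lambda>y. k (y 0)) \<in> F" if "smooth_real k" for k
        using cinf_ring.cval_closed[OF Spec_sections_ring[OF U], of "[s]"] ring.cval_closed[of "[a]"] s V(4) that by simp_all
      have "restrict (cval (Spec_sections A U) [s] (\<lambda>y. g (y 0))) ?W = restrict (cval (Spec_sections A U) [s] (\<lambda>y. h (y 0))) ?W"
      proof (rule restrict_ext)
        fix y assume y: "y \<in> ?W"
        have "germ_rel y (cval A [a] (\<lambda>y. g (y 0))) (cval A [a] (\<lambda>y. h (y 0)))"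
          unfolding germ_rel_def using d y by blast
        then show "cval (Spec_sections A U) [s] (\<lambda>y. g (y 0)) y = cval (Spec_sections A U) [s] (\<lambda>y. h (y 0)) y"
          using sp gh y Spec_proj_eq_iff[of y] cc(2)[OF gh(1)] cc(2)[OF gh(2)] by simp
      qed
      then show "\<exists>W. openin (rs_top (Spec A)) W \<and> p \<in> W \<and> W \<subseteq> U \<and>
        restr (Spec A) U W (cval (sections (Spec A) U) [s] (\<lambda>y. g (y 0))) =
        restr (Spec A) U W (cval (sections (Spec A) U) [s] (\<lambda>y. h (y 0)))"
        using W cc(1)[OF gh(1)] cc(1)[OF gh(2)] by (intro exI[of _ ?W]) (simp add: Spec_simps)
    qed
  qed
qed

end

section \<open>Smooth functions on manifolds\<close>

text \<open>
  The conditions on a single chart, separated from the manifold so that the same facts serve the group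
  and the space on which it acts.
\<close>

definition is_chart :: "'m topology \<Rightarrow> nat \<Rightarrow> 'm set \<Rightarrow> ('m \<Rightarrow> nat \<Rightarrow> real) \<Rightarrow> bool" where
  "is_chart T n U \<phi> \<longleftrightarrow> openin T U \<and> openin (Euclidean_space n) (\<phi> ` U) \<and>
     homeomorphic_map (subtopology T U) (subtopology (Euclidean_space n) (\<phi> ` U)) \<phi>"

context
  fixes T n U \<phi> assumes chart: "is_chart T n U \<phi>"
begin

lemma chart_open_domain: "openin T U" "U \<subseteq> topspace T" and chart_open_range: "openin (Euclidean_space n) (\<phi> ` U)"
  using chart openin_subset unfolding is_chart_def by auto

lemma chart_homeomorphic: "homeomorphic_map (subtopology T U) (subtopology (Euclidean_space n) (\<phi> ` U)) \<phi>"
  using chart by (simp add: is_chart_def)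

lemma chart_inj: "inj_on \<phi> U"
  using homeomorphic_imp_injective_map[OF chart_homeomorphic] chart_open_domain(2)
  by (simp add: Int_absorb1)

lemma chart_inv: "x \<in> U \<Longrightarrow> inv_into U \<phi> (\<phi> x) = x"
  by (rule inv_into_f_f[OF chart_inj])

lemma chart_image_open: 
  assumes "openin T W" shows "openin (Euclidean_space n) (\<phi> ` (U \<inter> W))"
proof -
  have "openin (subtopology T U) (U \<inter> W)"
    using openin_Int[OF chart_open_domain(1) assms] chart_open_domain(1) by (simp add: openin_open_subtopology)
  then have "openin (subtopology (Euclidean_space n) (\<phi> ` U)) (\<phi> ` (U \<inter> W))"
    using homeomorphic_imp_open_map[OF chart_homeomorphic] unfolding open_map_def by blast
  then show ?thesis using chart_open_range by (rule openin_trans_full)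
qed

lemma chart_preimage_open:
  assumes "openin (Euclidean_space n) Z" shows "openin T {x \<in> U. \<phi> x \<in> Z}"
proof -
  have "continuous_map (subtopology T U) (Euclidean_space n) \<phi>"
    using homeomorphic_imp_continuous_map[OF chart_homeomorphic] by (simp add: continuous_map_in_subtopology)
  then have "openin (subtopology T U) {x \<in> topspace (subtopology T U). \<phi> x \<in> Z}"
    using assms by (rule openin_continuous_map_preimage)
  moreover have "{x \<in> topspace (subtopology T U). \<phi> x \<in> Z} = {x \<in> U. \<phi> x \<in> Z}"
    using chart_open_domain(2) by auto
  ultimately show ?thesis using chart_open_domain(1) by (simp add: openin_open_subtopology)
qed

lemma chart_inverse_continuous:
  "continuous_map (subtopology (Euclidean_space n) (\<phi> ` U)) T (inv_into U \<phi>)"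
proof -
  obtain g where g: "homeomorphic_maps (subtopology T U) (subtopology (Euclidean_space n) (\<phi> ` U)) \<phi> g"
    using chart_homeomorphic homeomorphic_map_maps by blast
  have top: "topspace (subtopology (Euclidean_space n) (\<phi> ` U)) = \<phi> ` U"
    using openin_subset[OF chart_open_range] by auto
  have gx: "g (\<phi> x) = x" if "x \<in> U" for x
    using g that chart_open_domain(2) by (auto simp: homeomorphic_maps_def)
  have "continuous_map (subtopology (Euclidean_space n) (\<phi> ` U)) T g"
    using g by (simp add: homeomorphic_maps_def continuous_map_in_subtopology)
  then show ?thesis
    by (rule continuous_map_eq) (use top gx chart_inv in auto)
qed

end

lemma openin_pointwise:
  assumes "\<And>x. x \<in> S \<Longrightarrow> \<exists>W. openin T W \<and> x \<in> W \<and> W \<subseteq> S"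
  shows "openin T S"
  using assms openin_subopen by metis

definition smooth_in_chart :: "nat \<Rightarrow> 'm set \<Rightarrow> ('m \<Rightarrow> nat \<Rightarrow> real) \<Rightarrow> 'm set \<Rightarrow> ('m \<Rightarrow> real) \<Rightarrow> bool" where
  "smooth_in_chart n U \<phi> W f \<longleftrightarrow> smooth_on n (\<phi> ` (U \<inter> W)) (\<lambda>z. f (inv_into U \<phi> z))"

lemma smooth_real_on_iff:
  "smooth_real_on M W f \<longleftrightarrow> (\<forall>(U, \<phi>)\<in>atlas M. smooth_in_chart (mdim M) U \<phi> W f)"
  by (simp add: smooth_real_on_def smooth_in_chart_def)

context
  fixes T n U \<phi> W assumes chart: "is_chart T n U \<phi>" and W: "openin T W"
begin

lemma smooth_in_chart_cong:
  assumes "\<And>x. x \<in> W \<Longrightarrow> f x = g x" "smooth_in_chart n U \<phi> W f"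
  shows "smooth_in_chart n U \<phi> W g"
  using assms(2) unfolding smooth_in_chart_def
  by (rule smooth_on_cong[OF chart_image_open[OF chart W], rotated]) (auto simp: chart_inv[OF chart] assms(1))

lemma smooth_in_chart_subset: "W' \<subseteq> W \<Longrightarrow> smooth_in_chart n U \<phi> W f \<Longrightarrow> smooth_in_chart n U \<phi> W' f"
  unfolding smooth_in_chart_def by (erule smooth_on_subset[rotated]) auto

lemma smooth_in_chart_local:
  assumes "\<And>x. x \<in> W \<Longrightarrow> \<exists>W'. openin T W' \<and> x \<in> W' \<and> smooth_in_chart n U \<phi> (W \<inter> W') f"
  shows "smooth_in_chart n U \<phi> W f"
  unfolding smooth_in_chart_def
proof (rule smooth_on_local)
  show "\<phi> ` (U \<inter> W) \<subseteq> Rn n" using chart_image_open[OF chart W] by (rule openin_subset)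
  fix z assume "z \<in> \<phi> ` (U \<inter> W)"
  then obtain x where x: "x \<in> U" "x \<in> W" "z = \<phi> x" by blast
  obtain W' where W': "openin T W'" "x \<in> W'" "smooth_in_chart n U \<phi> (W \<inter> W') f" using assms x by blast
  have "\<phi> ` (U \<inter> W) \<inter> \<phi> ` (U \<inter> W') \<subseteq> \<phi> ` (U \<inter> (W \<inter> W'))"
    using chart_inj[OF chart] by (auto simp: inj_on_def)
  then have "smooth_on n (\<phi> ` (U \<inter> W) \<inter> \<phi> ` (U \<inter> W')) (\<lambda>z. f (inv_into U \<phi> z))"
    using W'(3) smooth_on_subset unfolding smooth_in_chart_def by blast
  then show "\<exists>V. openin (Euclidean_space n) V \<and> z \<in> V \<and> smooth_on n (\<phi> ` (U \<inter> W) \<inter> V) (\<lambda>z. f (inv_into U \<phi> z))"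
    using chart_image_open[OF chart W'(1)] x W' by (intro exI[of _ "\<phi> ` (U \<inter> W')"]) auto
qed

lemma smooth_in_chart_compose:
  assumes V: "openin (Euclidean_space m) V" and H: "smooth_on m V H"
    and G: "\<And>x. x \<in> W \<Longrightarrow> G x \<in> V" "\<And>i. i < m \<Longrightarrow> smooth_in_chart n U \<phi> W (\<lambda>x. G x i)"
  shows "smooth_in_chart n U \<phi> W (\<lambda>x. H (G x))"
  unfolding smooth_in_chart_def
  by (rule smooth_on_compose[where f=H and G="\<lambda>z. G (inv_into U \<phi> z)" and V=V and m=m])
     (use assms chart_image_open[OF chart W] chart_inv[OF chart] in \<open>auto simp: smooth_in_chart_def\<close>)

lemma smooth_in_chart_preimage:
  assumes f: "smooth_in_chart n U \<phi> W f" and S: "open S"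
  shows "openin T {x \<in> U \<inter> W. f x \<in> S}"
proof -
  let ?D = "\<phi> ` (U \<inter> W)"
  have "continuous_map (subtopology (Euclidean_space n) ?D) euclideanreal (\<lambda>z. f (inv_into U \<phi> z))"
    using f by (auto simp: smooth_in_chart_def smooth_on_def intro: Ck_on_continuous[of 0])
  then have "openin (subtopology (Euclidean_space n) ?D) {z \<in> topspace (subtopology (Euclidean_space n) ?D). f (inv_into U \<phi> z) \<in> S}"
    by (rule openin_continuous_map_preimage) (use S in simp)
  moreover have top: "topspace (subtopology (Euclidean_space n) ?D) = ?D"
    using openin_subset[OF chart_image_open[OF chart W]] by auto
  ultimately have "openin (subtopology (Euclidean_space n) ?D) {z \<in> ?D. f (inv_into U \<phi> z) \<in> S}"
    by (simp only: top)
  then have "openin (Euclidean_space n) {z \<in> ?D. f (inv_into U \<phi> z) \<in> S}"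
    using chart_image_open[OF chart W] by (rule openin_trans_full)
  from chart_preimage_open[OF chart this]
  have "openin T {x \<in> U. \<phi> x \<in> {z \<in> ?D. f (inv_into U \<phi> z) \<in> S}}" .
  also have "{x \<in> U. \<phi> x \<in> {z \<in> ?D. f (inv_into U \<phi> z) \<in> S}} = {x \<in> U \<inter> W. f x \<in> S}"
    using chart_inv[OF chart] by (auto dest: inj_onD[OF chart_inj[OF chart]])
  finally show ?thesis .
qed

end

context smooth_manifold
begin

abbreviation OpM where "OpM \<equiv> openin (mtop M)"
abbreviation pM where "pM \<equiv> topspace (mtop M)"

lemma atlas_chart: "(U, \<phi>) \<in> atlas M \<Longrightarrow> is_chart (mtop M) (mdim M) U \<phi>"
  using chart_open chart_homeo unfolding is_chart_def by blast

lemma chart_at: "x \<in> pM \<Longrightarrow> \<exists>U \<phi>. (U, \<phi>) \<in> atlas M \<and> x \<in> U"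
  using charts_cover by blast

lemma smooth_real_on_cong:
  "OpM W \<Longrightarrow> (\<And>x. x \<in> W \<Longrightarrow> f x = g x) \<Longrightarrow> smooth_real_on M W f \<Longrightarrow> smooth_real_on M W g"
  unfolding smooth_real_on_iff using smooth_in_chart_cong[OF atlas_chart] by fastforce

lemma smooth_real_on_subset: "OpM W \<Longrightarrow> W' \<subseteq> W \<Longrightarrow> smooth_real_on M W f \<Longrightarrow> smooth_real_on M W' f"
  unfolding smooth_real_on_iff using smooth_in_chart_subset[OF atlas_chart] by fastforce

lemma smooth_real_on_local:
  assumes W: "OpM W" and loc: "\<And>x. x \<in> W \<Longrightarrow> \<exists>W'. OpM W' \<and> x \<in> W' \<and> smooth_real_on M (W \<inter> W') f"
  shows "smooth_real_on M W f"
  unfolding smooth_real_on_iff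
proof (intro ballI, unfold split_paired_all split)
  fix U \<phi> assume c: "(U, \<phi>) \<in> atlas M"
  show "smooth_in_chart (mdim M) U \<phi> W f"
  proof (rule smooth_in_chart_local[OF atlas_chart[OF c] W])
    fix x assume "x \<in> W"
    then obtain W' where "OpM W'" "x \<in> W'" "smooth_real_on M (W \<inter> W') f" using loc by blast
    then show "\<exists>W'. OpM W' \<and> x \<in> W' \<and> smooth_in_chart (mdim M) U \<phi> (W \<inter> W') f"
      using c unfolding smooth_real_on_iff by blast
  qed
qed

lemma smooth_real_on_compose:
  assumes W: "OpM W" and V: "openin (Euclidean_space m) V" "smooth_on m V H"
    and G: "\<And>x. x \<in> W \<Longrightarrow> G x \<in> V" "\<And>i. i < m \<Longrightarrow> smooth_real_on M W (\<lambda>x. G x i)"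
  shows "smooth_real_on M W (\<lambda>x. H (G x))"
  unfolding smooth_real_on_iff
proof (intro ballI, unfold split_paired_all split)
  fix U \<phi> assume c: "(U, \<phi>) \<in> atlas M"
  show "smooth_in_chart (mdim M) U \<phi> W (\<lambda>x. H (G x))"
    by (rule smooth_in_chart_compose[OF atlas_chart[OF c] W V G(1)])
       (use G(2) c in \<open>auto simp: smooth_real_on_iff\<close>)
qed

lemma smooth_real_on_op:
  assumes W: "OpM W" and as: "\<And>a. a \<in> set as \<Longrightarrow> smooth_real_on M W a" and f: "f \<in> Cinf_Rn (length as)"
  shows "smooth_real_on M W (\<lambda>x. f (point (map (\<lambda>a. a x) as)))"
proof (rule smooth_real_on_compose[OF W openin_Rn Cinf_RnD(1)[OF f]])
  fix x show "point (map (\<lambda>a. a x) as) \<in> Rn (length as)"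
    using point_in_Rn[of "map (\<lambda>a. a x) as"] by simp
next
  fix i assume i: "i < length as"
  have "smooth_real_on M W (as ! i)" using as i by simp
  then show "smooth_real_on M W (\<lambda>x. point (map (\<lambda>a. a x) as) i)" using i by (simp add: point_def)
qed

text \<open>
  The transition functions carry smoothness in one chart over to the others.
\<close>

lemma smooth_real_on_chart:
  assumes c: "(U, \<phi>) \<in> atlas M" and W: "OpM W" "W \<subseteq> U" and f: "smooth_in_chart (mdim M) U \<phi> W f"
  shows "smooth_real_on M W f"
  unfolding smooth_real_on_iff
proof (intro ballI, unfold split_paired_all split)
  fix V \<psi> assume c': "(V, \<psi>) \<in> atlas M"
  note ch = atlas_chart[OF c] and ch' = atlas_chart[OF c']
  let ?n = "mdim M"
  have "smooth_on ?n (\<psi> ` (V \<inter> W)) (\<lambda>z. (\<lambda>w. f (inv_into U \<phi> w)) (\<phi> (inv_into V \<psi> z)))"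
  proof (rule smooth_on_compose[where V="\<phi> ` (U \<inter> W)" and m="?n" and f="\<lambda>w. f (inv_into U \<phi> w)" and G="\<lambda>z. \<phi> (inv_into V \<psi> z)"])
    show "openin (Euclidean_space ?n) (\<psi> ` (V \<inter> W))" by (rule chart_image_open[OF ch' W(1)])
    show "openin (Euclidean_space ?n) (\<phi> ` (U \<inter> W))" by (rule chart_image_open[OF ch W(1)])
    show "smooth_on ?n (\<phi> ` (U \<inter> W)) (\<lambda>w. f (inv_into U \<phi> w))" using f by (simp add: smooth_in_chart_def)
    show "\<phi> (inv_into V \<psi> z) \<in> \<phi> ` (U \<inter> W)" if "z \<in> \<psi> ` (V \<inter> W)" for z
      using that chart_inv[OF ch'] W(2) by auto
    show "smooth_on ?n (\<psi> ` (V \<inter> W)) (\<lambda>z. \<phi> (inv_into V \<psi> z) i)" if "i < ?n" for i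
      by (rule smooth_on_subset[OF _ transition_smooth[OF c' c that]]) (use W(2) in auto)
  qed
  then have "smooth_in_chart ?n V \<psi> W (\<lambda>x. f (inv_into U \<phi> (\<phi> x)))" by (simp add: smooth_in_chart_def)
  then show "smooth_in_chart ?n V \<psi> W f"
    by (rule smooth_in_chart_cong[OF ch' W(1), rotated]) (use chart_inv[OF ch] W(2) in auto)
qed

lemma smooth_real_preimage:
  assumes W: "OpM W" and f: "smooth_real_on M W f" and S: "open S"
  shows "OpM {x \<in> W. f x \<in> S}"
proof (rule openin_pointwise)
  fix x assume x: "x \<in> {x \<in> W. f x \<in> S}"
  then obtain U \<phi> where c: "(U, \<phi>) \<in> atlas M" "x \<in> U" using chart_at openin_subset[OF W] by blast
  have "smooth_in_chart (mdim M) U \<phi> W f" using f c by (auto simp: smooth_real_on_iff)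
  then have "OpM {x \<in> U \<inter> W. f x \<in> S}" by (rule smooth_in_chart_preimage[OF atlas_chart[OF c(1)] W _ S])
  then show "\<exists>V. OpM V \<and> x \<in> V \<and> V \<subseteq> {x \<in> W. f x \<in> S}"
    using x c by (intro exI[of _ "{x \<in> U \<inter> W. f x \<in> S}"]) auto
qed

lemma
  assumes W: "OpM W" and fg: "smooth_real_on M W f" "smooth_real_on M W g"
  shows smooth_real_on_add: "smooth_real_on M W (\<lambda>x. f x + g x)"
    and smooth_real_on_mult: "smooth_real_on M W (\<lambda>x. f x * g x)"
    and smooth_real_on_divide: "(\<And>x. x \<in> W \<Longrightarrow> g x \<noteq> 0) \<Longrightarrow> smooth_real_on M W (\<lambda>x. f x / g x)"
  using fg unfolding smooth_real_on_iff smooth_in_chart_def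
  by (auto intro!: smooth_on_add smooth_on_mult smooth_on_divide chart_image_open[OF atlas_chart _] W
      simp: chart_inv[OF atlas_chart])

lemma smooth_real_on_const: "OpM W \<Longrightarrow> smooth_real_on M W (\<lambda>_. c)"
  unfolding smooth_real_on_iff smooth_in_chart_def
  by (auto intro!: smooth_on_const chart_image_open[OF atlas_chart])

lemma smooth_real_on_sum:
  assumes W: "OpM W" and "\<And>j. j \<in> J \<Longrightarrow> smooth_real_on M W (f j)"
  shows "smooth_real_on M W (\<lambda>x. \<Sum>j\<in>J. f j x)"
  using assms(2) by (induction J rule: infinite_finite_induct)
    (auto intro: smooth_real_on_const[OF W] smooth_real_on_add[OF W])

end

section \<open>The orbit space as a local C-infinity-ringed space\<close>

definition fiber_preimage :: "('g, 'b) monoid_scheme \<Rightarrow> 'm manifold \<Rightarrow> ('g \<Rightarrow> 'm \<Rightarrow> 'm) \<Rightarrow> 'm set set \<Rightarrow> 'm set" where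
  "fiber_preimage G M act U = {x \<in> topspace (mtop M). orbit G act x \<in> U}"

context smooth_manifold
begin

context
  fixes G :: "('g, 'b) monoid_scheme" and act :: "'g \<Rightarrow> 'm \<Rightarrow> 'm"
begin

abbreviation Q where "Q \<equiv> orbit_space G M act"
abbreviation OpQ where "OpQ \<equiv> openin (rs_top (orbit_space G M act))"
abbreviation pre where "pre \<equiv> fiber_preimage G M act"
abbreviation sect where "sect \<equiv> orbit_space_sections G M act"

lemma OpQ_iff: "OpQ U \<longleftrightarrow> U \<subseteq> orbit G act ` pM \<and> OpM (pre U)"
  by (simp add: orbit_space_def openin_quotient_topology fiber_preimage_def)

lemma OpQ_pre: "OpQ U \<Longrightarrow> OpM (pre U)"
  by (simp add: OpQ_iff)

lemma orbit_space_simps: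
  "sections Q = sect"
  "s \<in> carrier (sect U) \<Longrightarrow> restr Q U V s = restrict s V"
  by (simp_all add: orbit_space_def)

lemma topspace_Q: "topspace (rs_top Q) = orbit G act ` pM"
  by (simp add: orbit_space_def topspace_quotient_topology)

lemma carrier_sect:
  "s \<in> carrier (sect U) \<longleftrightarrow> s \<in> extensional U \<and> smooth_real_on M (pre U) (\<lambda>x. s (orbit G act x))"
  by (simp add: orbit_space_sections_def function_cinf_ring_def fiber_preimage_def o_def)

lemma sect_functions:
  assumes U: "OpQ U"
  shows "cinf_functions U (carrier (sect U))" "function_cinf_ring U (carrier (sect U)) = sect U"
proof -
  show "cinf_functions U (carrier (sect U))"
  proof (rule cinf_functions.intro)
  show "carrier (sect U) \<subseteq> extensional U" by (auto simp: carrier_sect)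
  fix as f assume as: "as \<in> lists (carrier (sect U))" and f: "f \<in> Cinf_Rn (length as)"
  have "smooth_real_on M (pre U) (\<lambda>x. f (point (map (\<lambda>a. a x) (map (\<lambda>s x. s (orbit G act x)) as))))"
    by (rule smooth_real_on_op[OF OpQ_pre[OF U]]) (use as f in \<open>auto simp: carrier_sect\<close>)
  then have "smooth_real_on M (pre U) (\<lambda>x. (\<lambda>y\<in>U. f (point (map (\<lambda>a. a y) as))) (orbit G act x))"
    by (rule smooth_real_on_cong[OF OpQ_pre[OF U], rotated]) (simp add: o_def fiber_preimage_def)
  then show "(\<lambda>y\<in>U. f (point (map (\<lambda>a. a y) as))) \<in> carrier (sect U)" by (simp add: carrier_sect)
  qed
  show "function_cinf_ring U (carrier (sect U)) = sect U"
    by (simp add: orbit_space_sections_def function_cinf_ring_def)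
qed

lemma cop_sect: "cop (sect U) f as = (\<lambda>x\<in>U. f (point (map (\<lambda>a. a x) as)))"
  by (simp add: orbit_space_sections_def function_cinf_ring_def)

lemma cval_sect:
  assumes "x \<in> U" shows "cval (sect U) as g x = g (point (map (\<lambda>a. a x) as))"
proof -
  have "point (map (\<lambda>a. a x) as) \<in> Rn (length as)"
    using point_in_Rn[of "map (\<lambda>a. a x) as"] by simp
  then show ?thesis using assms by (simp add: cval_def cop_sect)
qed

lemma sect_ring:
  assumes U: "OpQ U" shows "cinf_ring (sect U)"
proof -
  interpret F: cinf_functions U "carrier (sect U)" by (rule sect_functions(1)[OF U])
  show ?thesis using F.ring.cinf_ring_axioms sect_functions(2)[OF U] by simp
qed

lemma restrict_sect:
  assumes "OpQ U" "OpQ V" "V \<subseteq> U" "s \<in> carrier (sect U)"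
  shows "restrict s V \<in> carrier (sect V)"
proof -
  have "smooth_real_on M (pre V) (\<lambda>x. s (orbit G act x))"
    by (rule smooth_real_on_subset[OF OpQ_pre[OF assms(1)]])
       (use assms(3,4) in \<open>auto simp: carrier_sect fiber_preimage_def\<close>)
  then have "smooth_real_on M (pre V) (\<lambda>x. restrict s V (orbit G act x))"
    by (rule smooth_real_on_cong[OF OpQ_pre[OF assms(2)], rotated]) (simp add: fiber_preimage_def)
  then show ?thesis by (simp add: carrier_sect)
qed

lemma orbit_space_ringed_space: "cinf_ringed_space Q"
proof (rule function_sheafI, unfold orbit_space_simps(1))
  show "s \<in> extensional U" if "s \<in> carrier (sect U)" for s U
    using that by (simp add: carrier_sect)
  show "restr Q U V = (\<lambda>s\<in>carrier (sect U). restrict s V)" for U V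
    by (simp add: orbit_space_def)
  show "restrict (cop (sect U) f ss) V = cop (sect V) f (map (\<lambda>s. restrict s V) ss)"
    if "V \<subseteq> U" for U V ss f
    unfolding cop_sect using that by (auto simp: o_def fun_eq_iff restrict_def)
  fix \<U> t assume U: "\<And>U. U \<in> \<U> \<Longrightarrow> OpQ U" and t: "t \<in> extensional (\<Union>\<U>)"
    and tU: "\<And>U. U \<in> \<U> \<Longrightarrow> restrict t U \<in> carrier (sect U)"
  have UU: "OpQ (\<Union>\<U>)" using U by (intro openin_Union) blast
  have "smooth_real_on M (pre (\<Union>\<U>)) (\<lambda>x. t (orbit G act x))"
  proof (rule smooth_real_on_local[OF OpQ_pre[OF UU]])
    fix x assume x: "x \<in> pre (\<Union>\<U>)"
    then obtain U where V: "U \<in> \<U>" "orbit G act x \<in> U" "x \<in> pM" by (auto simp: fiber_preimage_def)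
    have "smooth_real_on M (pre U) (\<lambda>x. t (orbit G act x))"
      by (rule smooth_real_on_cong[OF OpQ_pre[OF U[OF V(1)]], where f="\<lambda>x. restrict t U (orbit G act x)"])
         (use tU[OF V(1)] in \<open>simp_all add: carrier_sect fiber_preimage_def\<close>)
    moreover have "pre (\<Union>\<U>) \<inter> pre U = pre U" using V(1) by (auto simp: fiber_preimage_def)
    ultimately show "\<exists>W'. OpM W' \<and> x \<in> W' \<and> smooth_real_on M (pre (\<Union>\<U>) \<inter> W') (\<lambda>x. t (orbit G act x))"
      using OpQ_pre[OF U[OF V(1)]] V by (intro exI[of _ "pre U"]) (simp add: fiber_preimage_def)
  qed
  then show "t \<in> carrier (sect (\<Union>\<U>))" using t by (simp add: carrier_sect)
qed (use sect_ring restrict_sect in simp_all)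

lemma openin_Q_section_preimage:
  assumes U: "OpQ U" and s: "s \<in> carrier (sect U)" and S: "open S"
  shows "OpQ {y \<in> U. s y \<in> S}"
proof -
  have "OpM {x \<in> pre U. s (orbit G act x) \<in> S}"
    by (rule smooth_real_preimage[OF OpQ_pre[OF U] _ S]) (use s in \<open>simp add: carrier_sect\<close>)
  moreover have "{x \<in> pre U. s (orbit G act x) \<in> S} = pre {y \<in> U. s y \<in> S}"
    by (auto simp: fiber_preimage_def)
  ultimately show ?thesis using U by (auto simp: OpQ_iff)
qed

text \<open>
  Sections are functions on \<open>M/G\<close>, so a section \<open>s\<close> has the value \<open>s y\<close> at \<open>y\<close>, and it is continuous: if \<open>g\<close>
  and \<open>h\<close> agree near \<open>s y\<close>, then \<open>g \<circ> s\<close> and \<open>h \<circ> s\<close> agree near \<open>y\<close>.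
\<close>

lemma orbit_space_local_ringed_space: "local_cinf_ringed_space Q"
proof -
  interpret X: cinf_ringed_space Q by (rule orbit_space_ringed_space)
  have "local_cinf_ring (stalk Q y)" if y: "y \<in> topspace (rs_top Q)" for y
  proof (rule X.local_stalkI[where val="\<lambda>U. \<lambda>s\<in>carrier (sect U). s y", OF y])
    fix U assume U: "OpQ U" "y \<in> U"
    show "(\<lambda>s\<in>carrier (sect U). s y) \<in> cinf_hom (sections Q U) cinf_real"
      unfolding cinf_hom_def orbit_space_simps(1)
    proof (intro CollectI conjI ballI)
      fix ss f assume ss: "ss \<in> lists (carrier (sect U))" and f: "f \<in> Cinf_Rn (length ss)"
      have c: "cop (sect U) f ss \<in> carrier (sect U)" using cinf_ring.cop_closed[OF sect_ring[OF U(1)] ss f] .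
      have m: "map (\<lambda>s\<in>carrier (sect U). s y) ss = map (\<lambda>s. s y) ss" using ss by auto
      have "(\<lambda>s\<in>carrier (sect U). s y) (cop (sect U) f ss) = cop (sect U) f ss y" using c by simp
      also have "\<dots> = f (point (map (\<lambda>s. s y) ss))" using U(2) by (simp add: cop_sect)
      finally show "(\<lambda>s\<in>carrier (sect U). s y) (cop (sect U) f ss) = cop cinf_real f (map (\<lambda>s\<in>carrier (sect U). s y) ss)"
        unfolding m by (simp add: cinf_real_def)
    qed simp
  next
    fix U V s assume "OpQ U" "OpQ V" "y \<in> V" "V \<subseteq> U" "s \<in> carrier (sections Q U)"
    then show "(\<lambda>s\<in>carrier (sect V). s y) (restr Q U V s) = (\<lambda>s\<in>carrier (sect U). s y) s"
      using restrict_sect[of U V s] by (simp add: orbit_space_simps)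
  next
    fix U s and g h :: "real \<Rightarrow> real" and e :: real
    assume U: "OpQ U" "y \<in> U" and s': "s \<in> carrier (sections Q U)"
      and gh: "smooth_real g" "smooth_real h" and e: "e > 0"
      and agree: "\<And>t. \<bar>t - (\<lambda>s\<in>carrier (sect U). s y) s\<bar> < e \<Longrightarrow> g t = h t"
    have s: "s \<in> carrier (sect U)" using s' by (simp add: orbit_space_simps)
    let ?W = "{z \<in> U. s z \<in> ball (s y) e}"
    have W: "OpQ ?W" by (rule openin_Q_section_preimage[OF U(1) s]) simp
    have cc: "cval (sect U) [s] (\<lambda>y. k (y 0)) \<in> carrier (sect U)" if "smooth_real k" for k
      using cinf_ring.cval_closed[OF sect_ring[OF U(1)], of "[s]"] s that by simp
    have "restrict (cval (sect U) [s] (\<lambda>y. g (y 0))) ?W = restrict (cval (sect U) [s] (\<lambda>y. h (y 0))) ?W"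
    proof (rule restrict_ext)
      fix z assume z: "z \<in> ?W"
      then have "g (s z) = h (s z)" using agree[of "s z"] s by (simp add: dist_real_def abs_minus_commute)
      then show "cval (sect U) [s] (\<lambda>y. g (y 0)) z = cval (sect U) [s] (\<lambda>y. h (y 0)) z"
        using z by (simp add: cval_sect point_def)
    qed
    then show "\<exists>W. OpQ W \<and> y \<in> W \<and> W \<subseteq> U \<and>
        restr Q U W (cval (sections Q U) [s] (\<lambda>y. g (y 0))) = restr Q U W (cval (sections Q U) [s] (\<lambda>y. h (y 0)))"
      using W U(2) e cc[OF gh(1)] cc[OF gh(2)] by (intro exI[of _ ?W]) (simp add: orbit_space_simps)
  qed
  then show ?thesis using orbit_space_ringed_space
    by (simp add: local_cinf_ringed_space_def local_cinf_ringed_space_axioms_def)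
qed

end

end

section \<open>Points of the ring of invariant functions\<close>

context smooth_action
begin

definition inv_funs :: "('m \<Rightarrow> real) set" where
  "inv_funs = {a \<in> extensional (topspace (mtop M)). smooth_real_on M (topspace (mtop M)) a \<and>
     (\<forall>g\<in>carrier G. \<forall>x\<in>topspace (mtop M). a (act g x) = a x)}"

lemma act_closed: "g \<in> carrier G \<Longrightarrow> x \<in> M.pM \<Longrightarrow> act g x \<in> M.pM"
  using element_image by blast

lemma open_pM: "M.OpM M.pM"
  by (rule openin_topspace)

lemma inv_funsI:
  assumes "smooth_real_on M M.pM a" "\<And>g x. g \<in> carrier G \<Longrightarrow> x \<in> M.pM \<Longrightarrow> a (act g x) = a x"
  shows "restrict a M.pM \<in> inv_funs"
proof -
  have "smooth_real_on M M.pM (restrict a M.pM)"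
    by (rule M.smooth_real_on_cong[OF open_pM _ assms(1)]) simp
  then show ?thesis using assms(2) act_closed by (simp add: inv_funs_def)
qed

lemma inv_funsD:
  assumes "a \<in> inv_funs"
  shows "smooth_real_on M M.pM a" "\<And>g x. g \<in> carrier G \<Longrightarrow> x \<in> M.pM \<Longrightarrow> a (act g x) = a x" "a \<in> extensional M.pM"
  using assms by (auto simp: inv_funs_def)

sublocale inv: cinf_functions "topspace (mtop M)" inv_funs
proof (rule cinf_functions.intro)
  show "inv_funs \<subseteq> extensional M.pM" by (auto simp: inv_funs_def)
  fix as f assume as: "as \<in> lists inv_funs" and f: "f \<in> Cinf_Rn (length as)"
  show "(\<lambda>x\<in>M.pM. f (point (map (\<lambda>a. a x) as))) \<in> inv_funs"
  proof (rule inv_funsI)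
    show "smooth_real_on M M.pM (\<lambda>x. f (point (map (\<lambda>a. a x) as)))"
      by (rule M.smooth_real_on_op[OF open_pM _ f]) (use as inv_funsD in auto)
    fix g x assume "g \<in> carrier G" "x \<in> M.pM"
    then have "map (\<lambda>a. a (act g x)) as = map (\<lambda>a. a x) as" using as inv_funsD(2) by auto
    then show "f (point (map (\<lambda>a. a (act g x)) as)) = f (point (map (\<lambda>a. a x) as))" by (simp only:)
  qed
qed

lemma invariant_functions_eq: "invariant_functions G M act = inv.A"
  by (simp add: invariant_functions_def inv_funs_def)

lemma cval_inv_closed:
  "as \<in> lists inv_funs \<Longrightarrow> smooth_on (length as) (Rn (length as)) g \<Longrightarrow> cval inv.A as g \<in> inv_funs"
  using inv.ring.cval_closed[of as g] by simp

text \<open>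
  An invariant function without zeros is invertible, so it is not in the kernel of a point.
\<close>

lemma nonvanishing_not_in_kernel:
  assumes p: "p \<in> cinf_hom inv.A cinf_real" and b: "b \<in> inv_funs" and nz: "\<And>x. x \<in> M.pM \<Longrightarrow> b x \<noteq> 0"
  shows "p b \<noteq> 0"
proof -
  define d where "d = (\<lambda>x\<in>M.pM. 1 / b x)"
  have "smooth_real_on M M.pM (\<lambda>x. 1 / b x)"
    by (rule M.smooth_real_on_divide[OF open_pM M.smooth_real_on_const[OF open_pM] inv_funsD(1)[OF b] nz])
  then have d: "d \<in> inv_funs" unfolding d_def by (rule inv_funsI) (simp add: inv_funsD(2)[OF b])
  have "(\<lambda>x\<in>M.pM. b x * d x) = (\<lambda>x\<in>M.pM. 1)" by (rule restrict_ext) (simp add: d_def nz)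
  then have "p b * p d = 1"
    using inv.hom_mult[OF p b d] inv.one_functions(2)[OF p] by simp
  then show ?thesis by auto
qed

text \<open>
  The function \<open>\<psi>\<^sub>n = flat_exp (1 / (n + 1) - s\<^sub>n) / flat_exp (1 / (n + 1))\<close> with \<open>s\<^sub>n = \<Sum>i<n. a\<^sub>i\<^sup>2\<close> is \<open>1\<close> on
  the common zeros of \<open>a\<^sub>0, \<dots>, a\<^sub>n\<^sub>-\<^sub>1\<close>, so that at a common zero of \<open>a\<^sub>0, \<dots>, a\<^sub>N\<^sub>-\<^sub>1\<close> at least \<open>N + 1\<close> of these
  functions are \<open>1\<close>.  Their sum \<open>h\<close> is locally finite: where \<open>a\<^sub>i\<^sup>2 > \<delta>\<close>, all terms with \<open>n > i\<close> and
  \<open>1 / (n + 1) < \<delta>\<close> vanish.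
\<close>

lemma exhaustion_by_zero_sets:
  assumes a: "\<And>i. a i \<in> inv_funs" and cover: "\<And>x. x \<in> M.pM \<Longrightarrow> \<exists>i. a i x \<noteq> 0"
  shows "\<exists>h\<in>inv_funs. \<forall>x\<in>M.pM. \<forall>N. (\<forall>i<N. a i x = 0) \<longrightarrow> h x > real N"
proof -
  define s where "s = (\<lambda>n x. \<Sum>i<n. a i x ^ 2)"
  define \<psi> where "\<psi> = (\<lambda>n x. flat_exp (1 / real (Suc n) - s n x) / flat_exp (1 / real (Suc n)))"
  define h where "h = (\<lambda>x. \<Sum>n. \<psi> n x)"
  have smooth_s: "smooth_real_on M M.pM (s n)" for n
    unfolding s_def power2_eq_square
    by (intro M.smooth_real_on_sum[OF open_pM] M.smooth_real_on_mult[OF open_pM] inv_funsD(1) a)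
  have smooth_\<psi>: "smooth_real_on M M.pM (\<psi> n)" for n
  proof -
    let ?H = "\<lambda>t. flat_exp (1 / real (Suc n) - t) / flat_exp (1 / real (Suc n))"
    have nz: "flat_exp (1 / real (Suc n)) \<noteq> 0" using flat_exp_pos[of "1 / real (Suc n)"] by simp
    have "smooth_real ?H"
      using nz by (intro smooth_on_divide smooth_on_flat_exp[where g="\<lambda>_. 0"] smooth_on_diff smooth_on_const smooth_on_proj openin_Rn)
    from M.smooth_real_on_compose[OF open_pM openin_Rn this, of "\<lambda>x i. if i = 0 then s n x else 0"]
    show ?thesis using smooth_s by (simp add: \<psi>_def Rn_iff)
  qed
  have \<psi>_nonneg: "\<psi> n x \<ge> 0" for n x by (simp add: \<psi>_def flat_exp_nonneg)
  have loc: "\<exists>K W. M.OpM W \<and> x \<in> W \<and> W \<subseteq> M.pM \<and> (\<forall>y\<in>W. \<forall>n\<ge>K. \<psi> n y = 0)" if x: "x \<in> M.pM" for x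
  proof -
    obtain i where i: "a i x \<noteq> 0" using cover x by blast
    define \<delta> where "\<delta> = a i x ^ 2 / 2"
    have \<delta>: "\<delta> > 0" using i by (simp add: \<delta>_def)
    obtain k where k: "1 / real (Suc k) < \<delta>" using \<delta> nat_approx_posE by blast
    let ?W = "{y \<in> M.pM. a i y * a i y \<in> {\<delta><..}}"
    have "M.OpM ?W"
      by (rule M.smooth_real_preimage[OF open_pM M.smooth_real_on_mult[OF open_pM]])
         (simp_all add: inv_funsD(1)[OF a])
    moreover have "x \<in> ?W" using x \<delta> by (simp add: \<delta>_def power2_eq_square)
    moreover have "\<psi> n y = 0" if y: "y \<in> ?W" and n: "n \<ge> max k (Suc i)" for y n
    proof -
      have "a i y ^ 2 \<le> s n y" unfolding s_def using n by (intro member_le_sum) auto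
      moreover have "a i y ^ 2 > \<delta>" using y by (simp add: power2_eq_square)
      moreover have "1 / real (Suc n) \<le> 1 / real (Suc k)" using n by (intro divide_left_mono) auto
      ultimately have "1 / real (Suc n) - s n y \<le> 0" using k by linarith
      then show ?thesis by (simp add: \<psi>_def flat_exp_zero)
    qed
    ultimately show ?thesis by (intro exI[of _ "max k (Suc i)"] exI[of _ ?W]) blast
  qed
  have h_sum: "h x = (\<Sum>n<K. \<psi> n x)" if "\<forall>n\<ge>K. \<psi> n x = 0" for x K
    unfolding h_def using that by (intro suminf_finite) auto
  have "smooth_real_on M M.pM h"
  proof (rule M.smooth_real_on_local[OF open_pM])
    fix x assume x: "x \<in> M.pM"
    obtain K W where W: "M.OpM W" "x \<in> W" "W \<subseteq> M.pM" "\<forall>y\<in>W. \<forall>n\<ge>K. \<psi> n y = 0"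
      using loc[OF x] by (elim exE conjE)
    have "smooth_real_on M W (\<lambda>y. \<Sum>n<K. \<psi> n y)"
      by (rule M.smooth_real_on_subset[OF open_pM W(3)]) (intro M.smooth_real_on_sum[OF open_pM] smooth_\<psi>)
    then have "smooth_real_on M W h"
      by (rule M.smooth_real_on_cong[OF W(1), rotated]) (use h_sum W(4) in auto)
    moreover have "M.pM \<inter> W = W" using W(3) by blast
    ultimately show "\<exists>W. M.OpM W \<and> x \<in> W \<and> smooth_real_on M (M.pM \<inter> W) h"
      using W by (intro exI[of _ W]) simp
  qed
  moreover have "h (act g x) = h x" if "g \<in> carrier G" "x \<in> M.pM" for g x
    unfolding h_def \<psi>_def s_def using inv_funsD(2)[OF a that] by simp
  ultimately have "restrict h M.pM \<in> inv_funs" by (rule inv_funsI)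
  moreover have "h x > real N" if x: "x \<in> M.pM" and z: "\<forall>i<N. a i x = 0" for x N
  proof -
    obtain K W where "x \<in> W" "\<forall>y\<in>W. \<forall>n\<ge>K. \<psi> n y = 0" using loc[OF x] by (elim exE conjE)
    then have K: "\<forall>n\<ge>K. \<psi> n x = 0" by blast
    have "\<psi> n x = 1" if "n \<le> N" for n
    proof -
      have "s n x = 0" unfolding s_def using z that by (intro sum.neutral) auto
      then show ?thesis using flat_exp_pos[of "1 / real (Suc n)"] by (simp add: \<psi>_def)
    qed
    then have "real (Suc N) = (\<Sum>n<Suc N. \<psi> n x)" by simp
    also have "\<dots> \<le> (\<Sum>n<max K (Suc N). \<psi> n x)" by (intro sum_mono2) (auto simp: \<psi>_nonneg)
    also have "\<dots> = h x" using h_sum[of "max K (Suc N)" x] K by simp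
    finally show ?thesis by simp
  qed
  ultimately show ?thesis by (intro bexI[of _ "restrict h M.pM"]) auto
qed

text \<open>
  If \<open>p\<close> is not an evaluation, then \<open>M\<close> is covered by countably many sets on which some \<open>a\<^sub>i\<close> in the
  kernel of \<open>p\<close> does not vanish.  With the function \<open>h\<close> of the previous lemma and \<open>N \<ge> p h\<close>, the
  function \<open>(h - p h)\<^sup>2 + \<Sum>i<N. a\<^sub>i\<^sup>2\<close> is in the kernel of \<open>p\<close> and has no zeros.
\<close>

lemma hom_is_evaluation:
  assumes p: "p \<in> cinf_hom inv.A cinf_real"
  shows "\<exists>x\<in>M.pM. \<forall>a\<in>inv_funs. p a = a x"
proof (rule ccontr)
  assume "\<not> (\<exists>x\<in>M.pM. \<forall>a\<in>inv_funs. p a = a x)"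
  then have ex: "\<exists>a\<in>inv_funs. p a = 0 \<and> a x \<noteq> 0" if x: "x \<in> M.pM" for x
  proof -
    obtain a where a: "a \<in> inv_funs" "p a \<noteq> a x" using \<open>\<not> _\<close> x by blast
    let ?b = "cval inv.A [a] (\<lambda>y. y 0 - p a)"
    have sm: "smooth_on (length [a]) (Rn (length [a])) (\<lambda>y. y 0 - p a)"
      using smooth_real_affine[of "p a"] by simp
    have "?b \<in> inv_funs" using cval_inv_closed[OF _ sm] a by simp
    moreover have "p ?b = 0" using cinf_hom_cval[OF p _ sm] a by (simp add: point_def)
    moreover have "?b x \<noteq> 0" using inv.cval_functions[OF x] a by (simp add: point_def)
    ultimately show ?thesis by blast
  qed
  have "Lindelof_space (mtop M)" by (rule second_countable_imp_Lindelof_space[OF M.second_countable])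
  define ker where "ker = {a \<in> inv_funs. p a = 0}"
  define nz where "nz = (\<lambda>a. {x \<in> M.pM. a x \<in> - {0::real}})"
  have op: "M.OpM (nz a)" if "a \<in> ker" for a
    unfolding nz_def
    by (rule M.smooth_real_preimage[OF open_pM]) (use that inv_funsD(1) in \<open>auto simp: ker_def\<close>)
  have all: "\<Union>(nz ` ker) = M.pM"
  proof (intro equalityI subsetI)
    fix x assume x: "x \<in> M.pM"
    then obtain a where "a \<in> ker" "a x \<noteq> 0" using ex[OF x] by (auto simp: ker_def)
    then show "x \<in> \<Union>(nz ` ker)" using x by (intro UN_I[of a]) (simp_all add: nz_def)
  qed (auto simp: nz_def)
  have "\<exists>\<V>. countable \<V> \<and> \<V> \<subseteq> nz ` ker \<and> \<Union>\<V> = M.pM"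
    by (rule Lindelof_spaceD[OF \<open>Lindelof_space (mtop M)\<close> _ all]) (use op in auto)
  then obtain \<V> where \<V>: "countable \<V>" "\<V> \<subseteq> nz ` ker" "\<Union>\<V> = M.pM"
    by (elim exE conjE)
  obtain C where C: "countable C" "C \<subseteq> ker" "\<V> = nz ` C"
    using countable_subset_image[THEN iffD1, OF conjI[OF \<V>(1,2)]] by (elim exE conjE)
  \<comment> \<open>\<open>0\<close> is added so that the kernel elements can be enumerated even if none was chosen, as \<open>M\<close> may be empty\<close>
  define z where "z = (\<lambda>x\<in>M.pM. 0::real)"
  have z: "z \<in> ker"
  proof -
    have "cval inv.A [] (\<lambda>_. 0) = z"
      by (rule extensionalityI[of _ "M.pM"])
         (use inv.ring.cval_closed[of "[]" "\<lambda>_. 0"] inv.functions_extensional in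
          \<open>auto simp: inv.cval_functions smooth_on_const openin_Rn z_def\<close>)
    then show ?thesis
      using cinf_hom_zero[OF p] inv.ring.cval_closed[of "[]" "\<lambda>_. 0"]
      by (simp add: ker_def underlying_ring_simps smooth_on_const openin_Rn)
  qed
  define a where "a = from_nat_into (insert z C)"
  have range_a: "range a = insert z C"
    unfolding a_def using C(1) by (intro range_from_nat_into) auto
  have a_ker: "a i \<in> ker" for i
  proof -
    have "a i \<in> insert z C" using range_a by blast
    then show ?thesis using C(2) z by blast
  qed
  then have a: "a i \<in> inv_funs" "p (a i) = 0" for i by (auto simp: ker_def)
  have cover: "\<exists>i. a i x \<noteq> 0" if x: "x \<in> M.pM" for x
  proof -
    have "x \<in> \<Union>(nz ` C)" using \<V>(3) C(3) x by simp
    then obtain c where "c \<in> C" "c x \<noteq> 0" by (auto simp: nz_def)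
    moreover then obtain i where "c = a i" using range_a by (metis imageE insertCI)
    ultimately show ?thesis by blast
  qed
  obtain h where h: "h \<in> inv_funs" "\<forall>x\<in>M.pM. \<forall>N. (\<forall>i<N. a i x = 0) \<longrightarrow> h x > real N"
    using exhaustion_by_zero_sets[OF a(1) cover] by blast
  obtain N where N: "p h \<le> real N" using real_arch_simple by blast
  let ?as = "h # map a [0..<N]"
  let ?B = "\<lambda>y. (y 0 - p h) * (y 0 - p h) + (\<Sum>i<N. y (Suc i) * y (Suc i))"
  have sm: "smooth_on (length ?as) (Rn (length ?as)) ?B"
    by (intro smooth_on_add smooth_on_mult smooth_on_diff smooth_on_sum smooth_on_proj smooth_on_const openin_Rn)
  have as: "?as \<in> lists inv_funs" using h a by auto
  have coord: "point (map f ?as) 0 = f h" "i < N \<Longrightarrow> point (map f ?as) (Suc i) = f (a i)" for f :: "('m \<Rightarrow> real) \<Rightarrow> real" and i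
    by (simp_all add: point_def)
  let ?b = "cval inv.A ?as ?B"
  have b: "?b \<in> inv_funs" by (rule cval_inv_closed[OF as sm])
  have "p ?b = ?B (point (map p ?as))" using cinf_hom_cval[OF p _ sm] as by simp
  also have "\<dots> = 0" unfolding coord(1) by (simp add: coord(2) a(2) del: list.map map_map)
  finally have "p ?b = 0" .
  moreover have "?b x \<noteq> 0" if x: "x \<in> M.pM" for x
  proof
    assume "?b x = 0"
    then have "?B (point (map (\<lambda>a. a x) ?as)) = 0" using inv.cval_functions[OF x] by simp
    then have "(h x - p h) * (h x - p h) + (\<Sum>i<N. a i x * a i x) = 0"
      unfolding coord(1) by (simp add: coord(2) del: list.map map_map)
    moreover have "(h x - p h) * (h x - p h) \<ge> 0" "(\<Sum>i<N. a i x * a i x) \<ge> 0" by (auto intro: sum_nonneg)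
    ultimately have 0: "(h x - p h) * (h x - p h) = 0" "(\<Sum>i<N. a i x * a i x) = 0" by linarith+
    then have "\<forall>i<N. a i x = 0" by (simp add: sum_nonneg_eq_0_iff)
    then have "h x > real N" using h(2) x by blast
    then show False using 0(1) N by simp
  qed
  ultimately show False using nonvanishing_not_in_kernel[OF p b] by blast
qed

end

section \<open>Haar functionals on locally compact groups\<close>

definition cc_functions :: "'a topology \<Rightarrow> ('a \<Rightarrow> real) set" where
  "cc_functions T = {f. continuous_map T euclideanreal f \<and>
     (\<exists>K. compactin T K \<and> (\<forall>x\<in>topspace T - K. f x = 0))}"

lemma compactin_pointwise_cover:
  assumes K: "compactin T K" and U: "\<And>k. k \<in> K \<Longrightarrow> openin T (U k)" "\<And>k. k \<in> K \<Longrightarrow> k \<in> U k"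
  obtains F where "finite F" "F \<subseteq> K" "K \<subseteq> \<Union>(U ` F)"
proof -
  have "\<exists>\<F>. finite \<F> \<and> \<F> \<subseteq> U ` K \<and> K \<subseteq> \<Union>\<F>"
    by (rule compactinD[OF K]) (use U in auto)
  then obtain \<F> where \<F>: "finite \<F>" "\<F> \<subseteq> U ` K" "K \<subseteq> \<Union>\<F>" by (elim exE conjE)
  obtain F where "F \<subseteq> K" "finite F" "\<F> = U ` F" using finite_subset_image[OF \<F>(1,2)] by blast
  then show thesis using \<F>(3) by (intro that[of F]) auto
qed

lemma compact_locally_compact_nbhd:
  assumes lc: "locally_compact_space T" and K: "compactin T K"
  shows "\<exists>V K'. openin T V \<and> compactin T K' \<and> K \<subseteq> V \<and> V \<subseteq> K'"
proof -
  have "\<forall>x\<in>K. \<exists>U C. openin T U \<and> compactin T C \<and> x \<in> U \<and> U \<subseteq> C"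
    using lc K compactin_subset_topspace unfolding locally_compact_space_def by blast
  then obtain U C where UC: "\<And>x. x \<in> K \<Longrightarrow> openin T (U x) \<and> compactin T (C x) \<and> x \<in> U x \<and> U x \<subseteq> C x"
    by metis
  obtain F where F: "finite F" "F \<subseteq> K" "K \<subseteq> \<Union>(U ` F)"
    by (rule compactin_pointwise_cover[OF K, of U]) (use UC in blast)+
  have "openin T (\<Union>(U ` F))" using F UC by (intro openin_Union) auto
  moreover have "compactin T (\<Union>(C ` F))" using F UC by (intro compactin_Union) auto
  moreover have "\<Union>(U ` F) \<subseteq> \<Union>(C ` F)" using F UC by blast
  ultimately show ?thesis using F(3) by blast
qed

lemma cc_bump:
  assumes lc: "locally_compact_space T" and H: "Hausdorff_space T"
    and K: "compactin T K" and U: "openin T U" "K \<subseteq> U"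
  obtains h where "h \<in> cc_functions T" "\<And>x. x \<in> topspace T \<Longrightarrow> 0 \<le> h x" "\<And>x. x \<in> K \<Longrightarrow> h x = (1::real)"
    "\<And>x. x \<in> topspace T - U \<Longrightarrow> h x = 0"
proof -
  obtain V K' where V: "openin T V" "compactin T K'" "K \<subseteq> V" "V \<subseteq> K'"
    using compact_locally_compact_nbhd[OF lc K] by blast
  have cr: "completely_regular_space T"
    using locally_compact_regular_imp_completely_regular_space lc H by blast
  have cl: "closedin T (topspace T - U \<inter> V)" using U V by (intro closedin_diff) auto
  have dj: "disjnt K (topspace T - U \<inter> V)" using U V by (auto simp: disjnt_def)
  obtain f where f: "continuous_map T (top_of_set {0..1::real}) f" "f ` (topspace T - U \<inter> V) \<subseteq> {0}" "f ` K \<subseteq> {1}"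
    using Urysohn_completely_regular_compact_closed[OF zero_le_one cr K cl dj] by blast
  show thesis
  proof
    show "f \<in> cc_functions T"
      using f(1,2) V by (auto simp: cc_functions_def continuous_map_in_subtopology intro!: exI[of _ K'])
    show "0 \<le> f x" if "x \<in> topspace T" for x
      using f(1) that by (auto simp: continuous_map_in_subtopology)
  qed (use f in auto)
qed

lemma cc_bounded:
  assumes "f \<in> cc_functions T"
  obtains B where "B > 0" "\<And>x. x \<in> topspace T \<Longrightarrow> \<bar>f x\<bar> \<le> B"
proof -
  obtain K where K: "compactin T K" "\<forall>x\<in>topspace T - K. f x = 0" and c: "continuous_map T euclideanreal f"
    using assms by (auto simp: cc_functions_def)
  have "compact (f ` K)" using image_compactin[OF K(1) c] by simp
  then obtain B where B: "\<forall>y\<in>f ` K. \<bar>y\<bar> \<le> B" using compact_imp_bounded bounded_real by blast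
  have "\<bar>f x\<bar> \<le> \<bar>B\<bar> + 1" if "x \<in> topspace T" for x
    using B K(2) that by (cases "x \<in> K") force+
  then show thesis using that[of "\<bar>B\<bar> + 1"] by simp
qed

lemma cc_add: "f \<in> cc_functions T \<Longrightarrow> g \<in> cc_functions T \<Longrightarrow> (\<lambda>x. f x + g x) \<in> cc_functions T"
proof -
  assume "f \<in> cc_functions T" "g \<in> cc_functions T"
  then obtain K L where "compactin T K" "\<forall>x\<in>topspace T - K. f x = 0" "compactin T L" "\<forall>x\<in>topspace T - L. g x = 0"
    "continuous_map T euclideanreal f" "continuous_map T euclideanreal g" by (auto simp: cc_functions_def)
  then show ?thesis unfolding cc_functions_def
    by (intro CollectI conjI exI[of _ "K \<union> L"] continuous_map_add compactin_Un) auto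
qed

lemma cc_vanish:
  assumes "f \<in> cc_functions T" "continuous_map T euclideanreal g"
    "\<And>x. x \<in> topspace T \<Longrightarrow> f x = 0 \<Longrightarrow> g x = 0"
  shows "g \<in> cc_functions T"
  using assms by (auto simp: cc_functions_def)

lemma cc_cont: "f \<in> cc_functions T \<Longrightarrow> continuous_map T euclideanreal f"
  by (simp add: cc_functions_def)

lemma cc_scale: "f \<in> cc_functions T \<Longrightarrow> (\<lambda>x. c * f x) \<in> cc_functions T"
  by (rule cc_vanish) (auto intro: continuous_map_real_mult_left cc_cont)

locale loc_compact_group = group G for G (structure) +
  fixes T
  assumes carrier_top: "carrier G = topspace T"
    and Hausdorff_T: "Hausdorff_space T" and loc_compact_T: "locally_compact_space T"
    and mult_cont: "continuous_map (prod_topology T T) T (\<lambda>(g, h). g \<otimes> h)"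
    and inv_cont: "continuous_map T T (m_inv G)"
begin

definition Cp :: "('a \<Rightarrow> real) set" where
  "Cp = {f \<in> cc_functions T. \<forall>x\<in>carrier G. 0 \<le> f x}"

lemma CpD: "f \<in> Cp \<Longrightarrow> f \<in> cc_functions T" "f \<in> Cp \<Longrightarrow> x \<in> carrier G \<Longrightarrow> 0 \<le> f x"
  by (auto simp: Cp_def)

lemma Cp_add: "f \<in> Cp \<Longrightarrow> g \<in> Cp \<Longrightarrow> (\<lambda>x. f x + g x) \<in> Cp"
  by (auto simp: Cp_def cc_add)

lemma Cp_scale: "f \<in> Cp \<Longrightarrow> c \<ge> 0 \<Longrightarrow> (\<lambda>x. c * f x) \<in> Cp"
  by (auto simp: Cp_def cc_scale)

lemma right_mult_cont: "s \<in> carrier G \<Longrightarrow> continuous_map T T (\<lambda>g. g \<otimes> s)"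
proof -
  assume s: "s \<in> carrier G"
  have "continuous_map T (prod_topology T T) (\<lambda>g. (g, s))"
    using s carrier_top by (auto intro!: continuous_map_pairedI continuous_map_id[unfolded id_def])
  from continuous_map_compose[OF this mult_cont] show ?thesis by (simp add: o_def)
qed

lemma cc_translate:
  assumes f: "f \<in> cc_functions T" and s: "s \<in> carrier G"
  shows "(\<lambda>g. f (g \<otimes> s)) \<in> cc_functions T"
proof -
  obtain K where K: "compactin T K" "\<forall>x\<in>topspace T - K. f x = 0" using f by (auto simp: cc_functions_def)
  have KG: "K \<subseteq> carrier G" using compactin_subset_topspace[OF K(1)] carrier_top by simp
  have "compactin T ((\<lambda>g. g \<otimes> inv s) ` K)"
    by (rule image_compactin[OF K(1) right_mult_cont]) (use s in simp)
  moreover have "f (g \<otimes> s) = 0" if g: "g \<in> topspace T - (\<lambda>g. g \<otimes> inv s) ` K" for g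
  proof -
    have gG: "g \<in> carrier G" using g carrier_top by simp
    have "g \<otimes> s \<notin> K"
    proof
      assume "g \<otimes> s \<in> K"
      then have "g \<otimes> s \<otimes> inv s \<in> (\<lambda>g. g \<otimes> inv s) ` K" by blast
      then show False using g gG s by (simp add: m_assoc)
    qed
    moreover have "g \<otimes> s \<in> topspace T" using gG s carrier_top by blast
    ultimately show ?thesis using K(2) by blast
  qed
  moreover have "continuous_map T euclideanreal (\<lambda>g. f (g \<otimes> s))"
    using continuous_map_compose[OF right_mult_cont[OF s] cc_cont[OF f]] by (simp add: o_def)
  ultimately show ?thesis by (auto simp: cc_functions_def)
qed

lemma Cp_translate: "f \<in> Cp \<Longrightarrow> s \<in> carrier G \<Longrightarrow> (\<lambda>g. f (g \<otimes> s)) \<in> Cp"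
  by (auto simp: Cp_def cc_translate)

subsection \<open>Covering numbers\<close>

text \<open>
  A list of pairs \<open>(c, s)\<close> stands for the combination of the right translates \<open>\<lambda>g. \<phi> (g \<otimes> s)\<close> of \<open>\<phi>\<close> with
  coefficients \<open>c\<close>.  The covering number compares the size of \<open>f\<close> with that of \<open>\<phi>\<close>: if \<open>I\<close> is invariant and
  positive, then \<open>I f \<le> cov f \<phi> * I \<phi>\<close>, and for \<open>\<phi>\<close> concentrated near \<open>\<one>\<close> this is almost an equality.
\<close>

definition covers :: "('a \<Rightarrow> real) \<Rightarrow> ('a \<Rightarrow> real) \<Rightarrow> (real \<times> 'a) list \<Rightarrow> bool" where
  "covers f \<phi> ps \<longleftrightarrow> (\<forall>(c, s)\<in>set ps. 0 \<le> c \<and> s \<in> carrier G) \<and>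
     (\<forall>g\<in>carrier G. f g \<le> (\<Sum>(c, s)\<leftarrow>ps. c * \<phi> (g \<otimes> s)))"

definition total :: "(real \<times> 'a) list \<Rightarrow> real" where "total ps = (\<Sum>(c, s)\<leftarrow>ps. c)"

definition cov :: "('a \<Rightarrow> real) \<Rightarrow> ('a \<Rightarrow> real) \<Rightarrow> real" where
  "cov f \<phi> = Inf (total ` {ps. covers f \<phi> ps})"

definition bumps :: "('a \<Rightarrow> real) set" where
  "bumps = {\<phi> \<in> Cp. \<exists>x\<in>carrier G. \<phi> x > 0}"

lemma total_nonneg: "covers f \<phi> ps \<Longrightarrow> 0 \<le> total ps"
  unfolding total_def covers_def by (intro sum_list_nonneg) auto

lemma total_bdd: "bdd_below (total ` {ps. covers f \<phi> ps})"
  by (rule bdd_belowI[of _ 0]) (auto intro: total_nonneg)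

lemma cov_le: "covers f \<phi> ps \<Longrightarrow> cov f \<phi> \<le> total ps"
  unfolding cov_def by (rule cInf_lower[OF _ total_bdd]) auto

text \<open>
  The support of \<open>f\<close> is covered by finitely many translates of the open set where \<open>\<phi>\<close> exceeds half
  of one of its positive values.
\<close>

lemma covers_exist:
  assumes f: "f \<in> Cp" and \<phi>: "\<phi> \<in> bumps"
  shows "\<exists>ps. covers f \<phi> ps"
proof -
  obtain K where K: "compactin T K" "\<forall>x\<in>topspace T - K. f x = 0"
    using CpD(1)[OF f] by (auto simp: cc_functions_def)
  obtain B where B: "B > 0" "\<And>x. x \<in> topspace T \<Longrightarrow> \<bar>f x\<bar> \<le> B" by (rule cc_bounded[OF CpD(1)[OF f]]) (rule that)
  obtain x0 where x0: "x0 \<in> carrier G" "\<phi> x0 > 0" using \<phi> by (auto simp: bumps_def)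
  have \<phi>p: "\<phi> \<in> Cp" using \<phi> by (simp add: bumps_def)
  have KG: "K \<subseteq> carrier G" using compactin_subset_topspace[OF K(1)] carrier_top by simp
  define U where "U = (\<lambda>s. {g \<in> topspace T. \<phi> (g \<otimes> s) \<in> {\<phi> x0 / 2 <..}})"
  have oU: "openin T (U s)" if "s \<in> carrier G" for s
    unfolding U_def by (rule openin_continuous_map_preimage[OF cc_cont[OF cc_translate[OF CpD(1)[OF \<phi>p] that]]]) simp
  define t where "t = (\<lambda>k. inv k \<otimes> x0)"
  have tG: "t k \<in> carrier G" if "k \<in> K" for k using that KG x0 by (auto simp: t_def)
  have kU: "k \<in> U (t k)" if "k \<in> K" for k
  proof -
    have "k \<in> carrier G" using that KG by blast
    then have "k \<otimes> t k = x0" using x0 by (simp add: t_def m_assoc[symmetric])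
    then show ?thesis using x0 \<open>k \<in> carrier G\<close> carrier_top by (simp add: U_def)
  qed
  obtain F where F: "finite F" "F \<subseteq> K" "K \<subseteq> \<Union>((\<lambda>k. U (t k)) ` F)"
    by (rule compactin_pointwise_cover[OF K(1), of "\<lambda>k. U (t k)"]) (use oU tG kU in blast)+
  obtain ks where ks: "set ks = F" using finite_list[OF F(1)] by blast
  define ps where "ps = map (\<lambda>k. (2 * B / \<phi> x0, t k)) ks"
  have nn: "0 \<le> c * \<phi> (g \<otimes> s)" if "g \<in> carrier G" "(c, s) \<in> set ps" for g c s
    using that B x0 tG F(2) ks CpD(2)[OF \<phi>p] by (auto simp: ps_def intro!: mult_nonneg_nonneg)
  have "f g \<le> (\<Sum>(c, s)\<leftarrow>ps. c * \<phi> (g \<otimes> s))" if g: "g \<in> carrier G" for g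
  proof (cases "g \<in> K")
    case True
    then obtain k where k: "k \<in> F" "g \<in> U (t k)" using F(3) by blast
    then have "(2 * B / \<phi> x0, t k) \<in> set ps" using ks by (auto simp: ps_def)
    then have "2 * B / \<phi> x0 * \<phi> (g \<otimes> t k) \<in> set (map (\<lambda>(c, s). c * \<phi> (g \<otimes> s)) ps)" by force
    then have "2 * B / \<phi> x0 * \<phi> (g \<otimes> t k) \<le> (\<Sum>(c, s)\<leftarrow>ps. c * \<phi> (g \<otimes> s))"
      by (rule member_le_sum_list) (use nn[OF g] in auto)
    moreover have "B \<le> 2 * B / \<phi> x0 * \<phi> (g \<otimes> t k)"
      using k(2) x0 B(1) by (simp add: U_def field_simps)
    moreover have "f g \<le> B" using B(2)[of g] g carrier_top by auto
    ultimately show ?thesis by linarith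
  next
    case False
    then have "f g = 0" using K(2) g carrier_top by blast
    moreover have "0 \<le> (\<Sum>(c, s)\<leftarrow>ps. c * \<phi> (g \<otimes> s))" by (intro sum_list_nonneg) (use nn[OF g] in auto)
    ultimately show ?thesis by simp
  qed
  moreover have "\<forall>(c, s)\<in>set ps. 0 \<le> c \<and> s \<in> carrier G" using B x0 tG F(2) ks by (auto simp: ps_def)
  ultimately have "covers f \<phi> ps" by (simp add: covers_def)
  then show ?thesis ..
qed

lemma cov_greatest:
  assumes "f \<in> Cp" "\<phi> \<in> bumps" "\<And>ps. covers f \<phi> ps \<Longrightarrow> b \<le> total ps"
  shows "b \<le> cov f \<phi>"
  unfolding cov_def by (rule cInf_greatest) (use assms covers_exist in auto)

lemma cov_nonneg: "f \<in> Cp \<Longrightarrow> \<phi> \<in> bumps \<Longrightarrow> 0 \<le> cov f \<phi>"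
  by (rule cov_greatest) (auto intro: total_nonneg)

lemma cov_le_mult:
  assumes f: "f \<in> Cp" "\<phi> \<in> bumps" and a: "0 \<le> a" "\<And>ps. covers f \<phi> ps \<Longrightarrow> b \<le> a * total ps"
  shows "b \<le> a * cov f \<phi>"
proof (cases "a = 0")
  case True
  then show ?thesis using covers_exist[OF f] a(2) by fastforce
next
  case False
  then have a0: "a > 0" using a by simp
  have "b / a \<le> cov f \<phi>"
    by (rule cov_greatest[OF f]) (use a(2) a0 in \<open>simp add: pos_divide_le_eq mult.commute\<close>)
  then show ?thesis using a0 by (simp add: pos_divide_le_eq mult.commute)
qed

lemma cov_mono:
  assumes "f \<in> Cp" "f' \<in> Cp" "\<phi> \<in> bumps" "\<And>g. g \<in> carrier G \<Longrightarrow> f g \<le> f' g"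
  shows "cov f \<phi> \<le> cov f' \<phi>"
proof (rule cov_greatest[OF assms(2,3)])
  fix ps assume "covers f' \<phi> ps"
  then have "covers f \<phi> ps" using assms(4) by (force simp: covers_def)
  then show "cov f \<phi> \<le> total ps" by (rule cov_le)
qed

lemma cov_add_le:
  assumes "f \<in> Cp" "f' \<in> Cp" "\<phi> \<in> bumps"
  shows "cov (\<lambda>g. f g + f' g) \<phi> \<le> cov f \<phi> + cov f' \<phi>"
proof -
  have *: "cov (\<lambda>g. f g + f' g) \<phi> \<le> total ps + total qs" if "covers f \<phi> ps" "covers f' \<phi> qs" for ps qs
  proof -
    have "covers (\<lambda>g. f g + f' g) \<phi> (ps @ qs)" using that by (force simp: covers_def intro: add_mono)
    from cov_le[OF this] show ?thesis by (simp add: total_def)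
  qed
  have "cov (\<lambda>g. f g + f' g) \<phi> - total ps \<le> cov f' \<phi>" if "covers f \<phi> ps" for ps
    by (rule cov_greatest[OF assms(2,3)]) (use *[OF that] in force)
  then have "cov (\<lambda>g. f g + f' g) \<phi> - cov f' \<phi> \<le> cov f \<phi>"
    by (intro cov_greatest[OF assms(1,3)]) (simp add: algebra_simps)
  then show ?thesis by simp
qed

lemma cov_scale_le:
  assumes "f \<in> Cp" "\<phi> \<in> bumps" "c \<ge> 0"
  shows "cov (\<lambda>g. c * f g) \<phi> \<le> c * cov f \<phi>"
proof (rule cov_le_mult[OF assms])
  fix ps assume ps: "covers f \<phi> ps"
  let ?qs = "map (\<lambda>(d, s). (c * d, s)) ps"
  have sums: "(\<Sum>(d, s)\<leftarrow>?qs. d * \<phi> (g \<otimes> s)) = c * (\<Sum>(d, s)\<leftarrow>ps. d * \<phi> (g \<otimes> s))" for g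
    by (induction ps) (auto simp: algebra_simps)
  have "total ?qs = c * total ps" unfolding total_def by (induction ps) (auto simp: algebra_simps)
  moreover have "covers (\<lambda>g. c * f g) \<phi> ?qs"
    using ps assms(3) unfolding covers_def sums by (auto intro!: mult_left_mono)
  ultimately show "cov (\<lambda>g. c * f g) \<phi> \<le> c * total ps" using cov_le by metis
qed

lemma cov_translate_le:
  assumes "f \<in> Cp" "\<phi> \<in> bumps" "t \<in> carrier G"
  shows "cov (\<lambda>g. f (g \<otimes> t)) \<phi> \<le> cov f \<phi>"
proof (rule cov_greatest[OF assms(1,2)])
  fix ps assume ps: "covers f \<phi> ps"
  let ?qs = "map (\<lambda>(d, s). (d, t \<otimes> s)) ps"
  have S: "s \<in> carrier G" if "(d, s) \<in> set ps" for d s using ps that by (auto simp: covers_def)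
  have sums: "(\<Sum>(d, s)\<leftarrow>?qs. d * \<phi> (g \<otimes> s)) = (\<Sum>(d, s)\<leftarrow>ps. d * \<phi> (g \<otimes> t \<otimes> s))" if "g \<in> carrier G" for g
    unfolding map_map using S that assms(3)
    by (intro arg_cong[where f=sum_list] map_cong) (auto simp: m_assoc)
  have "covers (\<lambda>g. f (g \<otimes> t)) \<phi> ?qs"
    unfolding covers_def
  proof (intro conjI ballI)
    fix g assume g: "g \<in> carrier G"
    show "f (g \<otimes> t) \<le> (\<Sum>(d, s)\<leftarrow>?qs. d * \<phi> (g \<otimes> s))"
      unfolding sums[OF g] using ps g assms(3) by (simp add: covers_def)
  qed (use ps assms(3) in \<open>auto simp: covers_def\<close>)
  moreover have "total ?qs = total ps" unfolding total_def by (induction ps) auto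
  ultimately show "cov (\<lambda>g. f (g \<otimes> t)) \<phi> \<le> total ps" using cov_le by metis
qed

text \<open>
  Insert a cover of \<open>\<psi>\<close> by translates of \<open>\<phi>\<close> into a cover of \<open>f\<close> by translates of \<open>\<psi>\<close>.
\<close>

lemma cov_submult:
  assumes f: "f \<in> Cp" and \<psi>: "\<psi> \<in> bumps" and \<phi>: "\<phi> \<in> bumps"
  shows "cov f \<phi> \<le> cov f \<psi> * cov \<psi> \<phi>"
proof -
  have \<psi>p: "\<psi> \<in> Cp" using \<psi> by (simp add: bumps_def)
  have *: "cov f \<phi> \<le> total ps * total qs" if ps: "covers f \<psi> ps" and qs: "covers \<psi> \<phi> qs" for ps qs
  proof -
    let ?rs = "concat (map (\<lambda>(c, s). map (\<lambda>(d, t). (c * d, s \<otimes> t)) qs) ps)"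
    have S: "0 \<le> c \<and> s \<in> carrier G" if "(c, s) \<in> set ps" for c s using ps that by (auto simp: covers_def)
    have Q: "0 \<le> c \<and> s \<in> carrier G" if "(c, s) \<in> set qs" for c s using qs that by (auto simp: covers_def)
    have inner_total: "(\<Sum>(d, t)\<leftarrow>map (\<lambda>(d, t). (c * d, s \<otimes> t)) qs. d) = c * total qs" for c s
      unfolding total_def by (induction qs) (auto simp: algebra_simps)
    have "total ?rs = total ps * total qs"
    proof (induction ps)
      case (Cons p ps)
      then show ?case using inner_total by (cases p) (simp add: total_def algebra_simps)
    qed (simp add: total_def)
    moreover have "covers f \<phi> ?rs"
      unfolding covers_def
    proof (intro conjI ballI)
      fix g assume g: "g \<in> carrier G"
      have inner: "c * \<psi> (g \<otimes> s) \<le> (\<Sum>(d, t)\<leftarrow>map (\<lambda>(d, t). (c * d, s \<otimes> t)) qs. d * \<phi> (g \<otimes> t))"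
        if cs: "(c, s) \<in> set ps" for c s
      proof -
        have "\<psi> (g \<otimes> s) \<le> (\<Sum>(d, t)\<leftarrow>qs. d * \<phi> (g \<otimes> s \<otimes> t))" using qs g S[OF cs] by (simp add: covers_def)
        then have "c * \<psi> (g \<otimes> s) \<le> c * (\<Sum>(d, t)\<leftarrow>qs. d * \<phi> (g \<otimes> s \<otimes> t))" using S[OF cs] by (intro mult_left_mono) auto
        also have "\<dots> = (\<Sum>(d, t)\<leftarrow>qs. c * d * \<phi> (g \<otimes> s \<otimes> t))"
          by (simp add: sum_list_const_mult[symmetric] case_prod_unfold mult.assoc)
        also have "\<dots> = (\<Sum>(d, t)\<leftarrow>map (\<lambda>(d, t). (c * d, s \<otimes> t)) qs. d * \<phi> (g \<otimes> t))"
          unfolding map_map using Q S[OF cs] g by (intro arg_cong[where f=sum_list] map_cong) (auto simp: m_assoc)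
        finally show ?thesis .
      qed
      have "f g \<le> (\<Sum>(c, s)\<leftarrow>ps. c * \<psi> (g \<otimes> s))" using ps g by (simp add: covers_def)
      also have "\<dots> \<le> (\<Sum>(c, s)\<leftarrow>ps. (\<Sum>(d, t)\<leftarrow>map (\<lambda>(d, t). (c * d, s \<otimes> t)) qs. d * \<phi> (g \<otimes> t)))"
        by (intro sum_list_mono) (use inner in auto)
      also have "\<dots> = (\<Sum>(d, t)\<leftarrow>?rs. d * \<phi> (g \<otimes> t))"
        by (induction ps) auto
      finally show "f g \<le> (\<Sum>(d, t)\<leftarrow>?rs. d * \<phi> (g \<otimes> t))" .
    qed (use S Q in auto)
    ultimately show ?thesis using cov_le by metis
  qed
  have "cov f \<phi> \<le> total ps * cov \<psi> \<phi>" if "covers f \<psi> ps" for ps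
    by (rule cov_le_mult[OF \<psi>p \<phi> total_nonneg[OF that]]) (rule *[OF that])
  then show ?thesis
    using cov_le_mult[OF f \<psi> cov_nonneg[OF \<psi>p \<phi>], of "cov f \<phi>"] by (simp add: mult.commute)
qed

text \<open>
  At a point \<open>x\<close> with \<open>f x > 0\<close>, a cover must have coefficients of total at least \<open>f x / sup \<phi>\<close>.
\<close>

lemma cov_pos:
  assumes f: "f \<in> bumps" and \<phi>: "\<phi> \<in> bumps"
  shows "cov f \<phi> > 0"
proof -
  have fp: "f \<in> Cp" and \<phi>p: "\<phi> \<in> Cp" using f \<phi> by (simp_all add: bumps_def)
  obtain x where x: "x \<in> carrier G" "f x > 0" using f by (auto simp: bumps_def)
  obtain B where B: "B > 0" "\<And>x. x \<in> topspace T \<Longrightarrow> \<bar>\<phi> x\<bar> \<le> B" by (rule cc_bounded[OF CpD(1)[OF \<phi>p]]) (rule that)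
  have "f x / B \<le> cov f \<phi>"
  proof (rule cov_greatest[OF fp \<phi>])
    fix ps assume ps: "covers f \<phi> ps"
    have "f x \<le> (\<Sum>(c, s)\<leftarrow>ps. c * \<phi> (x \<otimes> s))" using ps x by (simp add: covers_def)
    also have "\<dots> \<le> (\<Sum>(c, s)\<leftarrow>ps. c * B)"
    proof (intro sum_list_mono, clarify)
      fix c s assume "(c, s) \<in> set ps"
      then have "0 \<le> c" "x \<otimes> s \<in> topspace T" using ps x carrier_top m_closed[of x s] by (auto simp: covers_def)
      then show "c * \<phi> (x \<otimes> s) \<le> c * B" using B(2)[of "x \<otimes> s"] by (intro mult_left_mono) auto
    qed
    also have "\<dots> = total ps * B" unfolding total_def by (induction ps) (auto simp: algebra_simps)
    finally show "f x / B \<le> total ps" using B by (simp add: pos_divide_le_eq)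
  qed
  then show ?thesis using x B by (smt (verit) divide_pos_pos)
qed

subsection \<open>Approximate additivity\<close>

text \<open>
  The point \<open>s\<inverse>\<close> is where \<open>g \<otimes> s = \<one>\<close>, so \<open>V\<close> measures how far \<open>g\<close> is from \<open>s\<inverse>\<close>.  On the compact support \<open>K\<close>
  the tube lemma gives \<open>V\<close>.  Taking \<open>V\<close> symmetric makes the condition symmetric in \<open>g\<close> and \<open>s\<inverse>\<close>, so that it
  is enough that one of them is in \<open>K\<close>; otherwise both values are \<open>0\<close>.
\<close>

lemma uniformly_continuous_cc:
  assumes q: "q \<in> cc_functions T" and e: "e > 0"
  shows "\<exists>V. openin T V \<and> \<one> \<in> V \<and> (\<forall>g\<in>carrier G. \<forall>s\<in>carrier G. g \<otimes> s \<in> V \<longrightarrow> \<bar>q g - q (inv s)\<bar> < e)"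
proof -
  obtain K where K: "compactin T K" "\<forall>x\<in>topspace T - K. q x = 0" using q by (auto simp: cc_functions_def)
  have KG: "K \<subseteq> carrier G" using compactin_subset_topspace[OF K(1)] carrier_top by simp
  let ?D = "\<lambda>z. q (fst z \<otimes> snd z) - q (snd z)"
  have "continuous_map (prod_topology T T) euclideanreal (\<lambda>z. q (fst z \<otimes> snd z))"
    using continuous_map_compose[OF mult_cont cc_cont[OF q]] by (simp add: o_def case_prod_unfold)
  moreover have "continuous_map (prod_topology T T) euclideanreal (\<lambda>z. q (snd z))"
    using continuous_map_compose[OF continuous_map_snd cc_cont[OF q]] by (simp add: o_def)
  ultimately have "continuous_map (prod_topology T T) euclideanreal ?D"
    by (rule continuous_map_diff)
  then have op: "openin (prod_topology T T) {z \<in> topspace (prod_topology T T). ?D z \<in> ball 0 e}"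
    by (rule openin_continuous_map_preimage) simp
  have sub: "{\<one>} \<times> K \<subseteq> {z \<in> topspace (prod_topology T T). ?D z \<in> ball 0 e}"
    using KG e carrier_top by auto
  have 1: "\<one> \<in> topspace T" using carrier_top one_closed by simp
  obtain V W where V: "openin T V" "\<one> \<in> V" "K \<subseteq> W"
     "V \<times> W \<subseteq> {z \<in> topspace (prod_topology T T). ?D z \<in> ball 0 e}"
    using tube_lemma_right[OF op K(1) 1 sub] by (elim exE conjE)
  have D: "\<bar>q (v \<otimes> x) - q x\<bar> < e" if "v \<in> V" "x \<in> K" for v x
  proof -
    have "(v, x) \<in> V \<times> W" using that V(3) by blast
    then have "?D (v, x) \<in> ball 0 e" using V(4) by blast
    then show ?thesis by simp
  qed
  define V' where "V' = V \<inter> {x \<in> topspace T. inv x \<in> V}"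
  have V': "openin T V'" unfolding V'_def
    using V(1) openin_continuous_map_preimage[OF inv_cont V(1)] by (rule openin_Int)
  have 1: "\<one> \<in> V'" using V(2) carrier_top one_closed by (auto simp: V'_def)
  have "\<bar>q g - q (inv s)\<bar> < e" if g: "g \<in> carrier G" and s: "s \<in> carrier G" and gs: "g \<otimes> s \<in> V'" for g s
  proof -
    have g_eq: "g = (g \<otimes> s) \<otimes> inv s" using g s by (simp add: m_assoc)
    have s_eq: "inv s = inv (g \<otimes> s) \<otimes> g" using g s by (simp add: inv_mult_group m_assoc)
    consider "inv s \<in> K" | "g \<in> K" | "inv s \<notin> K" "g \<notin> K" by blast
    then show ?thesis
    proof cases
      case 1
      then show ?thesis using D[of "g \<otimes> s" "inv s"] gs g_eq by (simp add: V'_def)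
    next
      case 2
      have "\<bar>q (inv (g \<otimes> s) \<otimes> g) - q g\<bar> < e" using D[OF _ 2, of "inv (g \<otimes> s)"] gs by (simp add: V'_def)
      then show ?thesis using s_eq by (simp add: abs_minus_commute)
    next
      case 3
      then have "q g = 0" "q (inv s) = 0" using K(2) g s carrier_top inv_closed[OF s] by auto
      then show ?thesis using e by simp
    qed
  qed
  then show ?thesis using V' 1 by blast
qed

text \<open>
  The reverse of subadditivity, up to \<open>\<delta>\<close>.  Write \<open>f\<^sub>i = q\<^sub>i p\<close> with \<open>p = f\<^sub>1 + f\<^sub>2 + \<delta> h\<close>, where \<open>h = 1\<close> on the
  supports, so that \<open>q\<^sub>i\<close> is continuous.  In a cover of \<open>p\<close> by translates of a function supported near \<open>1\<close>, the
  factor \<open>q\<^sub>i\<close> is almost constant on each of the translates.  Multiplying the coefficients by these constants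
  gives covers of \<open>f\<^sub>1\<close> and \<open>f\<^sub>2\<close>, whose totals add up correctly as \<open>q\<^sub>1 + q\<^sub>2 \<le> 1\<close>.
\<close>

lemma cov_almost_additive:
  assumes f: "f1 \<in> Cp" "f2 \<in> Cp" and d: "\<delta> > 0"
    and h: "h \<in> Cp" "\<And>x. x \<in> carrier G \<Longrightarrow> f1 x \<noteq> 0 \<or> f2 x \<noteq> 0 \<Longrightarrow> h x = 1"
  shows "\<exists>V. openin T V \<and> \<one> \<in> V \<and> (\<forall>\<phi>\<in>bumps. (\<forall>x\<in>carrier G - V. \<phi> x = 0) \<longrightarrow>
     cov f1 \<phi> + cov f2 \<phi> \<le> (1 + 2 * \<delta>) * (cov (\<lambda>x. f1 x + f2 x) \<phi> + \<delta> * cov h \<phi>))"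
proof -
  define p where "p = (\<lambda>x. (f1 x + f2 x) + \<delta> * h x)"
  have p: "p \<in> Cp" unfolding p_def using f h(1) d by (intro Cp_add Cp_scale) auto
  \<comment> \<open>where \<open>f1\<close> or \<open>f2\<close> is nonzero, we have \<open>p \<ge> \<delta>\<close>; elsewhere the maximum only keeps the denominator positive\<close>
  define q where "q = (\<lambda>f x. f x / max (p x) \<delta>)"
  have qc: "q f' \<in> cc_functions T" if "f' \<in> Cp" for f'
  proof (rule cc_vanish[OF CpD(1)[OF that]])
    show "continuous_map T euclideanreal (q f')" unfolding q_def
      using CpD(1)[OF p, THEN cc_cont] CpD(1)[OF that, THEN cc_cont] d
      by (intro continuous_map_real_divide continuous_map_real_max) auto
  qed (simp add: q_def)
  have qnn: "0 \<le> q f' x" if "f' \<in> Cp" "x \<in> carrier G" for f' x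
    using CpD(2)[OF that] d by (simp add: q_def)
  have pq: "f1 x = p x * q f1 x" "f2 x = p x * q f2 x" and qsum: "q f1 x + q f2 x \<le> 1" if x: "x \<in> carrier G" for x
  proof -
    have nn: "0 \<le> f1 x" "0 \<le> f2 x" "0 \<le> h x" using CpD(2) f h(1) x by auto
    have "max (p x) \<delta> = p x \<and> p x > 0" if "f1 x \<noteq> 0 \<or> f2 x \<noteq> 0"
      using h(2)[OF x that] nn d by (simp add: p_def)
    then show "f1 x = p x * q f1 x" "f2 x = p x * q f2 x"
      by (cases "f1 x \<noteq> 0 \<or> f2 x \<noteq> 0", auto simp: q_def)+
    have "0 \<le> \<delta> * h x" using nn(3) d by simp
    then have "f1 x + f2 x \<le> max (p x) \<delta>" by (simp add: p_def le_max_iff_disj)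
    then show "q f1 x + q f2 x \<le> 1"
      using d by (simp add: q_def add_divide_distrib[symmetric])
  qed
  obtain V1 where V1: "openin T V1" "\<one> \<in> V1"
    "\<And>g s. g \<in> carrier G \<Longrightarrow> s \<in> carrier G \<Longrightarrow> g \<otimes> s \<in> V1 \<Longrightarrow> \<bar>q f1 g - q f1 (inv s)\<bar> < \<delta>"
    using uniformly_continuous_cc[OF qc[OF f(1)] d] by blast
  obtain V2 where V2: "openin T V2" "\<one> \<in> V2"
    "\<And>g s. g \<in> carrier G \<Longrightarrow> s \<in> carrier G \<Longrightarrow> g \<otimes> s \<in> V2 \<Longrightarrow> \<bar>q f2 g - q f2 (inv s)\<bar> < \<delta>"
    using uniformly_continuous_cc[OF qc[OF f(2)] d] by blast
  have main: "cov f1 \<phi> + cov f2 \<phi> \<le> (1 + 2 * \<delta>) * (cov (\<lambda>x. f1 x + f2 x) \<phi> + \<delta> * cov h \<phi>)"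
    if \<phi>: "\<phi> \<in> bumps" and supp: "\<forall>x\<in>carrier G - V1 \<inter> V2. \<phi> x = 0" for \<phi>
  proof -
    have \<phi>p: "\<phi> \<in> Cp" using \<phi> by (simp add: bumps_def)
    have one: "cov f' \<phi> \<le> total (map (\<lambda>(c, s). (c * (q f' (inv s) + \<delta>), s)) ps)"
      if ps: "covers p \<phi> ps" and f': "f' \<in> Cp" and fq: "\<And>x. x \<in> carrier G \<Longrightarrow> f' x = p x * q f' x"
        and near: "\<And>g s. g \<in> carrier G \<Longrightarrow> s \<in> carrier G \<Longrightarrow> g \<otimes> s \<in> V1 \<inter> V2 \<Longrightarrow> \<bar>q f' g - q f' (inv s)\<bar> < \<delta>" for ps f'
    proof (rule cov_le)
      have S: "0 \<le> c \<and> s \<in> carrier G" if "(c, s) \<in> set ps" for c s using ps that by (auto simp: covers_def)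
      show "covers f' \<phi> (map (\<lambda>(c, s). (c * (q f' (inv s) + \<delta>), s)) ps)"
        unfolding covers_def
      proof (intro conjI ballI)
        show "case z of (c, s) \<Rightarrow> 0 \<le> c \<and> s \<in> carrier G" if z: "z \<in> set (map (\<lambda>(c, s). (c * (q f' (inv s) + \<delta>), s)) ps)" for z
        proof -
          obtain c s where cs: "(c, s) \<in> set ps" "z = (c * (q f' (inv s) + \<delta>), s)" using z by auto
          moreover have "0 \<le> q f' (inv s)" using qnn[OF f'] S[OF cs(1)] inv_closed by blast
          ultimately show ?thesis using S[OF cs(1)] d by simp
        qed
        fix g assume g: "g \<in> carrier G"
        have "f' g = p g * q f' g" by (rule fq[OF g])
        also have "\<dots> \<le> (\<Sum>(c, s)\<leftarrow>ps. c * \<phi> (g \<otimes> s)) * q f' g"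
          using ps g qnn[OF f' g] by (intro mult_right_mono) (auto simp: covers_def)
        also have "\<dots> = (\<Sum>(c, s)\<leftarrow>ps. c * \<phi> (g \<otimes> s) * q f' g)"
          by (simp add: sum_list_mult_const[symmetric] case_prod_unfold)
        also have "\<dots> \<le> (\<Sum>(c, s)\<leftarrow>ps. c * (q f' (inv s) + \<delta>) * \<phi> (g \<otimes> s))"
        proof (intro sum_list_mono, clarify)
          fix c s assume cs: "(c, s) \<in> set ps"
          have gs: "g \<otimes> s \<in> carrier G" using S[OF cs] g by blast
          show "c * \<phi> (g \<otimes> s) * q f' g \<le> c * (q f' (inv s) + \<delta>) * \<phi> (g \<otimes> s)"
          proof (cases "g \<otimes> s \<in> V1 \<inter> V2")
            case True
            have "q f' g \<le> q f' (inv s) + \<delta>" using near[OF g _ True] S[OF cs] by fastforce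
            then have "(c * \<phi> (g \<otimes> s)) * q f' g \<le> (c * \<phi> (g \<otimes> s)) * (q f' (inv s) + \<delta>)"
              using S[OF cs] CpD(2)[OF \<phi>p gs] by (intro mult_left_mono) auto
            then show ?thesis by (simp add: mult_ac)
          next
            case False
            then show ?thesis using supp gs by simp
          qed
        qed
        also have "\<dots> = (\<Sum>(c, s)\<leftarrow>map (\<lambda>(c, s). (c * (q f' (inv s) + \<delta>), s)) ps. c * \<phi> (g \<otimes> s))"
          by (simp add: o_def case_prod_unfold)
        finally show "f' g \<le> (\<Sum>(c, s)\<leftarrow>map (\<lambda>(c, s). (c * (q f' (inv s) + \<delta>), s)) ps. c * \<phi> (g \<otimes> s))" .
      qed
    qed
    have "cov f1 \<phi> + cov f2 \<phi> \<le> (1 + 2 * \<delta>) * cov p \<phi>"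
    proof (rule cov_le_mult[OF p \<phi>])
      fix ps assume ps: "covers p \<phi> ps"
      have S: "0 \<le> c \<and> s \<in> carrier G" if "(c, s) \<in> set ps" for c s using ps that by (auto simp: covers_def)
      have "cov f1 \<phi> + cov f2 \<phi> \<le> total (map (\<lambda>(c, s). (c * (q f1 (inv s) + \<delta>), s)) ps)
          + total (map (\<lambda>(c, s). (c * (q f2 (inv s) + \<delta>), s)) ps)"
        using V1(3) V2(3) by (intro add_mono one ps f pq) auto
      also have "\<dots> = (\<Sum>(c, s)\<leftarrow>ps. c * (q f1 (inv s) + \<delta>) + c * (q f2 (inv s) + \<delta>))"
        by (simp add: total_def o_def case_prod_unfold sum_list_addf)
      also have "\<dots> \<le> (\<Sum>(c, s)\<leftarrow>ps. (1 + 2 * \<delta>) * c)"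
      proof (intro sum_list_mono, clarify)
        fix c s assume cs: "(c, s) \<in> set ps"
        have "c * ((q f1 (inv s) + \<delta>) + (q f2 (inv s) + \<delta>)) \<le> c * (1 + 2 * \<delta>)"
          using qsum[of "inv s"] S[OF cs] by (intro mult_left_mono) auto
        then show "c * (q f1 (inv s) + \<delta>) + c * (q f2 (inv s) + \<delta>) \<le> (1 + 2 * \<delta>) * c"
          by (simp add: distrib_left mult.commute)
      qed
      also have "\<dots> = (1 + 2 * \<delta>) * total ps"
        by (simp add: total_def sum_list_const_mult case_prod_unfold)
      finally show "cov f1 \<phi> + cov f2 \<phi> \<le> (1 + 2 * \<delta>) * total ps" .
    qed (use d in simp)
    also have "cov p \<phi> \<le> cov (\<lambda>x. f1 x + f2 x) \<phi> + cov (\<lambda>x. \<delta> * h x) \<phi>"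
      unfolding p_def using f h(1) d by (intro cov_add_le Cp_add Cp_scale \<phi>) auto
    also have "cov (\<lambda>x. \<delta> * h x) \<phi> \<le> \<delta> * cov h \<phi>" using cov_scale_le[OF h(1) \<phi>] d by simp
    finally show ?thesis using d by simp
  qed
  show ?thesis using V1 V2 main by (intro exI[of _ "V1 \<inter> V2"]) auto
qed

subsection \<open>The limit functional\<close>

text \<open>
  The bump functions \<open>\<phi>\<close> as their supports shrink to \<open>1\<close>.
\<close>

definition bump_filter :: "('a \<Rightarrow> real) filter" where
  "bump_filter = (INF V\<in>{V. openin T V \<and> \<one> \<in> V}. principal {\<phi> \<in> bumps. \<forall>x\<in>carrier G - V. \<phi> x = 0})"

lemma eventually_bump_filter:
  "eventually P bump_filter \<longleftrightarrow>
    (\<exists>V. openin T V \<and> \<one> \<in> V \<and> (\<forall>\<phi>\<in>bumps. (\<forall>x\<in>carrier G - V. \<phi> x = 0) \<longrightarrow> P \<phi>))"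
proof -
  have "eventually P bump_filter \<longleftrightarrow>
     (\<exists>V\<in>{V. openin T V \<and> \<one> \<in> V}. eventually P (principal {\<phi> \<in> bumps. \<forall>x\<in>carrier G - V. \<phi> x = 0}))"
    unfolding bump_filter_def
  proof (rule eventually_INF_base)
    have "topspace T \<in> {V. openin T V \<and> \<one> \<in> V}" using carrier_top one_closed by auto
    then show "{V. openin T V \<and> \<one> \<in> V} \<noteq> {}" by blast
    fix V W assume VW: "V \<in> {V. openin T V \<and> \<one> \<in> V}" "W \<in> {V. openin T V \<and> \<one> \<in> V}"
    then have "V \<inter> W \<in> {V. openin T V \<and> \<one> \<in> V}" by auto
    then show "\<exists>U\<in>{V. openin T V \<and> \<one> \<in> V}. principal {\<phi> \<in> bumps. \<forall>x\<in>carrier G - U. \<phi> x = 0}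
        \<le> inf (principal {\<phi> \<in> bumps. \<forall>x\<in>carrier G - V. \<phi> x = 0}) (principal {\<phi> \<in> bumps. \<forall>x\<in>carrier G - W. \<phi> x = 0})"
      by (rule bexI[rotated]) auto
  qed
  then show ?thesis unfolding eventually_principal by blast
qed

lemma bump_exists:
  assumes "openin T V" "\<one> \<in> V"
  shows "\<exists>\<phi>\<in>bumps. \<forall>x\<in>carrier G - V. \<phi> x = 0"
proof -
  have "compactin T {\<one>}" using carrier_top one_closed by simp
  then obtain h where h: "h \<in> cc_functions T" "\<And>x. x \<in> topspace T \<Longrightarrow> 0 \<le> h x" "\<And>x. x \<in> {\<one>} \<Longrightarrow> h x = (1::real)"
    "\<And>x. x \<in> topspace T - V \<Longrightarrow> h x = 0"
    using cc_bump[OF loc_compact_T Hausdorff_T _ assms(1), of "{\<one>}"] assms(2) by (metis empty_subsetI insert_subset)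
  have "h \<in> bumps" using h(1,2,3) carrier_top one_closed by (auto simp: bumps_def Cp_def intro!: bexI[of _ "\<one>"])
  then show ?thesis using h(4) carrier_top by auto
qed

lemma bump_filter_nontrivial: "bump_filter \<noteq> bot"
  using bump_exists unfolding trivial_limit_def eventually_bump_filter by blast

lemma eventually_bumps: "eventually (\<lambda>\<phi>. \<phi> \<in> bumps) bump_filter"
  unfolding eventually_bump_filter using carrier_top one_closed by (intro exI[of _ "topspace T"]) auto

text \<open>
  The normalized covering numbers \<open>cov f \<phi> / cov f\<^sub>0 \<phi>\<close> lie between \<open>0\<close> and \<open>cov f f\<^sub>0\<close>, as covering numbers are
  submultiplicative.  So all of them together, for fixed \<open>\<phi>\<close>, are a point in a product of compact intervals.
  These points have a cluster point as the support of \<open>\<phi>\<close> shrinks to \<open>1\<close>.  It inherits the inequalities that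
  the covering numbers satisfy for each \<open>\<phi>\<close>, and it is additive by \<open>cov_almost_additive\<close>.
\<close>

lemma positive_haar_functional:
  "\<exists>\<Lambda>. (\<forall>f\<in>Cp. \<forall>g\<in>Cp. (\<forall>x\<in>carrier G. f x \<le> g x) \<longrightarrow> \<Lambda> f \<le> \<Lambda> g) \<and>
     (\<forall>f\<in>Cp. \<forall>g\<in>Cp. \<Lambda> (\<lambda>x. f x + g x) = \<Lambda> f + \<Lambda> g) \<and>
     (\<forall>f\<in>Cp. \<forall>c\<ge>0. \<Lambda> (\<lambda>x. c * f x) \<le> c * \<Lambda> f) \<and>
     (\<forall>f\<in>Cp. \<forall>s\<in>carrier G. \<Lambda> (\<lambda>x. f (x \<otimes> s)) \<le> \<Lambda> f) \<and>
     (\<forall>f\<in>Cp. 0 \<le> \<Lambda> f) \<and> (\<forall>f\<in>bumps. (0::real) < \<Lambda> f)"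
proof -
  have top1: "openin T (topspace T)" "\<one> \<in> topspace T" using carrier_top one_closed by auto
  obtain f0 where f0: "f0 \<in> bumps" using bump_exists[OF top1] by blast
  then have f0p: "f0 \<in> Cp" by (simp add: bumps_def)
  define J where "J = (\<lambda>\<phi> f. if f \<in> Cp then cov f \<phi> / cov f0 \<phi> else 0)"
  define B where "B = (\<lambda>f. if f \<in> Cp then cov f f0 else 0)"
  have J: "J \<phi> f = cov f \<phi> / cov f0 \<phi>" if "f \<in> Cp" for f \<phi> using that by (simp add: J_def)
  define \<K> where "\<K> = Pi\<^sub>E UNIV (\<lambda>f. {0..B f})"
  have JK: "J \<phi> \<in> \<K>" if \<phi>: "\<phi> \<in> bumps" for \<phi>
  proof -
    have "0 \<le> J \<phi> f \<and> J \<phi> f \<le> B f" for f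
    proof (cases "f \<in> Cp")
      case True
      then show ?thesis using cov_nonneg[OF True \<phi>] cov_pos[OF f0 \<phi>] cov_submult[OF True f0 \<phi>]
        by (simp add: J_def B_def pos_divide_le_eq)
    qed (simp add: J_def B_def)
    then show ?thesis by (auto simp: \<K>_def)
  qed
  have "compactin (product_topology (\<lambda>_. euclideanreal) UNIV) \<K>"
    unfolding \<K>_def compactin_PiE by simp
  then have cK: "compact \<K>" by (simp add: euclidean_product_topology)
  have ntb: "filtermap J bump_filter \<noteq> bot" using bump_filter_nontrivial by (simp add: filtermap_bot_iff)
  have evK: "eventually (\<lambda>y. y \<in> \<K>) (filtermap J bump_filter)"
    unfolding eventually_filtermap using eventually_bumps by eventually_elim (rule JK)
  have "\<exists>\<Lambda>\<in>\<K>. inf (nhds \<Lambda>) (filtermap J bump_filter) \<noteq> bot"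
    using compact_filter[THEN iffD1, OF cK, THEN spec, THEN mp, THEN mp, OF ntb evK] .
  then obtain \<Lambda> where \<Lambda>: "inf (nhds \<Lambda>) (filtermap J bump_filter) \<noteq> bot" by blast
  define F where "F = inf (nhds \<Lambda>) (filtermap J bump_filter)"
  have F: "F \<noteq> bot" using \<Lambda> by (simp add: F_def)
  have lim: "((\<lambda>y. y f) \<longlongrightarrow> \<Lambda> f) F" for f
  proof -
    have "continuous_on UNIV (\<lambda>y::('a \<Rightarrow> real) \<Rightarrow> real. y f)" by (rule continuous_on_product_coordinates)
    then have "((\<lambda>y. y f) \<longlongrightarrow> \<Lambda> f) (at \<Lambda>)" by (simp only: continuous_on_def UNIV_I)
    then have "((\<lambda>y. y f) \<longlongrightarrow> \<Lambda> f) (nhds \<Lambda>)"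
      using tendsto_at_iff_tendsto_nhds[of "\<lambda>y. y f" \<Lambda>] by simp
    then show ?thesis by (rule tendsto_mono[rotated]) (simp add: F_def)
  qed
  have ev: "eventually P F" if "eventually (\<lambda>\<phi>. P (J \<phi>)) bump_filter" for P
  proof -
    have "eventually P (filtermap J bump_filter)" using that by (simp add: eventually_filtermap)
    then show ?thesis by (rule filter_leD[rotated]) (simp add: F_def)
  qed
  have evb: "eventually P F" if "\<And>\<phi>. \<phi> \<in> bumps \<Longrightarrow> P (J \<phi>)" for P
    by (rule ev) (use eventually_bumps that in \<open>auto elim: eventually_mono\<close>)
  have nn: "0 \<le> \<Lambda> f" if f: "f \<in> Cp" for f
    by (rule tendsto_lowerbound[OF lim _ F], rule evb)
       (use f cov_nonneg[OF f] cov_nonneg[OF f0p] in \<open>simp add: J\<close>)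
  have mono: "\<Lambda> f \<le> \<Lambda> g" if f: "f \<in> Cp" "g \<in> Cp" "\<forall>x\<in>carrier G. f x \<le> g x" for f g
    by (rule tendsto_le[OF F lim lim], rule evb)
       (use f cov_mono[OF f(1,2)] cov_pos[OF f0] in \<open>simp add: J divide_right_mono less_imp_le\<close>)
  have sub: "\<Lambda> (\<lambda>x. f x + g x) \<le> \<Lambda> f + \<Lambda> g" if f: "f \<in> Cp" "g \<in> Cp" for f g
    by (rule tendsto_le[OF F tendsto_add[OF lim lim] lim], rule evb)
       (use f cov_add_le[OF f] cov_pos[OF f0] Cp_add[OF f] in
         \<open>simp add: J add_divide_distrib[symmetric] divide_right_mono less_imp_le\<close>)
  have scale: "\<Lambda> (\<lambda>x. c * f x) \<le> c * \<Lambda> f" if f: "f \<in> Cp" "c \<ge> 0" for f c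
    by (rule tendsto_le[OF F tendsto_mult_left[OF lim] lim], rule evb)
       (use f cov_scale_le[OF f(1) _ f(2)] cov_pos[OF f0] Cp_scale[OF f] in
         \<open>simp add: J divide_right_mono less_imp_le\<close>)
  have transl: "\<Lambda> (\<lambda>x. f (x \<otimes> s)) \<le> \<Lambda> f" if f: "f \<in> Cp" "s \<in> carrier G" for f s
    by (rule tendsto_le[OF F lim lim], rule evb)
       (use f cov_translate_le[OF f(1) _ f(2)] cov_pos[OF f0] Cp_translate[OF f] in
         \<open>simp add: J divide_right_mono less_imp_le\<close>)
  have pos: "0 < \<Lambda> f" if f: "f \<in> bumps" for f
  proof -
    have fp: "f \<in> Cp" using f by (simp add: bumps_def)
    have "1 / cov f0 f \<le> \<Lambda> f"
    proof (rule tendsto_lowerbound[OF lim _ F], rule evb)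
      fix \<phi> assume \<phi>: "\<phi> \<in> bumps"
      have "cov f0 \<phi> \<le> cov f0 f * cov f \<phi>" by (rule cov_submult[OF f0p f \<phi>])
      then show "1 / cov f0 f \<le> J \<phi> f"
        using cov_pos[OF f0 f] cov_pos[OF f0 \<phi>] by (simp add: J[OF fp] field_simps)
    qed
    then show ?thesis using cov_pos[OF f0 f] by (smt (verit) divide_pos_pos)
  qed
  have add: "\<Lambda> f + \<Lambda> g \<le> \<Lambda> (\<lambda>x. f x + g x)" if f: "f \<in> Cp" "g \<in> Cp" for f g
  proof -
    obtain K where K: "compactin T K" "\<forall>x\<in>topspace T - K. f x = 0" using CpD(1)[OF f(1)] by (auto simp: cc_functions_def)
    obtain L where L: "compactin T L" "\<forall>x\<in>topspace T - L. g x = 0" using CpD(1)[OF f(2)] by (auto simp: cc_functions_def)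
    have KL: "compactin T (K \<union> L)" "K \<union> L \<subseteq> topspace T"
      using compactin_Un[OF K(1) L(1)] compactin_subset_topspace by blast+
    obtain h where h: "h \<in> cc_functions T" "\<And>x. x \<in> topspace T \<Longrightarrow> 0 \<le> h x" "\<And>x. x \<in> K \<union> L \<Longrightarrow> h x = (1::real)"
      by (rule cc_bump[OF loc_compact_T Hausdorff_T KL(1) openin_topspace KL(2)]) (rule that)
    have hp: "h \<in> Cp" using h(1,2) carrier_top by (simp add: Cp_def)
    have h1: "h x = 1" if "x \<in> carrier G" "f x \<noteq> 0 \<or> g x \<noteq> 0" for x
      using that K(2) L(2) carrier_top by (intro h(3)) blast
    have approx: "\<Lambda> f + \<Lambda> g \<le> (1 + 2 * \<delta>) * (\<Lambda> (\<lambda>x. f x + g x) + \<delta> * \<Lambda> h)" if \<delta>: "\<delta> > 0" for \<delta>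
    proof (rule tendsto_le[OF F])
      show "((\<lambda>y. y f + y g) \<longlongrightarrow> \<Lambda> f + \<Lambda> g) F" by (intro tendsto_add lim)
      show "((\<lambda>y. (1 + 2 * \<delta>) * (y (\<lambda>x. f x + g x) + \<delta> * y h)) \<longlongrightarrow> (1 + 2 * \<delta>) * (\<Lambda> (\<lambda>x. f x + g x) + \<delta> * \<Lambda> h)) F"
        by (intro tendsto_add tendsto_mult tendsto_const lim)
      show "eventually (\<lambda>y. y f + y g \<le> (1 + 2 * \<delta>) * (y (\<lambda>x. f x + g x) + \<delta> * y h)) F"
      proof (rule ev)
        have "eventually (\<lambda>\<phi>. cov f \<phi> + cov g \<phi> \<le> (1 + 2 * \<delta>) * (cov (\<lambda>x. f x + g x) \<phi> + \<delta> * cov h \<phi>)) bump_filter"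
          unfolding eventually_bump_filter by (rule cov_almost_additive[OF f \<delta> hp h1])
        then show "eventually (\<lambda>\<phi>. J \<phi> f + J \<phi> g \<le> (1 + 2 * \<delta>) * (J \<phi> (\<lambda>x. f x + g x) + \<delta> * J \<phi> h)) bump_filter"
          using eventually_bumps
        proof eventually_elim
          case (elim \<phi>)
          have "(cov f \<phi> + cov g \<phi>) / cov f0 \<phi> \<le> (1 + 2 * \<delta>) * (cov (\<lambda>x. f x + g x) \<phi> + \<delta> * cov h \<phi>) / cov f0 \<phi>"
            using elim(1) cov_pos[OF f0 elim(2)] by (intro divide_right_mono) auto
          also have "\<dots> = (1 + 2 * \<delta>) * (cov (\<lambda>x. f x + g x) \<phi> / cov f0 \<phi> + \<delta> * (cov h \<phi> / cov f0 \<phi>))"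
            by (simp only: times_divide_eq_right[symmetric] add_divide_distrib)
          finally show ?case by (simp add: J f hp Cp_add add_divide_distrib)
        qed
      qed
    qed
    have "((\<lambda>\<delta>. (1 + 2 * \<delta>) * (\<Lambda> (\<lambda>x. f x + g x) + \<delta> * \<Lambda> h)) \<longlongrightarrow> (1 + 2 * 0) * (\<Lambda> (\<lambda>x. f x + g x) + 0 * \<Lambda> h)) (at_right 0)"
      by (intro tendsto_intros)
    then have "((\<lambda>\<delta>. (1 + 2 * \<delta>) * (\<Lambda> (\<lambda>x. f x + g x) + \<delta> * \<Lambda> h)) \<longlongrightarrow> \<Lambda> (\<lambda>x. f x + g x)) (at_right 0)" by simp
    then show ?thesis
      by (rule tendsto_lowerbound) (use approx in \<open>auto simp: eventually_at_filter\<close>)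
  qed
  show ?thesis
  proof (intro exI[of _ \<Lambda>] conjI ballI allI impI)
    fix f g assume fg: "f \<in> Cp" "g \<in> Cp"
    show "\<Lambda> f \<le> \<Lambda> g" if "\<forall>x\<in>carrier G. f x \<le> g x" by (rule mono[OF fg that])
    show "\<Lambda> (\<lambda>x. f x + g x) = \<Lambda> f + \<Lambda> g" by (rule antisym[OF sub[OF fg] add[OF fg]])
  next
    fix f assume f: "f \<in> Cp"
    show "\<Lambda> (\<lambda>x. c * f x) \<le> c * \<Lambda> f" if "0 \<le> c" for c by (rule scale[OF f that])
    show "\<Lambda> (\<lambda>x. f (x \<otimes> s)) \<le> \<Lambda> f" if "s \<in> carrier G" for s by (rule transl[OF f that])
    show "0 \<le> \<Lambda> f" by (rule nn[OF f])
  next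
    fix f assume "f \<in> bumps"
    then show "0 < \<Lambda> f" by (rule pos)
  qed
qed

text \<open>
  A functional that is additive on nonnegative functions extends to all functions with compact support, by
  \<open>I f = \<Lambda> f\<^sup>+ - \<Lambda> f\<^sup>-\<close>; any other decomposition \<open>f = a - b\<close> gives the same value, which yields additivity.  The
  inequalities for scaling and translation become equalities, as they can be applied to the inverse scaling
  and translation as well.
\<close>

theorem haar_functional:
  "\<exists>I. (\<forall>f\<in>cc_functions T. \<forall>g\<in>cc_functions T. I (\<lambda>x. f x + g x) = I f + I g) \<and>
     (\<forall>f\<in>cc_functions T. \<forall>c. I (\<lambda>x. c * f x) = c * I f) \<and>
     (\<forall>f\<in>cc_functions T. (\<forall>x\<in>carrier G. 0 \<le> f x) \<longrightarrow> 0 \<le> I f) \<and>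
     (\<forall>f\<in>cc_functions T. (\<forall>x\<in>carrier G. 0 \<le> f x) \<longrightarrow> (\<exists>x\<in>carrier G. 0 < f x) \<longrightarrow> (0::real) < I f) \<and>
     (\<forall>f\<in>cc_functions T. \<forall>s\<in>carrier G. I (\<lambda>x. f (x \<otimes> s)) = I f)"
proof -
  obtain \<Lambda> where L: "\<And>f g. f \<in> Cp \<Longrightarrow> g \<in> Cp \<Longrightarrow> (\<And>x. x \<in> carrier G \<Longrightarrow> f x \<le> g x) \<Longrightarrow> \<Lambda> f \<le> \<Lambda> g"
    "\<And>f g. f \<in> Cp \<Longrightarrow> g \<in> Cp \<Longrightarrow> \<Lambda> (\<lambda>x. f x + g x) = \<Lambda> f + \<Lambda> g"
    "\<And>f c. f \<in> Cp \<Longrightarrow> 0 \<le> c \<Longrightarrow> \<Lambda> (\<lambda>x. c * f x) \<le> c * \<Lambda> f"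
    "\<And>f s. f \<in> Cp \<Longrightarrow> s \<in> carrier G \<Longrightarrow> \<Lambda> (\<lambda>x. f (x \<otimes> s)) \<le> \<Lambda> f"
    "\<And>f. f \<in> Cp \<Longrightarrow> 0 \<le> \<Lambda> f" "\<And>f. f \<in> bumps \<Longrightarrow> (0::real) < \<Lambda> f"
  proof -
    obtain \<Lambda> where *: "\<forall>f\<in>Cp. \<forall>g\<in>Cp. (\<forall>x\<in>carrier G. f x \<le> g x) \<longrightarrow> \<Lambda> f \<le> \<Lambda> g"
      "\<forall>f\<in>Cp. \<forall>g\<in>Cp. \<Lambda> (\<lambda>x. f x + g x) = \<Lambda> f + \<Lambda> g"
      "\<forall>f\<in>Cp. \<forall>c\<ge>0. \<Lambda> (\<lambda>x. c * f x) \<le> c * \<Lambda> f"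
      "\<forall>f\<in>Cp. \<forall>s\<in>carrier G. \<Lambda> (\<lambda>x. f (x \<otimes> s)) \<le> \<Lambda> f"
      "\<forall>f\<in>Cp. 0 \<le> \<Lambda> f" "\<forall>f\<in>bumps. (0::real) < \<Lambda> f"
      using positive_haar_functional by (elim exE conjE) (rule that)
    show ?thesis
    proof (rule that[of \<Lambda>])
      show "\<Lambda> f \<le> \<Lambda> g" if "f \<in> Cp" "g \<in> Cp" "\<And>x. x \<in> carrier G \<Longrightarrow> f x \<le> g x" for f g
        using *(1)[rule_format, OF that] .
    qed (rule *(2-6)[rule_format]; assumption)+
  qed
  have cong: "\<Lambda> f = \<Lambda> g" if "f \<in> Cp" "g \<in> Cp" "\<And>x. x \<in> carrier G \<Longrightarrow> f x = g x" for f g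
    using L(1)[of f g] L(1)[of g f] that by force
  have scale: "\<Lambda> (\<lambda>x. c * f x) = c * \<Lambda> f" if f: "f \<in> Cp" "0 \<le> c" for f c
  proof (cases "c = 0")
    case True
    then show ?thesis using L(3)[OF f] L(5)[OF Cp_scale[OF f]] by simp
  next
    case False
    have "\<Lambda> (\<lambda>x. (1 / c) * (c * f x)) \<le> (1 / c) * \<Lambda> (\<lambda>x. c * f x)"
      by (rule L(3)[OF Cp_scale[OF f]]) (use f in simp)
    then show ?thesis using L(3)[OF f] False f(2) by (simp add: field_simps)
  qed
  have transl: "\<Lambda> (\<lambda>x. f (x \<otimes> s)) = \<Lambda> f" if f: "f \<in> Cp" "s \<in> carrier G" for f s
  proof (rule antisym[OF L(4)[OF f]])
    have "\<Lambda> f = \<Lambda> (\<lambda>x. f ((x \<otimes> inv s) \<otimes> s))"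
      by (rule cong[OF f(1) Cp_translate[OF Cp_translate[OF f] inv_closed[OF f(2)]]])
         (use f(2) in \<open>simp add: m_assoc\<close>)
    also have "\<dots> \<le> \<Lambda> (\<lambda>x. f (x \<otimes> s))" by (rule L(4)[OF Cp_translate[OF f] inv_closed[OF f(2)]])
    finally show "\<Lambda> f \<le> \<Lambda> (\<lambda>x. f (x \<otimes> s))" .
  qed
  define P where "P = (\<lambda>(f::'a \<Rightarrow> real) x. max (f x) 0)"
  define I where "I = (\<lambda>f. \<Lambda> (P f) - \<Lambda> (P (\<lambda>x. - f x)))"
  have P: "P f \<in> Cp" if f: "f \<in> cc_functions T" for f
  proof -
    have "P f \<in> cc_functions T"
    proof (rule cc_vanish[OF f])
      show "continuous_map T euclideanreal (P f)"
        unfolding P_def by (intro continuous_map_real_max cc_cont[OF f]) simp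
    qed (simp add: P_def)
    then show ?thesis by (simp add: Cp_def P_def)
  qed
  have m: "(\<lambda>x. - f x) \<in> cc_functions T" if "f \<in> cc_functions T" for f
    using cc_scale[OF that, of "-1"] by simp
  have diff: "I f = \<Lambda> a - \<Lambda> b" if f: "f \<in> cc_functions T" and ab: "a \<in> Cp" "b \<in> Cp" "\<And>x. x \<in> carrier G \<Longrightarrow> f x = a x - b x" for f a b
  proof -
    have "\<Lambda> (\<lambda>x. P f x + b x) = \<Lambda> (\<lambda>x. P (\<lambda>x. - f x) x + a x)"
      by (rule cong[OF Cp_add[OF P[OF f] ab(2)] Cp_add[OF P[OF m[OF f]] ab(1)]])
         (use ab(3) in \<open>auto simp: P_def max_def\<close>)
    then show ?thesis using L(2) P[OF f] P[OF m[OF f]] ab by (simp add: I_def)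
  qed
  have Iadd: "I (\<lambda>x. f x + g x) = I f + I g" if fg: "f \<in> cc_functions T" "g \<in> cc_functions T" for f g
  proof -
    note c = P[OF fg(1)] P[OF fg(2)] P[OF m[OF fg(1)]] P[OF m[OF fg(2)]]
    have "I (\<lambda>x. f x + g x) = \<Lambda> (\<lambda>x. P f x + P g x) - \<Lambda> (\<lambda>x. P (\<lambda>x. - f x) x + P (\<lambda>x. - g x) x)"
      by (rule diff[OF cc_add[OF fg] Cp_add[OF c(1,2)] Cp_add[OF c(3,4)]]) (simp add: P_def max_def)
    then show ?thesis using L(2)[OF c(1,2)] L(2)[OF c(3,4)] by (simp add: I_def)
  qed
  have Iscale: "I (\<lambda>x. c * f x) = c * I f" if f: "f \<in> cc_functions T" for f c
  proof (cases "c \<ge> 0")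
    case True
    have "I (\<lambda>x. c * f x) = \<Lambda> (\<lambda>x. c * P f x) - \<Lambda> (\<lambda>x. c * P (\<lambda>x. - f x) x)"
      by (rule diff[OF cc_scale[OF f] Cp_scale[OF P[OF f] True] Cp_scale[OF P[OF m[OF f]] True]])
         (simp add: P_def max_def)
    then show ?thesis using scale[OF P[OF f] True] scale[OF P[OF m[OF f]] True] by (simp add: I_def algebra_simps)
  next
    case False
    then have n: "- c \<ge> 0" by simp
    have "I (\<lambda>x. c * f x) = \<Lambda> (\<lambda>x. - c * P (\<lambda>x. - f x) x) - \<Lambda> (\<lambda>x. - c * P f x)"
      by (rule diff[OF cc_scale[OF f] Cp_scale[OF P[OF m[OF f]] n] Cp_scale[OF P[OF f] n]])
         (simp add: P_def max_def)
    then show ?thesis using scale[OF P[OF f] n] scale[OF P[OF m[OF f]] n] by (simp add: I_def algebra_simps)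
  qed
  have Ipos: "I f = \<Lambda> f" if f: "f \<in> Cp" for f
    using diff[OF CpD(1)[OF f] f Cp_scale[OF f, of 0]] scale[OF f, of 0] by simp
  have Itransl: "I (\<lambda>x. f (x \<otimes> s)) = I f" if f: "f \<in> cc_functions T" "s \<in> carrier G" for f s
    using transl[OF P[OF f(1)] f(2)] transl[OF P[OF m[OF f(1)]] f(2)] by (simp add: I_def P_def)
  have "0 \<le> I f" if "f \<in> cc_functions T" "\<forall>x\<in>carrier G. 0 \<le> f x" for f
    using Ipos[of f] L(5)[of f] that by (simp add: Cp_def)
  moreover have "0 < I f" if "f \<in> cc_functions T" "\<forall>x\<in>carrier G. 0 \<le> f x" "\<exists>x\<in>carrier G. 0 < f x" for f
    using Ipos[of f] L(6)[of f] that by (simp add: Cp_def bumps_def)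
  ultimately show ?thesis using Iadd Iscale Itransl
    by (intro exI[of _ I] conjI ballI allI impI) simp_all
qed

end

section \<open>Differentiation under a positive functional\<close>

locale cc_functional =
  fixes T :: "'a topology" and I :: "('a \<Rightarrow> real) \<Rightarrow> real"
  assumes Hausdorff_T: "Hausdorff_space T" and loc_compact_T: "locally_compact_space T"
    and I_add: "f \<in> cc_functions T \<Longrightarrow> g \<in> cc_functions T \<Longrightarrow> I (\<lambda>x. f x + g x) = I f + I g"
    and I_scale: "f \<in> cc_functions T \<Longrightarrow> I (\<lambda>x. c * f x) = c * I f"
    and I_nonneg: "f \<in> cc_functions T \<Longrightarrow> (\<And>x. x \<in> topspace T \<Longrightarrow> 0 \<le> f x) \<Longrightarrow> 0 \<le> I f"
begin

lemma cc_diff: "f \<in> cc_functions T \<Longrightarrow> g \<in> cc_functions T \<Longrightarrow> (\<lambda>x. f x - g x) \<in> cc_functions T"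
  using cc_add[of f T "\<lambda>x. -1 * g x"] cc_scale[of g T "-1"] by simp

lemma I_diff: "f \<in> cc_functions T \<Longrightarrow> g \<in> cc_functions T \<Longrightarrow> I (\<lambda>x. f x - g x) = I f - I g"
  using I_add[of f "\<lambda>x. -1 * g x"] cc_scale[of g T "-1"] I_scale[of g "-1"] by simp

lemma I_mono:
  assumes "f \<in> cc_functions T" "g \<in> cc_functions T" "\<And>x. x \<in> topspace T \<Longrightarrow> f x \<le> g x"
  shows "I f \<le> I g"
  using I_nonneg[OF cc_diff[OF assms(2,1)]] I_diff[OF assms(2,1)] assms(3) by simp

lemma I_cong:
  assumes "f \<in> cc_functions T" "g \<in> cc_functions T" "\<And>x. x \<in> topspace T \<Longrightarrow> f x = g x"
  shows "I f = I g"
  using I_mono[OF assms(1,2)] I_mono[OF assms(2,1)] assms(3) by simp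

text \<open>
  On functions supported in a fixed compact set, a positive functional is bounded in the supremum norm:
  compare with a bump function that is \<open>1\<close> on the set.
\<close>

lemma I_bound:
  assumes K: "compactin T K"
  shows "\<exists>B\<ge>0. \<forall>f e. f \<in> cc_functions T \<longrightarrow> e \<ge> 0 \<longrightarrow> (\<forall>x\<in>topspace T - K. f x = 0) \<longrightarrow>
    (\<forall>x\<in>K. \<bar>f x\<bar> \<le> e) \<longrightarrow> \<bar>I f\<bar> \<le> e * B"
proof -
  have KT: "K \<subseteq> topspace T" using compactin_subset_topspace[OF K] .
  obtain h where h: "h \<in> cc_functions T" "\<And>x. x \<in> topspace T \<Longrightarrow> 0 \<le> h x" "\<And>x. x \<in> K \<Longrightarrow> h x = (1::real)"
    by (rule cc_bump[OF loc_compact_T Hausdorff_T K openin_topspace KT]) (rule that)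
  show ?thesis
  proof (intro exI[of _ "I h"] conjI allI impI)
    show "0 \<le> I h" by (rule I_nonneg[OF h(1,2)])
    fix f e assume f: "f \<in> cc_functions T" and e: "e \<ge> (0::real)"
      and supp: "\<forall>x\<in>topspace T - K. f x = 0" and le: "\<forall>x\<in>K. \<bar>f x\<bar> \<le> e"
    have b: "\<bar>f x\<bar> \<le> e * h x" if x: "x \<in> topspace T" for x
      using le supp h(2,3)[of x] e x by (cases "x \<in> K") auto
    have "I f \<le> I (\<lambda>x. e * h x)" by (rule I_mono[OF f cc_scale[OF h(1)]]) (use b in force)
    moreover have "I (\<lambda>x. -1 * f x) \<le> I (\<lambda>x. e * h x)"
      by (rule I_mono[OF cc_scale[OF f] cc_scale[OF h(1)]]) (use b in force)
    ultimately show "\<bar>I f\<bar> \<le> e * I h" using I_scale[OF f, of "-1"] I_scale[OF h(1), of e] by (simp add: abs_le_iff)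
  qed
qed

context
  fixes n :: nat and W :: "(nat \<Rightarrow> real) set"
  assumes W: "openin (Euclidean_space n) W"
begin

text \<open>
  All partial derivatives up to order \<open>k\<close> in the parameter \<open>z\<close> exist and are continuous jointly in \<open>g\<close> and \<open>z\<close>;
  the joint continuity makes the estimates uniform for \<open>g\<close> in a compact set.
\<close>

primrec param_Ck :: "nat \<Rightarrow> ('a \<Rightarrow> (nat \<Rightarrow> real) \<Rightarrow> real) \<Rightarrow> bool" where
  "param_Ck 0 F \<longleftrightarrow> continuous_map (prod_topology T (subtopology (Euclidean_space n) W)) euclideanreal (\<lambda>z. F (fst z) (snd z))"
| "param_Ck (Suc k) F \<longleftrightarrow>
     continuous_map (prod_topology T (subtopology (Euclidean_space n) W)) euclideanreal (\<lambda>z. F (fst z) (snd z)) \<and>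
     (\<forall>i<n. (\<forall>g\<in>topspace T. \<forall>z\<in>W. ((\<lambda>t. F g (z(i := t))) has_real_derivative pderiv_at i (F g) z) (at (z i))) \<and>
            param_Ck k (\<lambda>g. pderiv_at i (F g)))"

text \<open>
  The functions \<open>F g z\<close> of \<open>g\<close> are supported in one compact set for all \<open>z\<close> near a given point.  So
  estimates that are uniform on compact sets carry over to the values of a positive functional.
\<close>

definition loc_support :: "('a \<Rightarrow> (nat \<Rightarrow> real) \<Rightarrow> real) \<Rightarrow> bool" where
  "loc_support F \<longleftrightarrow> (\<forall>z\<in>W. \<exists>N K. openin (Euclidean_space n) N \<and> z \<in> N \<and> N \<subseteq> W \<and> compactin T K \<and>
     (\<forall>g\<in>topspace T - K. \<forall>y\<in>N. F g y = 0))"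

lemma loc_supportE:
  assumes "loc_support F" "z \<in> W"
  obtains N K where "openin (Euclidean_space n) N" "z \<in> N" "N \<subseteq> W" "compactin T K"
    "\<forall>g\<in>topspace T - K. \<forall>y\<in>N. F g y = 0"
  using assms(1)[unfolded loc_support_def, THEN bspec, OF assms(2)] by (elim exE conjE)

lemma topspace_W: "topspace (subtopology (Euclidean_space n) W) = W"
  using openin_subset[OF W] by auto

lemma param_continuous:
  "param_Ck k F \<Longrightarrow> continuous_map (prod_topology T (subtopology (Euclidean_space n) W)) euclideanreal (\<lambda>z. F (fst z) (snd z))"
  by (cases k) auto

lemma fiber_cc:
  assumes c: "param_Ck k F" and s: "loc_support F" and z: "z \<in> W"
  shows "(\<lambda>g. F g z) \<in> cc_functions T"
proof -
  have "continuous_map T (prod_topology T (subtopology (Euclidean_space n) W)) (\<lambda>g. (g, z))"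
    using z topspace_W by (intro continuous_map_pairedI) (auto simp: continuous_map_id[unfolded id_def])
  from continuous_map_compose[OF this param_continuous[OF c]]
  have "continuous_map T euclideanreal (\<lambda>g. F g z)" by (simp add: o_def)
  moreover obtain N K where "openin (Euclidean_space n) N" "z \<in> N" "N \<subseteq> W" "compactin T K" "\<forall>g\<in>topspace T - K. \<forall>y\<in>N. F g y = 0"
    by (rule loc_supportE[OF s z]) (rule that)
  ultimately show ?thesis by (auto simp: cc_functions_def)
qed

lemma loc_support_pderiv:
  assumes s: "loc_support F" and i: "i < n"
  shows "loc_support (\<lambda>g. pderiv_at i (F g))"
  unfolding loc_support_def
proof
  fix z assume z: "z \<in> W"
  obtain N K where N: "openin (Euclidean_space n) N" "z \<in> N" "N \<subseteq> W" "compactin T K"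
    "\<forall>g\<in>topspace T - K. \<forall>y\<in>N. F g y = 0" by (rule loc_supportE[OF s z]) (rule that)
  have "pderiv_at i (F g) y = 0" if g: "g \<in> topspace T - K" and y: "y \<in> N" for g y
  proof -
    have "\<forall>\<^sub>F t in nhds (y i). F g (y(i := t)) = 0"
      using eventually_line_in[OF N(1) y i] by eventually_elim (use N(5) g in blast)
    then have "deriv (\<lambda>t. F g (y(i := t))) (y i) = deriv (\<lambda>t. 0) (y i)" by (rule deriv_cong_ev) simp
    then show ?thesis by (simp add: pderiv_at_def)
  qed
  then show "\<exists>N K. openin (Euclidean_space n) N \<and> z \<in> N \<and> N \<subseteq> W \<and> compactin T K \<and>
     (\<forall>g\<in>topspace T - K. \<forall>y\<in>N. pderiv_at i (F g) y = 0)" using N(1-4) by (intro exI conjI ballI)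
qed

lemma uniform_near:
  assumes c: "continuous_map (prod_topology T (subtopology (Euclidean_space n) W)) euclideanreal (\<lambda>z. F (fst z) (snd z))"
    and K: "compactin T K" and z: "z \<in> W" and e: "e > 0"
  shows "\<exists>d>0. cube n z d \<subseteq> W \<and> (\<forall>y\<in>cube n z d. \<forall>g\<in>K. \<bar>F g y - F g z\<bar> < e)"
proof -
  let ?P = "prod_topology T (subtopology (Euclidean_space n) W)"
  have "continuous_map ?P ?P (\<lambda>p. (fst p, z))"
    using z topspace_W by (intro continuous_map_pairedI continuous_map_fst) auto
  from continuous_map_compose[OF this c]
  have "continuous_map ?P euclideanreal (\<lambda>p. F (fst p) z)" by (simp add: o_def)
  with c have "continuous_map ?P euclideanreal (\<lambda>p. F (fst p) (snd p) - F (fst p) z)" by (rule continuous_map_diff)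
  then have op: "openin ?P {p \<in> topspace ?P. F (fst p) (snd p) - F (fst p) z \<in> ball 0 e}"
    by (rule openin_continuous_map_preimage) simp
  have sub: "K \<times> {z} \<subseteq> {p \<in> topspace ?P. F (fst p) (snd p) - F (fst p) z \<in> ball 0 e}"
    using compactin_subset_topspace[OF K] z e topspace_W by auto
  have z': "z \<in> topspace (subtopology (Euclidean_space n) W)" using z topspace_W by simp
  obtain U V where UV: "openin (subtopology (Euclidean_space n) W) V" "K \<subseteq> U" "z \<in> V"
    "U \<times> V \<subseteq> {p \<in> topspace ?P. F (fst p) (snd p) - F (fst p) z \<in> ball 0 e}"
    using tube_lemma_left[OF op K z' sub] by (elim exE conjE) (rule that)
  have V: "openin (Euclidean_space n) V" "V \<subseteq> W" using UV(1) W by (simp_all add: openin_open_subtopology)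
  obtain d where d: "d > 0" "cube n z d \<subseteq> V" using cube_in_open[OF V(1) UV(3)] by blast
  have "\<bar>F g y - F g z\<bar> < e" if "y \<in> cube n z d" "g \<in> K" for y g
  proof -
    have "(g, y) \<in> U \<times> V" using that d(2) UV(2) by blast
    then have "F (fst (g, y)) (snd (g, y)) - F (fst (g, y)) z \<in> ball 0 e" using UV(4) by blast
    then show ?thesis by simp
  qed
  then show ?thesis using d V(2) by blast
qed

lemma I_parameter_continuous:
  assumes F: "param_Ck k F" "loc_support F"
  shows "continuous_map (subtopology (Euclidean_space n) W) euclideanreal (\<lambda>z. I (\<lambda>g. F g z))"
  unfolding continuous_on_cube_iff[OF openin_subset[OF W]]
proof (intro ballI allI impI)
  fix z e assume z: "z \<in> W" and e: "(0::real) < e"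
  obtain N K where N: "openin (Euclidean_space n) N" "z \<in> N" "N \<subseteq> W" "compactin T K"
    "\<forall>g\<in>topspace T - K. \<forall>y\<in>N. F g y = 0" by (rule loc_supportE[OF F(2) z]) (rule that)
  obtain B where B: "B \<ge> 0" "\<forall>f e. f \<in> cc_functions T \<longrightarrow> e \<ge> 0 \<longrightarrow> (\<forall>x\<in>topspace T - K. f x = 0) \<longrightarrow>
    (\<forall>x\<in>K. \<bar>f x\<bar> \<le> e) \<longrightarrow> \<bar>I f\<bar> \<le> e * B" using I_bound[OF N(4)] by (elim exE conjE) (rule that)
  define e' where "e' = e / (B + 1)"
  have e': "e' > 0" "e' * B < e" using e B(1) by (simp_all add: e'_def field_simps)
  obtain d where d: "d > 0" "\<forall>y\<in>cube n z d. \<forall>g\<in>K. \<bar>F g y - F g z\<bar> < e'"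
    using uniform_near[OF param_continuous[OF F(1)] N(4) z e'(1)] by blast
  obtain d' where d': "d' > 0" "cube n z d' \<subseteq> N" using cube_in_open[OF N(1,2)] by blast
  have "\<bar>I (\<lambda>g. F g y) - I (\<lambda>g. F g z)\<bar> < e" if y: "y \<in> W" "y \<in> cube n z (min d d')" for y
  proof -
    have yd: "y \<in> cube n z d" "y \<in> cube n z d'" using y(2) by (auto simp: cube_def)
    note cc = fiber_cc[OF F y(1)] fiber_cc[OF F z]
    have "\<bar>I (\<lambda>g. F g y - F g z)\<bar> \<le> e' * B"
    proof (rule B(2)[rule_format, OF cc_diff[OF cc]])
      show "F g y - F g z = 0" if "g \<in> topspace T - K" for g using N(2,5) that yd(2) d'(2) by auto
      show "\<bar>F g y - F g z\<bar> \<le> e'" if "g \<in> K" for g using d(2) yd(1) that by (auto intro: less_imp_le)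
    qed (use e' in simp)
    then show ?thesis using I_diff[OF cc] e'(2) by simp
  qed
  then show "\<exists>d>0. \<forall>y\<in>W. y \<in> cube n z d \<longrightarrow> \<bar>I (\<lambda>g. F g y) - I (\<lambda>g. F g z)\<bar> < e"
    using d(1) d'(1) by (intro exI[of _ "min d d'"]) simp
qed

text \<open>
  By the mean value theorem and joint continuity, the difference quotient converges to the partial derivative
  uniformly on the compact set that contains all supports, and on functions supported there the
  functional is bounded.
\<close>

lemma I_parameter_derivative:
  assumes F: "param_Ck (Suc k) F" "loc_support F" and i: "i < n" and z: "z \<in> W"
  shows "((\<lambda>t. I (\<lambda>g. F g (z(i := t)))) has_real_derivative I (\<lambda>g. pderiv_at i (F g) z)) (at (z i))"
  unfolding has_field_derivative_iff tendsto_iff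
proof (intro allI impI)
  fix e :: real assume e: "0 < e"
  have Fi: "param_Ck k (\<lambda>g. pderiv_at i (F g))"
    and der: "\<And>g y. g \<in> topspace T \<Longrightarrow> y \<in> W \<Longrightarrow> ((\<lambda>t. F g (y(i := t))) has_real_derivative pderiv_at i (F g) y) (at (y i))"
    using F(1) i by auto
  obtain N K where N: "openin (Euclidean_space n) N" "z \<in> N" "N \<subseteq> W" "compactin T K"
    "\<forall>g\<in>topspace T - K. \<forall>y\<in>N. F g y = 0" by (rule loc_supportE[OF F(2) z]) (rule that)
  have KT: "K \<subseteq> topspace T" using compactin_subset_topspace[OF N(4)] .
  obtain B where B: "B \<ge> 0" "\<forall>f e. f \<in> cc_functions T \<longrightarrow> e \<ge> 0 \<longrightarrow> (\<forall>x\<in>topspace T - K. f x = 0) \<longrightarrow>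
    (\<forall>x\<in>K. \<bar>f x\<bar> \<le> e) \<longrightarrow> \<bar>I f\<bar> \<le> e * B" using I_bound[OF N(4)] by (elim exE conjE) (rule that)
  define e' where "e' = e / (B + 1)"
  have e': "e' > 0" "e' * B < e" using e B(1) by (simp_all add: e'_def field_simps)
  obtain d where d: "d > 0" "cube n z d \<subseteq> W" "\<forall>y\<in>cube n z d. \<forall>g\<in>K. \<bar>pderiv_at i (F g) y - pderiv_at i (F g) z\<bar> < e'"
    using uniform_near[OF param_continuous[OF Fi] N(4) z e'(1)] by blast
  obtain d' where d': "d' > 0" "cube n z d' \<subseteq> N" using cube_in_open[OF N(1,2)] by blast
  define r where "r = min d d'"
  have r: "r > 0" using d d' by (simp add: r_def)
  have line: "z(i := t) \<in> cube n z d \<and> z(i := t) \<in> N \<and> z(i := t) \<in> W" if "\<bar>t - z i\<bar> < r" for t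
  proof -
    have "z \<in> Rn n" using openin_subset[OF W] z by blast
    then have "z(i := t) \<in> cube n z d" "z(i := t) \<in> cube n z d'" using that i d(1) d'(1) Rn_upd[OF _ i]
      by (auto simp: cube_def r_def)
    then show ?thesis using d d' by blast
  qed
  have mvt: "\<bar>(F g (z(i := t)) - F g z) / (t - z i) - pderiv_at i (F g) z\<bar> \<le> e'"
    if t: "t \<noteq> z i" "\<bar>t - z i\<bar> < r" and g: "g \<in> K" for t g
  proof -
    have D: "((\<lambda>t. F g (z(i := t))) has_real_derivative pderiv_at i (F g) (z(i := s))) (at s)" if "\<bar>s - z i\<bar> < r" for s
    proof -
      have "((\<lambda>t. F g ((z(i := s))(i := t))) has_real_derivative pderiv_at i (F g) (z(i := s))) (at ((z(i := s)) i))"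
        using der[of g "z(i := s)"] line[OF that] g KT by blast
      then show ?thesis by simp
    qed
    obtain s where s: "\<bar>s - z i\<bar> < r" "F g (z(i := t)) - F g z = (t - z i) * pderiv_at i (F g) (z(i := s))"
      using mean_value_between[where F="\<lambda>t. F g (z(i := t))" and F'="\<lambda>s. pderiv_at i (F g) (z(i := s))", OF D t(2)]
      by auto
    then have "(F g (z(i := t)) - F g z) / (t - z i) = pderiv_at i (F g) (z(i := s))" using t by simp
    then show ?thesis using d(3) line[OF s(1)] g by (auto intro: less_imp_le)
  qed
  note cz = fiber_cc[OF F z] and ci = fiber_cc[OF Fi loc_support_pderiv[OF F(2) i] z]
  have est: "dist ((I (\<lambda>g. F g (z(i := t))) - I (\<lambda>g. F g (z(i := z i)))) / (t - z i)) (I (\<lambda>g. pderiv_at i (F g) z)) < e"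
    if t: "t \<noteq> z i" "\<bar>t - z i\<bar> < r" for t
  proof -
    have tW: "z(i := t) \<in> W" using line[OF t(2)] by blast
    note ct = fiber_cc[OF F tW]
    let ?q = "\<lambda>g. inverse (t - z i) * (F g (z(i := t)) - F g z)"
    have cq: "?q \<in> cc_functions T" by (rule cc_scale[OF cc_diff[OF ct cz]])
    have Iq: "I ?q = inverse (t - z i) * (I (\<lambda>g. F g (z(i := t))) - I (\<lambda>g. F g z))"
      using I_scale[OF cc_diff[OF ct cz]] I_diff[OF ct cz] by simp
    have "\<bar>I (\<lambda>g. ?q g - pderiv_at i (F g) z)\<bar> \<le> e' * B"
    proof (rule B(2)[rule_format, OF cc_diff[OF cq ci]])
      fix g assume g: "g \<in> topspace T - K"
      have "\<forall>\<^sub>F t in nhds (z i). F g (z(i := t)) = 0"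
        using eventually_line_in[OF N(1,2) i] by eventually_elim (use N(5) g in blast)
      then have "deriv (\<lambda>t. F g (z(i := t))) (z i) = deriv (\<lambda>t. 0) (z i)" by (rule deriv_cong_ev) simp
      then have "pderiv_at i (F g) z = 0" by (simp add: pderiv_at_def)
      then show "?q g - pderiv_at i (F g) z = 0" using N(2,5) g line[OF t(2)] by simp
    next
      fix g assume "g \<in> K"
      then show "\<bar>?q g - pderiv_at i (F g) z\<bar> \<le> e'" using mvt[OF t] by (simp add: divide_inverse mult.commute)
    qed (use e' in simp)
    then have "\<bar>I ?q - I (\<lambda>g. pderiv_at i (F g) z)\<bar> < e" using I_diff[OF cq ci] e'(2) by simp
    then show ?thesis unfolding Iq by (simp add: dist_real_def divide_inverse mult.commute)
  qed
  show "\<forall>\<^sub>F t in at (z i). dist ((I (\<lambda>g. F g (z(i := t))) - I (\<lambda>g. F g (z(i := z i)))) / (t - z i)) (I (\<lambda>g. pderiv_at i (F g) z)) < e"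
    unfolding eventually_at using r est by (intro exI[of _ r]) (auto simp: dist_real_def)
qed

lemma I_parameter_Ck:
  assumes "param_Ck k F" "loc_support F"
  shows "Ck_on k n W (\<lambda>z. I (\<lambda>g. F g z))"
  using assms
proof (induction k arbitrary: F)
  case 0
  show ?case using I_parameter_continuous[OF 0] by simp
next
  case (Suc k)
  show ?case
  proof (rule Ck_on_SucI[OF W I_parameter_continuous[OF Suc.prems], where f'="\<lambda>i z. I (\<lambda>g. pderiv_at i (F g) z)"])
    fix i assume i: "i < n"
    show "Ck_on k n W (\<lambda>z. I (\<lambda>g. pderiv_at i (F g) z))"
      by (rule Suc.IH[OF _ loc_support_pderiv[OF Suc.prems(2) i]]) (use Suc.prems(1) i in simp)
    fix z assume "z \<in> W"
    then show "((\<lambda>t. I (\<lambda>g. F g (z(i := t)))) has_real_derivative I (\<lambda>g. pderiv_at i (F g) z)) (at (z i))"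
      by (rule I_parameter_derivative[OF Suc.prems i])
  qed
qed

end

end

section \<open>Products of charts\<close>

definition join :: "nat \<Rightarrow> (nat \<Rightarrow> real) \<Rightarrow> (nat \<Rightarrow> real) \<Rightarrow> nat \<Rightarrow> real" where
  "join l u z = (\<lambda>i. if i < l then u i else z (i - l))"

definition left_part :: "nat \<Rightarrow> (nat \<Rightarrow> real) \<Rightarrow> nat \<Rightarrow> real" where
  "left_part l w = (\<lambda>i. if i < l then w i else 0)"

definition right_part :: "nat \<Rightarrow> (nat \<Rightarrow> real) \<Rightarrow> nat \<Rightarrow> real" where
  "right_part l w = (\<lambda>i. w (i + l))"

lemma join_parts:
  "u \<in> Rn l \<Longrightarrow> left_part l (join l u z) = u" "right_part l (join l u z) = z"
  "join l (left_part l w) (right_part l w) = w"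
  "u \<in> Rn l \<Longrightarrow> z \<in> Rn n \<Longrightarrow> join l u z \<in> Rn (l + n)"
  "w \<in> Rn (l + n) \<Longrightarrow> left_part l w \<in> Rn l" "w \<in> Rn (l + n) \<Longrightarrow> right_part l w \<in> Rn n"
  by (auto simp: join_def left_part_def right_part_def Rn_iff fun_eq_iff)

lemma join_update: "i < n \<Longrightarrow> join l u (z(i := t)) = (join l u z)(l + i := t)"
  by (auto simp: join_def fun_eq_iff)

lemma continuous_left_part: "continuous_map (Euclidean_space (l + n)) (Euclidean_space l) (left_part l)"
  unfolding left_part_def[abs_def]
  by (subst continuous_map_componentwise_Euclidean_space) (simp add: continuous_map_coordinate)

lemma continuous_right_part: "continuous_map (Euclidean_space (l + n)) (Euclidean_space n) (right_part l)"
proof -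
  have "continuous_map (Euclidean_space (l + n)) (Euclidean_space n) (\<lambda>w i. if i < n then w (i + l) else 0)"
    by (subst continuous_map_componentwise_Euclidean_space) (simp add: continuous_map_coordinate)
  then show ?thesis
    by (rule continuous_map_eq) (auto simp: right_part_def Rn_iff fun_eq_iff)
qed

definition join_set :: "nat \<Rightarrow> nat \<Rightarrow> (nat \<Rightarrow> real) set \<Rightarrow> (nat \<Rightarrow> real) set \<Rightarrow> (nat \<Rightarrow> real) set" where
  "join_set l n A B = {w \<in> Rn (l + n). left_part l w \<in> A \<and> right_part l w \<in> B}"

lemma openin_join_set:
  assumes "openin (Euclidean_space l) A" "openin (Euclidean_space n) B"
  shows "openin (Euclidean_space (l + n)) (join_set l n A B)"
proof -
  have "join_set l n A B = {w \<in> Rn (l + n). left_part l w \<in> A} \<inter> {w \<in> Rn (l + n). right_part l w \<in> B}"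
    by (auto simp: join_set_def)
  then show ?thesis
    using openin_continuous_map_preimage[OF continuous_left_part assms(1), of n]
      openin_continuous_map_preimage[OF continuous_right_part assms(2), of l] by (simp only: openin_Int)
qed

lemma join_in_set: "A \<subseteq> Rn l \<Longrightarrow> B \<subseteq> Rn n \<Longrightarrow> u \<in> A \<Longrightarrow> z \<in> B \<Longrightarrow> join l u z \<in> join_set l n A B"
  unfolding join_set_def using join_parts(1)[of u l z] join_parts(2)[of l u z] join_parts(4)[of u l z n]
  by (simp add: subset_iff)

text \<open>
  Joint smoothness of \<open>F\<close> in charts for \<open>g\<close> gives smoothness in the parameter: a partial derivative in \<open>z\<close> is one
  of the last \<open>n\<close> partial derivatives in the coordinates of the product.
\<close>

lemma (in cc_functional) param_CkI:
  fixes atl :: "('a set \<times> ('a \<Rightarrow> nat \<Rightarrow> real)) set"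
  assumes W: "openin (Euclidean_space n) W"
    and chart: "\<And>U \<phi>. (U, \<phi>) \<in> atl \<Longrightarrow> is_chart T l U \<phi>"
    and cover: "\<And>g. g \<in> topspace T \<Longrightarrow> \<exists>U \<phi>. (U, \<phi>) \<in> atl \<and> g \<in> U"
    and Ck: "\<And>U \<phi>. (U, \<phi>) \<in> atl \<Longrightarrow>
       Ck_on k (l + n) (join_set l n (\<phi> ` U) W) (\<lambda>w. F (inv_into U \<phi> (left_part l w)) (right_part l w))"
  shows "param_Ck n W k F"
  using Ck
proof (induction k arbitrary: F)
  have WR: "W \<subseteq> Rn n" using openin_subset[OF W] .
  have UR: "\<phi> ` U \<subseteq> Rn l" if "(U, \<phi>) \<in> atl" for U \<phi> using openin_subset[OF chart_open_range[OF chart[OF that]]] .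
  have FH: "F g z = F (inv_into U \<phi> (left_part l (join l (\<phi> g) z))) (right_part l (join l (\<phi> g) z))"
    if "(U, \<phi>) \<in> atl" "g \<in> U" for F :: "'a \<Rightarrow> (nat \<Rightarrow> real) \<Rightarrow> real" and U \<phi> g z
  proof -
    have "\<phi> g \<in> Rn l" using UR[OF that(1)] that(2) by blast
    then show ?thesis
      using join_parts(1)[of "\<phi> g" l z] join_parts(2)[of l "\<phi> g" z] chart_inv[OF chart[OF that(1)] that(2)] by simp
  qed
  have inO: "join l (\<phi> g) z \<in> join_set l n (\<phi> ` U) W" if "(U, \<phi>) \<in> atl" "g \<in> U" "z \<in> W" for U \<phi> g z
    using join_in_set[OF UR[OF that(1)] WR imageI[OF that(2)] that(3)] .
  have cont: "continuous_map (prod_topology T (subtopology (Euclidean_space n) W)) euclideanreal (\<lambda>z. F (fst z) (snd z))"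
    if Ck: "\<And>U \<phi>. (U, \<phi>) \<in> atl \<Longrightarrow>
       Ck_on k (l + n) (join_set l n (\<phi> ` U) W) (\<lambda>w. F (inv_into U \<phi> (left_part l w)) (right_part l w))" for k F
    unfolding continuous_map
  proof (intro conjI allI impI)
    fix S :: "real set" assume "openin euclideanreal S"
    then have S: "open S" by simp
    let ?P = "prod_topology T (subtopology (Euclidean_space n) W)"
    show "openin ?P {x \<in> topspace ?P. F (fst x) (snd x) \<in> S}"
    proof (rule openin_pointwise)
      fix p assume p: "p \<in> {x \<in> topspace ?P. F (fst x) (snd x) \<in> S}"
      then obtain U \<phi> where c: "(U, \<phi>) \<in> atl" "fst p \<in> U" using cover[of "fst p"] by auto
      let ?O = "join_set l n (\<phi> ` U) W" and ?H = "\<lambda>w. F (inv_into U \<phi> (left_part l w)) (right_part l w)"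
      let ?PU = "prod_topology (subtopology T U) (subtopology (Euclidean_space n) W)"
      have "continuous_map (subtopology T U) (Euclidean_space l) \<phi>"
        using homeomorphic_imp_continuous_map[OF chart_homeomorphic[OF chart[OF c(1)]]] by (simp add: continuous_map_in_subtopology)
      then have \<phi>i: "continuous_map ?PU euclideanreal (\<lambda>x. \<phi> (fst x) i)" for i
        using continuous_map_compose[OF continuous_map_compose[OF continuous_map_fst] continuous_map_coordinate] by (simp add: o_def)
      have "continuous_map ?PU (Euclidean_space n) snd"
        using continuous_map_snd[of "subtopology T U" "subtopology (Euclidean_space n) W"] by (simp add: continuous_map_in_subtopology)
      then have si: "continuous_map ?PU euclideanreal (\<lambda>x. snd x i)" for i
        using continuous_map_compose[OF _ continuous_map_coordinate] by (fastforce simp: o_def)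
      have "continuous_map ?PU (Euclidean_space (l + n)) (\<lambda>x i. if i < l + n then (if i < l then \<phi> (fst x) i else snd x (i - l)) else 0)"
        unfolding continuous_map_componentwise_Euclidean_space
      proof (intro allI impI)
        fix i assume "i < l + n"
        show "continuous_map ?PU euclideanreal (\<lambda>x. if i < l then \<phi> (fst x) i else snd x (i - l))"
          by (cases "i < l") (simp_all add: \<phi>i si)
      qed
      moreover have tPU: "topspace ?PU = U \<times> W"
        using chart_open_domain(2)[OF chart[OF c(1)]] WR by auto
      ultimately have "continuous_map ?PU (Euclidean_space (l + n)) (\<lambda>x. join l (\<phi> (fst x)) (snd x))"
        by (elim continuous_map_eq) (use WR in \<open>auto simp: join_def Rn_iff fun_eq_iff\<close>)
      then have "continuous_map ?PU (subtopology (Euclidean_space (l + n)) ?O) (\<lambda>x. join l (\<phi> (fst x)) (snd x))"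
        by (rule continuous_map_into_subtopology) (use tPU inO[OF c(1)] in auto)
      from continuous_map_compose[OF this Ck_on_continuous[OF Ck[OF c(1)]]]
      have "continuous_map ?PU euclideanreal (\<lambda>x. F (fst x) (snd x))"
      proof (rule continuous_map_eq)
        fix x assume "x \<in> topspace ?PU"
        then have "fst x \<in> U" unfolding tPU by auto
        from FH[OF c(1) this, of F "snd x"]
        show "(?H \<circ> (\<lambda>x. join l (\<phi> (fst x)) (snd x))) x = F (fst x) (snd x)" by (simp only: o_def)
      qed
      then have a1: "openin ?PU {x \<in> topspace ?PU. F (fst x) (snd x) \<in> S}"
        by (rule openin_continuous_map_preimage) (use S in simp)
      have a2: "?PU = subtopology ?P (U \<times> topspace (subtopology (Euclidean_space n) W))"
        by (simp only: subtopology_Times subtopology_topspace)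
      have a3: "openin ?P (U \<times> topspace (subtopology (Euclidean_space n) W))"
        unfolding openin_prod_Times_iff using chart_open_domain(1)[OF chart[OF c(1)]] openin_topspace by blast
      have "openin ?P {x \<in> topspace ?PU. F (fst x) (snd x) \<in> S}"
        by (rule openin_trans_full[OF a1[unfolded a2] a3, folded a2])
      then have "openin ?P {x \<in> U \<times> W. F (fst x) (snd x) \<in> S}" by (simp only: tPU)
      then show "\<exists>V. openin ?P V \<and> p \<in> V \<and> V \<subseteq> {x \<in> topspace ?P. F (fst x) (snd x) \<in> S}"
        using p c chart_open_domain(2)[OF chart[OF c(1)]] WR
        by (intro exI[of _ "{x \<in> U \<times> W. F (fst x) (snd x) \<in> S}"]) auto
    qed
  qed simp
  {
    case 0
    show ?case using cont[OF "0"] by (simp only: param_Ck.simps(1)[OF W])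
  next
    case (Suc k)
    have der: "((\<lambda>t. F g (z(i := t))) has_real_derivative
        pderiv_at (l + i) (\<lambda>w. F (inv_into U \<phi> (left_part l w)) (right_part l w)) (join l (\<phi> g) z)) (at (z i))"
      if c: "(U, \<phi>) \<in> atl" and g: "g \<in> U" and i: "i < n" and z: "z \<in> W" for U \<phi> g z i
    proof -
      let ?H = "\<lambda>w. F (inv_into U \<phi> (left_part l w)) (right_part l w)"
      have "((\<lambda>t. ?H ((join l (\<phi> g) z)(l + i := t))) has_real_derivative pderiv_at (l + i) ?H (join l (\<phi> g) z)) (at ((join l (\<phi> g) z) (l + i)))"
        using Suc.prems[OF c] inO[OF c g z] i unfolding Ck_on_Suc_iff by simp
      moreover have "?H ((join l (\<phi> g) z)(l + i := t)) = F g (z(i := t))" for t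
        using FH[OF c g, of F "z(i := t)"] by (simp add: join_update[OF i])
      moreover have "(join l (\<phi> g) z) (l + i) = z i" by (simp add: join_def)
      ultimately show ?thesis by simp
    qed
    have pd: "pderiv_at i (F g) z = pderiv_at (l + i) (\<lambda>w. F (inv_into U \<phi> (left_part l w)) (right_part l w)) (join l (\<phi> g) z)"
      if "(U, \<phi>) \<in> atl" "g \<in> U" "i < n" "z \<in> W" for U \<phi> g z i
      unfolding pderiv_at_def[of i "F g"] by (rule DERIV_imp_deriv[OF der[OF that]])
    have "param_Ck n W k (\<lambda>g. pderiv_at i (F g))" if i: "i < n" for i
    proof (rule Suc.IH)
      fix U \<phi> assume c: "(U, \<phi>) \<in> atl"
      let ?H = "\<lambda>w. F (inv_into U \<phi> (left_part l w)) (right_part l w)"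
      show "Ck_on k (l + n) (join_set l n (\<phi> ` U) W) (\<lambda>w. pderiv_at i (F (inv_into U \<phi> (left_part l w))) (right_part l w))"
      proof (rule Ck_on_cong[OF openin_join_set[OF chart_open_range[OF chart[OF c]] W]])
        show "Ck_on k (l + n) (join_set l n (\<phi> ` U) W) (pderiv_at (l + i) ?H)"
          using Suc.prems[OF c] i by (simp add: Ck_on_Suc_iff)
        fix w assume "w \<in> join_set l n (\<phi> ` U) W"
        then obtain g where g: "g \<in> U" "left_part l w = \<phi> g" "right_part l w \<in> W" by (auto simp: join_set_def)
        then have "inv_into U \<phi> (left_part l w) = g" using chart_inv[OF chart[OF c]] by simp
        moreover have "join l (\<phi> g) (right_part l w) = w" using join_parts(3)[of l w] g(2) by simp
        ultimately show "pderiv_at (l + i) ?H w = pderiv_at i (F (inv_into U \<phi> (left_part l w))) (right_part l w)"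
          using pd[OF c g(1) i g(3)] by simp
      qed
    qed
    moreover have "((\<lambda>t. F g (z(i := t))) has_real_derivative pderiv_at i (F g) z) (at (z i))"
      if gzi: "g \<in> topspace T" "z \<in> W" "i < n" for g z i
    proof -
      obtain U \<phi> where c: "(U, \<phi>) \<in> atl" "g \<in> U" using cover[OF gzi(1)] by blast
      show ?thesis using der[OF c gzi(3,2)] pd[OF c gzi(3,2)] by simp
    qed
    ultimately show ?case
      unfolding param_Ck.simps(2)[OF W] using cont[OF Suc.prems] by (intro conjI allI impI ballI) simp_all
  }
qed

section \<open>Bump functions on manifolds\<close>

definition closed_cube :: "nat \<Rightarrow> (nat \<Rightarrow> real) \<Rightarrow> real \<Rightarrow> (nat \<Rightarrow> real) set" where
  "closed_cube n x r = {y \<in> Rn n. \<forall>i<n. \<bar>y i - x i\<bar> \<le> r}"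

lemma compactin_closed_cube: "compactin (Euclidean_space n) (closed_cube n x r)"
proof -
  have eq: "closed_cube n x r = Pi\<^sub>E UNIV (\<lambda>i. if i < n then {x i - r..x i + r} else {0})"
    by (auto simp: closed_cube_def Rn_iff PiE_iff abs_le_iff split: if_splits; smt (verit))
  have "compactin (powertop_real UNIV) (closed_cube n x r)"
    unfolding eq compactin_PiE by auto
  then show ?thesis
    by (auto simp: Euclidean_space_def compactin_subtopology closed_cube_def Rn_iff)
qed

context smooth_manifold
begin

lemma chart_closed_cube:
  assumes W: "OpM W" "x \<in> W"
  obtains U \<phi> r where "(U, \<phi>) \<in> atlas M" "x \<in> U" "r > 0" "closed_cube (mdim M) (\<phi> x) r \<subseteq> \<phi> ` (U \<inter> W)"
    "compactin (mtop M) (inv_into U \<phi> ` closed_cube (mdim M) (\<phi> x) r)"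
    "inv_into U \<phi> ` closed_cube (mdim M) (\<phi> x) r = {y \<in> U. \<phi> y \<in> closed_cube (mdim M) (\<phi> x) r}"
    "inv_into U \<phi> ` closed_cube (mdim M) (\<phi> x) r \<subseteq> U \<inter> W"
proof -
  have "x \<in> pM" using W openin_subset by blast
  then obtain U \<phi> where c: "(U, \<phi>) \<in> atlas M" "x \<in> U" using chart_at by blast
  note ch = atlas_chart[OF c(1)]
  have "\<phi> x \<in> \<phi> ` (U \<inter> W)" using c W by blast
  then obtain e where e: "e > 0" "cube (mdim M) (\<phi> x) e \<subseteq> \<phi> ` (U \<inter> W)"
    using cube_in_open[OF chart_image_open[OF ch W(1)]] by blast
  have sub: "closed_cube (mdim M) (\<phi> x) (e / 2) \<subseteq> \<phi> ` (U \<inter> W)"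
  proof -
    have "closed_cube (mdim M) (\<phi> x) (e / 2) \<subseteq> cube (mdim M) (\<phi> x) e" using e(1) by (fastforce simp: closed_cube_def cube_def)
    then show ?thesis using e(2) by blast
  qed
  have "compactin (subtopology (Euclidean_space (mdim M)) (\<phi> ` U)) (closed_cube (mdim M) (\<phi> x) (e / 2))"
    using compactin_closed_cube sub by (auto simp: compactin_subtopology)
  then have cK: "compactin (mtop M) (inv_into U \<phi> ` closed_cube (mdim M) (\<phi> x) (e / 2))"
    by (rule image_compactin[OF _ chart_inverse_continuous[OF ch]])
  have eq: "inv_into U \<phi> ` closed_cube (mdim M) (\<phi> x) (e / 2) = {y \<in> U. \<phi> y \<in> closed_cube (mdim M) (\<phi> x) (e / 2)}"
  proof (intro equalityI subsetI)
    fix y assume "y \<in> inv_into U \<phi> ` closed_cube (mdim M) (\<phi> x) (e / 2)"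
    then obtain z where z: "z \<in> closed_cube (mdim M) (\<phi> x) (e / 2)" "y = inv_into U \<phi> z" by blast
    then obtain u where "u \<in> U" "z = \<phi> u" using sub by blast
    then show "y \<in> {y \<in> U. \<phi> y \<in> closed_cube (mdim M) (\<phi> x) (e / 2)}" using z chart_inv[OF ch] by simp
  next
    fix y assume y: "y \<in> {y \<in> U. \<phi> y \<in> closed_cube (mdim M) (\<phi> x) (e / 2)}"
    then have "y = inv_into U \<phi> (\<phi> y)" using chart_inv[OF ch] by simp
    then show "y \<in> inv_into U \<phi> ` closed_cube (mdim M) (\<phi> x) (e / 2)" using y by blast
  qed
  have "inv_into U \<phi> ` closed_cube (mdim M) (\<phi> x) (e / 2) \<subseteq> U \<inter> W"
  proof
    fix y assume "y \<in> inv_into U \<phi> ` closed_cube (mdim M) (\<phi> x) (e / 2)"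
    then obtain z where z: "z \<in> closed_cube (mdim M) (\<phi> x) (e / 2)" "y = inv_into U \<phi> z" by blast
    then obtain u where "u \<in> U \<inter> W" "z = \<phi> u" using sub by blast
    then show "y \<in> U \<inter> W" using z chart_inv[OF ch] by simp
  qed
  then show thesis using that[OF c _ sub cK eq] e(1) by simp
qed

lemma compact_nbhd:
  assumes W: "OpM W" "x \<in> W"
  obtains V K where "OpM V" "x \<in> V" "V \<subseteq> K" "compactin (mtop M) K" "K \<subseteq> W"
proof -
  obtain U \<phi> r where c: "(U, \<phi>) \<in> atlas M" "x \<in> U" and r: "r > 0"
    and cK: "compactin (mtop M) (inv_into U \<phi> ` closed_cube (mdim M) (\<phi> x) r)"
    and eq: "inv_into U \<phi> ` closed_cube (mdim M) (\<phi> x) r = {y \<in> U. \<phi> y \<in> closed_cube (mdim M) (\<phi> x) r}"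
    and sub: "inv_into U \<phi> ` closed_cube (mdim M) (\<phi> x) r \<subseteq> U \<inter> W"
    by (rule chart_closed_cube[OF W]) (rule that)
  let ?V = "{y \<in> U. \<phi> y \<in> cube (mdim M) (\<phi> x) r}"
  have "OpM ?V" by (rule chart_preimage_open[OF atlas_chart[OF c(1)] openin_cube])
  moreover have "\<phi> x \<in> Rn (mdim M)" using openin_subset[OF chart_open_range[OF atlas_chart[OF c(1)]]] c by blast
  then have "x \<in> ?V" using c r by (simp add: cube_def)
  moreover have "?V \<subseteq> inv_into U \<phi> ` closed_cube (mdim M) (\<phi> x) r"
    unfolding eq by (auto simp: cube_def closed_cube_def intro: less_imp_le)
  ultimately show thesis using that cK sub by blast
qed

lemma manifold_locally_compact: "locally_compact_space (mtop M)"
  unfolding locally_compact_space_def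
proof
  fix x assume "x \<in> pM"
  then show "\<exists>U K. OpM U \<and> compactin (mtop M) K \<and> x \<in> U \<and> U \<subseteq> K"
    by (rule compact_nbhd[OF openin_topspace]) blast
qed

text \<open>
  The flat exponential of \<open>r\<^sup>2 - \<bar>\<phi> y - \<phi> x\<bar>\<^sup>2\<close> in a chart, continued by \<open>0\<close>.  It is smooth also at the boundary of
  the chart, as it vanishes outside of a compact subset of the chart, which is closed in \<open>M\<close> because \<open>M\<close> is
  Hausdorff.
\<close>

lemma manifold_bump:
  assumes W: "OpM W" "x \<in> W"
  obtains f K where "smooth_real_on M pM f" "f x > 0" "\<And>y. f y \<ge> 0" "compactin (mtop M) K" "K \<subseteq> W"
    "\<And>y. y \<notin> K \<Longrightarrow> f y = 0"
proof -
  obtain U \<phi> r where c: "(U, \<phi>) \<in> atlas M" "x \<in> U" and r: "r > 0"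
    and cK: "compactin (mtop M) (inv_into U \<phi> ` closed_cube (mdim M) (\<phi> x) r)"
    and eq: "inv_into U \<phi> ` closed_cube (mdim M) (\<phi> x) r = {y \<in> U. \<phi> y \<in> closed_cube (mdim M) (\<phi> x) r}"
    and sub: "inv_into U \<phi> ` closed_cube (mdim M) (\<phi> x) r \<subseteq> U \<inter> W"
    by (rule chart_closed_cube[OF W]) (rule that)
  note ch = atlas_chart[OF c(1)]
  define n where "n = mdim M"
  define K where "K = inv_into U \<phi> ` closed_cube n (\<phi> x) r"
  have K: "compactin (mtop M) K" "K = {y \<in> U. \<phi> y \<in> closed_cube n (\<phi> x) r}" "K \<subseteq> U \<inter> W"
    using cK eq sub by (simp_all add: K_def n_def)
  have UR: "\<phi> ` U \<subseteq> Rn n" using openin_subset[OF chart_open_range[OF ch]] by (simp add: n_def)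
  define H where "H = (\<lambda>z. flat_exp (r * r - (\<Sum>i<n. (z i - \<phi> x i) * (z i - \<phi> x i))))"
  define f where "f = (\<lambda>y. if y \<in> U then H (\<phi> y) else 0)"
  have Hs: "smooth_on n (Rn n) H" unfolding H_def
    by (intro smooth_on_flat_exp[where g="\<lambda>_. 0"] smooth_on_diff smooth_on_sum smooth_on_mult smooth_on_proj smooth_on_const openin_Rn)
  have fK: "f y = 0" if y: "y \<notin> K" for y
  proof (cases "y \<in> U")
    case True
    then have "\<phi> y \<notin> closed_cube n (\<phi> x) r" "\<phi> y \<in> Rn n" using y K(2) UR by auto
    then obtain i where i: "i < n" "r < \<bar>\<phi> y i - \<phi> x i\<bar>" by (auto simp: closed_cube_def not_le)
    have "r * r \<le> \<bar>\<phi> y i - \<phi> x i\<bar> * \<bar>\<phi> y i - \<phi> x i\<bar>" using i r by (intro mult_mono) auto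
    also have "\<dots> = (\<phi> y i - \<phi> x i) * (\<phi> y i - \<phi> x i)" by simp
    also have "\<dots> \<le> (\<Sum>i<n. (\<phi> y i - \<phi> x i) * (\<phi> y i - \<phi> x i))" using i(1) by (intro member_le_sum) auto
    finally show ?thesis using True by (simp add: f_def H_def flat_exp_zero)
  qed (simp add: f_def)
  have Kcl: "closedin (mtop M) K" by (rule compactin_imp_closedin[OF Hausdorff K(1)])
  have "smooth_real_on M pM f"
  proof (rule smooth_real_on_local[OF openin_topspace])
    fix y assume y: "y \<in> pM"
    show "\<exists>W'. OpM W' \<and> y \<in> W' \<and> smooth_real_on M (pM \<inter> W') f"
    proof (cases "y \<in> U")
      case True
      have "smooth_in_chart n U \<phi> U f" unfolding smooth_in_chart_def
      proof (rule smooth_on_cong[where f=H])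
        show "openin (Euclidean_space n) (\<phi> ` (U \<inter> U))" using chart_open_range[OF ch] by (simp add: n_def)
        show "H z = f (inv_into U \<phi> z)" if "z \<in> \<phi> ` (U \<inter> U)" for z using that chart_inv[OF ch] by (auto simp: f_def)
        show "smooth_on n (\<phi> ` (U \<inter> U)) H" by (rule smooth_on_subset[OF _ Hs]) (use UR in auto)
      qed
      then have "smooth_real_on M U f"
        using smooth_real_on_chart[OF c(1) chart_open_domain(1)[OF ch] subset_refl] by (simp add: n_def)
      moreover have "pM \<inter> U = U" using chart_open_domain(2)[OF ch] by blast
      ultimately show ?thesis using chart_open_domain(1)[OF ch] True by (intro exI[of _ U]) simp
    next
      case False
      then have "y \<notin> K" using K(2) by blast
      have op: "OpM (pM - K)" using Kcl by blast
      have "smooth_real_on M (pM - K) f"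
        by (rule smooth_real_on_cong[OF op _ smooth_real_on_const[OF op, of 0]]) (simp add: fK)
      moreover have "pM \<inter> (pM - K) = pM - K" by blast
      ultimately show ?thesis using op y \<open>y \<notin> K\<close> by (intro exI[of _ "pM - K"]) simp
    qed
  qed
  moreover have "f x > 0" using c(2) r by (simp add: f_def H_def flat_exp_pos)
  moreover have "f y \<ge> 0" for y by (simp add: f_def H_def flat_exp_nonneg)
  ultimately show thesis using that[of f K] K fK by blast
qed

end

section \<open>Averaging over the group\<close>

context smooth_action
begin

lemma loc_compact_group: "loc_compact_group G (mtop L)"
proof (rule loc_compact_group.intro[OF is_group loc_compact_group_axioms.intro])
  show "carrier G = topspace (mtop L)" by (rule carrier_eq)
  show "Hausdorff_space (mtop L)" by (rule L.Hausdorff)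
  show "locally_compact_space (mtop L)" by (rule L.manifold_locally_compact)
  show "continuous_map (prod_topology (mtop L) (mtop L)) (mtop L) (\<lambda>(g, h). g \<otimes> h)"
    using smooth_mult by (simp add: smooth_map_def prod_manifold_def)
  show "continuous_map (mtop L) (mtop L) (m_inv G)"
    using smooth_inv by (simp add: smooth_map_def)
qed

lemma act_continuous: "continuous_map (prod_topology (mtop L) (mtop M)) (mtop M) (\<lambda>(g, x). act g x)"
  using smooth_act by (simp add: smooth_map_def prod_manifold_def)

text \<open>
  The inverse of the product chart sends \<open>w\<close> to the pair of the points with coordinates \<open>left_part w\<close> and
  \<open>right_part w\<close>.  Near each point, composing it with the action and a chart around the image point gives
  smooth coordinates.
\<close>

lemma smooth_act_in_charts:
  assumes f: "smooth_real_on M M.pM f" and c: "(U, \<phi>) \<in> atlas L" "(V, \<psi>) \<in> atlas M"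
  shows "smooth_on (mdim L + mdim M) (join_set (mdim L) (mdim M) (\<phi> ` U) (\<psi> ` V))
    (\<lambda>w. f (act (inv_into U \<phi> (left_part (mdim L) w)) (inv_into V \<psi> (right_part (mdim L) w))))"
proof -
  define l where "l = mdim L"
  define n where "n = mdim M"
  note cL = L.atlas_chart[OF c(1), folded l_def] and cM = M.atlas_chart[OF c(2), folded n_def]
  let ?\<Omega> = "join_set l n (\<phi> ` U) (\<psi> ` V)"
  define \<Phi> where "\<Phi> = (\<lambda>(x, y). join l (\<phi> x) (\<psi> y))"
  define p where "p = (\<lambda>w. (inv_into U \<phi> (left_part l w), inv_into V \<psi> (right_part l w)))"
  have UR: "\<phi> ` U \<subseteq> Rn l" using openin_subset[OF chart_open_range[OF cL]] .
  have VR: "\<psi> ` V \<subseteq> Rn n" using openin_subset[OF chart_open_range[OF cM]] .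
  have op\<Omega>: "openin (Euclidean_space (l + n)) ?\<Omega>"
    by (rule openin_join_set[OF chart_open_range[OF cL] chart_open_range[OF cM]])
  have top\<Omega>: "topspace (subtopology (Euclidean_space (l + n)) ?\<Omega>) = ?\<Omega>"
    using openin_subset[OF op\<Omega>] by auto
  have p\<Phi>: "p (\<Phi> (x, y)) = (x, y)" if "x \<in> U" "y \<in> V" for x y
  proof -
    have "\<phi> x \<in> Rn l" using that UR by blast
    then show ?thesis using that join_parts(1)[of "\<phi> x" l "\<psi> y"] join_parts(2)[of l "\<phi> x" "\<psi> y"] chart_inv[OF cL] chart_inv[OF cM]
      by (simp add: p_def \<Phi>_def)
  qed
  have p\<Omega>: "\<exists>x\<in>U. \<exists>y\<in>V. w = \<Phi> (x, y) \<and> p w = (x, y)" if w: "w \<in> ?\<Omega>" for w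
  proof -
    obtain x y where xy: "x \<in> U" "y \<in> V" "left_part l w = \<phi> x" "right_part l w = \<psi> y"
      using w by (auto simp: join_set_def)
    have "w = \<Phi> (x, y)" using join_parts(3)[of l w] xy by (simp add: \<Phi>_def)
    then show ?thesis using p\<Phi>[OF xy(1,2)] xy by blast
  qed
  have \<Phi>in: "\<Phi> (x, y) \<in> ?\<Omega>" if "x \<in> U" "y \<in> V" for x y
    using join_in_set[OF UR VR] that by (simp add: \<Phi>_def)
  have p_cont: "continuous_map (subtopology (Euclidean_space (l + n)) ?\<Omega>) (prod_topology (mtop L) (mtop M)) p"
    unfolding p_def
  proof (rule continuous_map_pairedI)
    have "continuous_map (subtopology (Euclidean_space (l + n)) ?\<Omega>) (subtopology (Euclidean_space l) (\<phi> ` U)) (left_part l)"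
      by (intro continuous_map_into_subtopology continuous_map_from_subtopology continuous_left_part) (auto simp: join_set_def)
    from continuous_map_compose[OF this chart_inverse_continuous[OF cL]]
    show "continuous_map (subtopology (Euclidean_space (l + n)) ?\<Omega>) (mtop L) (\<lambda>w. inv_into U \<phi> (left_part l w))" by (simp add: o_def)
    have "continuous_map (subtopology (Euclidean_space (l + n)) ?\<Omega>) (subtopology (Euclidean_space n) (\<psi> ` V)) (right_part l)"
      by (intro continuous_map_into_subtopology continuous_map_from_subtopology continuous_right_part) (auto simp: join_set_def)
    from continuous_map_compose[OF this chart_inverse_continuous[OF cM]]
    show "continuous_map (subtopology (Euclidean_space (l + n)) ?\<Omega>) (mtop M) (\<lambda>w. inv_into V \<psi> (right_part l w))" by (simp add: o_def)
  qed
  define A where "A = (\<lambda>w. (\<lambda>(g, x). act g x) (p w))"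
  have A_cont: "continuous_map (subtopology (Euclidean_space (l + n)) ?\<Omega>) (mtop M) A"
    using continuous_map_compose[OF p_cont act_continuous] by (simp add: A_def[abs_def] o_def)
  have "smooth_on (l + n) ?\<Omega> (\<lambda>w. f (A w))"
  proof (rule smooth_on_local)
    show "?\<Omega> \<subseteq> Rn (l + n)" using openin_subset[OF op\<Omega>] .
    fix w assume w: "w \<in> ?\<Omega>"
    then have "A w \<in> M.pM" using A_cont top\<Omega> by (auto simp: continuous_map_def)
    then obtain V' \<xi>' where c': "(V', \<xi>') \<in> atlas M" "A w \<in> V'" using M.chart_at by blast
    note cM' = M.atlas_chart[OF c'(1), folded n_def]
    let ?\<Omega>' = "{w \<in> ?\<Omega>. A w \<in> V'}"
    have "openin (subtopology (Euclidean_space (l + n)) ?\<Omega>) {w \<in> topspace (subtopology (Euclidean_space (l + n)) ?\<Omega>). A w \<in> V'}"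
      by (rule openin_continuous_map_preimage[OF A_cont chart_open_domain(1)[OF cM']])
    then have op': "openin (Euclidean_space (l + n)) ?\<Omega>'"
      unfolding top\<Omega> using op\<Omega> by (rule openin_trans_full)
    have img: "\<Phi> ` ((U \<times> V) \<inter> (\<lambda>(g, x). act g x) -` V') = ?\<Omega>'"
    proof (intro equalityI subsetI)
      fix w assume "w \<in> \<Phi> ` ((U \<times> V) \<inter> (\<lambda>(g, x). act g x) -` V')"
      then obtain x y where "x \<in> U" "y \<in> V" "w = \<Phi> (x, y)" "act x y \<in> V'" by auto
      then show "w \<in> ?\<Omega>'" using \<Phi>in p\<Phi> by (simp add: A_def)
    next
      fix w assume w: "w \<in> ?\<Omega>'"
      then obtain x y where "x \<in> U" "y \<in> V" "w = \<Phi> (x, y)" "p w = (x, y)" using p\<Omega> by blast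
      then show "w \<in> \<Phi> ` ((U \<times> V) \<inter> (\<lambda>(g, x). act g x) -` V')" using w by (auto simp: A_def)
    qed
    have "(U \<times> V, \<Phi>) \<in> atlas (prod_manifold L M)"
      unfolding prod_manifold_def using c by (auto simp: \<Phi>_def join_def l_def)
    then have sm: "smooth_on (l + n) ?\<Omega>' (\<lambda>w. \<xi>' ((\<lambda>(g, x). act g x) (inv_into (U \<times> V) \<Phi> w)) i)" if "i < n" for i
      using smooth_act c'(1) that unfolding smooth_map_def img[symmetric]
      by (fastforce simp: prod_manifold_def l_def n_def)
    have inv: "inv_into (U \<times> V) \<Phi> w = p w" if "w \<in> ?\<Omega>'" for w
    proof -
      obtain x y where xy: "x \<in> U" "y \<in> V" "w = \<Phi> (x, y)" "p w = (x, y)" using p\<Omega> \<open>w \<in> ?\<Omega>'\<close> by blast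
      have "inj_on \<Phi> (U \<times> V)" by (rule inj_on_inverseI[where g=p]) (use p\<Phi> in auto)
      then show ?thesis using xy by (simp add: inv_into_f_f)
    qed
    have "smooth_on (l + n) ?\<Omega>' (\<lambda>w. (\<lambda>z. f (inv_into V' \<xi>' z)) (\<xi>' (A w)))"
    proof (rule smooth_on_compose[where V="\<xi>' ` V'" and m=n and G="\<lambda>w. \<xi>' (A w)" and f="\<lambda>z. f (inv_into V' \<xi>' z)"])
      show "openin (Euclidean_space n) (\<xi>' ` V')" by (rule chart_open_range[OF cM'])
      show "\<xi>' (A w) \<in> \<xi>' ` V'" if "w \<in> ?\<Omega>'" for w using that by blast
      show "smooth_on (l + n) ?\<Omega>' (\<lambda>w. \<xi>' (A w) i)" if "i < n" for i
        by (rule smooth_on_cong[OF op' _ sm[OF that]]) (simp add: A_def inv)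
      have "V' \<inter> M.pM = V'" using chart_open_domain(2)[OF cM'] by blast
      then show "smooth_on n (\<xi>' ` V') (\<lambda>z. f (inv_into V' \<xi>' z))"
        using f c'(1) unfolding smooth_real_on_def n_def by fastforce
    qed (rule op')
    then have "smooth_on (l + n) ?\<Omega>' (\<lambda>w. f (A w))"
      by (rule smooth_on_cong[OF op', rotated]) (simp add: chart_inv[OF cM'])
    moreover have "?\<Omega> \<inter> ?\<Omega>' = ?\<Omega>'" by blast
    ultimately show "\<exists>V. openin (Euclidean_space (l + n)) V \<and> w \<in> V \<and> smooth_on (l + n) (?\<Omega> \<inter> V) (\<lambda>w. f (A w))"
      using op' w c'(2) by (intro exI[of _ ?\<Omega>']) simp
  qed
  then show ?thesis by (simp add: A_def p_def l_def n_def)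
qed

end

context proper_smooth_action
begin

text \<open>
  The map \<open>(g, x) \<mapsto> (g x, x)\<close> is proper, so the \<open>g\<close> that move some point of a compact set into another
  compact set form a compact set.
\<close>

lemma compact_transporter:
  assumes K: "compactin (mtop M) K" and C: "compactin (mtop M) C"
  shows "\<exists>D. compactin (mtop L) D \<and> (\<forall>g\<in>topspace (mtop L) - D. \<forall>x\<in>C. act g x \<notin> K)"
proof -
  let ?P = "{p \<in> topspace (prod_topology (mtop L) (mtop M)). (\<lambda>(g, x). (act g x, x)) p \<in> K \<times> C}"
  have "compactin (prod_topology (mtop M) (mtop M)) (K \<times> C)" using K C by (simp add: compactin_Times)
  then have "compactin (prod_topology (mtop L) (mtop M)) ?P"
    by (rule compactin_proper_map_preimage[OF proper_act])
  then have "compactin (mtop L) (fst ` ?P)" by (rule image_compactin[OF _ continuous_map_fst])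
  moreover have "act g x \<notin> K" if g: "g \<in> topspace (mtop L) - fst ` ?P" and x: "x \<in> C" for g x
  proof
    assume "act g x \<in> K"
    then have "(g, x) \<in> ?P" using g x compactin_subset_topspace[OF C] by auto
    then have "g \<in> fst ` ?P" by (rule image_eqI[rotated]) simp
    then show False by (rule DiffD2[OF g])
  qed
  ultimately show ?thesis by (intro exI[of _ "fst ` ?P"] conjI ballI)
qed

text \<open>
  The average \<open>a x = I (\<lambda>g. f (g x))\<close> of a bump function \<open>f\<close> with compact support \<open>K \<subseteq> W\<close>.  It is invariant, as \<open>I\<close> is
  invariant under right translations; it is smooth, as for \<open>x\<close> in a compact set \<open>C\<close> only the \<open>g\<close> in a compact
  set move \<open>x\<close> into \<open>K\<close>; it vanishes outside of the invariant set \<open>W\<close>, as no \<open>g\<close> moves such an \<open>x\<close> into \<open>W\<close>; and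
  it is positive at \<open>x\<^sub>0\<close>, as the averaged function is positive at \<open>g = 1\<close>.
\<close>

lemma invariant_bump:
  assumes W: "M.OpM W" and inv: "\<And>g x. g \<in> carrier G \<Longrightarrow> x \<in> M.pM \<Longrightarrow> act g x \<in> W \<Longrightarrow> x \<in> W" and x0: "x0 \<in> W"
  shows "\<exists>a\<in>inv_funs. a x0 > 0 \<and> (\<forall>x\<in>M.pM - W. a x = 0)"
proof -
  interpret H: loc_compact_group G "mtop L" by (rule loc_compact_group)
  obtain I where I: "\<forall>f\<in>cc_functions (mtop L). \<forall>g\<in>cc_functions (mtop L). I (\<lambda>x. f x + g x) = I f + I g"
     "\<forall>f\<in>cc_functions (mtop L). \<forall>c. I (\<lambda>x. c * f x) = c * I f"
     "\<forall>f\<in>cc_functions (mtop L). (\<forall>x\<in>carrier G. 0 \<le> f x) \<longrightarrow> 0 \<le> I f"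
     "\<forall>f\<in>cc_functions (mtop L). (\<forall>x\<in>carrier G. 0 \<le> f x) \<longrightarrow> (\<exists>x\<in>carrier G. 0 < f x) \<longrightarrow> (0::real) < I f"
     "\<forall>f\<in>cc_functions (mtop L). \<forall>s\<in>carrier G. I (\<lambda>x. f (x \<otimes> s)) = I f"
    using H.haar_functional by (elim exE conjE) (rule that)
  interpret I: cc_functional "mtop L" I
  proof
    show "Hausdorff_space (mtop L)" by (rule L.Hausdorff)
    show "locally_compact_space (mtop L)" by (rule L.manifold_locally_compact)
    fix f assume f: "f \<in> cc_functions (mtop L)"
    show "I (\<lambda>x. f x + g x) = I f + I g" if "g \<in> cc_functions (mtop L)" for g
      by (rule I(1)[rule_format, OF f that])
    show "I (\<lambda>x. c * f x) = c * I f" for c by (rule I(2)[rule_format, OF f])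
    show "0 \<le> I f" if "\<And>x. x \<in> topspace (mtop L) \<Longrightarrow> 0 \<le> f x" using I(3) f that carrier_eq by simp
  qed
  obtain f K where f: "smooth_real_on M M.pM f" "f x0 > 0" "\<And>y. f y \<ge> 0" "compactin (mtop M) K" "K \<subseteq> W" "\<And>y. y \<notin> K \<Longrightarrow> f y = 0"
    by (rule M.manifold_bump[OF W x0]) (rule that)
  define a where "a = (\<lambda>x. I (\<lambda>g. f (act g x)))"
  let ?n = "mdim M"
  have in_chart: "I.param_Ck ?n (\<psi> ` V) k (\<lambda>g z. f (act g (inv_into V \<psi> z))) \<and> I.loc_support ?n (\<psi> ` V) (\<lambda>g z. f (act g (inv_into V \<psi> z)))"
    if c: "(V, \<psi>) \<in> atlas M" for V \<psi> k
  proof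
    note cM = M.atlas_chart[OF c]
    show "I.param_Ck ?n (\<psi> ` V) k (\<lambda>g z. f (act g (inv_into V \<psi> z)))"
    proof (rule I.param_CkI[OF chart_open_range[OF cM], where atl="atlas L" and l="mdim L"])
      show "is_chart (mtop L) (mdim L) U \<phi>" if "(U, \<phi>) \<in> atlas L" for U \<phi> by (rule L.atlas_chart[OF that])
      show "\<exists>U \<phi>. (U, \<phi>) \<in> atlas L \<and> g \<in> U" if "g \<in> topspace (mtop L)" for g by (rule L.chart_at[OF that])
      show "Ck_on k (mdim L + ?n) (join_set (mdim L) ?n (\<phi> ` U) (\<psi> ` V))
          (\<lambda>w. f (act (inv_into U \<phi> (left_part (mdim L) w)) (inv_into V \<psi> (right_part (mdim L) w))))"
        if "(U, \<phi>) \<in> atlas L" for U \<phi>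
        using smooth_act_in_charts[OF f(1) that c] by (simp add: smooth_on_def)
    qed
    show "I.loc_support ?n (\<psi> ` V) (\<lambda>g z. f (act g (inv_into V \<psi> z)))"
      unfolding I.loc_support_def[OF chart_open_range[OF cM]]
    proof
      fix z assume "z \<in> \<psi> ` V"
      then obtain y where y: "y \<in> V" "z = \<psi> y" by blast
      obtain N C where N: "M.OpM N" "y \<in> N" "N \<subseteq> C" "compactin (mtop M) C" "C \<subseteq> V"
        by (rule M.compact_nbhd[OF chart_open_domain(1)[OF cM] y(1)]) (rule that)
      obtain D where D: "compactin (mtop L) D" "\<forall>g\<in>topspace (mtop L) - D. \<forall>x\<in>C. act g x \<notin> K"
        using compact_transporter[OF f(4) N(4)] by blast
      have "f (act g (inv_into V \<psi> w)) = 0" if g: "g \<in> topspace (mtop L) - D" and w: "w \<in> \<psi> ` (V \<inter> N)" for g w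
      proof -
        have "inv_into V \<psi> w \<in> C" using w chart_inv[OF cM] N(3) by auto
        then show ?thesis using D(2) g f(6) by blast
      qed
      then show "\<exists>N K. openin (Euclidean_space ?n) N \<and> z \<in> N \<and> N \<subseteq> \<psi> ` V \<and> compactin (mtop L) K \<and>
        (\<forall>g\<in>topspace (mtop L) - K. \<forall>w\<in>N. f (act g (inv_into V \<psi> w)) = 0)"
        using chart_image_open[OF cM N(1)] y N(2) D(1)
        by (intro exI[of _ "\<psi> ` (V \<inter> N)"] exI[of _ D]) auto
    qed
  qed
  have cc: "(\<lambda>g. f (act g x)) \<in> cc_functions (mtop L)" if x: "x \<in> M.pM" for x
  proof -
    obtain V \<psi> where c: "(V, \<psi>) \<in> atlas M" "x \<in> V" using M.chart_at[OF x] by blast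
    have "(\<lambda>g. f (act g (inv_into V \<psi> (\<psi> x)))) \<in> cc_functions (mtop L)"
      by (rule I.fiber_cc[OF chart_open_range[OF M.atlas_chart[OF c(1)]] conjunct1[OF in_chart[OF c(1)], of 0] conjunct2[OF in_chart[OF c(1)]]])
         (use c in simp)
    then show ?thesis by (simp add: chart_inv[OF M.atlas_chart[OF c(1)] c(2)])
  qed
  have "smooth_real_on M M.pM a"
    unfolding smooth_real_on_def
  proof (intro ballI, unfold split_paired_all split)
    fix V \<psi> assume c: "(V, \<psi>) \<in> atlas M"
    note cM = M.atlas_chart[OF c]
    have "smooth_on ?n (\<psi> ` V) (\<lambda>z. a (inv_into V \<psi> z))"
      unfolding smooth_on_def a_def
      using I.I_parameter_Ck[OF chart_open_range[OF cM] conjunct1[OF in_chart[OF c]] conjunct2[OF in_chart[OF c]]] by blast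
    moreover have "V \<inter> M.pM = V" using chart_open_domain(2)[OF cM] by blast
    ultimately show "smooth_on ?n (\<psi> ` (V \<inter> M.pM)) (\<lambda>z. a (inv_into V \<psi> z))" by simp
  qed
  moreover have "a (act h x) = a x" if h: "h \<in> carrier G" and x: "x \<in> M.pM" for h x
  proof -
    have "a (act h x) = I (\<lambda>g. f (act (g \<otimes> h) x))" unfolding a_def
    proof (rule I.I_cong[OF cc[OF act_closed[OF h x]] H.cc_translate[OF cc[OF x] h]])
      fix g assume "g \<in> topspace (mtop L)"
      then show "f (act g (act h x)) = f (act (g \<otimes> h) x)"
        using composition_rule[OF x _ h] carrier_eq by simp
    qed
    also have "\<dots> = a x" unfolding a_def by (rule I(5)[rule_format, OF cc[OF x] h])
    finally show ?thesis .
  qed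
  ultimately have a: "restrict a M.pM \<in> inv_funs" by (rule inv_funsI)
  have x0M: "x0 \<in> M.pM" using W x0 openin_subset by blast
  have "act \<one> x0 = x0" using id_eq_one x0M by (metis restrict_apply')
  then have "\<exists>g\<in>carrier G. 0 < f (act g x0)" using f(2) by (intro bexI[of _ "\<one>"]) auto
  then have "a x0 > 0" unfolding a_def using I(4)[THEN bspec, OF cc[OF x0M]] f(3) by simp
  moreover have "a x = 0" if x: "x \<in> M.pM - W" for x
  proof -
    have xM: "x \<in> M.pM" using x by blast
    have "a x = I (\<lambda>g. 0 * f (act g x))" unfolding a_def
    proof (rule I.I_cong[OF cc[OF xM] cc_scale[OF cc[OF xM]]])
      fix g assume "g \<in> topspace (mtop L)"
      then have "act g x \<notin> K" using inv[of g x] x f(5) carrier_eq by blast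
      then show "f (act g x) = 0 * f (act g x)" using f(6) by simp
    qed
    then show ?thesis using I.I_scale[OF cc[OF xM], of 0] by simp
  qed
  ultimately show ?thesis using a x0M by (intro bexI[of _ "restrict a M.pM"]) auto
qed

end

section \<open>The isomorphism\<close>

lemma smooth_step:
  assumes "a < (b::real)"
  obtains B where "smooth_real B" "\<And>t. t \<le> a \<Longrightarrow> B t = 0" "\<And>t. t \<ge> b \<Longrightarrow> B t = 1"
proof
  define B where "B = (\<lambda>t. flat_exp (t - a) / (flat_exp (t - a) + flat_exp (b - t)))"
  have pos: "flat_exp (t - a) + flat_exp (b - t) \<noteq> 0" for t
  proof (cases "t > a")
    case True
    then have "flat_exp (t - a) > 0" by (simp add: flat_exp_pos)
    then show ?thesis using flat_exp_nonneg[of "b - t"] by linarith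
  next
    case False
    then have "flat_exp (b - t) > 0" using assms by (simp add: flat_exp_pos)
    then show ?thesis using flat_exp_nonneg[of "t - a"] by linarith
  qed
  show "smooth_real B" unfolding B_def
    by (intro smooth_on_divide smooth_on_add smooth_on_flat_exp[where g="\<lambda>_. 0"] smooth_on_diff
        smooth_on_const smooth_on_proj openin_Rn pos)
  show "B t = 0" if "t \<le> a" for t using that by (simp add: B_def flat_exp_zero)
  show "B t = 1" if "t \<ge> b" for t using that pos[of t] by (simp add: B_def flat_exp_zero)
qed

context proper_smooth_action
begin

abbreviation q where "q \<equiv> orbit G act"
abbreviation X where "X \<equiv> Spec inv.A"
abbreviation Y where "Y \<equiv> orbit_space G M act"
abbreviation OpY where "OpY \<equiv> openin (rs_top (orbit_space G M act))"
abbreviation secY where "secY \<equiv> orbit_space_sections G M act"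
abbreviation secX where "secX \<equiv> Spec_sections inv.A"
abbreviation preM where "preM \<equiv> fiber_preimage G M act"

lemma orbit_act: "g \<in> carrier G \<Longrightarrow> x \<in> M.pM \<Longrightarrow> q (act g x) = q x"
proof -
  assume g: "g \<in> carrier G" and x: "x \<in> M.pM"
  have y: "act g x \<in> M.pM" "act g x \<in> q x" using act_closed[OF g x] g by (auto simp: orbit_def)
  have sub: "q z \<subseteq> M.pM" if "z \<in> M.pM" for z using act_closed that by (auto simp: orbit_def)
  show ?thesis
  proof (intro equalityI subsetI)
    fix z assume z: "z \<in> q (act g x)"
    then show "z \<in> q x" using orbit_trans[OF x y(1) _ y(2)] sub[OF y(1)] by blast
  next
    fix z assume z: "z \<in> q x"
    then show "z \<in> q (act g x)"
      using orbit_trans[OF y(1) x _ orbit_sym[OF x y(1) y(2)]] sub[OF x] by blast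
  qed
qed

lemma orbit_eqD: "x \<in> M.pM \<Longrightarrow> y \<in> M.pM \<Longrightarrow> q x = q y \<Longrightarrow> \<exists>g\<in>carrier G. y = act g x"
  using orbit_refl[of y] by (auto simp: orbit_def)

lemma inv_funs_orbit: "a \<in> inv_funs \<Longrightarrow> x \<in> M.pM \<Longrightarrow> y \<in> M.pM \<Longrightarrow> q x = q y \<Longrightarrow> a x = a y"
  using orbit_eqD[of x y] inv_funsD(2)[of a] by auto

text \<open>
  The closed map \<open>(g, x) \<mapsto> (g x, x)\<close> sends \<open>G \<times> {y}\<close> to the product of the orbit with \<open>{y}\<close>.
\<close>

lemma closedin_orbit:
  assumes y: "y \<in> M.pM"
  shows "closedin (mtop M) (q y)"
proof -
  let ?P = "prod_topology (mtop L) (mtop M)"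
  let ?f = "\<lambda>(g, x). (act g x, x)"
  have "closedin (mtop M) {y}" using closedin_Hausdorff_singleton[OF M.Hausdorff y] .
  then have "closedin ?P (topspace (mtop L) \<times> {y})" by (simp add: closedin_prod_Times_iff)
  then have cl: "closedin (prod_topology (mtop M) (mtop M)) (?f ` (topspace (mtop L) \<times> {y}))"
    using proper_act unfolding proper_map_def closed_map_def by blast
  have "continuous_map (mtop M) (prod_topology (mtop M) (mtop M)) (\<lambda>z. (z, y))"
    using y by (auto intro!: continuous_map_pairedI continuous_map_id[unfolded id_def])
  then have "closedin (mtop M) {z \<in> M.pM. (z, y) \<in> ?f ` (topspace (mtop L) \<times> {y})}"
    using cl by (rule closedin_continuous_map_preimage)
  moreover have "{z \<in> M.pM. (z, y) \<in> ?f ` (topspace (mtop L) \<times> {y})} = q y"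
    using act_closed[OF _ y] carrier_eq by (auto simp: orbit_def image_iff)
  ultimately show ?thesis by simp
qed

lemma preM_iff: "x \<in> preM V \<longleftrightarrow> x \<in> M.pM \<and> q x \<in> V"
  by (simp add: fiber_preimage_def)

lemma OpY_I: "V \<subseteq> q ` M.pM \<Longrightarrow> M.OpM (preM V) \<Longrightarrow> OpY V"
  by (simp add: M.OpQ_iff)

lemma OpY_sub: "OpY V \<Longrightarrow> y \<in> V \<Longrightarrow> \<exists>x\<in>M.pM. y = q x"
  by (auto simp: M.OpQ_iff)

lemma orbit_bump:
  assumes V: "OpY V" and x: "x \<in> M.pM" "q x \<in> V"
  obtains a where "a \<in> inv_funs" "a x > 0" "\<And>y. y \<in> M.pM \<Longrightarrow> q y \<notin> V \<Longrightarrow> a y = 0"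
proof -
  have "\<exists>a\<in>inv_funs. a x > 0 \<and> (\<forall>y\<in>M.pM - preM V. a y = 0)"
  proof (rule invariant_bump[OF M.OpQ_pre[OF V]])
    show "z \<in> preM V" if "g \<in> carrier G" "z \<in> M.pM" "act g z \<in> preM V" for g z
      using that orbit_act by (simp add: preM_iff)
    show "x \<in> preM V" using x by (simp add: preM_iff)
  qed
  then show thesis using that by (auto simp: preM_iff)
qed

definition ev :: "'c \<Rightarrow> ('c \<Rightarrow> real) \<Rightarrow> real" where
  "ev x = (\<lambda>a\<in>inv_funs. a x)"

lemma ev_apply: "a \<in> inv_funs \<Longrightarrow> ev x a = a x"
  by (simp add: ev_def)

lemma ev_point:
  assumes x: "x \<in> M.pM" shows "ev x \<in> inv.pts"
  unfolding cinf_hom_def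
proof (intro CollectI conjI ballI)
  show "ev x \<in> carrier inv.A \<rightarrow>\<^sub>E carrier cinf_real" by (simp add: ev_def)
  fix as f assume as: "as \<in> lists (carrier inv.A)" and f: "f \<in> Cinf_Rn (length as)"
  have c: "cop inv.A f as \<in> inv_funs" using inv.ring.cop_closed[OF as f] by simp
  have m: "map (ev x) as = map (\<lambda>a. a x) as" using as by (auto simp: ev_apply)
  have "ev x (cop inv.A f as) = f (point (map (\<lambda>a. a x) as))"
    using x by (simp only: ev_apply[OF c]) (simp add: inv.cop_functions)
  then show "ev x (cop inv.A f as) = cop cinf_real f (map (ev x) as)"
    unfolding m by (simp add: cinf_real_def)
qed

lemma point_is_ev: "p \<in> inv.pts \<Longrightarrow> \<exists>x\<in>M.pM. p = ev x"
proof -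
  assume p: "p \<in> inv.pts"
  then obtain x where x: "x \<in> M.pM" "\<forall>a\<in>inv_funs. p a = a x" using hom_is_evaluation by blast
  have "p = ev x" by (rule cinf_hom_eqI[OF p ev_point[OF x(1)]]) (use x(2) in \<open>simp add: ev_apply\<close>)
  then show ?thesis using x by blast
qed

text \<open>
  Orbits are closed, so a bump function around one orbit separates it from another one.
\<close>

lemma ev_eq_iff:
  assumes x: "x \<in> M.pM" and y: "y \<in> M.pM"
  shows "ev x = ev y \<longleftrightarrow> q x = q y"
proof
  assume eq: "ev x = ev y"
  show "q x = q y"
  proof (rule ccontr)
    assume ne: "q x \<noteq> q y"
    have op: "M.OpM (M.pM - q y)" using closedin_orbit[OF y] by blast
    have "\<exists>a\<in>inv_funs. a x > 0 \<and> (\<forall>z\<in>M.pM - (M.pM - q y). a z = 0)"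
    proof (rule invariant_bump[OF op])
      have inq: "z \<in> q y \<longleftrightarrow> q z = q y" if "z \<in> M.pM" for z
      proof
        assume "z \<in> q y"
        then obtain g where "g \<in> carrier G" "z = act g y" by (auto simp: orbit_def)
        then show "q z = q y" using orbit_act[OF _ y] by simp
      next
        assume "q z = q y"
        then show "z \<in> q y" using orbit_refl[OF that] by simp
      qed
      show "z \<in> M.pM - q y" if "g \<in> carrier G" "z \<in> M.pM" "act g z \<in> M.pM - q y" for g z
        using that inq[OF act_closed[OF that(1,2)]] inq[OF that(2)] orbit_act[OF that(1,2)] by simp
      show "x \<in> M.pM - q y" using inq[OF x] x ne by simp
    qed
    then obtain a where a: "a \<in> inv_funs" "a x > 0" "\<forall>z\<in>M.pM - (M.pM - q y). a z = 0" by blast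
    have "y \<in> M.pM - (M.pM - q y)" using y orbit_refl[OF y] by blast
    then have "a y = 0" using a(3) by blast
    then show False using fun_cong[OF eq, of a] a by (simp add: ev_apply)
  qed
next
  assume "q x = q y"
  then show "ev x = ev y" unfolding ev_def using inv_funs_orbit[OF _ x y] by (intro restrict_ext) simp
qed

text \<open>
  The two maps on points, inverse to each other.  Representatives are chosen; by \<open>ev_eq_iff\<close> the choice does not
  matter.
\<close>

definition to_orbit :: "(('c \<Rightarrow> real) \<Rightarrow> real) \<Rightarrow> 'c set" where
  "to_orbit p = q (SOME x. x \<in> M.pM \<and> ev x = p)"

definition to_point :: "'c set \<Rightarrow> ('c \<Rightarrow> real) \<Rightarrow> real" where
  "to_point y = ev (SOME x. x \<in> M.pM \<and> q x = y)"

lemma to_orbit_ev: "x \<in> M.pM \<Longrightarrow> to_orbit (ev x) = q x"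
proof -
  assume x: "x \<in> M.pM"
  have "(SOME z. z \<in> M.pM \<and> ev z = ev x) \<in> M.pM \<and> ev (SOME z. z \<in> M.pM \<and> ev z = ev x) = ev x"
    by (rule someI[of _ x]) (use x in simp)
  then show ?thesis unfolding to_orbit_def using ev_eq_iff x by blast
qed

lemma to_point_orbit: "x \<in> M.pM \<Longrightarrow> to_point (q x) = ev x"
proof -
  assume x: "x \<in> M.pM"
  have "(SOME z. z \<in> M.pM \<and> q z = q x) \<in> M.pM \<and> q (SOME z. z \<in> M.pM \<and> q z = q x) = q x"
    by (rule someI[of _ x]) (use x in simp)
  then show ?thesis unfolding to_point_def using ev_eq_iff x by blast
qed

lemma topspace_X: "topspace (rs_top X) = inv.pts"
  by (simp add: inv.Spec_simps inv.topspace_Spec)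

lemma topspace_Y: "topspace (rs_top Y) = q ` M.pM"
  by (rule M.topspace_Q)

lemma preimg_X: "preimg X to_orbit V = {p \<in> inv.pts. to_orbit p \<in> V}"
  by (simp add: preimg_def topspace_X)

lemma preimg_Y: "preimg Y to_point U = {y \<in> q ` M.pM. to_point y \<in> U}"
  by (simp add: preimg_def topspace_Y)

lemma ev_in_preimg: "x \<in> M.pM \<Longrightarrow> ev x \<in> preimg X to_orbit V \<longleftrightarrow> q x \<in> V"
  by (simp add: preimg_X ev_point to_orbit_ev)

lemma q_in_preimg: "x \<in> M.pM \<Longrightarrow> q x \<in> preimg Y to_point U \<longleftrightarrow> ev x \<in> U"
  by (auto simp: preimg_Y to_point_orbit)

text \<open>
  A bump function around an orbit in \<open>V\<close> that vanishes outside of \<open>V\<close> gives a basic open neighbourhood of the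
  corresponding point.
\<close>

lemma continuous_to_orbit: "continuous_map (rs_top X) (rs_top Y) to_orbit"
  unfolding continuous_map
proof (intro conjI allI impI)
  show "to_orbit ` topspace (rs_top X) \<subseteq> topspace (rs_top Y)"
    unfolding topspace_X topspace_Y using point_is_ev to_orbit_ev by fastforce
  fix V assume V: "OpY V"
  have "inv.OpS {p \<in> inv.pts. to_orbit p \<in> V}"
  proof (rule openin_pointwise)
    fix p assume "p \<in> {p \<in> inv.pts. to_orbit p \<in> V}"
    then obtain x where x: "x \<in> M.pM" "p = ev x" "q x \<in> V" using point_is_ev to_orbit_ev by force
    obtain a where a: "a \<in> inv_funs" "a x > 0" "\<And>y. y \<in> M.pM \<Longrightarrow> q y \<notin> V \<Longrightarrow> a y = 0"
      by (rule orbit_bump[OF V x(1,3)]) (rule that)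
    have "to_orbit p' \<in> V" if "p' \<in> inv.pts" "p' a \<noteq> 0" for p'
    proof -
      obtain y where y: "y \<in> M.pM" "p' = ev y" using point_is_ev \<open>p' \<in> inv.pts\<close> by blast
      then show ?thesis using a(3)[OF y(1)] that(2) a(1) by (auto simp: ev_apply to_orbit_ev)
    qed
    then show "\<exists>W. inv.OpS W \<and> p \<in> W \<and> W \<subseteq> {p \<in> inv.pts. to_orbit p \<in> V}"
      using inv.open_nonvanishing[OF a(1)] x a(1,2) ev_point[OF x(1)]
      by (intro exI[of _ "{x \<in> inv.pts. x a \<noteq> 0}"]) (auto simp: ev_apply)
  qed
  then show "openin (rs_top X) {p \<in> topspace (rs_top X). to_orbit p \<in> V}"
    by (simp only: topspace_X) (simp only: inv.Spec_simps)
qed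

lemma continuous_to_point: "continuous_map (rs_top Y) (rs_top X) to_point"
  unfolding inv.Spec_simps Spec_top_def
proof (rule continuous_on_generated_topo)
  fix U assume "U \<in> {{x \<in> inv.pts. x a \<noteq> 0} | a. a \<in> carrier inv.A}"
  then obtain a where a: "a \<in> inv_funs" "U = {x \<in> inv.pts. x a \<noteq> 0}" by auto
  show "OpY (to_point -` U \<inter> topspace (rs_top Y))"
  proof (rule OpY_I)
    have "preM (to_point -` U \<inter> topspace (rs_top Y)) = {x \<in> M.pM. a x \<in> - {0}}"
    proof (intro Set.set_eqI)
      fix x
      have "to_point (q x) \<in> U \<longleftrightarrow> a x \<noteq> 0" if "x \<in> M.pM"
        using that ev_point[OF that] by (simp add: a(2) to_point_orbit ev_apply[OF a(1)])
      then show "x \<in> preM (to_point -` U \<inter> topspace (rs_top Y)) \<longleftrightarrow> x \<in> {x \<in> M.pM. a x \<in> - {0}}"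
        by (auto simp: preM_iff topspace_Y)
    qed
    moreover have "M.OpM {x \<in> M.pM. a x \<in> - {0}}"
      by (rule M.smooth_real_preimage[OF open_pM inv_funsD(1)[OF a(1)]]) auto
    ultimately show "M.OpM (preM (to_point -` U \<inter> topspace (rs_top Y)))" by simp
  qed (auto simp: topspace_Y)
next
  have "to_point y \<in> topspace (Spec_top inv.A)" if "y \<in> topspace (rs_top Y)" for y
    using that ev_point unfolding topspace_Y inv.topspace_Spec by (auto simp: to_point_orbit)
  then show "to_point ` topspace (rs_top Y) \<subseteq> \<Union>{{x \<in> inv.pts. x a \<noteq> 0} | a. a \<in> carrier inv.A}"
    unfolding Spec_top_def topology_generated_by_topspace by blast
qed

lemma preimg_X_open: "OpY V \<Longrightarrow> inv.OpS (preimg X to_orbit V)"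
  using openin_continuous_map_preimage[OF continuous_to_orbit] by (simp add: preimg_def inv.Spec_simps)

lemma preimg_Y_open: "inv.OpS U \<Longrightarrow> OpY (preimg Y to_point U)"
  using openin_continuous_map_preimage[OF continuous_to_point] by (simp add: preimg_def inv.Spec_simps)

definition extends_germ :: "'c set set \<Rightarrow> ('c set \<Rightarrow> real) \<Rightarrow> 'c set \<Rightarrow> ('c \<Rightarrow> real) \<Rightarrow> bool" where
  "extends_germ V t y a \<longleftrightarrow> a \<in> inv_funs \<and>
     (\<exists>W. OpY W \<and> y \<in> W \<and> W \<subseteq> V \<and> (\<forall>x\<in>M.pM. q x \<in> W \<longrightarrow> a x = t (q x)))"

text \<open>
  Take a bump function \<open>b\<close> around the orbit that vanishes outside of \<open>V\<close>, and a smooth step \<open>B\<close> from \<open>0\<close> to \<open>1\<close>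
  below its value there.  Then \<open>B \<circ> b\<close> is \<open>1\<close> near the orbit, and \<open>(B \<circ> b) * t\<close>, continued by \<open>0\<close>, is smooth at the
  boundary of \<open>V\<close>, because \<open>b\<close> is so small there that \<open>B \<circ> b\<close> vanishes.
\<close>

lemma extension_exists:
  assumes V: "OpY V" and t: "t \<in> carrier (secY V)" and y: "y \<in> V"
  shows "\<exists>a. extends_germ V t y a"
proof -
  obtain x where x: "x \<in> M.pM" "y = q x" using OpY_sub[OF V y] by blast
  obtain b where b: "b \<in> inv_funs" "b x > 0" "\<And>z. z \<in> M.pM \<Longrightarrow> q z \<notin> V \<Longrightarrow> b z = 0"
    by (rule orbit_bump[OF V x(1)]) (use x y in blast, rule that)
  define c where "c = b x / 3"
  have c: "c > 0" "c < 2 * c" "2 * c < b x" using b(2) by (auto simp: c_def)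
  obtain B where B: "smooth_real B" "\<And>t. t \<le> c \<Longrightarrow> B t = 0" "\<And>t. t \<ge> 2 * c \<Longrightarrow> B t = 1"
    by (rule smooth_step[OF c(2)]) (rule that)
  define a where "a = (\<lambda>z. if q z \<in> V then B (b z) * t (q z) else 0)"
  have sb: "smooth_real_on M M.pM b" by (rule inv_funsD(1)[OF b(1)])
  have opV: "M.OpM (preM V)" by (rule M.OpQ_pre[OF V])
  have "smooth_real_on M M.pM a"
  proof (rule M.smooth_real_on_local[OF open_pM])
    fix z assume z: "z \<in> M.pM"
    show "\<exists>W. M.OpM W \<and> z \<in> W \<and> smooth_real_on M (M.pM \<inter> W) a"
    proof (cases "q z \<in> V")
      case True
      have sbV: "smooth_real_on M (preM V) b"
        by (rule M.smooth_real_on_subset[OF open_pM _ sb]) (auto simp: preM_iff)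
      have "smooth_real_on M (preM V) (\<lambda>z. B (b z))"
        using M.smooth_real_on_compose[OF opV openin_Rn B(1), of "\<lambda>x i. if i = 0 then b x else 0"] sbV
        by (simp add: Rn_iff)
      then have "smooth_real_on M (preM V) (\<lambda>z. B (b z) * t (q z))"
        by (rule M.smooth_real_on_mult[OF opV]) (use t in \<open>simp add: M.carrier_sect\<close>)
      then have "smooth_real_on M (preM V) a"
        by (rule M.smooth_real_on_cong[OF opV, rotated]) (simp add: a_def preM_iff)
      moreover have "M.pM \<inter> preM V = preM V" by (auto simp: preM_iff)
      ultimately show ?thesis using opV True z by (intro exI[of _ "preM V"]) (simp add: preM_iff)
    next
      case False
      let ?W = "{z \<in> M.pM. b z \<in> {..<c}}"
      have W: "M.OpM ?W" by (rule M.smooth_real_preimage[OF open_pM sb]) simp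
      have "smooth_real_on M ?W a"
        by (rule M.smooth_real_on_cong[OF W _ M.smooth_real_on_const[OF W, of 0]]) (auto simp: a_def B(2))
      moreover have "z \<in> ?W" using False z b(3) c(1) by simp
      moreover have "M.pM \<inter> ?W = ?W" by blast
      ultimately show ?thesis using W by (intro exI[of _ ?W]) simp
    qed
  qed
  moreover have "a (act g z) = a z" if "g \<in> carrier G" "z \<in> M.pM" for g z
    using orbit_act[OF that] inv_funsD(2)[OF b(1) that] by (simp add: a_def)
  ultimately have a: "restrict a M.pM \<in> inv_funs" by (rule inv_funsI)
  define W where "W = {y \<in> V. to_point y b > 2 * c}"
  have preW: "preM W = {z \<in> preM V. b z \<in> {2 * c <..}}"
    by (auto simp: W_def preM_iff to_point_orbit ev_apply[OF b(1)])
  have "M.OpM (preM W)" unfolding preW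
    by (rule M.smooth_real_preimage[OF opV M.smooth_real_on_subset[OF open_pM _ sb]]) (auto simp: preM_iff)
  then have "OpY W" using V by (intro OpY_I) (auto simp: W_def M.OpQ_iff)
  moreover have "y \<in> W" using y x c by (simp add: W_def to_point_orbit ev_apply[OF b(1)])
  moreover have "restrict a M.pM z = t (q z)" if "z \<in> M.pM" "q z \<in> W" for z
  proof -
    have "q z \<in> V" "b z > 2 * c" using that by (simp_all add: W_def to_point_orbit ev_apply[OF b(1)])
    then show ?thesis using that(1) B(3)[of "b z"] by (simp add: a_def)
  qed
  moreover have "W \<subseteq> V" by (auto simp: W_def)
  ultimately show ?thesis using a unfolding extends_germ_def by (intro exI[of _ "restrict a M.pM"] conjI exI[of _ W]) auto
qed

text \<open>
  Two such functions agree where some bump function around the orbit does not vanish.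
\<close>

lemma extension_unique:
  assumes x: "x \<in> M.pM" and a: "extends_germ V t (q x) a" and a': "extends_germ V t (q x) a'"
  shows "Spec_proj inv.A (ev x) a = Spec_proj inv.A (ev x) a'"
proof -
  obtain W where W: "OpY W" "q x \<in> W" "\<forall>z\<in>M.pM. q z \<in> W \<longrightarrow> a z = t (q z)" and af: "a \<in> inv_funs"
    using a unfolding extends_germ_def by blast
  obtain W' where W': "OpY W'" "q x \<in> W'" "\<forall>z\<in>M.pM. q z \<in> W' \<longrightarrow> a' z = t (q z)" and af': "a' \<in> inv_funs"
    using a' unfolding extends_germ_def by blast
  have N: "OpY (W \<inter> W')" "q x \<in> W \<inter> W'" using W W' by auto
  obtain d where d: "d \<in> inv_funs" "d x > 0" "\<And>z. z \<in> M.pM \<Longrightarrow> q z \<notin> W \<inter> W' \<Longrightarrow> d z = 0"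
    by (rule orbit_bump[OF N(1) x N(2)]) (rule that)
  have "inv.germ_rel (ev x) a a'"
    unfolding inv.germ_rel_def
  proof (intro bexI[OF _ d(1)] conjI ballI impI)
    show "ev x d \<noteq> 0" using d by (simp add: ev_apply)
    fix z assume "z \<in> M.pM" "d z \<noteq> 0"
    then have "q z \<in> W \<inter> W'" using d(3) by blast
    then show "a z = a' z" using W(3) W'(3) \<open>z \<in> M.pM\<close> by simp
  qed
  then show ?thesis using inv.Spec_proj_eq_iff[OF ev_point[OF x] af af'] by simp
qed

text \<open>
  \<open>pull\<close> sends a function to the family of its germs, represented by global functions; \<open>push\<close> sends a family of
  germs to the function of its values.
\<close>

definition pull :: "'c set set \<Rightarrow> ('c set \<Rightarrow> real) \<Rightarrow> (('c \<Rightarrow> real) \<Rightarrow> real) \<Rightarrow> ('c \<Rightarrow> real) set" where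
  "pull V = (\<lambda>t\<in>carrier (secY V). \<lambda>p\<in>preimg X to_orbit V. Spec_proj inv.A p (SOME a. extends_germ V t (to_orbit p) a))"

definition push :: "(('c \<Rightarrow> real) \<Rightarrow> real) set \<Rightarrow> ((('c \<Rightarrow> real) \<Rightarrow> real) \<Rightarrow> ('c \<Rightarrow> real) set) \<Rightarrow> 'c set \<Rightarrow> real" where
  "push U = (\<lambda>s\<in>carrier (secX U). \<lambda>y\<in>preimg Y to_point U. inv.germ_value (to_point y) (s (to_point y)))"

lemma pull_eq:
  assumes t: "t \<in> carrier (secY V)" and x: "x \<in> M.pM" and a: "extends_germ V t (q x) a"
  shows "pull V t (ev x) = Spec_proj inv.A (ev x) a"
proof -
  have "q x \<in> V" using a unfolding extends_germ_def by blast
  then have "pull V t (ev x) = Spec_proj inv.A (ev x) (SOME a. extends_germ V t (q x) a)"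
    using t x by (simp add: pull_def ev_in_preimg to_orbit_ev)
  also have "\<dots> = Spec_proj inv.A (ev x) a"
    by (rule extension_unique[OF x someI[of "extends_germ V t (q x)", OF a] a])
  finally show ?thesis .
qed

lemma push_eq:
  assumes s: "s \<in> carrier (secX U)" and x: "x \<in> M.pM" "ev x \<in> U" and a: "a \<in> inv_funs" "s (ev x) = Spec_proj inv.A (ev x) a"
  shows "push U s (q x) = a x"
  using assms inv.germ_value[OF ev_point[OF x(1)] a(1)]
  by (simp add: push_def q_in_preimg to_point_orbit ev_apply)

lemma pull_closed:
  assumes V: "OpY V" and t: "t \<in> carrier (secY V)"
  shows "pull V t \<in> carrier (secX (preimg X to_orbit V))"
  unfolding inv.carrier_Spec_sections
proof (intro conjI ballI)
  have ex: "\<exists>x\<in>M.pM. p = ev x \<and> (\<exists>a. extends_germ V t (q x) a)" if "p \<in> preimg X to_orbit V" for p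
  proof -
    have "p \<in> inv.pts" using that by (simp add: preimg_X)
    then obtain x where x: "x \<in> M.pM" "p = ev x" using point_is_ev by blast
    then have "q x \<in> V" using that ev_in_preimg by simp
    then show ?thesis using x extension_exists[OF V t] by blast
  qed
  show "pull V t \<in> (\<Pi>\<^sub>E p\<in>preimg X to_orbit V. carrier (Spec_local inv.A p))"
  proof (rule PiE_I)
    fix p assume "p \<in> preimg X to_orbit V"
    then obtain x a where x: "x \<in> M.pM" "p = ev x" and a: "extends_germ V t (q x) a" using ex by blast
    then have "a \<in> inv_funs" by (simp add: extends_germ_def)
    then show "pull V t p \<in> carrier (Spec_local inv.A p)"
      using pull_eq[OF t x(1) a] x(2) inv.Spec_proj_onto[OF ev_point[OF x(1)]] by simp
  qed (use t in \<open>simp add: pull_def\<close>)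
  fix p assume "p \<in> preimg X to_orbit V"
  then obtain x a where x: "x \<in> M.pM" "p = ev x" and a: "extends_germ V t (q x) a" using ex by blast
  then obtain W where W: "OpY W" "q x \<in> W" "W \<subseteq> V" "\<forall>z\<in>M.pM. q z \<in> W \<longrightarrow> a z = t (q z)" and af: "a \<in> inv_funs"
    unfolding extends_germ_def by blast
  have "pull V t p' = Spec_proj inv.A p' a" if p': "p' \<in> preimg X to_orbit W" for p'
  proof -
    obtain z where z: "z \<in> M.pM" "p' = ev z" using p' point_is_ev by (auto simp: preimg_X)
    then have "q z \<in> W" using p' ev_in_preimg by simp
    then have "extends_germ V t (q z) a" unfolding extends_germ_def using W af by blast
    then show ?thesis using pull_eq[OF t z(1)] z(2) by simp
  qed
  moreover have "preimg X to_orbit W \<subseteq> preimg X to_orbit V" using W(3) by (auto simp: preimg_X)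
  moreover have "p \<in> preimg X to_orbit W" using x W(2) ev_in_preimg by simp
  ultimately show "\<exists>N. \<exists>a\<in>inv_funs. inv.OpS N \<and> p \<in> N \<and> N \<subseteq> preimg X to_orbit V \<and> (\<forall>y\<in>N. pull V t y = Spec_proj inv.A y a)"
    using preimg_X_open[OF W(1)] af by (intro exI[of _ "preimg X to_orbit W"] bexI[of _ a]) auto
qed

lemma push_closed:
  assumes U: "inv.OpS U" and s: "s \<in> carrier (secX U)"
  shows "push U s \<in> carrier (secY (preimg Y to_point U))"
  unfolding M.carrier_sect
proof
  show "push U s \<in> extensional (preimg Y to_point U)" using s by (simp add: push_def)
  let ?P = "preM (preimg Y to_point U)"
  have P: "M.OpM ?P" by (rule M.OpQ_pre[OF preimg_Y_open[OF U]])
  show "smooth_real_on M ?P (\<lambda>x. push U s (q x))"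
  proof (rule M.smooth_real_on_local[OF P])
    fix x assume x: "x \<in> ?P"
    then have xU: "x \<in> M.pM" "ev x \<in> U" by (auto simp: preM_iff q_in_preimg)
    then obtain V a where V: "inv.OpS V" "ev x \<in> V" "V \<subseteq> U" "a \<in> inv_funs" "\<forall>y\<in>V. s y = Spec_proj inv.A y a"
      using s unfolding inv.carrier_Spec_sections by blast
    let ?N = "preM (preimg Y to_point V)"
    have N: "M.OpM ?N" by (rule M.OpQ_pre[OF preimg_Y_open[OF V(1)]])
    have sa: "smooth_real_on M ?N a"
      by (rule M.smooth_real_on_subset[OF open_pM _ inv_funsD(1)[OF V(4)]]) (auto simp: preM_iff)
    have "smooth_real_on M ?N (\<lambda>x. push U s (q x))"
    proof (rule M.smooth_real_on_cong[OF N _ sa])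
      fix z assume "z \<in> ?N"
      then have z: "z \<in> M.pM" "ev z \<in> V" by (auto simp: preM_iff q_in_preimg)
      then show "a z = push U s (q z)" using push_eq[OF s z(1) _ V(4)] V(3,5) by auto
    qed
    moreover have "?P \<inter> ?N = ?N" using V(3) by (auto simp: preM_iff preimg_Y)
    ultimately show "\<exists>W. M.OpM W \<and> x \<in> W \<and> smooth_real_on M (?P \<inter> W) (\<lambda>x. push U s (q x))"
      using N xU V(2) by (intro exI[of _ ?N]) (simp add: preM_iff q_in_preimg)
  qed
qed

lemma common_extension:
  assumes V: "OpY V" and y: "y \<in> V" and ts: "ts \<in> lists (carrier (secY V))"
  shows "\<exists>W as. OpY W \<and> y \<in> W \<and> W \<subseteq> V \<and> as \<in> lists inv_funs \<and>
    (\<forall>x\<in>M.pM. q x \<in> W \<longrightarrow> map (\<lambda>a. a x) as = map (\<lambda>t. t (q x)) ts)"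
  using ts
proof (induction ts)
  case Nil
  then show ?case using V y by (intro exI[of _ V] exI[of _ "[]"]) simp
next
  case (Cons t ts)
  obtain W as where W: "OpY W" "y \<in> W" "W \<subseteq> V" "as \<in> lists inv_funs"
    "\<forall>x\<in>M.pM. q x \<in> W \<longrightarrow> map (\<lambda>a. a x) as = map (\<lambda>t. t (q x)) ts" using Cons.IH by (elim exE conjE) (rule that)
  have "t \<in> carrier (secY V)" using Cons by simp
  then obtain a where "extends_germ V t y a" using extension_exists[OF V _ y] by blast
  then obtain W' where W': "OpY W'" "y \<in> W'" "\<forall>x\<in>M.pM. q x \<in> W' \<longrightarrow> a x = t (q x)" "a \<in> inv_funs"
    unfolding extends_germ_def by blast
  show ?case using W W' by (intro exI[of _ "W \<inter> W'"] exI[of _ "a # as"]) auto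
qed

lemma pull_hom:
  assumes V: "OpY V"
  shows "pull V \<in> cinf_hom (secY V) (secX (preimg X to_orbit V))"
  unfolding cinf_hom_def
proof (intro CollectI conjI ballI)
  show "pull V \<in> carrier (secY V) \<rightarrow>\<^sub>E carrier (secX (preimg X to_orbit V))"
    using pull_closed[OF V] by (intro PiE_I) (auto simp: pull_def)
  fix ts f assume ts: "ts \<in> lists (carrier (secY V))" and f: "f \<in> Cinf_Rn (length ts)"
  have tc: "cop (secY V) f ts \<in> carrier (secY V)" using cinf_ring.cop_closed[OF M.sect_ring[OF V] ts f] .
  have pc: "map (pull V) ts \<in> lists (carrier (secX (preimg X to_orbit V)))" using ts pull_closed[OF V] by auto
  show "pull V (cop (secY V) f ts) = cop (secX (preimg X to_orbit V)) f (map (pull V) ts)"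
  proof (rule extensionalityI[of _ "preimg X to_orbit V"])
    show "pull V (cop (secY V) f ts) \<in> extensional (preimg X to_orbit V)" using tc by (simp add: pull_def)
    show "cop (secX (preimg X to_orbit V)) f (map (pull V) ts) \<in> extensional (preimg X to_orbit V)"
      by (simp add: inv.cop_Spec_sections)
    fix p assume p: "p \<in> preimg X to_orbit V"
    then obtain x where x: "x \<in> M.pM" "p = ev x" using point_is_ev by (auto simp: preimg_X)
    then have xV: "q x \<in> V" using p ev_in_preimg by simp
    obtain W as where W: "OpY W" "q x \<in> W" "W \<subseteq> V" and as: "as \<in> lists inv_funs"
      and agree: "\<forall>z\<in>M.pM. q z \<in> W \<longrightarrow> map (\<lambda>a. a z) as = map (\<lambda>t. t (q z)) ts"
      using common_extension[OF V xV ts] by (elim exE conjE)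
    have len: "length as = length ts"
    proof -
      have "map (\<lambda>a. a x) as = map (\<lambda>t. t (q x)) ts" using agree x(1) W(2) by blast
      then show ?thesis by (metis length_map)
    qed
    have f': "f \<in> Cinf_Rn (length as)" using f len by simp
    have one: "pull V (ts ! i) (ev x) = Spec_proj inv.A (ev x) (as ! i)" if i: "i < length ts" for i
    proof (rule pull_eq[OF _ x(1)])
      show "ts ! i \<in> carrier (secY V)" using ts i by (simp add: in_lists_conv_set)
      have "(as ! i) z = (ts ! i) (q z)" if "z \<in> M.pM" "q z \<in> W" for z
      proof -
        have "map (\<lambda>a. a z) as = map (\<lambda>t. t (q z)) ts" using agree that by blast
        then have "map (\<lambda>a. a z) as ! i = map (\<lambda>t. t (q z)) ts ! i" by simp
        then show ?thesis using i len by simp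
      qed
      moreover have "as ! i \<in> inv_funs" using as i len by (simp add: in_lists_conv_set)
      ultimately show "extends_germ V (ts ! i) (q x) (as ! i)" unfolding extends_germ_def using W by blast
    qed
    have "extends_germ V (cop (secY V) f ts) (q x) (cop inv.A f as)"
    proof -
      have "cop inv.A f as \<in> inv_funs" using inv.ring.cop_closed[of as f] as f' by simp
      moreover have "cop inv.A f as z = cop (secY V) f ts (q z)" if z: "z \<in> M.pM" "q z \<in> W" for z
      proof -
        have "map (\<lambda>a. a z) as = map (\<lambda>t. t (q z)) ts" using agree z by blast
        then show ?thesis using z W(3) by (auto simp: inv.cop_functions M.cop_sect)
      qed
      ultimately show ?thesis unfolding extends_germ_def using W by blast
    qed
    then have "pull V (cop (secY V) f ts) p = Spec_proj inv.A (ev x) (cop inv.A f as)"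
      using pull_eq[OF tc x(1)] x(2) by simp
    also have "\<dots> = cop (Spec_local inv.A (ev x)) f (map (Spec_proj inv.A (ev x)) as)"
      using inv.cop_Spec_proj[OF ev_point[OF x(1)] as f'] by simp
    also have "map (Spec_proj inv.A (ev x)) as = map (\<lambda>s. s p) (map (pull V) ts)"
      by (rule nth_equalityI) (use len one x(2) in auto)
    finally show "pull V (cop (secY V) f ts) p = cop (secX (preimg X to_orbit V)) f (map (pull V) ts) p"
      using p x(2) by (simp add: inv.cop_Spec_sections)
  qed
qed

lemma push_hom:
  assumes U: "inv.OpS U"
  shows "push U \<in> cinf_hom (secX U) (secY (preimg Y to_point U))"
  unfolding cinf_hom_def
proof (intro CollectI conjI ballI)
  show "push U \<in> carrier (secX U) \<rightarrow>\<^sub>E carrier (secY (preimg Y to_point U))"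
    using push_closed[OF U] by (intro PiE_I) (auto simp: push_def)
  fix ss f assume ss: "ss \<in> lists (carrier (secX U))" and f: "f \<in> Cinf_Rn (length ss)"
  have sc: "cop (secX U) f ss \<in> carrier (secX U)" using cinf_ring.cop_closed[OF inv.Spec_sections_ring[OF U] ss f] .
  show "push U (cop (secX U) f ss) = cop (secY (preimg Y to_point U)) f (map (push U) ss)"
  proof (rule extensionalityI[of _ "preimg Y to_point U"])
    show "push U (cop (secX U) f ss) \<in> extensional (preimg Y to_point U)" using sc by (simp add: push_def)
    show "cop (secY (preimg Y to_point U)) f (map (push U) ss) \<in> extensional (preimg Y to_point U)"
      by (simp add: M.cop_sect)
    fix y assume y: "y \<in> preimg Y to_point U"
    then obtain x where x: "x \<in> M.pM" "y = q x" by (auto simp: preimg_Y)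
    then have xU: "ev x \<in> U" using y q_in_preimg by simp
    obtain V as where V: "ev x \<in> V" and as: "as \<in> lists inv_funs"
      and agree: "\<forall>p\<in>V. map (\<lambda>s. s p) ss = map (Spec_proj inv.A p) as"
      using inv.Spec_sections_common[OF U xU ss] by (elim exE conjE) (rule that)
    have eq: "map (\<lambda>s. s (ev x)) ss = map (Spec_proj inv.A (ev x)) as" using agree V by blast
    have len: "length as = length ss" using eq by (metis length_map)
    have f': "f \<in> Cinf_Rn (length as)" using f len by simp
    have cA: "cop inv.A f as \<in> inv_funs" using inv.ring.cop_closed[of as f] as f' by simp
    have "cop (secX U) f ss (ev x) = Spec_proj inv.A (ev x) (cop inv.A f as)"
      using inv.cop_Spec_proj[OF ev_point[OF x(1)] as f'] xU by (simp add: inv.cop_Spec_sections eq)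
    then have "push U (cop (secX U) f ss) y = cop inv.A f as x"
      using push_eq[OF sc x(1) xU cA] x(2) by simp
    also have "\<dots> = f (point (map (\<lambda>a. a x) as))" using x(1) by (simp add: inv.cop_functions)
    also have "map (\<lambda>a. a x) as = map (\<lambda>s. s y) (map (push U) ss)"
    proof (rule nth_equalityI)
      fix i assume "i < length (map (\<lambda>a. a x) as)"
      then have i: "i < length as" "i < length ss" using len by auto
      have "map (\<lambda>s. s (ev x)) ss ! i = map (Spec_proj inv.A (ev x)) as ! i" using eq by simp
      then have "(ss ! i) (ev x) = Spec_proj inv.A (ev x) (as ! i)" using i by simp
      moreover have "ss ! i \<in> carrier (secX U)" "as ! i \<in> inv_funs" using ss as i by (auto simp: in_lists_conv_set)
      ultimately have "push U (ss ! i) (q x) = (as ! i) x" using push_eq[OF _ x(1) xU] by blast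
      then show "map (\<lambda>a. a x) as ! i = map (\<lambda>s. s y) (map (push U) ss) ! i" using i x(2) by simp
    qed (use len in simp)
    finally show "push U (cop (secX U) f ss) y = cop (secY (preimg Y to_point U)) f (map (push U) ss) y"
      using y by (simp add: M.cop_sect)
  qed
qed

lemma secX_extensional: "s \<in> carrier (secX U) \<Longrightarrow> s \<in> extensional U"
  by (simp add: inv.carrier_Spec_sections PiE_def)

lemma push_pull:
  assumes V: "OpY V" and t: "t \<in> carrier (secY V)"
  shows "push (preimg X to_orbit V) (pull V t) = t"
proof (rule extensionalityI[of _ V])
  have eqV: "preimg Y to_point (preimg X to_orbit V) = V"
  proof (intro equalityI subsetI)
    fix y assume "y \<in> preimg Y to_point (preimg X to_orbit V)"
    then show "y \<in> V" by (auto simp: preimg_Y preimg_X to_point_orbit to_orbit_ev)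
  next
    fix y assume "y \<in> V"
    moreover then obtain x where "x \<in> M.pM" "y = q x" using OpY_sub[OF V] by blast
    ultimately show "y \<in> preimg Y to_point (preimg X to_orbit V)" by (simp add: q_in_preimg ev_in_preimg)
  qed
  note pc = pull_closed[OF V t]
  show "push (preimg X to_orbit V) (pull V t) \<in> extensional V" using pc eqV by (simp add: push_def)
  show "t \<in> extensional V" using t by (simp add: M.carrier_sect)
  fix y assume y: "y \<in> V"
  then obtain x where x: "x \<in> M.pM" "y = q x" using OpY_sub[OF V] by blast
  obtain a where a: "extends_germ V t (q x) a" using extension_exists[OF V t] y x by blast
  then have af: "a \<in> inv_funs" and "a x = t (q x)" using x(1) unfolding extends_germ_def by blast+
  moreover have "push (preimg X to_orbit V) (pull V t) (q x) = a x"
    by (rule push_eq[OF pc x(1) _ af pull_eq[OF t x(1) a]]) (use y x ev_in_preimg in simp)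
  ultimately show "push (preimg X to_orbit V) (pull V t) y = t y" using x(2) by simp
qed

lemma pull_push:
  assumes U: "inv.OpS U" and s: "s \<in> carrier (secX U)"
  shows "pull (preimg Y to_point U) (push U s) = s"
proof (rule extensionalityI[of _ U])
  have eqU: "preimg X to_orbit (preimg Y to_point U) = U"
  proof (intro equalityI subsetI)
    fix p assume "p \<in> preimg X to_orbit (preimg Y to_point U)"
    moreover then obtain x where "x \<in> M.pM" "p = ev x" using point_is_ev by (auto simp: preimg_X)
    ultimately show "p \<in> U" by (simp add: q_in_preimg ev_in_preimg)
  next
    fix p assume "p \<in> U"
    moreover then obtain x where "x \<in> M.pM" "p = ev x" using point_is_ev inv.open_pts[OF U] by blast
    ultimately show "p \<in> preimg X to_orbit (preimg Y to_point U)" by (simp add: q_in_preimg ev_in_preimg)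
  qed
  note pc = push_closed[OF U s]
  show "pull (preimg Y to_point U) (push U s) \<in> extensional U" using pc eqU by (simp add: pull_def)
  show "s \<in> extensional U" by (rule secX_extensional[OF s])
  fix p assume p: "p \<in> U"
  then obtain x where x: "x \<in> M.pM" "p = ev x" using point_is_ev inv.open_pts[OF U] by blast
  obtain V a where V: "inv.OpS V" "ev x \<in> V" "V \<subseteq> U" "a \<in> inv_funs" "\<forall>y\<in>V. s y = Spec_proj inv.A y a"
    using s p x(2) unfolding inv.carrier_Spec_sections by blast
  have "extends_germ (preimg Y to_point U) (push U s) (q x) a"
    unfolding extends_germ_def
  proof (intro conjI exI[of _ "preimg Y to_point V"] ballI impI)
    show "a \<in> inv_funs" "OpY (preimg Y to_point V)" using V preimg_Y_open by auto
    show "q x \<in> preimg Y to_point V" using V(2) x(1) q_in_preimg by simp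
    show "preimg Y to_point V \<subseteq> preimg Y to_point U" using V(3) by (auto simp: preimg_Y)
    fix z assume z: "z \<in> M.pM" "q z \<in> preimg Y to_point V"
    then have "ev z \<in> V" using q_in_preimg by simp
    then show "a z = push U s (q z)" using push_eq[OF s z(1) _ V(4)] V(3,5) by auto
  qed
  then show "pull (preimg Y to_point U) (push U s) p = s p"
    using pull_eq[OF pc x(1)] V x(2) by simp
qed

lemma pull_map: "ringed_space_map X Y to_orbit pull"
  unfolding ringed_space_map_def
proof (intro conjI allI impI ballI)
  show "continuous_map (rs_top X) (rs_top Y) to_orbit" by (rule continuous_to_orbit)
  show "pull V \<in> cinf_hom (sections Y V) (sections X (preimg X to_orbit V))" if "OpY V" for V
    using pull_hom[OF that] by (simp add: M.orbit_space_simps(1) inv.Spec_simps(2))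
  fix V V' t assume "OpY V \<and> OpY V' \<and> V' \<subseteq> V" and "t \<in> carrier (sections Y V)"
  then have V: "OpY V" "OpY V'" "V' \<subseteq> V" and t: "t \<in> carrier (secY V)" by (simp_all add: M.orbit_space_simps(1))
  have t': "restrict t V' \<in> carrier (secY V')" by (rule M.restrict_sect[OF V t])
  have "pull V' (restrict t V') = restrict (pull V t) (preimg X to_orbit V')"
  proof (rule extensionalityI[of _ "preimg X to_orbit V'"])
    show "pull V' (restrict t V') \<in> extensional (preimg X to_orbit V')" using t' by (simp add: pull_def)
    fix p assume p: "p \<in> preimg X to_orbit V'"
    then obtain x where x: "x \<in> M.pM" "p = ev x" using point_is_ev by (auto simp: preimg_X)
    then have xV: "q x \<in> V'" using p ev_in_preimg by simp
    then obtain a where a: "extends_germ V t (q x) a" using extension_exists[OF V(1) t] V(3) by blast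
    then obtain W where W: "OpY W" "q x \<in> W" "\<forall>z\<in>M.pM. q z \<in> W \<longrightarrow> a z = t (q z)" and af: "a \<in> inv_funs"
      unfolding extends_germ_def by blast
    have "extends_germ V' (restrict t V') (q x) a"
      unfolding extends_germ_def using W af V(2) xV by (intro conjI exI[of _ "W \<inter> V'"]) auto
    then show "pull V' (restrict t V') p = restrict (pull V t) (preimg X to_orbit V') p"
      using pull_eq[OF t' x(1)] pull_eq[OF t x(1) a] p x(2) by simp
  qed simp
  then show "pull V' (restr Y V V' t) = restr X (preimg X to_orbit V) (preimg X to_orbit V') (pull V t)"
    using M.orbit_space_simps(2)[OF t] inv.Spec_simps(3)[OF pull_closed[OF V(1) t]] by simp
qed

lemma push_map: "ringed_space_map Y X to_point push"
  unfolding ringed_space_map_def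
proof (intro conjI allI impI ballI)
  show "continuous_map (rs_top Y) (rs_top X) to_point" by (rule continuous_to_point)
  show "push U \<in> cinf_hom (sections X U) (sections Y (preimg Y to_point U))" if "openin (rs_top X) U" for U
    using push_hom[of U] that by (simp add: M.orbit_space_simps(1) inv.Spec_simps)
  fix U U' s assume "openin (rs_top X) U \<and> openin (rs_top X) U' \<and> U' \<subseteq> U" and "s \<in> carrier (sections X U)"
  then have U: "inv.OpS U" "inv.OpS U'" "U' \<subseteq> U" and s: "s \<in> carrier (secX U)" by (simp_all add: inv.Spec_simps)
  have s': "restrict s U' \<in> carrier (secX U')" by (rule inv.Spec_restrict_closed[OF U(2,3) s])
  have "push U' (restrict s U') = restrict (push U s) (preimg Y to_point U')"
  proof (rule extensionalityI[of _ "preimg Y to_point U'"])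
    show "push U' (restrict s U') \<in> extensional (preimg Y to_point U')" using s' by (simp add: push_def)
    fix y assume y: "y \<in> preimg Y to_point U'"
    then have "to_point y \<in> U'" "y \<in> preimg Y to_point U" using U(3) by (auto simp: preimg_Y)
    then show "push U' (restrict s U') y = restrict (push U s) (preimg Y to_point U') y"
      using y s s' by (simp add: push_def)
  qed simp
  then show "push U' (restr X U U' s) = restr Y (preimg Y to_point U) (preimg Y to_point U') (push U s)"
    using inv.Spec_simps(3)[OF s] M.orbit_space_simps(2)[OF push_closed[OF U(1) s]] by simp
qed

lemma Spec_isomorphic_orbit_space: "ringed_space_isomorphic X Y"
  unfolding ringed_space_isomorphic_def
proof (intro exI conjI ballI allI impI)
  show "ringed_space_map X Y to_orbit pull" by (rule pull_map)
  show "ringed_space_map Y X to_point push" by (rule push_map)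
  show "to_point (to_orbit p) = p" if "p \<in> topspace (rs_top X)" for p
    using point_is_ev[of p] that by (auto simp: topspace_X to_orbit_ev to_point_orbit)
  show "to_orbit (to_point y) = y" if "y \<in> topspace (rs_top Y)" for y
    using that by (auto simp: topspace_Y to_orbit_ev to_point_orbit)
  show "pull (preimg Y to_point U) (push U s) = s" if "openin (rs_top X) U" "s \<in> carrier (sections X U)" for U s
    using pull_push that by (simp add: inv.Spec_simps)
  show "push (preimg X to_orbit V) (pull V t) = t" if "OpY V" "t \<in> carrier (sections Y V)" for V t
    using push_pull that by (simp add: M.orbit_space_simps(1))
qed

end

theorem lemma5p12:
  fixes G :: "('g, 'b) monoid_scheme" and L :: "'g manifold"
    and M :: "'m manifold" and act :: "'g \<Rightarrow> 'm \<Rightarrow> 'm"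
  assumes "proper_smooth_action G L M act"
  shows "local_cinf_ringed_space (Spec (invariant_functions G M act)) \<and>
         local_cinf_ringed_space (orbit_space G M act) \<and>
         ringed_space_isomorphic (Spec (invariant_functions G M act)) (orbit_space G M act)"
proof -
  interpret proper_smooth_action G L M act by fact
  show ?thesis
    unfolding invariant_functions_eq
    using inv.Spec_local_ringed_space M.orbit_space_local_ringed_space Spec_isomorphic_orbit_space by blast
qed

end
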